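(* There is a constant $C_{B,4}\ge9.5$, independent of $d$, $n$, $\beta$ and of the probability distributions involved (of the form described in the context), such that the following holds. Let $y=(y_1,\dots,y_n)$ be an i.i.d. sample from a p.d.f. or p.m.f. $p(x)$, and let $\mathcal P=\{p(x;\theta):\theta\in\Theta\subseteq\mathbb{R}^d\}$ be a known parametric family satisfying the standard regularity conditions. Suppose that $p(x)\equiv p(x;\theta_0)$ for some $\theta_0\in\Theta$ (no misspecification), and consider the simple hypothesis $H_0:\theta_0=\theta'$. Let $s(\theta')=\sum_{i=1}^n\partial\log p(y_i;\theta')/\partial\theta'$, $I(\theta')=\operatorname{Var}\{s(\theta')\}$ be positive definite, and $R(\theta')=s(\theta')^T\{I(\theta')\}^{-1}s(\theta')$. Let $\tilde X_i=\sqrt n\,\{I(\theta')\}^{-1/2}\partial\log p(y_i;\theta')/\partial\theta'$ and $\tilde\Sigma=n^{-1}I(\theta')$, and suppose that $\mathbb{E}|\tilde X_i^{\otimes4}|<\infty$. Then for every $\beta\in(0,1)$ $$\sup_{\alpha\in(0,1)}\bigl|\mathbb{P}_{H_0}\bigl(R(\theta')>q(\alpha;\chi_d^2)\bigr)-\alpha\bigr|\le(\sqrt6\,\beta^3)^{-1}\|\mathbb{E}(\tilde X_1^{\otimes3})\|_{\mathrm F}\,n^{-1/2}$$ $$\qquad+2C_{B,4}\|\tilde\Sigma^{-1}\|\|\tilde\Sigma\|\bigl\{(h_1(\beta)+(4\beta^4)^{-1})\mathbb{E}\|\tilde X_1\|^4+d^2+2d\bigr\}^{1/2}n^{-1/2}$$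 $$\qquad+(2\sqrt6)^{-1}\bigl\{h_1(\beta)\mathbb{E}\|\tilde X_1\|^4+h_2(\beta)(d^2+2d)\bigr\}n^{-1},$$ where $q(\alpha;\chi_d^2)$ denotes the $(1-\alpha)$-quantile of the $\chi_d^2$ distribution.
   Context: $\mathbb{P}_{H_0}$ denotes probability when $H_0$ holds. The regularity conditions are the usual ones guaranteeing that the score is well defined and, in particular, that it has zero expectation under $H_0$. For $\beta\in(0,1)$: $h_2(\beta)=(1-\beta^2)^2\beta^{-4}$ and $h_1(\beta)=h_2(\beta)+(1-\beta^2)^{-1}\beta^{-4}$. $\|\cdot\|$ is the Euclidean norm for vectors and the spectral (operator) norm for matrices; $\|\cdot\|_{\mathrm F}$ is the Frobenius norm of a tensor. $\mathbb{E}|X^{\otimes k}|<\infty$ means that $\mathbb{E}|x_{i_1}\cdots x_{i_k}|<\infty$ for all coordinate indices. $f^{(s)}(x)h^s=(h^T\nabla)^sf(x)$. Form of the constant: $C_{B,4}=9.5\,C_{\ell_2}C_{\phi,4}$. Here $C_{\ell_2}=\max\{1,\tilde C\}$, where $\tilde C>0$ is a numerical constant such that $\sup_{B}\mathbb{P}(Z\in B^{\varepsilon}\setminus B)\le\varepsilon\tilde C/\lambda$ for every $d$, every $\varepsilon>0$ and every Gaussian vector $Z$ in $\mathbb{R}^d$ with positive definite covariance whose smallest eigenvalue is $\lambda^2$ ($B=B(x_0,r)$ ranges over closed Euclidean balls, $B^\varepsilon=B(x_0,r+\varepsilon)$). $C_{\phi,4}=\max\{1,C_{\phi,1,2},C_{\phi,1,3}\}$,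 where for a fixed sufficiently smooth $\phi:\mathbb{R}\to[0,1]$ with $\phi=1$ on $(-\infty,0]$ and $\phi=0$ on $[1,\infty)$, and $\psi(x;B)=\phi\bigl((\|x-x_0\|^2-r^2)\mathbb 1\{x\notin B\}/(\varepsilon^2+2r\varepsilon)\bigr)$, the numerical constants $C_{\phi,1,j}$ satisfy $|\psi^{(j)}(x;B)h^j|\le C_{\phi,1,j}\|h\|^j(\varepsilon/2)^{-j}\mathbb 1\{x\in B(x_0,r+\varepsilon)\setminus B\}$ for all $B$, $\varepsilon>0$, $x,h\in\mathbb{R}^d$. *)

theory Defs
  imports
    "HOL-Probability.Probability"
    "Jordan_Normal_Form.Char_Poly"
    "Jordan_Normal_Form.Gauss_Jordan_Elimination"
begin

unbundle no vec_syntax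
unbundle no inner_syntax

text \<open>The constant of the theorem must not depend on the dimension, so \<open>d\<close> is quantified inside
  the formula.  Elements of $R^d$ are therefore rendered by \<open>carrier_vec d\<close> and square matrices by
  \<open>carrier_mat d d\<close>.\<close>

section \<open>Linear algebra\<close>

definition vnorm :: "real Matrix.vec \<Rightarrow> real" where
  "vnorm v = sqrt (scalar_prod v v)"

definition spectral_norm :: "real mat \<Rightarrow> real" where
  "spectral_norm A = (SUP v \<in> {v \<in> carrier_vec (dim_col A). vnorm v = 1}. vnorm (A *\<^sub>v v))"

definition pos_def :: "real mat \<Rightarrow> bool" where
  "pos_def A \<longleftrightarrow> A \<in> carrier_mat (dim_row A) (dim_row A) \<and> transpose_mat A = A \<and>
     (\<forall>v \<in> carrier_vec (dim_row A). v \<noteq> 0\<^sub>v (dim_row A) \<longrightarrow> 0 < scalar_prod v (A *\<^sub>v v))"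

definition mat_inv :: "real mat \<Rightarrow> real mat" where
  "mat_inv A = the (mat_inverse A)"

text \<open>For positive definite \<open>A\<close> there is exactly one such matrix, the principal square root of the
  inverse of \<open>A\<close>.\<close>

definition mat_inv_sqrt :: "real mat \<Rightarrow> real mat" where
  "mat_inv_sqrt A = (SOME B. B \<in> carrier_mat (dim_row A) (dim_row A) \<and> pos_def B \<and> B * B = mat_inv A)"


section \<open>Differentiation\<close>

definition partial_deriv :: "nat \<Rightarrow> (real Matrix.vec \<Rightarrow> real) \<Rightarrow> real Matrix.vec \<Rightarrow> real" where
  "partial_deriv j g v = deriv (\<lambda>t. g (v + t \<cdot>\<^sub>v unit_vec (dim_vec v) j)) 0"

text \<open>The operator $h^T \nabla$; \<open>deriv_form s g x h\<close> is $g^{(s)}(x) h^s = (h^T \nabla)^s g(x)$.\<close>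

definition dir_op :: "real Matrix.vec \<Rightarrow> (real Matrix.vec \<Rightarrow> real) \<Rightarrow> real Matrix.vec \<Rightarrow> real" where
  "dir_op h g = (\<lambda>x. \<Sum>i<dim_vec h. vec_index h i * partial_deriv i g x)"

definition deriv_form ::
    "nat \<Rightarrow> (real Matrix.vec \<Rightarrow> real) \<Rightarrow> real Matrix.vec \<Rightarrow> real Matrix.vec \<Rightarrow> real" where
  "deriv_form s g x h = ((dir_op h ^^ s) g) x"


section \<open>Random vectors\<close>

definition cov_mat :: "'w measure \<Rightarrow> nat \<Rightarrow> ('w \<Rightarrow> real Matrix.vec) \<Rightarrow> real mat" where
  "cov_mat P d X = mat d d (\<lambda>(i, j). \<integral>w.
      (vec_index (X w) i - (\<integral>u. vec_index (X u) i \<partial>P)) *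
      (vec_index (X w) j - (\<integral>u. vec_index (X u) j \<partial>P)) \<partial>P)"

definition finite_fourth_moments :: "'w measure \<Rightarrow> nat \<Rightarrow> ('w \<Rightarrow> real Matrix.vec) \<Rightarrow> bool" where
  "finite_fourth_moments P d X \<longleftrightarrow> (\<forall>i<d. \<forall>j<d. \<forall>k<d. \<forall>l<d. integrable P (\<lambda>w.
      vec_index (X w) i * vec_index (X w) j * vec_index (X w) k * vec_index (X w) l))"

definition third_moment_fnorm :: "'w measure \<Rightarrow> nat \<Rightarrow> ('w \<Rightarrow> real Matrix.vec) \<Rightarrow> real" where
  "third_moment_fnorm P d X = sqrt (\<Sum>i<d. \<Sum>j<d. \<Sum>k<d.
      (\<integral>w. vec_index (X w) i * vec_index (X w) j * vec_index (X w) k \<partial>P)\<^sup>2)"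


section \<open>Gaussian vectors and the chi-squared distribution\<close>

definition std_gauss :: "nat \<Rightarrow> (nat \<Rightarrow> real) measure" where
  "std_gauss d = PiM {..<d} (\<lambda>_. density lborel (\<lambda>x. ennreal (std_normal_density x)))"

text \<open>A general Gaussian vector of $R^d$ is, in law, an affine image of a standard one; its mean is
  \<open>m\<close> and its covariance is $A A^T$.\<close>

definition gauss_vec :: "nat \<Rightarrow> real Matrix.vec \<Rightarrow> real mat \<Rightarrow> (nat \<Rightarrow> real) \<Rightarrow> real Matrix.vec" where
  "gauss_vec d m A \<xi> = m + A *\<^sub>v Matrix.vec d \<xi>"

definition chi_square :: "nat \<Rightarrow> real measure" where
  "chi_square d = distr (std_gauss d) borel (\<lambda>\<xi>. \<Sum>i<d. (\<xi> i)\<^sup>2)"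

definition chi_square_q :: "nat \<Rightarrow> real \<Rightarrow> real" where
  "chi_square_q d \<alpha> = Inf {t. 1 - \<alpha> \<le> cdf (chi_square d) t}"


section \<open>The form of the constant\<close>

definition smallest_eigenvalue :: "real mat \<Rightarrow> real \<Rightarrow> bool" where
  "smallest_eigenvalue A k \<longleftrightarrow> eigenvalue A k \<and> (\<forall>l. eigenvalue A l \<longrightarrow> k \<le> l)"

definition anticoncentration_const :: "real \<Rightarrow> bool" where
  "anticoncentration_const c \<longleftrightarrow> 0 < c \<and>
     (\<forall>d\<ge>1. \<forall>m \<in> carrier_vec d. \<forall>A \<in> carrier_mat d d. \<forall>sd>0.
        pos_def (cov_mat (std_gauss d) d (gauss_vec d m A)) \<longrightarrow>
        smallest_eigenvalue (cov_mat (std_gauss d) d (gauss_vec d m A)) (sd\<^sup>2) \<longrightarrow>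
        (\<forall>\<epsilon>>0. \<forall>x0 \<in> carrier_vec d. \<forall>r\<ge>0.
           measure (std_gauss d) {\<xi> \<in> space (std_gauss d).
             r < vnorm (gauss_vec d m A \<xi> - x0) \<and> vnorm (gauss_vec d m A \<xi> - x0) \<le> r + \<epsilon>}
           \<le> \<epsilon> * c / sd))"

text \<open>\<open>C\<^sup>3\<close> is the smoothness needed for the derivatives up to order three used below.\<close>

definition cutoff :: "(real \<Rightarrow> real) \<Rightarrow> bool" where
  "cutoff \<phi> \<longleftrightarrow>
     (\<forall>k<3. \<forall>x. (deriv ^^ k) \<phi> differentiable (at x)) \<and> continuous_on UNIV ((deriv ^^ 3) \<phi>) \<and>
     (\<forall>x. 0 \<le> \<phi> x \<and> \<phi> x \<le> 1) \<and> (\<forall>x\<le>0. \<phi> x = 1) \<and> (\<forall>x\<ge>1. \<phi> x = 0)"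

definition ball_cutoff ::
    "(real \<Rightarrow> real) \<Rightarrow> real Matrix.vec \<Rightarrow> real \<Rightarrow> real \<Rightarrow> real Matrix.vec \<Rightarrow> real" where
  "ball_cutoff \<phi> x0 r \<epsilon> x =
     \<phi> (((vnorm (x - x0))\<^sup>2 - r\<^sup>2) * (if vnorm (x - x0) \<le> r then 0 else 1) / (\<epsilon>\<^sup>2 + 2 * r * \<epsilon>))"

definition cutoff_const :: "(real \<Rightarrow> real) \<Rightarrow> nat \<Rightarrow> real \<Rightarrow> bool" where
  "cutoff_const \<phi> j c \<longleftrightarrow>
     (\<forall>d\<ge>1. \<forall>x0 \<in> carrier_vec d. \<forall>r\<ge>0. \<forall>\<epsilon>>0. \<forall>x \<in> carrier_vec d. \<forall>h \<in> carrier_vec d.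
        \<bar>deriv_form j (ball_cutoff \<phi> x0 r \<epsilon>) x h\<bar> \<le>
          c * vnorm h ^ j / (\<epsilon> / 2) ^ j * (if r < vnorm (x - x0) \<and> vnorm (x - x0) \<le> r + \<epsilon> then 1 else 0))"

definition CB4_form :: "real \<Rightarrow> bool" where
  "CB4_form C \<longleftrightarrow> (\<exists>Ct \<phi> c2 c3.
     anticoncentration_const Ct \<and> cutoff \<phi> \<and> cutoff_const \<phi> 2 c2 \<and> cutoff_const \<phi> 3 c3 \<and>
     C = 9.5 * max 1 Ct * Max {1, c2, c3})"

definition h2 :: "real \<Rightarrow> real" where
  "h2 \<beta> = (1 - \<beta>\<^sup>2)\<^sup>2 / \<beta> ^ 4"

definition h1 :: "real \<Rightarrow> real" where
  "h1 \<beta> = h2 \<beta> + 1 / ((1 - \<beta>\<^sup>2) * \<beta> ^ 4)"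


section \<open>The statistical model\<close>

text \<open>The dominating measure is Lebesgue measure on some $R^k$ (densities) or counting measure on a
  countable set (mass functions).  The type of single observations is kept fixed, rather than a type
  variable, since the constant must not depend on it either.\<close>

definition reference_measure :: "(nat \<Rightarrow> real) measure \<Rightarrow> bool" where
  "reference_measure \<nu> \<longleftrightarrow>
     (\<exists>k\<ge>1. \<nu> = PiM {..<k} (\<lambda>_. lborel)) \<or> (\<exists>S. countable S \<and> \<nu> = count_space S)"

definition is_pdf :: "'x measure \<Rightarrow> ('x \<Rightarrow> real) \<Rightarrow> bool" where
  "is_pdf \<nu> p \<longleftrightarrow> p \<in> borel_measurable \<nu> \<and> (\<forall>x \<in> space \<nu>. 0 \<le> p x) \<and> (\<integral>\<^sup>+x. ennreal (p x) \<partial>\<nu>) = 1"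

text \<open>The law of $(y_1, \dots, y_n)$; \<open>y i\<close> with \<open>i < n\<close> is the observation number \<open>i + 1\<close>.\<close>

definition sample_law :: "'x measure \<Rightarrow> ('x \<Rightarrow> real) \<Rightarrow> nat \<Rightarrow> (nat \<Rightarrow> 'x) measure" where
  "sample_law \<nu> p n = PiM {..<n} (\<lambda>_. density \<nu> (\<lambda>x. ennreal (p x)))"

definition score1 :: "nat \<Rightarrow> (real Matrix.vec \<Rightarrow> 'x \<Rightarrow> real) \<Rightarrow> real Matrix.vec \<Rightarrow> 'x \<Rightarrow> real Matrix.vec" where
  "score1 d f \<theta> x = Matrix.vec d (\<lambda>j. partial_deriv j (\<lambda>u. ln (f u x)) \<theta>)"

text \<open>Regularity at \<open>\<theta>\<close>: \<open>\<theta>\<close> is an interior point of the parameter set, the partial derivatives of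
  the density exist there almost everywhere, the score is measurable, and the integral of the density
  can be differentiated under the integral sign.  As that integral is constantly 1, the last condition
  gives the score expectation zero at \<open>\<theta>\<close>.\<close>

definition regular_at ::
    "nat \<Rightarrow> 'x measure \<Rightarrow> real Matrix.vec set \<Rightarrow> (real Matrix.vec \<Rightarrow> 'x \<Rightarrow> real) \<Rightarrow> real Matrix.vec \<Rightarrow> bool" where
  "regular_at d \<nu> \<Theta> f \<theta> \<longleftrightarrow>
     (\<exists>e>0. \<forall>u \<in> carrier_vec d. vnorm (u - \<theta>) < e \<longrightarrow> u \<in> \<Theta>) \<and>
     (\<forall>j<d.
        (AE x in \<nu>. (\<lambda>t. f (\<theta> + t \<cdot>\<^sub>v unit_vec d j) x) differentiable (at 0)) \<and>
        (\<lambda>x. vec_index (score1 d f \<theta> x) j) \<in> borel_measurable \<nu> \<and>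
        integrable \<nu> (\<lambda>x. partial_deriv j (\<lambda>u. f u x) \<theta>) \<and>
        ((\<lambda>t. \<integral>x. f (\<theta> + t \<cdot>\<^sub>v unit_vec d j) x \<partial>\<nu>) has_real_derivative
           (\<integral>x. partial_deriv j (\<lambda>u. f u x) \<theta> \<partial>\<nu>)) (at 0))"

definition score ::
    "nat \<Rightarrow> nat \<Rightarrow> (real Matrix.vec \<Rightarrow> 'x \<Rightarrow> real) \<Rightarrow> real Matrix.vec \<Rightarrow> (nat \<Rightarrow> 'x) \<Rightarrow> real Matrix.vec" where
  "score d n f \<theta> y = Matrix.vec d (\<lambda>j. \<Sum>i<n. vec_index (score1 d f \<theta> (y i)) j)"

definition fisher_info ::
    "(nat \<Rightarrow> 'x) measure \<Rightarrow> nat \<Rightarrow> nat \<Rightarrow> (real Matrix.vec \<Rightarrow> 'x \<Rightarrow> real) \<Rightarrow> real Matrix.vec \<Rightarrow> real mat" where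
  "fisher_info P d n f \<theta> = cov_mat P d (score d n f \<theta>)"

definition rao_stat ::
    "real mat \<Rightarrow> nat \<Rightarrow> nat \<Rightarrow> (real Matrix.vec \<Rightarrow> 'x \<Rightarrow> real) \<Rightarrow> real Matrix.vec \<Rightarrow> (nat \<Rightarrow> 'x) \<Rightarrow> real" where
  "rao_stat I d n f \<theta> y = scalar_prod (score d n f \<theta> y) (mat_inv I *\<^sub>v score d n f \<theta> y)"

definition std_score ::
    "real mat \<Rightarrow> nat \<Rightarrow> nat \<Rightarrow> (real Matrix.vec \<Rightarrow> 'x \<Rightarrow> real) \<Rightarrow> real Matrix.vec \<Rightarrow> nat \<Rightarrow> (nat \<Rightarrow> 'x) \<Rightarrow>
       real Matrix.vec" where
  "std_score I d n f \<theta> i y = sqrt (real n) \<cdot>\<^sub>v (mat_inv_sqrt I *\<^sub>v score1 d f \<theta> (y i))"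

end

theory Submission
  imports Defs "HOL-Real_Asymp.Real_Asymp"
begin

text \<open>The first and third terms of the bound are nonnegative, \<open>\<parallel>\<Sigma>\<^sup>-\<^sup>1\<parallel> \<parallel>\<Sigma>\<parallel> \<ge> 1\<close>, and \<open>C\<close> may be taken large because
  every number from 24 on is an admissible anticoncentration constant.  It is therefore enough to bound
  \<open>|P(|S - a|\<^sup>2 \<le> t) - P(|\<surd>n g - a|\<^sup>2 \<le> t)|\<close> by \<open>K (E|X|\<^sup>4 / n)\<^sup>1\<^sup>/\<^sup>2\<close> with a universal \<open>K\<close>, for the sum \<open>S\<close> of \<open>n\<close>
  independent copies of an isotropic vector \<open>X\<close> and a standard Gaussian \<open>g\<close>.

  Lindeberg's exchange is carried out under additional Gaussian noise of scale \<open>\<tau>\<close> proportional to \<open>(E|X|\<^sup>4)\<^sup>1\<^sup>/\<^sup>2\<close>.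
  The effect of one exchange is the mean likelihood ratio of the translated noise, whose Hermite expansion agrees with the
  Gaussian one up to order two; the third-order term is controlled by Bessel's inequality and the remainder by fourth
  moments, without a factor depending on the dimension.  The noise is removed by the monotonicity of the Gaussian measure
  of a ball in the distance of its centre and by the bound \<open>24 / \<lambda>\<close> for the density of \<open>|A g + m|\<close>, which follows from
  integration by parts along the field of dilations about the centre.\<close>

section \<open>Standard Gaussian vectors\<close>

text \<open>The indicator of a ball is not smooth, and derivatives of a smoothed indicator can cost
  powers of d. Differentiating the Gaussian noise instead turns an exchange of summands into an L1
  distance of likelihood ratios. Under noise of variance u its third-order part is at most sqrt(m4)
  / u^(3/2), where m4 = E|X|^4, because E (X.X')^3 for independent copies is the squared Frobenius
  norm of the third moment tensor; the fourth-order part m4 / u^2 is no larger once u \<ge> m4. This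
  fixes the scale of the noise. Summed over all exchanges, this alone gives a constant and not
  n^(-1/2), as little noise is left in the late ones. There the distance between the genuine and the
  Gaussian past supplies a second small factor, the error for fewer summands; hence an induction on
  n. The other summands move the centre, so the induction needs balls about every point, not only
  about 0. The mean shift \<tau>^2 d that noise adds to squared distances is the same for all points
  and is absorbed by the choice of a threshold; only the fluctuations count.\<close>

abbreviation stdN :: "real measure" where
  "stdN \<equiv> density lborel (\<lambda>x. ennreal (std_normal_density x))"

lemma prob_space_stdN: "prob_space stdN"
  by (rule prob_space_normal_density) simp

interpretation stdN: prob_space stdN
  by (rule prob_space_stdN)

interpretation stdNs: product_prob_space "\<lambda>_::nat. stdN" UNIV
  by (rule product_prob_spaceI) (rule prob_space_stdN)

lemma prob_space_std_gauss: "prob_space (std_gauss d)"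
  unfolding std_gauss_def by (intro prob_space_PiM prob_space_stdN)

interpretation gauss: prob_space "std_gauss d"
  by (rule prob_space_std_gauss)

lemma sets_std_gauss [measurable_cong]: "sets (std_gauss d) = sets (PiM {..<d} (\<lambda>_. borel))"
  unfolding std_gauss_def by (intro sets_PiM_cong) auto

lemma measurable_std_gauss_coord:
  "i < d \<Longrightarrow> (\<lambda>g. g i) \<in> borel_measurable (std_gauss d)"
  by (subst measurable_cong_sets[OF sets_std_gauss refl]) simp

section \<open>Images and densities of finite product measures\<close>

lemma distr_pair_snd:
  assumes "prob_space N" "prob_space K"
  shows "distr (N \<Otimes>\<^sub>M K) K snd = K"
proof (rule measure_eqI)
  interpret N: prob_space N by fact
  interpret K: prob_space K by fact
  fix A assume "A \<in> sets (distr (N \<Otimes>\<^sub>M K) K snd)"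
  then have A: "A \<in> sets K" by simp
  then have "snd -` A \<inter> space (N \<Otimes>\<^sub>M K) = space N \<times> A"
    using sets.sets_into_space[OF A] by (auto simp: space_pair_measure)
  then show "emeasure (distr (N \<Otimes>\<^sub>M K) K snd) A = emeasure K A"
    using A by (simp add: emeasure_distr K.emeasure_pair_measure_Times N.emeasure_space_1)
qed simp

lemma indicator_PiE_restrict:
  assumes "finite I"
  shows "indicator (PiE I A) (\<lambda>i\<in>I. h i) = (\<Prod>i\<in>I. indicator (A i) (h i) :: ennreal)"
proof (cases "\<forall>i\<in>I. h i \<in> A i")
  case True
  then have "(\<lambda>i\<in>I. h i) \<in> PiE I A" by auto
  then show ?thesis using True by simp
next
  case False
  then obtain i where i: "i \<in> I" "h i \<notin> A i" by auto
  then have "(\<lambda>i\<in>I. h i) \<notin> PiE I A" by (auto simp: PiE_iff)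
  moreover have "(\<Prod>i\<in>I. indicator (A i) (h i) :: ennreal) = 0"
    using i assms by (intro prod_zero) (auto intro!: bexI[of _ i])
  ultimately show ?thesis by simp
qed

text \<open>A finite product measure is determined by its values on boxes. On a box the left side is
  a double integral of a product over \<open>I\<close>, and Tonelli factors it coordinate by
  coordinate. With \<open>f i\<close> a weighted sum this lifts the addition rule for normal
  variables to Gaussian vectors.\<close>

lemma distr_pair_PiM:
  fixes I :: "nat set" and N :: "nat \<Rightarrow> 'a measure" and K :: "nat \<Rightarrow> 'b measure"
  assumes fin: "finite I" and N: "\<And>i. prob_space (N i)" and K: "\<And>i. prob_space (K i)"
    and f: "\<And>i. i \<in> I \<Longrightarrow> case_prod (f i) \<in> borel_measurable (N i \<Otimes>\<^sub>M K i)"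
  shows "distr (PiM I N \<Otimes>\<^sub>M PiM I K) (PiM I (\<lambda>_. borel)) (\<lambda>(g, h). \<lambda>i\<in>I. f i (g i) (h i)) =
    PiM I (\<lambda>i. distr (N i \<Otimes>\<^sub>M K i) (borel :: real measure) (case_prod (f i)))"
proof -
  interpret N: product_prob_space N by (rule product_prob_spaceI) (rule N)
  interpret K: product_prob_space K by (rule product_prob_spaceI) (rule K)
  interpret NK: pair_prob_space "N i" "K i" for i
    unfolding pair_prob_space_def pair_sigma_finite_def
    by (intro conjI N K prob_space_imp_sigma_finite)
  have NKp: "prob_space (N i \<Otimes>\<^sub>M K i)" for i by unfold_locales
  \<comment> \<open>Outside \<open>I\<close> a point mass stands in, so that every factor is a
    probability measure, as \<open>product_prob_space\<close> demands.\<close>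
  define N' where "N' = (\<lambda>i. if i \<in> I then distr (N i \<Otimes>\<^sub>M K i) (borel :: real measure) (case_prod (f i)) else return borel 0)"
  interpret N': product_prob_space N'
    by (rule product_prob_spaceI)
       (auto simp: N'_def intro!: prob_space_return prob_space.prob_space_distr NKp f)
  have 1: "PiM I (\<lambda>i. distr (N i \<Otimes>\<^sub>M K i) (borel :: real measure) (case_prod (f i))) = PiM I N'"
    by (intro PiM_cong) (auto simp: N'_def)
  have sigma: "sigma_finite_measure (PiM I K)"
    using prob_space_PiM[of I K] K prob_space_imp_sigma_finite by blast
  have f1: "(\<lambda>z. f i (fst z) (snd z)) \<in> borel_measurable (N i \<Otimes>\<^sub>M K i)" if "i \<in> I" for i
    using f[OF that] by (simp add: case_prod_beta')
  have comp: "(\<lambda>p. f i (fst p i) (snd p i)) \<in> borel_measurable (PiM I N \<Otimes>\<^sub>M PiM I K)" if i: "i \<in> I" for i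
  proof -
    have m: "(\<lambda>p. (fst p i, snd p i)) \<in> (PiM I N \<Otimes>\<^sub>M PiM I K) \<rightarrow>\<^sub>M (N i \<Otimes>\<^sub>M K i)"
      using i by measurable
    show ?thesis using measurable_compose[OF m f1[OF i]] by simp
  qed
  have meas: "(\<lambda>(g, h). \<lambda>i\<in>I. f i (g i) (h i)) \<in> (PiM I N \<Otimes>\<^sub>M PiM I K) \<rightarrow>\<^sub>M PiM I (\<lambda>_. borel)"
    unfolding case_prod_beta' by (intro measurable_restrict comp)
  have "distr (PiM I N \<Otimes>\<^sub>M PiM I K) (PiM I (\<lambda>_. borel)) (\<lambda>(g, h). \<lambda>i\<in>I. f i (g i) (h i)) = PiM I N'"
  proof (rule N'.PiM_eqI[OF fin])
    show "sets (distr (PiM I N \<Otimes>\<^sub>M PiM I K) (PiM I (\<lambda>_. borel)) (\<lambda>(g, h). \<lambda>i\<in>I. f i (g i) (h i))) = sets (PiM I N')"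
      by (auto intro!: sets_PiM_cong simp: N'_def)
  next
    fix A assume A: "\<And>i. i \<in> I \<Longrightarrow> A i \<in> sets (N' i)"
    then have A': "\<And>i. i \<in> I \<Longrightarrow> A i \<in> sets borel" by (auto simp: N'_def)
    have box: "PiE I A \<in> sets (PiM I (\<lambda>_. borel))" using fin A' by (intro sets_PiM_I_finite) auto
    have fA: "(\<lambda>z. indicator (A i) (f i (fst z) (snd z)) :: ennreal) \<in> borel_measurable (N i \<Otimes>\<^sub>M K i)" if "i \<in> I" for i
      using measurable_compose[OF f1[OF that], of "indicator (A i)" borel] A'[OF that] by simp
    have fA1: "(\<lambda>y. indicator (A i) (f i x y) :: ennreal) \<in> borel_measurable (K i)" if "i \<in> I" "x \<in> space (N i)" for i x
      using measurable_compose[OF measurable_Pair1'[OF that(2)] fA[OF that(1)]] by simp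
    have fA2: "(\<lambda>x. \<integral>\<^sup>+y. indicator (A i) (f i x y) \<partial>K i) \<in> borel_measurable (N i)" if "i \<in> I" for i
      using K.M.borel_measurable_nn_integral_fst[OF fA[OF that]] by simp
    have "emeasure (distr (PiM I N \<Otimes>\<^sub>M PiM I K) (PiM I (\<lambda>_. borel)) (\<lambda>(g, h). \<lambda>i\<in>I. f i (g i) (h i))) (PiE I A)
      = (\<integral>\<^sup>+p. indicator (PiE I A) ((\<lambda>(g, h). \<lambda>i\<in>I. f i (g i) (h i)) p) \<partial>(PiM I N \<Otimes>\<^sub>M PiM I K))"
      by (subst nn_integral_indicator[symmetric], simp add: box, subst nn_integral_distr[OF meas])
         (auto intro!: borel_measurable_indicator box)
    also have "\<dots> = (\<integral>\<^sup>+p. (\<Prod>i\<in>I. indicator (A i) (f i (fst p i) (snd p i))) \<partial>(PiM I N \<Otimes>\<^sub>M PiM I K))"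
      by (intro nn_integral_cong) (simp add: case_prod_beta' indicator_PiE_restrict[OF fin])
    also have "\<dots> = (\<integral>\<^sup>+g. \<integral>\<^sup>+h. (\<Prod>i\<in>I. indicator (A i) (f i (g i) (h i))) \<partial>PiM I K \<partial>PiM I N)"
    proof (subst sigma_finite_measure.nn_integral_fst[OF sigma, symmetric])
      show "(\<lambda>p. \<Prod>i\<in>I. indicator (A i) (f i (fst p i) (snd p i)) :: ennreal) \<in> borel_measurable (PiM I N \<Otimes>\<^sub>M PiM I K)"
        by (intro borel_measurable_prod_ennreal measurable_compose[OF comp] borel_measurable_indicator A')
    qed simp
    also have "\<dots> = (\<integral>\<^sup>+g. (\<Prod>i\<in>I. \<integral>\<^sup>+y. indicator (A i) (f i (g i) y) \<partial>K i) \<partial>PiM I N)"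
    proof (intro nn_integral_cong)
      fix g assume g: "g \<in> space (PiM I N)"
      show "(\<integral>\<^sup>+h. (\<Prod>i\<in>I. indicator (A i) (f i (g i) (h i))) \<partial>PiM I K) = (\<Prod>i\<in>I. \<integral>\<^sup>+y. indicator (A i) (f i (g i) y) \<partial>K i)"
        using K.product_nn_integral_prod[of I "\<lambda>i y. indicator (A i) (f i (g i) y)"] fin g fA1
        by (auto simp: space_PiM PiE_iff)
    qed
    also have "\<dots> = (\<Prod>i\<in>I. \<integral>\<^sup>+x. \<integral>\<^sup>+y. indicator (A i) (f i x y) \<partial>K i \<partial>N i)"
      using N.product_nn_integral_prod[of I "\<lambda>i x. \<integral>\<^sup>+y. indicator (A i) (f i x y) \<partial>K i"] fin fA2 by auto
    also have "\<dots> = (\<Prod>i\<in>I. emeasure (N' i) (A i))"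
    proof (intro prod.cong refl)
      fix i assume i: "i \<in> I"
      have "emeasure (N' i) (A i) = (\<integral>\<^sup>+z. indicator (A i) (f i (fst z) (snd z)) \<partial>(N i \<Otimes>\<^sub>M K i))"
        using i A'[OF i] f[OF i]
        by (simp add: N'_def nn_integral_indicator[symmetric] del: nn_integral_indicator)
           (subst nn_integral_distr; simp add: case_prod_beta')
      also have "\<dots> = (\<integral>\<^sup>+x. \<integral>\<^sup>+y. indicator (A i) (f i x y) \<partial>K i \<partial>N i)"
        by (subst K.M.nn_integral_fst[OF fA[OF i], symmetric]) simp
      finally show "(\<integral>\<^sup>+x. \<integral>\<^sup>+y. indicator (A i) (f i x y) \<partial>K i \<partial>N i) = emeasure (N' i) (A i)" ..
    qed
    finally show "emeasure (distr (PiM I N \<Otimes>\<^sub>M PiM I K) (PiM I (\<lambda>_. borel)) (\<lambda>(g, h). \<lambda>i\<in>I. f i (g i) (h i))) (PiE I A)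
      = (\<Prod>i\<in>I. emeasure (N' i) (A i))" .
  qed
  then show ?thesis using 1 by simp
qed

lemma stdN_scale:
  assumes "a \<noteq> 0"
  shows "distr stdN borel (\<lambda>x. a * x) = density lborel (\<lambda>x. ennreal (normal_density 0 \<bar>a\<bar> x))"
proof -
  have "distributed stdN lborel (\<lambda>x. x) std_normal_density"
    unfolding distributed_def by (auto simp: distr_id2)
  from stdN.normal_density_affine[OF this, of a 0] assms
  have "distributed stdN lborel (\<lambda>x. a * x) (normal_density 0 \<bar>a\<bar>)" by simp
  then show ?thesis unfolding distributed_def by (metis distr_cong sets_lborel)
qed

lemma stdN_add:
  assumes b: "b > 0" and a: "a \<ge> 0"
  shows "distr (stdN \<Otimes>\<^sub>M stdN) borel (\<lambda>(x, y). a * x + b * y) = distr stdN borel (\<lambda>x. sqrt (a\<^sup>2 + b\<^sup>2) * x)"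
\<comment> \<open>There is no normal density of deviation 0, so the convolution rule applies only
  for \<open>a > 0\<close>; for \<open>a = 0\<close> the first variable is integrated out.\<close>
proof (cases "a = 0")
  case True
  interpret NN: pair_prob_space stdN stdN by unfold_locales
  have "distr (stdN \<Otimes>\<^sub>M stdN) borel (\<lambda>(x, y). a * x + b * y) = distr (distr (stdN \<Otimes>\<^sub>M stdN) stdN snd) borel (\<lambda>y. b * y)"
    using True by (subst distr_distr) (auto simp: comp_def case_prod_beta')
  also have "distr (stdN \<Otimes>\<^sub>M stdN) stdN snd = stdN"
    by (rule distr_pair_snd[OF prob_space_stdN prob_space_stdN])
  finally show ?thesis using True b by simp
next
  case False
  then have a: "a > 0" using a by simp
  interpret NN: pair_prob_space stdN stdN by unfold_locales
  have d: "distributed (stdN \<Otimes>\<^sub>M stdN) lborel fst std_normal_density"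
     "distributed (stdN \<Otimes>\<^sub>M stdN) lborel snd std_normal_density"
  proof -
    have "distr (stdN \<Otimes>\<^sub>M stdN) lborel fst = distr (stdN \<Otimes>\<^sub>M stdN) stdN fst"
      by (intro distr_cong) auto
    then show "distributed (stdN \<Otimes>\<^sub>M stdN) lborel fst std_normal_density"
      unfolding distributed_def using stdN.distr_pair_fst[of stdN] by simp
    have "distr (stdN \<Otimes>\<^sub>M stdN) lborel snd = distr (stdN \<Otimes>\<^sub>M stdN) stdN snd"
      by (intro distr_cong) auto
    then show "distributed (stdN \<Otimes>\<^sub>M stdN) lborel snd std_normal_density"
      unfolding distributed_def using distr_pair_snd[OF prob_space_stdN prob_space_stdN] by simp
  qed
  from NN.P.normal_density_affine[OF d(1), of a 0] NN.P.normal_density_affine[OF d(2), of b 0] a b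
  have n: "distributed (stdN \<Otimes>\<^sub>M stdN) lborel (\<lambda>z. a * fst z) (normal_density 0 a)"
    "distributed (stdN \<Otimes>\<^sub>M stdN) lborel (\<lambda>z. b * snd z) (normal_density 0 b)" by simp_all
  have ind: "NN.P.indep_var borel (\<lambda>z. a * fst z) borel (\<lambda>z. b * snd z)"
  proof -
    have "NN.P.indep_var stdN fst stdN snd"
      unfolding NN.P.indep_var_distribution_eq stdN.distr_pair_fst distr_pair_snd[OF prob_space_stdN prob_space_stdN]
      by (auto simp: distr_id2)
    then show ?thesis
      using NN.P.indep_var_compose[of stdN fst stdN snd "\<lambda>x. a * x" borel "\<lambda>x. b * x" borel]
      by (simp add: comp_def)
  qed
  from NN.P.add_indep_normal[OF ind a b n]
  have "distributed (stdN \<Otimes>\<^sub>M stdN) lborel (\<lambda>z. a * fst z + b * snd z) (normal_density 0 (sqrt (a\<^sup>2 + b\<^sup>2)))" by simp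
  moreover have "sqrt (a\<^sup>2 + b\<^sup>2) > 0" using a b by (simp add: sum_power2_gt_zero_iff)
  ultimately show ?thesis
    unfolding distributed_def
    using a by (subst stdN_scale) (auto simp: case_prod_beta' distr_cong[of _ _ borel lborel])
qed

text \<open>Points of R^d are functions on \<open>nat\<close> of which the first \<open>d\<close>
  values count. This fits the product measure \<open>std_gauss d\<close>, lets \<open>d\<close> vary
  in inductions, and leaves matrices and \<open>carrier_vec\<close> to the last stage.\<close>

definition sqn :: "nat \<Rightarrow> (nat \<Rightarrow> real) \<Rightarrow> real" where
  "sqn d x = (\<Sum>i<d. (x i)\<^sup>2)"

definition dot :: "nat \<Rightarrow> (nat \<Rightarrow> real) \<Rightarrow> (nat \<Rightarrow> real) \<Rightarrow> real" where
  "dot d x y = (\<Sum>i<d. x i * y i)"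

lemma sqn_nonneg [simp]: "0 \<le> sqn d x"
  unfolding sqn_def by (simp add: sum_nonneg)

lemma distr_PiM_coordinatewise:
  fixes I :: "nat set" and N :: "nat \<Rightarrow> 'a measure"
  assumes fin: "finite I" and N: "\<And>i. prob_space (N i)"
    and f: "\<And>i. i \<in> I \<Longrightarrow> f i \<in> borel_measurable (N i)"
  shows "distr (PiM I N) (PiM I (\<lambda>_. borel)) (\<lambda>g. \<lambda>i\<in>I. f i (g i)) =
    PiM I (\<lambda>i. distr (N i) (borel :: real measure) (f i))"
proof -
  interpret N: product_prob_space N by (rule product_prob_spaceI) (rule N)
  define N' where "N' = (\<lambda>i. if i \<in> I then distr (N i) (borel :: real measure) (f i) else return borel 0)"
  interpret N': product_prob_space N'
    by (rule product_prob_spaceI)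
       (auto simp: N'_def intro!: prob_space_return prob_space.prob_space_distr N f)
  have 1: "PiM I (\<lambda>i. distr (N i) (borel :: real measure) (f i)) = PiM I N'"
    by (intro PiM_cong) (auto simp: N'_def)
  have meas: "(\<lambda>g. \<lambda>i\<in>I. f i (g i)) \<in> PiM I N \<rightarrow>\<^sub>M PiM I (\<lambda>_. borel)"
    by (intro measurable_restrict) (rule measurable_compose[OF measurable_component_singleton], auto intro: f)
  have "distr (PiM I N) (PiM I (\<lambda>_. borel)) (\<lambda>g. \<lambda>i\<in>I. f i (g i)) = PiM I N'"
  proof (rule N'.PiM_eqI[OF fin])
    show "sets (distr (PiM I N) (PiM I (\<lambda>_. borel)) (\<lambda>g. \<lambda>i\<in>I. f i (g i))) = sets (PiM I N')"
      by (auto intro!: sets_PiM_cong simp: N'_def)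
  next
    fix A assume A: "\<And>i. i \<in> I \<Longrightarrow> A i \<in> sets (N' i)"
    then have A': "\<And>i. i \<in> I \<Longrightarrow> A i \<in> sets borel" by (auto simp: N'_def)
    have box: "PiE I A \<in> sets (PiM I (\<lambda>_. borel))" using fin A' by (intro sets_PiM_I_finite) auto
    have pre: "(\<lambda>g. \<lambda>i\<in>I. f i (g i)) -` PiE I A \<inter> space (PiM I N) = PiE I (\<lambda>i. f i -` A i \<inter> space (N i))"
      by (auto simp: space_PiM PiE_iff)
    show "emeasure (distr (PiM I N) (PiM I (\<lambda>_. borel)) (\<lambda>g. \<lambda>i\<in>I. f i (g i))) (PiE I A) =
        (\<Prod>i\<in>I. emeasure (N' i) (A i))"
      using f A' by (simp add: emeasure_distr[OF meas box] pre N.emeasure_PiM fin N'_def emeasure_distr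
          measurable_sets)
  qed
  then show ?thesis using 1 by simp
qed

text \<open>As for images, boxes suffice: a product weight times the indicator of a box is again a
  product over the coordinates.\<close>

lemma density_PiM:
  fixes I :: "nat set" and N :: "nat \<Rightarrow> 'a measure"
  assumes fin: "finite I" and N: "\<And>i. prob_space (N i)"
    and w: "\<And>i. i \<in> I \<Longrightarrow> w i \<in> borel_measurable (N i)"
    and pw: "\<And>i. i \<in> I \<Longrightarrow> prob_space (density (N i) (w i))"
  shows "density (PiM I N) (\<lambda>g. \<Prod>i\<in>I. w i (g i)) = PiM I (\<lambda>i. density (N i) (w i))"
proof -
  interpret N: product_prob_space N by (rule product_prob_spaceI) (rule N)
  define N' where "N' = (\<lambda>i. if i \<in> I then density (N i) (w i) else N i)"
  interpret N': product_prob_space N'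
    by (rule product_prob_spaceI) (auto simp: N'_def intro!: pw N)
  have 1: "PiM I (\<lambda>i. density (N i) (w i)) = PiM I N'"
    by (intro PiM_cong) (auto simp: N'_def)
  have meas: "(\<lambda>g. \<Prod>i\<in>I. w i (g i)) \<in> borel_measurable (PiM I N)"
    by (intro borel_measurable_prod_ennreal) (rule measurable_compose[OF measurable_component_singleton], auto intro: w)
  have "density (PiM I N) (\<lambda>g. \<Prod>i\<in>I. w i (g i)) = PiM I N'"
  proof (rule N'.PiM_eqI[OF fin])
    show "sets (density (PiM I N) (\<lambda>g. \<Prod>i\<in>I. w i (g i))) = sets (PiM I N')"
      by (auto intro!: sets_PiM_cong simp: N'_def)
  next
    fix A assume "\<And>i. i \<in> I \<Longrightarrow> A i \<in> sets (N' i)"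
    then have A: "\<And>i. i \<in> I \<Longrightarrow> A i \<in> sets (N i)" by (auto simp: N'_def)
    have box: "PiE I A \<in> sets (PiM I N)" using fin A by (intro sets_PiM_I_finite) auto
    have "emeasure (density (PiM I N) (\<lambda>g. \<Prod>i\<in>I. w i (g i))) (PiE I A)
      = (\<integral>\<^sup>+g. (\<Prod>i\<in>I. w i (g i)) * indicator (PiE I A) g \<partial>PiM I N)"
      using meas box by (rule emeasure_density)
    also have "\<dots> = (\<integral>\<^sup>+g. (\<Prod>i\<in>I. w i (g i) * indicator (A i) (g i)) \<partial>PiM I N)"
    proof (intro nn_integral_cong)
      fix g assume "g \<in> space (PiM I N)"
      then have "g = (\<lambda>i\<in>I. g i)" by (auto simp: space_PiM PiE_iff extensional_restrict)
      then have "indicator (PiE I A) g = (\<Prod>i\<in>I. indicator (A i) (g i) :: ennreal)"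
        using indicator_PiE_restrict[OF fin, of A g] by simp
      then show "(\<Prod>i\<in>I. w i (g i)) * indicator (PiE I A) g = (\<Prod>i\<in>I. w i (g i) * indicator (A i) (g i))"
        by (simp add: prod.distrib)
    qed
    also have "\<dots> = (\<Prod>i\<in>I. \<integral>\<^sup>+x. w i x * indicator (A i) x \<partial>N i)"
      by (intro N.product_nn_integral_prod fin borel_measurable_times_ennreal w borel_measurable_indicator A)
    also have "\<dots> = (\<Prod>i\<in>I. emeasure (N' i) (A i))"
      by (intro prod.cong) (auto simp: N'_def emeasure_density w A)
    finally show "emeasure (density (PiM I N) (\<lambda>g. \<Prod>i\<in>I. w i (g i))) (PiE I A) = (\<Prod>i\<in>I. emeasure (N' i) (A i))" .
  qed
  then show ?thesis using 1 by simp
qed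

text \<open>The variances of independent Gaussian noises add. In \<open>bprob_add\<close> this
  merges Gaussian summands with the auxiliary noise into noise of a single scale.\<close>

lemma std_gauss_add:
  assumes b: "b > 0" and a: "a \<ge> 0"
  shows "distr (std_gauss d \<Otimes>\<^sub>M std_gauss d) (PiM {..<d} (\<lambda>_. borel)) (\<lambda>(g, h). \<lambda>i\<in>{..<d}. a * g i + b * h i)
    = distr (std_gauss d) (PiM {..<d} (\<lambda>_. borel)) (\<lambda>g. \<lambda>i\<in>{..<d}. sqrt (a\<^sup>2 + b\<^sup>2) * g i)"
proof -
  have "distr (std_gauss d \<Otimes>\<^sub>M std_gauss d) (PiM {..<d} (\<lambda>_. borel)) (\<lambda>(g, h). \<lambda>i\<in>{..<d}. a * g i + b * h i)
    = PiM {..<d} (\<lambda>i. distr (stdN \<Otimes>\<^sub>M stdN) borel (\<lambda>(x, y). a * x + b * y))"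
    unfolding std_gauss_def by (rule distr_pair_PiM) (auto intro: prob_space_stdN)
  also have "\<dots> = PiM {..<d} (\<lambda>i. distr stdN borel (\<lambda>x. sqrt (a\<^sup>2 + b\<^sup>2) * x))"
    using stdN_add[OF b a] by simp
  also have "\<dots> = distr (std_gauss d) (PiM {..<d} (\<lambda>_. borel)) (\<lambda>g. \<lambda>i\<in>{..<d}. sqrt (a\<^sup>2 + b\<^sup>2) * g i)"
    unfolding std_gauss_def by (rule distr_PiM_coordinatewise[symmetric]) (auto intro: prob_space_stdN)
  finally show ?thesis .
qed

section \<open>Translations and linear functionals of Gaussian vectors\<close>

lemma stdN_shift: "distr stdN borel (\<lambda>y. y + a) = density stdN (\<lambda>y. ennreal (exp (a * y - a\<^sup>2 / 2)))"
proof -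
  have "distributed stdN lborel (\<lambda>x. x) std_normal_density"
    unfolding distributed_def by (auto simp: distr_id2)
  from stdN.normal_density_affine[OF this, of 1 a]
  have "distributed stdN lborel (\<lambda>x. x + a) (normal_density a 1)" by (simp add: add.commute)
  then have "distr stdN borel (\<lambda>y. y + a) = density lborel (normal_density a 1)"
    unfolding distributed_def by (metis distr_cong sets_lborel)
  also have "\<dots> = density lborel (\<lambda>y. ennreal (std_normal_density y) * ennreal (exp (a * y - a\<^sup>2 / 2)))"
    by (intro density_cong) (auto simp: normal_density_def ennreal_mult[symmetric] exp_add[symmetric] power2_eq_square field_simps
        intro!: AE_I2)
  also have "\<dots> = density stdN (\<lambda>y. ennreal (exp (a * y - a\<^sup>2 / 2)))"
    by (subst density_density_eq) auto
  finally show ?thesis .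
qed

text \<open>Cameron-Martin formula: the likelihood ratios of the coordinates multiply to the
  exponential of a linear functional minus half of |x|^2.\<close>

lemma std_gauss_shift:
  "distr (std_gauss d) (PiM {..<d} (\<lambda>_. borel)) (\<lambda>g. \<lambda>i\<in>{..<d}. g i + x i) =
    density (std_gauss d) (\<lambda>g. ennreal (exp (dot d x g - sqn d x / 2)))"
proof -
  have pr: "prob_space (density stdN (\<lambda>y. ennreal (exp (a * y - a\<^sup>2 / 2))))" for a
    using stdN.prob_space_distr[of "\<lambda>y. y + a" borel] unfolding stdN_shift by simp
  have "distr (std_gauss d) (PiM {..<d} (\<lambda>_. borel)) (\<lambda>g. \<lambda>i\<in>{..<d}. g i + x i) =
     PiM {..<d} (\<lambda>i. distr stdN borel (\<lambda>y. y + x i))"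
    unfolding std_gauss_def by (rule distr_PiM_coordinatewise) (auto intro: prob_space_stdN)
  also have "\<dots> = PiM {..<d} (\<lambda>i. density stdN (\<lambda>y. ennreal (exp (x i * y - (x i)\<^sup>2 / 2))))"
    unfolding stdN_shift ..
  also have "\<dots> = density (PiM {..<d} (\<lambda>i. stdN)) (\<lambda>g. \<Prod>i<d. ennreal (exp (x i * g i - (x i)\<^sup>2 / 2)))"
    by (rule density_PiM[symmetric]) (auto intro: prob_space_stdN pr)
  also have "\<dots> = density (std_gauss d) (\<lambda>g. ennreal (exp (dot d x g - sqn d x / 2)))"
    unfolding std_gauss_def
    by (simp add: prod_ennreal exp_sum[symmetric] dot_def sqn_def sum_subtractf sum_divide_distrib)
  finally show ?thesis .
qed

lemma dot_measurable [measurable]: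
  assumes "\<And>i. i < d \<Longrightarrow> (\<lambda>w. X w i) \<in> borel_measurable M" "\<And>i. i < d \<Longrightarrow> (\<lambda>w. Y w i) \<in> borel_measurable M"
  shows "(\<lambda>w. dot d (X w) (Y w)) \<in> borel_measurable M"
  unfolding dot_def using assms by (intro borel_measurable_sum borel_measurable_times) auto

lemma sqn_measurable [measurable]:
  assumes "\<And>i. i < d \<Longrightarrow> (\<lambda>w. X w i) \<in> borel_measurable M"
  shows "(\<lambda>w. sqn d (X w)) \<in> borel_measurable M"
  unfolding sqn_def using assms by (intro borel_measurable_sum borel_measurable_power) auto

text \<open>The translate \<open>\<lambda>i. g i + x i\<close> is in general not extensional and so
  lies outside the space of the product measure; the hypothesis that \<open>f\<close> ignores
  restriction to \<open>{..<d}\<close> makes the change of variables legitimate.\<close>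

lemma integral_std_gauss_shift:
  fixes f :: "(nat \<Rightarrow> real) \<Rightarrow> real"
  assumes f: "f \<in> borel_measurable (PiM {..<d} (\<lambda>_. borel))"
    and fr: "\<And>g. f (restrict g {..<d}) = f g"
  shows "(\<integral>g. f (\<lambda>i. g i + x i) \<partial>std_gauss d) = (\<integral>g. exp (dot d x g - sqn d x / 2) * f g \<partial>std_gauss d)"
proof -
  have "(\<integral>g. f (\<lambda>i. g i + x i) \<partial>std_gauss d) = (\<integral>g. f (\<lambda>i\<in>{..<d}. g i + x i) \<partial>std_gauss d)"
    by (intro Bochner_Integration.integral_cong refl) (metis fr)
  also have "\<dots> = (\<integral>g. f g \<partial>distr (std_gauss d) (PiM {..<d} (\<lambda>_. borel)) (\<lambda>g. \<lambda>i\<in>{..<d}. g i + x i))"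
    by (rule integral_distr[symmetric, OF _ f]) (intro measurable_restrict, measurable)
  also have "\<dots> = (\<integral>g. exp (dot d x g - sqn d x / 2) * f g \<partial>std_gauss d)"
    unfolding std_gauss_shift using f
    by (subst integral_density) (auto cong: measurable_cong_sets simp: measurable_cong_sets[OF sets_std_gauss refl])
  finally show ?thesis .
qed

lemma distr_std_gauss_coord:
  "i < d \<Longrightarrow> distr (std_gauss d) borel (\<lambda>g. f (g i)) = distr stdN borel f" if [measurable]: "f \<in> borel_measurable borel"
  for f :: "real \<Rightarrow> real"
proof -
  assume i: "i < d"
  have "distr (std_gauss d) borel (\<lambda>g. f (g i)) = distr (distr (std_gauss d) stdN (\<lambda>g. g i)) borel f"
    using i by (subst distr_distr) (auto simp: comp_def)
  also have "distr (std_gauss d) stdN (\<lambda>g. g i) = stdN"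
    unfolding std_gauss_def using i by (intro distr_PiM_component) (auto intro: prob_space_stdN)
  finally show ?thesis .
qed

text \<open>A sum of independent normal variables is normal, with variance |x|^2. Coordinates with
  \<open>x i = 0\<close> are dropped, since a normal density needs a positive deviation; if none
  remains, both sides are the point mass at 0.\<close>

lemma distr_dot_std_gauss: "distr (std_gauss d) borel (dot d x) = distr stdN borel (\<lambda>v. sqrt (sqn d x) * v)"
proof -
  define I where "I = {i. i < d \<and> x i \<noteq> 0}"
  have fI: "finite I" unfolding I_def by simp
  have dotI: "dot d x g = (\<Sum>i\<in>I. x i * g i)" for g
    unfolding dot_def I_def by (rule sum.mono_neutral_right) auto
  have sqnI: "sqn d x = (\<Sum>i\<in>I. \<bar>x i\<bar>\<^sup>2)"
    unfolding sqn_def I_def by (simp, rule sum.mono_neutral_right) auto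
  show ?thesis
  proof (cases "I = {}")
    case True
    then have "dot d x = (\<lambda>_. 0)" "sqn d x = 0" using dotI sqnI by auto
    then show ?thesis using gauss.distr_const[of 0 borel d] stdN.distr_const[of 0 borel] by simp
  next
    case False
    then have d0: "{..<d} \<noteq> {}" unfolding I_def by auto
    have "gauss.indep_vars d (\<lambda>_. borel) (\<lambda>i g. x i * g i) {..<d}"
    proof (subst gauss.indep_vars_iff_distr_eq_PiM'[OF d0])
      show "\<And>i. i \<in> {..<d} \<Longrightarrow> gauss.random_variable d borel (\<lambda>g. x i * g i)" by auto
      have "distr (std_gauss d) (PiM {..<d} (\<lambda>_. borel)) (\<lambda>g. \<lambda>i\<in>{..<d}. x i * g i)
        = PiM {..<d} (\<lambda>i. distr stdN borel (\<lambda>y. x i * y))"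
        unfolding std_gauss_def by (rule distr_PiM_coordinatewise) (auto intro: prob_space_stdN)
      also have "\<dots> = PiM {..<d} (\<lambda>i. distr (std_gauss d) borel (\<lambda>g. x i * g i))"
        by (intro PiM_cong refl distr_std_gauss_coord[symmetric]) auto
      finally show "distr (std_gauss d) (PiM {..<d} (\<lambda>_. borel)) (\<lambda>g. \<lambda>i\<in>{..<d}. x i * g i)
        = PiM {..<d} (\<lambda>i. distr (std_gauss d) borel (\<lambda>g. x i * g i))" .
    qed
    then have ind: "gauss.indep_vars d (\<lambda>_. borel) (\<lambda>i g. x i * g i) I"
      by (rule gauss.indep_vars_subset) (auto simp: I_def)
    have "distributed (std_gauss d) lborel (\<lambda>g. \<Sum>i\<in>I. x i * g i) (normal_density (\<Sum>i\<in>I. 0) (sqrt (\<Sum>i\<in>I. \<bar>x i\<bar>\<^sup>2)))"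
    proof (rule gauss.sum_indep_normal[OF fI False ind])
      fix i assume i: "i \<in> I"
      then show "0 < \<bar>x i\<bar>" by (auto simp: I_def)
      have "distr (std_gauss d) lborel (\<lambda>g. x i * g i) = distr (std_gauss d) borel (\<lambda>g. x i * g i)"
        by (intro distr_cong) auto
      also have "\<dots> = distr stdN borel (\<lambda>v. x i * v)"
        using i by (intro distr_std_gauss_coord) (auto simp: I_def)
      finally show "distributed (std_gauss d) lborel (\<lambda>g. x i * g i) (normal_density 0 \<bar>x i\<bar>)"
        using i stdN_scale[of "x i"] unfolding distributed_def by (auto simp: I_def)
    qed
    then have "distr (std_gauss d) lborel (dot d x) = density lborel (normal_density 0 (sqrt (sqn d x)))"
      unfolding distributed_def by (simp add: sqnI dotI[abs_def])
    moreover have "distr (std_gauss d) lborel (dot d x) = distr (std_gauss d) borel (dot d x)"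
      by (intro distr_cong) auto
    moreover have "sqn d x > 0" unfolding sqnI using False fI
      by (intro sum_pos) (auto simp: I_def)
    ultimately show ?thesis using stdN_scale[of "sqrt (sqn d x)"] by simp
  qed
qed

lemma integral_dot_std_gauss:
  fixes f :: "real \<Rightarrow> real"
  assumes [measurable]: "f \<in> borel_measurable borel"
  shows "(\<integral>g. f (dot d x g) \<partial>std_gauss d) = (\<integral>v. f (sqrt (sqn d x) * v) \<partial>stdN)"
    and "integrable (std_gauss d) (\<lambda>g. f (dot d x g)) \<longleftrightarrow> integrable stdN (\<lambda>v. f (sqrt (sqn d x) * v))"
proof -
  have m: "dot d x \<in> borel_measurable (std_gauss d)" by measurable
  have "(\<integral>g. f (dot d x g) \<partial>std_gauss d) = (\<integral>y. f y \<partial>distr (std_gauss d) borel (dot d x))"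
    by (rule integral_distr[symmetric, OF m]) simp
  also have "\<dots> = (\<integral>v. f (sqrt (sqn d x) * v) \<partial>stdN)"
    unfolding distr_dot_std_gauss by (rule integral_distr) auto
  finally show "(\<integral>g. f (dot d x g) \<partial>std_gauss d) = (\<integral>v. f (sqrt (sqn d x) * v) \<partial>stdN)" .
  have "integrable (std_gauss d) (\<lambda>g. f (dot d x g)) \<longleftrightarrow> integrable (distr (std_gauss d) borel (dot d x)) f"
    by (rule integrable_distr_eq[symmetric, OF m]) simp
  also have "\<dots> \<longleftrightarrow> integrable stdN (\<lambda>v. f (sqrt (sqn d x) * v))"
    unfolding distr_dot_std_gauss by (rule integrable_distr_eq) auto
  finally show "integrable (std_gauss d) (\<lambda>g. f (dot d x g)) \<longleftrightarrow> integrable stdN (\<lambda>v. f (sqrt (sqn d x) * v))" .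
qed

section \<open>Gaussian measure of balls\<close>

lemma nn_integral_real_translate:
  fixes f :: "real \<Rightarrow> ennreal"
  assumes "f \<in> borel_measurable borel"
  shows "(\<integral>\<^sup>+x. f (x + c) \<partial>lborel) = (\<integral>\<^sup>+x. f x \<partial>lborel)"
  using nn_integral_real_affine[of f 1 c] assms by (simp add: add.commute)

lemma nn_integral_lborel_rotate:
  fixes F :: "real \<Rightarrow> real \<Rightarrow> ennreal"
  assumes F: "(\<lambda>(x, y). F x y) \<in> borel_measurable (borel \<Otimes>\<^sub>M borel)"
    and s: "s \<noteq> 0" and cs: "c\<^sup>2 + s\<^sup>2 = 1"
  shows "(\<integral>\<^sup>+x. \<integral>\<^sup>+y. F (c * x - s * y) (s * x + c * y) \<partial>lborel \<partial>lborel) = (\<integral>\<^sup>+x. \<integral>\<^sup>+y. F x y \<partial>lborel \<partial>lborel)"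
proof -
  have shear1: "(\<integral>\<^sup>+x. \<integral>\<^sup>+y. G (x + t * y) y \<partial>lborel \<partial>lborel) = (\<integral>\<^sup>+x. \<integral>\<^sup>+y. G x y \<partial>lborel \<partial>lborel)"
    if G[measurable]: "(\<lambda>(x, y). G x y) \<in> borel_measurable (borel \<Otimes>\<^sub>M borel)" for G :: "real \<Rightarrow> real \<Rightarrow> ennreal" and t
  proof -
    have "(\<integral>\<^sup>+x. \<integral>\<^sup>+y. G (x + t * y) y \<partial>lborel \<partial>lborel) = (\<integral>\<^sup>+y. \<integral>\<^sup>+x. G (x + t * y) y \<partial>lborel \<partial>lborel)"
      by (rule lborel_pair.Fubini'[symmetric]) measurable
    also have "\<dots> = (\<integral>\<^sup>+y. \<integral>\<^sup>+x. G x y \<partial>lborel \<partial>lborel)"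
      by (intro nn_integral_cong nn_integral_real_translate) measurable
    also have "\<dots> = (\<integral>\<^sup>+x. \<integral>\<^sup>+y. G x y \<partial>lborel \<partial>lborel)"
      by (rule lborel_pair.Fubini') measurable
    finally show ?thesis .
  qed
  have shear2: "(\<integral>\<^sup>+x. \<integral>\<^sup>+y. G x (y + t * x) \<partial>lborel \<partial>lborel) = (\<integral>\<^sup>+x. \<integral>\<^sup>+y. G x y \<partial>lborel \<partial>lborel)"
    if G[measurable]: "(\<lambda>(x, y). G x y) \<in> borel_measurable (borel \<Otimes>\<^sub>M borel)" for G :: "real \<Rightarrow> real \<Rightarrow> ennreal" and t
    by (intro nn_integral_cong nn_integral_real_translate) measurable
  note F[measurable]
  \<comment> \<open>A rotation is a product of three shears with coefficients t, s, t, where t = -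
    tan(angle / 2). For a fixed value of the other variable a shear is a translation, hence
    preserves Lebesgue measure.\<close>
  define t where "t = (c - 1) / s"
  have t: "1 + t * s = c" "t * c + t = - s"
  proof -
    show "1 + t * s = c" using s by (simp add: t_def)
    have "t * c + t = (c\<^sup>2 - 1) / s" by (simp add: t_def power2_eq_square add_divide_distrib[symmetric] diff_divide_distrib[symmetric] algebra_simps)
    also have "c\<^sup>2 - 1 = - s\<^sup>2" using cs by simp
    finally show "t * c + t = - s" using s by (simp add: power2_eq_square)
  qed
  have "(\<integral>\<^sup>+x. \<integral>\<^sup>+y. F x y \<partial>lborel \<partial>lborel) = (\<integral>\<^sup>+x. \<integral>\<^sup>+y. F (x + t * y) y \<partial>lborel \<partial>lborel)"
    by (rule shear1[symmetric]) measurable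
  also have "\<dots> = (\<integral>\<^sup>+x. \<integral>\<^sup>+y. F (x + t * (y + s * x)) (y + s * x) \<partial>lborel \<partial>lborel)"
    by (rule shear2[symmetric]) measurable
  also have "\<dots> = (\<integral>\<^sup>+x. \<integral>\<^sup>+y. F ((x + t * y) + t * (y + s * (x + t * y))) (y + s * (x + t * y)) \<partial>lborel \<partial>lborel)"
    by (rule shear1[symmetric]) measurable
  also have "\<dots> = (\<integral>\<^sup>+x. \<integral>\<^sup>+y. F (c * x - s * y) (s * x + c * y) \<partial>lborel \<partial>lborel)"
  proof (intro nn_integral_cong)
    fix x y :: real
    have 1: "y + s * (x + t * y) = s * x + (1 + t * s) * y" by (simp add: algebra_simps)
    have 2: "(x + t * y) + t * (y + s * (x + t * y)) = (1 + t * s) * x + (t * (1 + t * s) + t) * y" by (simp add: algebra_simps)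
    show "F ((x + t * y) + t * (y + s * (x + t * y))) (y + s * (x + t * y)) = F (c * x - s * y) (s * x + c * y)"
      unfolding 2 unfolding 1 unfolding t by simp
  qed
  finally show ?thesis ..
qed

lemma nn_integral_stdN_reflect:
  fixes F :: "real \<Rightarrow> ennreal"
  assumes [measurable]: "F \<in> borel_measurable borel"
  shows "(\<integral>\<^sup>+x. F ((x + a)\<^sup>2 + c) \<partial>stdN) = (\<integral>\<^sup>+x. F ((x + \<bar>a\<bar>)\<^sup>2 + c) \<partial>stdN)"
proof (cases "a \<ge> 0")
  case False
  have "(\<integral>\<^sup>+x. F ((x + a)\<^sup>2 + c) \<partial>stdN) = (\<integral>\<^sup>+x. ennreal (std_normal_density x) * F ((x + a)\<^sup>2 + c) \<partial>lborel)"
    by (simp add: nn_integral_density)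
  also have "\<dots> = (\<integral>\<^sup>+x. ennreal (std_normal_density (- x)) * F ((- x + a)\<^sup>2 + c) \<partial>lborel)"
    by (subst nn_integral_real_affine[of _ "-1" 0]) (auto)
  also have "\<dots> = (\<integral>\<^sup>+x. ennreal (std_normal_density x) * F ((x + - a)\<^sup>2 + c) \<partial>lborel)"
    by (intro nn_integral_cong) (auto simp: normal_density_def power2_commute)
  also have "\<dots> = (\<integral>\<^sup>+x. F ((x + - a)\<^sup>2 + c) \<partial>stdN)"
    by (simp add: nn_integral_density)
  finally show ?thesis using False by (simp add: abs_if)
qed simp

text \<open>The rotation with cosine a / r and sine b / r, where r =
  \<open>sqrt (a\<^sup>2 + b\<^sup>2)\<close>, turns the shift (a, b) into (r, 0) and preserves both
  Lebesgue measure and the Gaussian weight.\<close>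

lemma nn_integral_stdN_shifted_pair:
  fixes F :: "real \<Rightarrow> ennreal"
  assumes F[measurable]: "F \<in> borel_measurable borel"
  shows "(\<integral>\<^sup>+y. \<integral>\<^sup>+x. F ((x + a)\<^sup>2 + (y + b)\<^sup>2) \<partial>stdN \<partial>stdN) =
    (\<integral>\<^sup>+y. \<integral>\<^sup>+x. F ((x + sqrt (a\<^sup>2 + b\<^sup>2))\<^sup>2 + y\<^sup>2) \<partial>stdN \<partial>stdN)"
proof -
  let ?r = "sqrt (a\<^sup>2 + b\<^sup>2)" and ?\<phi> = "std_normal_density"
  have lb: "(\<integral>\<^sup>+y. \<integral>\<^sup>+x. F ((x + u)\<^sup>2 + (y + v)\<^sup>2) \<partial>stdN \<partial>stdN) =
    (\<integral>\<^sup>+x. \<integral>\<^sup>+y. ennreal (?\<phi> x) * ennreal (?\<phi> y) * F ((x + u)\<^sup>2 + (y + v)\<^sup>2) \<partial>lborel \<partial>lborel)" for u v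
  proof -
    have "(\<integral>\<^sup>+y. \<integral>\<^sup>+x. F ((x + u)\<^sup>2 + (y + v)\<^sup>2) \<partial>stdN \<partial>stdN) =
      (\<integral>\<^sup>+y. ennreal (?\<phi> y) * (\<integral>\<^sup>+x. ennreal (?\<phi> x) * F ((x + u)\<^sup>2 + (y + v)\<^sup>2) \<partial>lborel) \<partial>lborel)"
      by (simp add: nn_integral_density)
    also have "\<dots> = (\<integral>\<^sup>+y. \<integral>\<^sup>+x. ennreal (?\<phi> x) * ennreal (?\<phi> y) * F ((x + u)\<^sup>2 + (y + v)\<^sup>2) \<partial>lborel \<partial>lborel)"
      by (intro nn_integral_cong, subst nn_integral_cmult[symmetric]) (auto simp: ac_simps)
    also have "\<dots> = (\<integral>\<^sup>+x. \<integral>\<^sup>+y. ennreal (?\<phi> x) * ennreal (?\<phi> y) * F ((x + u)\<^sup>2 + (y + v)\<^sup>2) \<partial>lborel \<partial>lborel)"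
      by (rule lborel_pair.Fubini') measurable
    finally show ?thesis .
  qed
  show ?thesis
  \<comment> \<open>For \<open>b = 0\<close> a reflection takes the place of the rotation, since
    \<open>sqrt (a\<^sup>2)\<close> is the absolute value of \<open>a\<close>.\<close>
  proof (cases "b = 0")
    case True
    then show ?thesis using nn_integral_stdN_reflect[OF F, of a] by simp
  next
    case False
    then have r: "?r > 0" by (simp add: sum_power2_gt_zero_iff)
    define c s where "c = a / ?r" and "s = b / ?r"
    have cs: "c\<^sup>2 + s\<^sup>2 = 1" using r False by (simp add: c_def s_def power_divide add_divide_distrib[symmetric] sum_power2_eq_zero_iff)
    have s0: "s \<noteq> 0" using False r by (simp add: s_def)
    have ca: "c * ?r = a" "s * ?r = b" using r by (simp_all add: c_def s_def)
    have "(\<integral>\<^sup>+x. \<integral>\<^sup>+y. ennreal (?\<phi> x) * ennreal (?\<phi> y) * F ((x + a)\<^sup>2 + (y + b)\<^sup>2) \<partial>lborel \<partial>lborel) =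
      (\<integral>\<^sup>+x. \<integral>\<^sup>+y. ennreal (?\<phi> (c * x - s * y)) * ennreal (?\<phi> (s * x + c * y)) * F ((c * x - s * y + a)\<^sup>2 + (s * x + c * y + b)\<^sup>2) \<partial>lborel \<partial>lborel)"
      by (rule nn_integral_lborel_rotate[OF _ s0 cs, symmetric]) measurable
    also have "\<dots> = (\<integral>\<^sup>+x. \<integral>\<^sup>+y. ennreal (?\<phi> x) * ennreal (?\<phi> y) * F ((x + ?r)\<^sup>2 + (y + 0)\<^sup>2) \<partial>lborel \<partial>lborel)"
    proof (intro nn_integral_cong)
      fix x y :: real
      have sq: "(c * u - s * v)\<^sup>2 + (s * u + c * v)\<^sup>2 = u\<^sup>2 + v\<^sup>2" for u v
      proof -
        have "(c * u - s * v)\<^sup>2 + (s * u + c * v)\<^sup>2 = (c\<^sup>2 + s\<^sup>2) * (u\<^sup>2 + v\<^sup>2)"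
          by (simp add: power2_eq_square algebra_simps)
        then show ?thesis using cs by simp
      qed
      have "(c * x - s * y + a)\<^sup>2 + (s * x + c * y + b)\<^sup>2 = (c * (x + ?r) - s * y)\<^sup>2 + (s * (x + ?r) + c * y)\<^sup>2"
        by (simp add: algebra_simps ca)
      also have "\<dots> = (x + ?r)\<^sup>2 + y\<^sup>2" by (rule sq)
      finally have 1: "(c * x - s * y + a)\<^sup>2 + (s * x + c * y + b)\<^sup>2 = (x + ?r)\<^sup>2 + (y + 0)\<^sup>2" by simp
      have "?\<phi> (c * x - s * y) * ?\<phi> (s * x + c * y) = ?\<phi> x * ?\<phi> y"
        using sq[of x y] by (simp add: std_normal_density_def exp_add[symmetric] add_divide_distrib[symmetric])
      then show "ennreal (?\<phi> (c * x - s * y)) * ennreal (?\<phi> (s * x + c * y)) * F ((c * x - s * y + a)\<^sup>2 + (s * x + c * y + b)\<^sup>2) =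
         ennreal (?\<phi> x) * ennreal (?\<phi> y) * F ((x + ?r)\<^sup>2 + (y + 0)\<^sup>2)"
        unfolding 1 by (simp add: ennreal_mult[symmetric])
    qed
    finally show ?thesis using lb[of a b] lb[of ?r 0] by simp
  qed
qed

lemma std_gauss_Suc:
  assumes "f \<in> borel_measurable (PiM {..<Suc d} (\<lambda>_. borel))"
  shows "(\<integral>\<^sup>+g. f g \<partial>std_gauss (Suc d)) = (\<integral>\<^sup>+y. \<integral>\<^sup>+g. f (g(d := y)) \<partial>std_gauss d \<partial>stdN)"
proof -
  have "f \<in> borel_measurable (PiM (insert d {..<d}) (\<lambda>_. stdN))"
    using assms by (simp add: lessThan_Suc[symmetric] cong: measurable_cong_sets sets_PiM_cong)
  then show ?thesis
    unfolding std_gauss_def lessThan_Suc by (intro stdNs.product_nn_integral_insert_rev) auto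
qed

lemma sqn_Suc: "sqn (Suc d) x = sqn d x + (x d)\<^sup>2"
  unfolding sqn_def by simp

lemma sqn_cong: "(\<And>i. i < d \<Longrightarrow> x i = y i) \<Longrightarrow> sqn d x = sqn d y"
  unfolding sqn_def by (intro sum.cong) auto

text \<open>Rotation invariance in all dimensions from planar rotations: each step of the induction
  rotates the shift of the new coordinate into the variable \<open>x\<close>, which carries the
  shift collected so far. Hence the law of |g + b|^2 depends on b through |b| alone, and the whole
  shift may be put on one axis.\<close>

lemma nn_integral_shifted_sqn:
  fixes F :: "real \<Rightarrow> ennreal"
  assumes F[measurable]: "F \<in> borel_measurable borel"
  shows "(\<integral>\<^sup>+g. F (sqn (Suc d) (\<lambda>i. g i + b i)) \<partial>std_gauss (Suc d)) =
    (\<integral>\<^sup>+g. \<integral>\<^sup>+x. F ((x + sqrt (sqn (Suc d) b))\<^sup>2 + sqn d g) \<partial>stdN \<partial>std_gauss d)"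
  using F
proof (induction d arbitrary: F)
  case 0
  note [measurable] = 0
  have m: "(\<lambda>g. F (sqn (Suc 0) (\<lambda>i. g i + b i))) \<in> borel_measurable (PiM {..<Suc 0} (\<lambda>_. borel))" by measurable
  have u: "std_gauss 0 = count_space {\<lambda>_. undefined}" unfolding std_gauss_def by (simp add: PiM_empty)
  have "(\<integral>\<^sup>+g. F (sqn (Suc 0) (\<lambda>i. g i + b i)) \<partial>std_gauss (Suc 0)) = (\<integral>\<^sup>+y. F ((y + b 0)\<^sup>2) \<partial>stdN)"
    by (subst std_gauss_Suc[OF m]) (simp add: sqn_def u nn_integral_count_space_finite)
  moreover have "(\<integral>\<^sup>+y. F ((y + b 0)\<^sup>2) \<partial>stdN) = (\<integral>\<^sup>+y. F ((y + sqrt ((b 0)\<^sup>2))\<^sup>2) \<partial>stdN)"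
    using nn_integral_stdN_reflect[OF 0, of "b 0" 0] by simp
  ultimately show ?case by (simp add: sqn_def u nn_integral_count_space_finite)
next
  case (Suc d)
  note [measurable] = Suc.prems
  interpret sg: pair_sigma_finite "std_gauss d" stdN
    unfolding pair_sigma_finite_def by (simp add: prob_space_imp_sigma_finite prob_space_std_gauss prob_space_stdN)
  interpret ss: pair_sigma_finite stdN stdN
    unfolding pair_sigma_finite_def by (simp add: prob_space_imp_sigma_finite prob_space_stdN)
  let ?\<beta> = "sqrt (sqn (Suc d) b)" and ?\<beta>' = "sqrt (sqn (Suc (Suc d)) b)"
  have \<beta>': "sqrt (?\<beta>\<^sup>2 + (b (Suc d))\<^sup>2) = ?\<beta>'" by (simp add: sqn_Suc[of "Suc d"])
  have m: "(\<lambda>g. F (sqn (Suc (Suc d)) (\<lambda>i. g i + b i))) \<in> borel_measurable (PiM {..<Suc (Suc d)} (\<lambda>_. borel))"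
    by measurable
  have "(\<integral>\<^sup>+g. F (sqn (Suc (Suc d)) (\<lambda>i. g i + b i)) \<partial>std_gauss (Suc (Suc d)))
    = (\<integral>\<^sup>+y. \<integral>\<^sup>+g. F (sqn (Suc d) (\<lambda>i. g i + b i) + (y + b (Suc d))\<^sup>2) \<partial>std_gauss (Suc d) \<partial>stdN)"
    by (subst std_gauss_Suc[OF m]) (simp add: sqn_Suc[of "Suc d"] cong: sqn_cong)
  also have "\<dots> = (\<integral>\<^sup>+y. \<integral>\<^sup>+g. \<integral>\<^sup>+x. F ((x + ?\<beta>)\<^sup>2 + sqn d g + (y + b (Suc d))\<^sup>2) \<partial>stdN \<partial>std_gauss d \<partial>stdN)"
  proof (rule nn_integral_cong)
    fix y
    show "(\<integral>\<^sup>+g. F (sqn (Suc d) (\<lambda>i. g i + b i) + (y + b (Suc d))\<^sup>2) \<partial>std_gauss (Suc d)) =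
      (\<integral>\<^sup>+g. \<integral>\<^sup>+x. F ((x + ?\<beta>)\<^sup>2 + sqn d g + (y + b (Suc d))\<^sup>2) \<partial>stdN \<partial>std_gauss d)"
      by (rule Suc.IH[of "\<lambda>z. F (z + (y + b (Suc d))\<^sup>2)"]) measurable
  qed
  also have "\<dots> = (\<integral>\<^sup>+g. \<integral>\<^sup>+y. \<integral>\<^sup>+x. F ((x + ?\<beta>)\<^sup>2 + sqn d g + (y + b (Suc d))\<^sup>2) \<partial>stdN \<partial>stdN \<partial>std_gauss d)"
    by (rule sg.Fubini') measurable
  also have "\<dots> = (\<integral>\<^sup>+g. \<integral>\<^sup>+y. \<integral>\<^sup>+x. F ((x + ?\<beta>')\<^sup>2 + y\<^sup>2 + sqn d g) \<partial>stdN \<partial>stdN \<partial>std_gauss d)"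
  proof (rule nn_integral_cong)
    fix g
    show "(\<integral>\<^sup>+y. \<integral>\<^sup>+x. F ((x + ?\<beta>)\<^sup>2 + sqn d g + (y + b (Suc d))\<^sup>2) \<partial>stdN \<partial>stdN) =
       (\<integral>\<^sup>+y. \<integral>\<^sup>+x. F ((x + ?\<beta>')\<^sup>2 + y\<^sup>2 + sqn d g) \<partial>stdN \<partial>stdN)"
      using nn_integral_stdN_shifted_pair[of "\<lambda>z. F (z + sqn d g)" ?\<beta> "b (Suc d)"] unfolding \<beta>'
      by (simp add: ac_simps)
  qed
  also have "\<dots> = (\<integral>\<^sup>+y. \<integral>\<^sup>+g. \<integral>\<^sup>+x. F ((x + ?\<beta>')\<^sup>2 + y\<^sup>2 + sqn d g) \<partial>stdN \<partial>std_gauss d \<partial>stdN)"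
    by (rule sg.Fubini'[symmetric]) measurable
  also have "\<dots> = (\<integral>\<^sup>+g. \<integral>\<^sup>+x. F ((x + ?\<beta>')\<^sup>2 + sqn (Suc d) g) \<partial>stdN \<partial>std_gauss (Suc d))"
    by (subst std_gauss_Suc) (simp_all add: sqn_Suc ac_simps cong: sqn_cong)
  finally show ?case .
qed

section \<open>Balls lose Gaussian measure as they move away from the origin\<close>

lemma integral_stdN:
  fixes f :: "real \<Rightarrow> real"
  assumes [measurable]: "f \<in> borel_measurable borel"
  shows "(\<integral>x. f x \<partial>stdN) = (\<integral>x. std_normal_density x * f x \<partial>lborel)"
    and "integrable stdN f \<longleftrightarrow> integrable lborel (\<lambda>x. std_normal_density x * f x)"
  by (simp_all add: integral_density integrable_density)

text \<open>Reflection at \<open>- (s + s') / 2\<close> exchanges the two intervals.\<close>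

lemma measure_stdN_interval_antimono:
  assumes s: "0 \<le> s" "s \<le> s'" and u: "0 \<le> u"
  shows "measure stdN {- u - s'..u - s'} \<le> measure stdN {- u - s..u - s}"
proof -
  define A A' where "A = {- u - s..u - s}" and "A' = {- u - s'..u - s'}"
  define m where "m = - (s + s') / 2"
  let ?\<phi> = "std_normal_density"
  have [measurable]: "A \<in> sets borel" "A' \<in> sets borel" unfolding A_def A'_def by auto
  have I: "integrable lborel (\<lambda>x. ?\<phi> x * indicator B x)" if "B \<in> sets borel" for B :: "real set"
    using that by (intro integrable_real_mult_indicator) auto
  have I2: "integrable lborel (\<lambda>x. ?\<phi> (2 * m - x) * indicator B (2 * m - x))" if "B \<in> sets borel" for B :: "real set"
    using lborel_integrable_real_affine[OF I[OF that], of "-1" "2 * m"] by simp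
  have M: "measure stdN B = (\<integral>x. ?\<phi> x * indicator B x \<partial>lborel)" if [measurable]: "B \<in> sets borel" for B
  proof -
    have "measure stdN B = (\<integral>x. indicator B x \<partial>stdN)" using that by simp
    then show ?thesis by (simp only: integral_stdN[of "indicator B"] borel_measurable_indicator that)
  qed
  have R: "(\<integral>x. ?\<phi> x * indicator B x \<partial>lborel) = (\<integral>x. ?\<phi> (2 * m - x) * indicator B (2 * m - x) \<partial>lborel)" for B :: "real set"
    by (subst lborel_integral_real_affine[of "-1" _ "2 * m"]) auto
  have refl: "indicator A' x = (indicator A (2 * m - x) :: real)" for x
    by (auto simp: indicator_def A_def A'_def m_def field_simps)
  have refl2: "indicator A' (2 * m - x) = (indicator A x :: real)" for x
    by (auto simp: indicator_def A_def A'_def m_def field_simps)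
  \<comment> \<open>The integrands are not comparable before symmetrization. Each integral is added
    to its reflected copy; then the integrands differ by a product of two factors of equal
    sign.\<close>
  have pt: "(\<integral>x. ?\<phi> x * indicator A' x + ?\<phi> (2 * m - x) * indicator A' (2 * m - x) \<partial>lborel) \<le>
    (\<integral>x. ?\<phi> x * indicator A x + ?\<phi> (2 * m - x) * indicator A (2 * m - x) \<partial>lborel)"
  proof (intro integral_mono Bochner_Integration.integrable_add I I2)
    fix x
    have \<phi>: "?\<phi> a \<le> ?\<phi> b" if "b\<^sup>2 \<le> a\<^sup>2" for a b
      using that by (simp add: std_normal_density_def divide_right_mono)
    have sq: "(2 * m - x)\<^sup>2 - x\<^sup>2 = 4 * m * (m - x)" by (simp add: power2_eq_square algebra_simps)
    have m0: "m \<le> 0" using s by (simp add: m_def)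
    have "0 \<le> (indicator A x - indicator A (2 * m - x)) * (?\<phi> x - ?\<phi> (2 * m - x))"
    proof (cases "x \<ge> m")
      case True
      then have "?\<phi> (2 * m - x) \<le> ?\<phi> x" using sq m0 mult_nonpos_nonpos[of "4 * m" "m - x"] by (intro \<phi>) auto
      moreover have "indicator A (2 * m - x) \<le> (indicator A x :: real)"
        using True s by (auto simp: indicator_def A_def m_def field_simps)
      ultimately show ?thesis by simp
    next
      case False
      then have "?\<phi> (2 * m - x) \<ge> ?\<phi> x" using sq m0 mult_nonpos_nonneg[of "4 * m" "m - x"] by (intro \<phi>) auto
      moreover have "indicator A (2 * m - x) \<ge> (indicator A x :: real)"
        using False s by (auto simp: indicator_def A_def m_def field_simps)
      ultimately show ?thesis by (simp add: mult_nonpos_nonpos)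
    qed
    then show "?\<phi> x * indicator A' x + ?\<phi> (2 * m - x) * indicator A' (2 * m - x) \<le>
        ?\<phi> x * indicator A x + ?\<phi> (2 * m - x) * indicator A (2 * m - x)"
      unfolding refl refl2 by (simp add: algebra_simps)
  qed simp_all
  have "2 * measure stdN A' \<le> 2 * measure stdN A"
    using pt by (simp add: Bochner_Integration.integral_add I I2 R[symmetric] M)
  then show ?thesis by (simp add: A_def A'_def)
qed

lemma emeasure_Collect_le:
  fixes f :: "'a \<Rightarrow> real"
  assumes f: "f \<in> borel_measurable M"
  shows "emeasure M {x \<in> space M. f x \<le> t} = (\<integral>\<^sup>+x. indicator {..t} (f x) \<partial>M)"
proof -
  have "{x \<in> space M. f x \<le> t} \<in> sets M" using f by measurable
  then have "emeasure M {x \<in> space M. f x \<le> t} = (\<integral>\<^sup>+x. indicator {x \<in> space M. f x \<le> t} x \<partial>M)"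
    by (rule nn_integral_indicator[symmetric])
  also have "\<dots> = (\<integral>\<^sup>+x. indicator {..t} (f x) \<partial>M)"
    by (intro nn_integral_cong) (auto simp: indicator_def)
  finally show ?thesis .
qed

definition gball :: "nat \<Rightarrow> (nat \<Rightarrow> real) \<Rightarrow> real \<Rightarrow> real" where
  "gball d y t = measure (std_gauss d) {g \<in> space (std_gauss d). sqn d (\<lambda>i. g i + y i) \<le> t}"

lemma gball_bounds: "0 \<le> gball d y t" "gball d y t \<le> 1"
  unfolding gball_def by simp_all

text \<open>With the shift on a single axis, lines parallel to this axis cut the ball in intervals,
  whose measure decreases as they move away from 0. This special case of Anderson's inequality makes
  the superlevel sets of noisy ball probabilities balls.\<close>

lemma gball_antimono:
  assumes d: "1 \<le> d" and le: "sqn d y \<le> sqn d y'"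
  shows "gball d y' t \<le> gball d y t"
proof -
  obtain k where k: "d = Suc k" using d by (cases d) auto
  have E: "emeasure (std_gauss (Suc k)) {g \<in> space (std_gauss (Suc k)). sqn (Suc k) (\<lambda>i. g i + y i) \<le> t} =
     (\<integral>\<^sup>+g. emeasure stdN {x. (x + sqrt (sqn (Suc k) y))\<^sup>2 + sqn k g \<le> t} \<partial>std_gauss k)" for y
  proof -
    have "emeasure (std_gauss (Suc k)) {g \<in> space (std_gauss (Suc k)). sqn (Suc k) (\<lambda>i. g i + y i) \<le> t} =
      (\<integral>\<^sup>+g. indicator {..t} (sqn (Suc k) (\<lambda>i. g i + y i)) \<partial>std_gauss (Suc k))"
      by (rule emeasure_Collect_le) measurable
    also have "\<dots> = (\<integral>\<^sup>+g. \<integral>\<^sup>+x. indicator {..t} ((x + sqrt (sqn (Suc k) y))\<^sup>2 + sqn k g) \<partial>stdN \<partial>std_gauss k)"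
      by (rule nn_integral_shifted_sqn) measurable
    also have "\<dots> = (\<integral>\<^sup>+g. emeasure stdN {x. (x + sqrt (sqn (Suc k) y))\<^sup>2 + sqn k g \<le> t} \<partial>std_gauss k)"
    proof (rule nn_integral_cong)
      fix g
      show "(\<integral>\<^sup>+x. indicator {..t} ((x + sqrt (sqn (Suc k) y))\<^sup>2 + sqn k g) \<partial>stdN) =
        emeasure stdN {x. (x + sqrt (sqn (Suc k) y))\<^sup>2 + sqn k g \<le> t}"
        using emeasure_Collect_le[of "\<lambda>x. (x + sqrt (sqn (Suc k) y))\<^sup>2 + sqn k g" stdN t] by simp
    qed
    finally show ?thesis .
  qed
  have "(\<integral>\<^sup>+g. emeasure stdN {x. (x + sqrt (sqn (Suc k) y'))\<^sup>2 + sqn k g \<le> t} \<partial>std_gauss k) \<le>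
     (\<integral>\<^sup>+g. emeasure stdN {x. (x + sqrt (sqn (Suc k) y))\<^sup>2 + sqn k g \<le> t} \<partial>std_gauss k)"
  proof (rule nn_integral_mono)
    fix g
    show "emeasure stdN {x. (x + sqrt (sqn (Suc k) y'))\<^sup>2 + sqn k g \<le> t} \<le> emeasure stdN {x. (x + sqrt (sqn (Suc k) y))\<^sup>2 + sqn k g \<le> t}"
    proof (cases "sqn k g \<le> t")
      case True
      define u where "u = sqrt (t - sqn k g)"
      have u0: "0 \<le> u" "u\<^sup>2 = t - sqn k g" using True by (simp_all add: u_def)
      have eq: "{x. (x + s)\<^sup>2 + sqn k g \<le> t} = {- u - s..u - s}" for s
      proof -
        have "(x + s)\<^sup>2 + sqn k g \<le> t \<longleftrightarrow> \<bar>x + s\<bar> \<le> \<bar>u\<bar>" for x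
          unfolding abs_le_square_iff u0(2) by auto
        then have "{x. (x + s)\<^sup>2 + sqn k g \<le> t} = {x. \<bar>x + s\<bar> \<le> \<bar>u\<bar>}" by (simp only:)
        also have "\<dots> = {- u - s..u - s}" using u0(1) by (auto simp: abs_le_iff)
        finally show ?thesis .
      qed
      show ?thesis unfolding eq stdN.emeasure_eq_measure
        using measure_stdN_interval_antimono[of "sqrt (sqn (Suc k) y)" "sqrt (sqn (Suc k) y')" u] le u0(1)
        by (intro ennreal_leI) (simp add: k)
    next
      case False
      have "\<not> (x + s)\<^sup>2 + sqn k g \<le> t" for x s using False zero_le_power2[of "x + s"] by linarith
      then show ?thesis by simp
    qed
  qed
  then show ?thesis
    unfolding gball_def k E[symmetric] gauss.emeasure_eq_measure by simp
qed

section \<open>Laplace transforms of squared distances and small balls\<close>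

lemma nn_integral_stdN_exp_square_le:
  assumes t: "0 \<le> t"
  shows "(\<integral>\<^sup>+x. ennreal (exp (- t * (x + b)\<^sup>2 / 2)) \<partial>stdN) \<le> ennreal (1 / sqrt (1 + t))"
proof -
  have "(\<integral>\<^sup>+x. ennreal (exp (- t * (x + b)\<^sup>2 / 2)) \<partial>stdN) =
     (\<integral>\<^sup>+x. ennreal (std_normal_density x) * ennreal (exp (- t * (x + b)\<^sup>2 / 2)) \<partial>lborel)"
    by (subst nn_integral_density) auto
  also have "\<dots> \<le> (\<integral>\<^sup>+x. ennreal (1 / sqrt (1 + t)) * ennreal (normal_density (- t * b / (1 + t)) (1 / sqrt (1 + t)) x) \<partial>lborel)"
  proof (intro nn_integral_mono)
    fix x :: real
    \<comment> \<open>Completing the square. The term t b^2 / (1 + t) is dropped, so the Laplace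
      transform for a shifted centre is at most that for centre 0.\<close>
    have "(x\<^sup>2 + t * (x + b)\<^sup>2) * (1 + t) = ((1 + t) * x + t * b)\<^sup>2 + t * b\<^sup>2"
      by (simp add: power2_eq_square algebra_simps)
    moreover have "(a * c\<^sup>2) * a = (a * c)\<^sup>2" for a c :: real by (simp add: power2_eq_square)
    then have "((1 + t) * (x + t * b / (1 + t))\<^sup>2) * (1 + t) = ((1 + t) * (x + t * b / (1 + t)))\<^sup>2" .
    moreover have "(1 + t) * (x + t * b / (1 + t)) = (1 + t) * x + t * b"
      using t by (simp add: distrib_left)
    moreover have "0 \<le> t * b\<^sup>2" using t by simp
    ultimately have "((1 + t) * (x + t * b / (1 + t))\<^sup>2) * (1 + t) \<le> (x\<^sup>2 + t * (x + b)\<^sup>2) * (1 + t)" by simp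
    then have "(1 + t) * (x + t * b / (1 + t))\<^sup>2 \<le> x\<^sup>2 + t * (x + b)\<^sup>2"
      using t by (simp add: mult_le_cancel_right)
    moreover have "(1 + t) * A \<le> x\<^sup>2 + t * B \<Longrightarrow> - x\<^sup>2 / 2 + - t * B / 2 \<le> - (1 + t) * A / 2" for A B
      by (simp add: algebra_simps)
    ultimately have "- x\<^sup>2 / 2 + - t * (x + b)\<^sup>2 / 2 \<le> - (1 + t) * (x + t * b / (1 + t))\<^sup>2 / 2" by blast
    then have "exp (- x\<^sup>2 / 2) * exp (- t * (x + b)\<^sup>2 / 2) \<le> exp (- (1 + t) * (x + t * b / (1 + t))\<^sup>2 / 2)"
      unfolding exp_add[symmetric] by (simp only: exp_le_cancel_iff)
    then have "std_normal_density x * exp (- t * (x + b)\<^sup>2 / 2) \<le> 1 / sqrt (2 * pi) * exp (- (1 + t) * (x + t * b / (1 + t))\<^sup>2 / 2)"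
      by (simp add: std_normal_density_def divide_right_mono)
    also have "\<dots> = 1 / sqrt (1 + t) * normal_density (- t * b / (1 + t)) (1 / sqrt (1 + t)) x"
      using t by (simp add: normal_density_def power_divide real_sqrt_divide real_sqrt_mult) (simp add: algebra_simps)
    finally show "ennreal (std_normal_density x) * ennreal (exp (- t * (x + b)\<^sup>2 / 2)) \<le>
      ennreal (1 / sqrt (1 + t)) * ennreal (normal_density (- t * b / (1 + t)) (1 / sqrt (1 + t)) x)"
      using t by (simp add: ennreal_mult[symmetric] del: ennreal_mult')
  qed
  also have "\<dots> = ennreal (1 / sqrt (1 + t)) * (\<integral>\<^sup>+x. ennreal (normal_density (- t * b / (1 + t)) (1 / sqrt (1 + t)) x) \<partial>lborel)"
    by (rule nn_integral_cmult) simp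
  also have "(\<integral>\<^sup>+x. ennreal (normal_density (- t * b / (1 + t)) (1 / sqrt (1 + t)) x) \<partial>lborel) = 1"
    using t by (subst nn_integral_eq_integral) auto
  finally show ?thesis by simp
qed

lemma prod_mono_ennreal:
  fixes f g :: "nat \<Rightarrow> ennreal"
  assumes "\<And>i. i < d \<Longrightarrow> f i \<le> g i"
  shows "(\<Prod>i<d. f i) \<le> (\<Prod>i<d. g i)"
  using assms by (induction d) (auto intro!: mult_mono)

lemma nn_integral_std_gauss_exp_sqn_le:
  assumes t: "0 \<le> t"
  shows "(\<integral>\<^sup>+g. ennreal (exp (- t * sqn d (\<lambda>i. g i + b i) / 2)) \<partial>std_gauss d) \<le> ennreal ((1 / sqrt (1 + t)) ^ d)"
proof -
  have "(\<integral>\<^sup>+g. ennreal (exp (- t * sqn d (\<lambda>i. g i + b i) / 2)) \<partial>std_gauss d) =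
    (\<integral>\<^sup>+g. (\<Prod>i<d. ennreal (exp (- t * (g i + b i)\<^sup>2 / 2))) \<partial>std_gauss d)"
    by (intro nn_integral_cong)
       (simp add: prod_ennreal exp_sum[symmetric] sqn_def sum_divide_distrib sum_distrib_left sum_negf)
  also have "\<dots> = (\<Prod>i<d. \<integral>\<^sup>+x. ennreal (exp (- t * (x + b i)\<^sup>2 / 2)) \<partial>stdN)"
    unfolding std_gauss_def by (rule stdNs.product_nn_integral_prod) auto
  also have "\<dots> \<le> (\<Prod>i<d. ennreal (1 / sqrt (1 + t)))"
    by (intro prod_mono_ennreal nn_integral_stdN_exp_square_le t)
  also have "\<dots> = ennreal ((1 / sqrt (1 + t)) ^ d)"
    using t by (simp add: ennreal_power)
  finally show ?thesis .
qed

text \<open>Exponential Markov inequality at t = 1 / \<rho>^2: the bound exp(d / 2) (1 + t)^(-d / 2)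
  is at most the d-th power of \<open>sqrt (exp 1) * \<rho>\<close>, and a number in [0, 1] is at
  least its d-th power. Measuring the squared radius in units of \<open>d\<close> keeps the constant
  free of the dimension.\<close>

lemma gball_small:
  fixes \<rho> :: real
  assumes d: "1 \<le> d" and \<rho>: "0 \<le> \<rho>"
  shows "gball d b (\<rho>\<^sup>2 * d) \<le> sqrt (exp 1) * \<rho>"
proof (cases "0 < \<rho> \<and> sqrt (exp 1) * \<rho> \<le> 1")
  case False
  show ?thesis
  proof (cases "\<rho> = 0")
    case True
    \<comment> \<open>At \<rho> = 0 the parameter t is sent to infinity: t = 1 / e^2 yields the
      bound e for every e > 0.\<close>
    have "gball d b 0 \<le> e" if e: "0 < e" for e :: real
    proof -
      define t where "t = 1 / e\<^sup>2"
      have t: "0 \<le> t" using e by (simp add: t_def)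
      have "ennreal (gball d b 0) = (\<integral>\<^sup>+g. indicator {g \<in> space (std_gauss d). sqn d (\<lambda>i. g i + b i) \<le> 0} g \<partial>std_gauss d)"
        unfolding gball_def by (simp add: gauss.emeasure_eq_measure)
      also have "\<dots> \<le> (\<integral>\<^sup>+g. ennreal (exp (- t * sqn d (\<lambda>i. g i + b i) / 2)) \<partial>std_gauss d)"
      proof (intro nn_integral_mono)
        fix g
        show "indicator {g \<in> space (std_gauss d). sqn d (\<lambda>i. g i + b i) \<le> 0} g \<le> ennreal (exp (- t * sqn d (\<lambda>i. g i + b i) / 2))"
          using order_antisym[OF _ sqn_nonneg[of d "\<lambda>i. g i + b i"]] by (auto simp: indicator_def)
      qed
      also have "\<dots> \<le> ennreal ((1 / sqrt (1 + t)) ^ d)" by (rule nn_integral_std_gauss_exp_sqn_le[OF t])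
      finally have "gball d b 0 \<le> (1 / sqrt (1 + t)) ^ d" using t by (simp add: ennreal_le_iff)
      also have "\<dots> \<le> (1 / sqrt (1 + t)) ^ 1" using t d by (intro power_decreasing) auto
      also have "\<dots> \<le> 1 / sqrt t" unfolding power_one_right
        using e t by (intro divide_left_mono mult_pos_pos) (auto simp: t_def add_pos_pos)
      also have "\<dots> = e" using e by (simp add: t_def real_sqrt_divide)
      finally show ?thesis .
    qed
    then have "gball d b 0 \<le> 0" by (rule field_le_epsilon[of _ 0, simplified])
    then show ?thesis using True by simp
  next
    case f: False
    then have "1 \<le> sqrt (exp 1) * \<rho>" using False \<rho> by auto
    then show ?thesis using gball_bounds(2)[of d b] by (rule order_trans[rotated])
  qed
next
  case True
  define t where "t = 1 / \<rho>\<^sup>2"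
  have t: "0 \<le> t" "t * \<rho>\<^sup>2 = 1" using True by (simp_all add: t_def)
  have "ennreal (gball d b (\<rho>\<^sup>2 * d)) = (\<integral>\<^sup>+g. indicator {g \<in> space (std_gauss d). sqn d (\<lambda>i. g i + b i) \<le> \<rho>\<^sup>2 * d} g \<partial>std_gauss d)"
    unfolding gball_def by (simp add: gauss.emeasure_eq_measure)
  also have "\<dots> \<le> (\<integral>\<^sup>+g. ennreal (exp (real d / 2)) * ennreal (exp (- t * sqn d (\<lambda>i. g i + b i) / 2)) \<partial>std_gauss d)"
  proof (intro nn_integral_mono)
    fix g
    have "real d / 2 - t * s / 2 \<ge> 0" if "s \<le> \<rho>\<^sup>2 * d" for s
    proof -
      have "t * s \<le> t * (\<rho>\<^sup>2 * d)" using that t by (intro mult_left_mono)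
      also have "\<dots> = d" using t(2) by (metis mult.assoc mult_1)
      finally show ?thesis by simp
    qed
    then show "indicator {g \<in> space (std_gauss d). sqn d (\<lambda>i. g i + b i) \<le> \<rho>\<^sup>2 * d} g \<le>
       ennreal (exp (real d / 2)) * ennreal (exp (- t * sqn d (\<lambda>i. g i + b i) / 2))"
      by (auto simp: indicator_def ennreal_mult[symmetric] exp_add[symmetric] simp del: ennreal_mult')
  qed
  also have "\<dots> = ennreal (exp (real d / 2)) * (\<integral>\<^sup>+g. ennreal (exp (- t * sqn d (\<lambda>i. g i + b i) / 2)) \<partial>std_gauss d)"
    by (rule nn_integral_cmult) measurable
  also have "\<dots> \<le> ennreal (exp (real d / 2)) * ennreal ((1 / sqrt (1 + t)) ^ d)"
    by (intro mult_left_mono nn_integral_std_gauss_exp_sqn_le t) simp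
  finally have "ennreal (gball d b (\<rho>\<^sup>2 * d)) \<le> ennreal (exp (real d / 2) * (1 / sqrt (1 + t)) ^ d)"
    using t by (simp add: ennreal_mult)
  then have "gball d b (\<rho>\<^sup>2 * d) \<le> exp (real d / 2) * (1 / sqrt (1 + t)) ^ d"
    using t by (simp add: ennreal_le_iff)
  also have "\<dots> \<le> exp (real d / 2) * \<rho> ^ d"
  proof (intro mult_left_mono power_mono)
    have "1 / sqrt (1 + t) \<le> 1 / sqrt t" using True t by (intro divide_left_mono mult_pos_pos) (auto simp: t_def add_pos_pos)
    also have "\<dots> = \<rho>" using True by (simp add: t_def real_sqrt_divide)
    finally show "1 / sqrt (1 + t) \<le> \<rho>" .
  qed (use t in auto)
  also have "\<dots> = (sqrt (exp 1) * \<rho>) ^ d"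
  proof -
    have "sqrt (exp 1) = exp (1/2 :: real)" by (rule real_sqrt_unique) (auto simp: exp_double[symmetric])
    then show ?thesis by (simp add: power_mult_distrib exp_of_nat_mult[symmetric])
  qed
  also have "\<dots> \<le> (sqrt (exp 1) * \<rho>) ^ 1"
    using True d by (intro power_decreasing) auto
  finally show ?thesis by simp
qed

section \<open>Hermite expansion of Gaussian likelihood ratios\<close>

lemma integrable_stdN_exp: "integrable stdN (\<lambda>x. exp (a * x))"
  and integral_stdN_exp_tilt: "(\<integral>x. exp (a * x - a\<^sup>2 / 2) \<partial>stdN) = 1"
proof -
  interpret D: prob_space "density stdN (\<lambda>y. ennreal (exp (a * y - a\<^sup>2 / 2)))"
    using stdN.prob_space_distr[of "\<lambda>y. y + a" borel] unfolding stdN_shift by simp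
  have "(\<integral>\<^sup>+y. ennreal (exp (a * y - a\<^sup>2 / 2)) \<partial>stdN) = ennreal 1"
    using D.emeasure_space_1 by (subst (asm) emeasure_density) (auto cong: nn_integral_cong)
  then have h: "has_bochner_integral stdN (\<lambda>y. exp (a * y - a\<^sup>2 / 2)) 1"
    by (intro has_bochner_integral_nn_integral) auto
  then show "(\<integral>x. exp (a * x - a\<^sup>2 / 2) \<partial>stdN) = 1" by (rule has_bochner_integral_integral_eq)
  have "integrable stdN (\<lambda>y. exp (a\<^sup>2 / 2) * exp (a * y - a\<^sup>2 / 2))"
    using h by (intro integrable_mult_right) (rule integrable.intros)
  then show "integrable stdN (\<lambda>x. exp (a * x))" by (simp add: exp_add[symmetric])
qed

lemma power_le_fact_exp: "0 \<le> x \<Longrightarrow> x ^ k \<le> fact k * exp (x :: real)"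
proof -
  assume x: "0 \<le> x"
  have "x ^ k / fact k = (\<Sum>i\<in>{k}. x ^ i /\<^sub>R fact i)" by (simp add: field_simps)
  also have "\<dots> \<le> (\<Sum>i. x ^ i /\<^sub>R fact i)"
    using x by (intro sum_le_suminf summable_exp_generic) auto
  also have "\<dots> = exp x" by (simp add: exp_def)
  finally show ?thesis by (simp add: field_simps)
qed

lemma integrable_stdN_power_exp: "integrable stdN (\<lambda>x. \<bar>x\<bar> ^ k * exp (c * \<bar>x\<bar>))"
proof (rule Bochner_Integration.integrable_bound)
  show "integrable stdN (\<lambda>x. fact k * (exp ((c + 1) * x) + exp (- (c + 1) * x)))"
    by (intro integrable_mult_right Bochner_Integration.integrable_add integrable_stdN_exp)
  show "AE x in stdN. norm (\<bar>x\<bar> ^ k * exp (c * \<bar>x\<bar>)) \<le> norm (fact k * (exp ((c + 1) * x) + exp (- (c + 1) * x)))"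
  proof (intro AE_I2)
    fix x :: real
    have "\<bar>x\<bar> ^ k * exp (c * \<bar>x\<bar>) \<le> fact k * exp \<bar>x\<bar> * exp (c * \<bar>x\<bar>)"
      by (intro mult_right_mono power_le_fact_exp) auto
    also have "\<dots> = fact k * exp ((c + 1) * \<bar>x\<bar>)" by (simp add: exp_add[symmetric] algebra_simps)
    also have "exp (k * \<bar>x\<bar>) \<le> exp (k * x) + exp (- k * x)" for k
      by (cases "x \<ge> 0") auto
    then have "exp ((c + 1) * \<bar>x\<bar>) \<le> exp ((c + 1) * x) + exp (- (c + 1) * x)" .
    finally show "norm (\<bar>x\<bar> ^ k * exp (c * \<bar>x\<bar>)) \<le> norm (fact k * (exp ((c + 1) * x) + exp (- (c + 1) * x)))"
      by (simp add: abs_mult)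
  qed
qed simp

lemma integrable_stdN_abs_power: "integrable stdN (\<lambda>x. \<bar>x\<bar> ^ k)"
  using integrable_stdN_power_exp[of k 0] by simp

lemma integrable_stdN_power: "integrable stdN (\<lambda>x. x ^ k)"
  by (rule Bochner_Integration.integrable_bound[OF integrable_stdN_abs_power[of k]]) (auto simp: power_abs)

lemma integral_stdN_power:
  "(\<integral>x. x\<^sup>2 \<partial>stdN) = 1" "(\<integral>x. x ^ 4 \<partial>stdN) = 3" "(\<integral>x. x ^ 6 \<partial>stdN) = 15"
  "(\<integral>x. x \<partial>stdN) = 0" "(\<integral>x. x ^ 3 \<partial>stdN) = 0"
  using integral_std_normal_moment_even[of 1] integral_std_normal_moment_even[of 2]
    integral_std_normal_moment_even[of 3] integral_std_normal_moment_odd[of 0] integral_std_normal_moment_odd[of 1]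
  by (simp_all add: integral_stdN(1) fact_numeral)

text \<open>exp(w - q / 2) generates the Hermite polynomials of variance q; those of degrees 0 to 3
  are removed, w^3 - 3 q w being the one of degree 3. With w = x.g and q = |x|^2 the exponential is
  the likelihood ratio of a translation by x.\<close>

definition exp_rem :: "real \<Rightarrow> real \<Rightarrow> real" where
  "exp_rem w q = exp (w - q / 2) - 1 - w - (w\<^sup>2 - q) / 2 - (w ^ 3 - 3 * q * w) / 6"

definition exp_rem_dom :: "real \<Rightarrow> real" where
  "exp_rem_dom v = 2 * (1 + \<bar>v\<bar> + \<bar>v\<bar> ^ 2 + \<bar>v\<bar> ^ 3 + \<bar>v\<bar> ^ 4 * exp \<bar>v\<bar>)"

text \<open>Counting \<open>w\<close> as one factor s and \<open>q\<close> as two, everything of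
  degree below 4 has been removed. For s \<le> 1 the bound follows from Taylor expansions of both
  exponentials; for s > 1 every lower power of s is at most s^4, and the exponential is kept as it
  stands. Keeping it is cheap: as a likelihood ratio it integrates to 1 over v, whatever s
  is.\<close>

lemma exp_rem_bound:
  assumes s: "0 \<le> s"
  shows "\<bar>exp_rem (s * v) (s\<^sup>2)\<bar> \<le> s ^ 4 * (exp_rem_dom v + exp (s * v - s\<^sup>2 / 2))"
proof (cases "s \<le> 1")
  case True
  define a where "a = \<bar>v\<bar>"
  have a: "0 \<le> a" by (simp add: a_def)
  define w q where "w = s * v" and "q = s\<^sup>2"
  have aw: "\<bar>w\<bar> = s * a" using s by (simp add: w_def a_def abs_mult)
  have wle: "\<bar>w\<bar> \<le> a" using True s a by (simp add: aw mult_left_le_one_le)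
  have q: "0 \<le> q" "q \<le> 1" using True s by (simp_all add: q_def power_le_one)
  have q2: "q\<^sup>2 = s ^ 4" by (simp add: q_def power_mult[symmetric])
  obtain t where t: "\<bar>t\<bar> \<le> \<bar>w\<bar>" "exp w = (\<Sum>m<4. w ^ m / fact m) + exp t / fact 4 * w ^ 4"
    using Maclaurin_exp_le[of w 4] by blast
  obtain u where u: "\<bar>u\<bar> \<le> \<bar>- q / 2\<bar>" "exp (- q / 2) = (\<Sum>m<2. (- q / 2) ^ m / fact m) + exp u / fact 2 * (- q / 2) ^ 2"
    using Maclaurin_exp_le[of "- q / 2" 2] by blast
  define \<rho> \<rho>' S where "\<rho> = exp t / 24 * w ^ 4" and "\<rho>' = exp u / 8 * q\<^sup>2" and "S = 1 + w + w\<^sup>2 / 2 + w ^ 3 / 6"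
  have e1: "exp w = S + \<rho>" using t(2) by (simp add: S_def \<rho>_def numeral_eq_Suc fact_numeral)
  have e2: "exp (- q / 2) = 1 - q / 2 + \<rho>'" using u(2) by (simp add: \<rho>'_def numeral_eq_Suc power2_eq_square)
  have "exp (w - q / 2) = exp w * exp (- q / 2)" by (simp add: exp_add[symmetric])
  also have "\<dots> = S * (1 - q / 2) + S * \<rho>' + \<rho> * exp (- q / 2)"
  proof -
    have "S * exp (- q / 2) = S * (1 - q / 2) + S * \<rho>'" by (simp only: e2 distrib_left)
    then show ?thesis by (simp only: e1 distrib_right)
  qed
  \<comment> \<open>The product of the two Taylor polynomials reproduces the removed Hermite terms
    up to q w^2 / 4 and q w^3 / 12, which have degrees 4 and 5 in s.\<close>
  finally have R: "exp_rem w q = S * \<rho>' + \<rho> * exp (- q / 2) - q * w\<^sup>2 / 4 - q * w ^ 3 / 12"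
    unfolding exp_rem_def S_def by (simp add: field_simps power2_eq_square power3_eq_cube)
  have "\<bar>w\<bar> ^ 4 = s ^ 4 * a ^ 4" by (simp add: aw power_mult_distrib)
  moreover have "exp t \<le> exp a" using t(1) wle by simp
  ultimately have \<rho>b: "\<bar>\<rho>\<bar> \<le> s ^ 4 * (a ^ 4 * exp a)"
  proof -
    have "\<bar>\<rho>\<bar> = exp t / 24 * (s ^ 4 * a ^ 4)" using \<open>\<bar>w\<bar> ^ 4 = s ^ 4 * a ^ 4\<close> by (simp add: \<rho>_def abs_mult power_abs)
    also have "\<dots> \<le> exp a * (s ^ 4 * a ^ 4)"
    proof (rule mult_right_mono)
      show "exp t / 24 \<le> exp a" using \<open>exp t \<le> exp a\<close> exp_gt_zero[of t] by linarith
    qed (use s a in simp)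
    finally show ?thesis by (simp add: ac_simps)
  qed
  have \<rho>'b: "\<bar>\<rho>'\<bar> \<le> s ^ 4"
  proof -
    have "exp u \<le> exp 1" using u(1) q by simp
    also have "\<dots> \<le> 8" using exp_le by simp
    finally have "exp u / 8 \<le> 1" by simp
    then have "exp u / 8 * q\<^sup>2 \<le> 1 * q\<^sup>2" by (intro mult_right_mono) auto
    then show ?thesis by (simp add: \<rho>'_def q2)
  qed
  have Sb: "\<bar>S\<bar> \<le> 1 + a + a\<^sup>2 / 2 + a ^ 3 / 6"
  proof -
    have "\<bar>S\<bar> \<le> 1 + \<bar>w\<bar> + \<bar>w\<bar>\<^sup>2 / 2 + \<bar>w\<bar> ^ 3 / 6"
      unfolding S_def power_abs[symmetric] using abs_triangle_ineq[of "1 + w + w\<^sup>2 / 2" "w ^ 3 / 6"]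
        abs_triangle_ineq[of "1 + w" "w\<^sup>2 / 2"] abs_triangle_ineq[of 1 w] by (simp add: power_abs)
    also have "\<dots> \<le> 1 + a + a\<^sup>2 / 2 + a ^ 3 / 6"
      using wle by (intro add_mono divide_right_mono power_mono) auto
    finally show ?thesis .
  qed
  have w2: "q * w\<^sup>2 = s ^ 4 * a\<^sup>2" by (simp add: q_def w_def a_def power_mult_distrib power4_eq_xxxx power2_eq_square)
  have w3: "\<bar>q * w ^ 3\<bar> \<le> s ^ 4 * a ^ 3"
  proof -
    have "\<bar>q * w ^ 3\<bar> = q * \<bar>w\<bar> ^ 3" using q by (simp add: abs_mult power_abs)
    also have "\<dots> = s ^ 4 * (s * a ^ 3)" by (simp add: q_def aw power_mult_distrib eval_nat_numeral)
    also have "\<dots> \<le> s ^ 4 * (1 * a ^ 3)" using True s a by (intro mult_left_mono mult_right_mono) auto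
    finally show ?thesis by simp
  qed
  have "\<bar>exp_rem w q\<bar> \<le> \<bar>S * \<rho>'\<bar> + \<bar>\<rho> * exp (- q / 2)\<bar> + \<bar>q * w\<^sup>2\<bar> / 4 + \<bar>q * w ^ 3\<bar> / 12"
    unfolding R by linarith
  also have "\<dots> \<le> (1 + a + a\<^sup>2 / 2 + a ^ 3 / 6) * s ^ 4 + s ^ 4 * (a ^ 4 * exp a) + s ^ 4 * a\<^sup>2 / 4 + s ^ 4 * a ^ 3 / 12"
  proof (intro add_mono divide_right_mono)
    show "\<bar>S * \<rho>'\<bar> \<le> (1 + a + a\<^sup>2 / 2 + a ^ 3 / 6) * s ^ 4"
      unfolding abs_mult using Sb \<rho>'b a by (intro mult_mono) auto
    have "\<bar>\<rho> * exp (- q / 2)\<bar> \<le> \<bar>\<rho>\<bar> * 1" unfolding abs_mult using q by (intro mult_left_mono) auto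
    then show "\<bar>\<rho> * exp (- q / 2)\<bar> \<le> s ^ 4 * (a ^ 4 * exp a)" using \<rho>b by simp
  qed (use w2 w3 s in auto)
  also have "\<dots> \<le> s ^ 4 * exp_rem_dom v"
  proof -
    have "s ^ 4 * exp_rem_dom v - ((1 + a + a\<^sup>2 / 2 + a ^ 3 / 6) * s ^ 4 + s ^ 4 * (a ^ 4 * exp a) + s ^ 4 * a\<^sup>2 / 4 + s ^ 4 * a ^ 3 / 12)
      = s ^ 4 * (1 + a + 5 / 4 * a\<^sup>2 + 7 / 4 * a ^ 3 + a ^ 4 * exp a)"
      unfolding exp_rem_dom_def a_def[symmetric] by (simp add: field_simps)
    also have "\<dots> \<ge> 0" using s a by auto
    finally show ?thesis by simp
  qed
  also have "\<dots> \<le> s ^ 4 * (exp_rem_dom v + exp (s * v - s\<^sup>2 / 2))" using s by (intro mult_left_mono) auto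
  finally show ?thesis by (simp add: w_def q_def)
next
  case False
  define a where "a = \<bar>v\<bar>"
  have a: "0 \<le> a" by (simp add: a_def)
  have s1: "s ^ k \<le> s ^ 4" if "k \<le> 4" for k using False that by (intro power_increasing) auto
  have s4: "1 \<le> s ^ 4" using s1[of 0] by simp
  have abs_sv: "\<bar>s * v\<bar> = s * a" using s by (simp add: a_def abs_mult)
  have p2: "(s * v)\<^sup>2 = s\<^sup>2 * a\<^sup>2" by (simp add: power_mult_distrib a_def)
  have p3: "\<bar>(s * v) ^ 3\<bar> = s ^ 3 * a ^ 3" using s by (simp add: power_mult_distrib a_def abs_mult power_abs)
  have p1: "\<bar>3 * s\<^sup>2 * (s * v)\<bar> = 3 * (s ^ 3 * a)" using s by (simp add: abs_mult a_def power3_eq_cube power2_eq_square)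
  have "\<bar>exp_rem (s * v) (s\<^sup>2)\<bar> \<le> exp (s * v - s\<^sup>2 / 2) + 1 + s * a + (s\<^sup>2 * a\<^sup>2 + s\<^sup>2) / 2 + (s ^ 3 * a ^ 3 + 3 * (s ^ 3 * a)) / 6"
  proof -
    have gen: "E - 1 - W - (P - q) / 2 - (T - U) / 6 \<le> R" "- (E - 1 - W - (P - q) / 2 - (T - U) / 6) \<le> R"
      if "0 \<le> E" "0 \<le> P" "0 \<le> q" "W \<le> W'" "- W \<le> W'" "T \<le> T'" "- T \<le> T'" "U \<le> U'" "- U \<le> U'"
        "R = E + 1 + W' + (P + q) / 2 + (T' + U') / 6" for E W P q T U W' T' U' R :: real
      using that by (simp_all add: field_simps)
    have "\<bar>E - 1 - W - (P - q) / 2 - (T - U) / 6\<bar> \<le> E + 1 + \<bar>W\<bar> + (P + q) / 2 + (\<bar>T\<bar> + \<bar>U\<bar>) / 6"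
      if "0 \<le> E" "0 \<le> P" "0 \<le> q" for E W P q T U :: real
      by (intro abs_leI gen[of E P q W "\<bar>W\<bar>" T "\<bar>T\<bar>" U "\<bar>U\<bar>"] that abs_ge_self abs_ge_minus_self refl)
    from this[of "exp (s * v - s\<^sup>2 / 2)" "(s * v)\<^sup>2" "s\<^sup>2" "s * v" "(s * v) ^ 3" "3 * s\<^sup>2 * (s * v)"]
    show ?thesis unfolding exp_rem_def abs_sv p3 p1 p2 by simp
  qed
  also have "\<dots> \<le> s ^ 4 * exp (s * v - s\<^sup>2 / 2) + s ^ 4 + s ^ 4 * a + (s ^ 4 * a\<^sup>2 + s ^ 4) / 2 + (s ^ 4 * a ^ 3 + 3 * (s ^ 4 * a)) / 6"
    using s1[of 1] s1[of 2] s1[of 3] s4 a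
    by (intro add_mono divide_right_mono mult_left_mono mult_right_mono) auto
  also have "\<dots> \<le> s ^ 4 * (exp_rem_dom v + exp (s * v - s\<^sup>2 / 2))"
  proof -
    have "s ^ 4 * (exp_rem_dom v + exp (s * v - s\<^sup>2 / 2)) - (s ^ 4 * exp (s * v - s\<^sup>2 / 2) + s ^ 4 + s ^ 4 * a
        + (s ^ 4 * a\<^sup>2 + s ^ 4) / 2 + (s ^ 4 * a ^ 3 + 3 * (s ^ 4 * a)) / 6)
      = s ^ 4 * (1 / 2 + 1 / 2 * a + 3 / 2 * a\<^sup>2 + 11 / 6 * a ^ 3 + 2 * (a ^ 4 * exp a))"
      unfolding exp_rem_dom_def a_def[symmetric] by (simp add: field_simps)
    also have "\<dots> \<ge> 0" using s a by auto
    finally show ?thesis by simp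
  qed
  finally show ?thesis .
qed

lemma integrable_exp_rem_dom: "integrable stdN exp_rem_dom"
  unfolding exp_rem_dom_def[abs_def] using integrable_stdN_power_exp[of 4 1] integrable_stdN_abs_power[of 1]
    integrable_stdN_abs_power[of 2] integrable_stdN_abs_power[of 3]
  by (intro integrable_mult_right Bochner_Integration.integrable_add) auto

lemma exp_rem_dom_nonneg: "0 \<le> exp_rem_dom v"
  unfolding exp_rem_dom_def by simp

text \<open>The summand 1 is the integral of the likelihood ratio retained in
  \<open>exp_rem_bound\<close>.\<close>

definition C_rem :: real where "C_rem = (\<integral>v. exp_rem_dom v \<partial>stdN) + 1"

lemma C_rem_ge_1: "1 \<le> C_rem"
  unfolding C_rem_def using exp_rem_dom_nonneg by (simp add: integral_nonneg_AE)

lemma exp_rem_measurable [measurable]: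
  assumes [measurable]: "f \<in> borel_measurable M" "g \<in> borel_measurable M"
  shows "(\<lambda>x. exp_rem (f x) (g x)) \<in> borel_measurable M"
  unfolding exp_rem_def by measurable

text \<open>\<open>dot d x g\<close> has the law of |x| v with v standard normal, so the question is
  one-dimensional and the bound involves |x|^4 but not the dimension.\<close>

lemma nn_integral_exp_rem_dot:
  "(\<integral>\<^sup>+g. ennreal \<bar>exp_rem (dot d x g) (sqn d x)\<bar> \<partial>std_gauss d) \<le> ennreal (C_rem * (sqn d x)\<^sup>2)"
proof -
  define s where "s = sqrt (sqn d x)"
  have s: "0 \<le> s" "s\<^sup>2 = sqn d x" by (simp_all add: s_def)
  have i2: "integrable stdN (\<lambda>v. exp (s * v - s\<^sup>2 / 2))"
    using integrable_stdN_exp[of s] by (simp add: exp_diff)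
  have i: "integrable stdN (\<lambda>v. s ^ 4 * (exp_rem_dom v + exp (s * v - s\<^sup>2 / 2)))"
    by (intro integrable_mult_right Bochner_Integration.integrable_add integrable_exp_rem_dom i2)
  have "(\<integral>\<^sup>+g. ennreal \<bar>exp_rem (dot d x g) (sqn d x)\<bar> \<partial>std_gauss d) =
     (\<integral>\<^sup>+w. ennreal \<bar>exp_rem w (sqn d x)\<bar> \<partial>distr (std_gauss d) borel (dot d x))"
    by (subst nn_integral_distr) auto
  also have "\<dots> = (\<integral>\<^sup>+v. ennreal \<bar>exp_rem (s * v) (s\<^sup>2)\<bar> \<partial>stdN)"
    unfolding distr_dot_std_gauss by (subst nn_integral_distr) (auto simp: s_def)
  also have "\<dots> \<le> (\<integral>\<^sup>+v. ennreal (s ^ 4 * (exp_rem_dom v + exp (s * v - s\<^sup>2 / 2))) \<partial>stdN)"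
    by (intro nn_integral_mono ennreal_leI exp_rem_bound s)
  also have "\<dots> = ennreal (\<integral>v. s ^ 4 * (exp_rem_dom v + exp (s * v - s\<^sup>2 / 2)) \<partial>stdN)"
    by (rule nn_integral_eq_integral[OF i]) (use s exp_rem_dom_nonneg in auto)
  also have "(\<integral>v. s ^ 4 * (exp_rem_dom v + exp (s * v - s\<^sup>2 / 2)) \<partial>stdN) = s ^ 4 * C_rem"
    unfolding C_rem_def
    by (simp add: Bochner_Integration.integral_add[OF integrable_exp_rem_dom i2] integral_stdN_exp_tilt)
  also have "s ^ 4 * C_rem = C_rem * (sqn d x)\<^sup>2"
    using s(2) by (simp add: s_def power4_eq_xxxx power2_eq_square)
  finally show ?thesis .
qed

section \<open>Mixed moments and the third Hermite polynomial\<close>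

lemma dot_add_scaled: "dot d (\<lambda>i. x i + b * y i) g = dot d x g + b * dot d y g"
  unfolding dot_def by (simp add: sum.distrib sum_distrib_left algebra_simps)

lemma sqn_add_scaled: "sqn d (\<lambda>i. x i + b * y i) = sqn d x + 2 * b * dot d x y + b\<^sup>2 * sqn d y"
  unfolding sqn_def dot_def by (simp add: sum.distrib sum_distrib_left algebra_simps power2_eq_square)

lemma integrable_std_gauss_dot_power: "integrable (std_gauss d) (\<lambda>g. (dot d x g) ^ k)"
  using integral_dot_std_gauss(2)[of "\<lambda>w. w ^ k" d x] integrable_stdN_power[of k]
  by (simp add: power_mult_distrib)

lemma integral_std_gauss_dot_power:
  "(\<integral>g. (dot d x g)\<^sup>2 \<partial>std_gauss d) = sqn d x"
  "(\<integral>g. (dot d x g) ^ 4 \<partial>std_gauss d) = 3 * (sqn d x)\<^sup>2"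
  "(\<integral>g. (dot d x g) ^ 6 \<partial>std_gauss d) = 15 * (sqn d x) ^ 3"
  "(\<integral>g. dot d x g \<partial>std_gauss d) = 0"
proof -
  have "sqrt s ^ 4 = s\<^sup>2" "sqrt s ^ 6 = s ^ 3" if "0 \<le> s" for s :: real
    using that power_mult[of "sqrt s" 2 2] power_mult[of "sqrt s" 2 3] by simp_all
  then show "(\<integral>g. (dot d x g)\<^sup>2 \<partial>std_gauss d) = sqn d x"
    "(\<integral>g. (dot d x g) ^ 4 \<partial>std_gauss d) = 3 * (sqn d x)\<^sup>2"
    "(\<integral>g. (dot d x g) ^ 6 \<partial>std_gauss d) = 15 * (sqn d x) ^ 3"
    "(\<integral>g. dot d x g \<partial>std_gauss d) = 0"
    using integral_dot_std_gauss(1)[of "\<lambda>w. w\<^sup>2" d x] integral_dot_std_gauss(1)[of "\<lambda>w. w ^ 4" d x]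
      integral_dot_std_gauss(1)[of "\<lambda>w. w ^ 6" d x] integral_dot_std_gauss(1)[of "\<lambda>w. w" d x]
    by (simp_all add: power_mult_distrib integral_stdN_power)
qed

text \<open>Mixed moments by polarization: \<open>w\<^sup>3 w'\<^sup>3\<close> is a linear combination of sixth powers of linear functionals.\<close>

lemma std_gauss_mixed_moments:
  fixes x y :: "nat \<Rightarrow> real" and d :: nat
  defines "w \<equiv> dot d x" and "w' \<equiv> dot d y"
  shows "has_bochner_integral (std_gauss d) (\<lambda>g. w g ^ 3 * w' g ^ 3) (6 * dot d x y ^ 3 + 9 * sqn d x * sqn d y * dot d x y)"
    "has_bochner_integral (std_gauss d) (\<lambda>g. w g ^ 3 * w' g) (3 * sqn d x * dot d x y)"
    "has_bochner_integral (std_gauss d) (\<lambda>g. w g * w' g) (dot d x y)"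
proof -
  have B6: "has_bochner_integral (std_gauss d) (\<lambda>g. (w g + b * w' g) ^ 6) (15 * (sqn d x + 2 * b * dot d x y + b\<^sup>2 * sqn d y) ^ 3)" for b
    using integrable_std_gauss_dot_power[of d "\<lambda>i. x i + b * y i" 6] integral_std_gauss_dot_power(3)[of d "\<lambda>i. x i + b * y i"]
    by (simp add: has_bochner_integral_iff dot_add_scaled sqn_add_scaled w_def w'_def)
  have B4: "has_bochner_integral (std_gauss d) (\<lambda>g. (w g + b * w' g) ^ 4) (3 * (sqn d x + 2 * b * dot d x y + b\<^sup>2 * sqn d y)\<^sup>2)" for b
    using integrable_std_gauss_dot_power[of d "\<lambda>i. x i + b * y i" 4] integral_std_gauss_dot_power(2)[of d "\<lambda>i. x i + b * y i"]
    by (simp add: has_bochner_integral_iff dot_add_scaled sqn_add_scaled w_def w'_def)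
  have B2: "has_bochner_integral (std_gauss d) (\<lambda>g. (w g + b * w' g)\<^sup>2) (sqn d x + 2 * b * dot d x y + b\<^sup>2 * sqn d y)" for b
    using integrable_std_gauss_dot_power[of d "\<lambda>i. x i + b * y i" 2] integral_std_gauss_dot_power(1)[of d "\<lambda>i. x i + b * y i"]
    by (simp add: has_bochner_integral_iff dot_add_scaled sqn_add_scaled w_def w'_def)
  \<comment> \<open>The difference of (a + j c)^6 and (a - j c)^6 contains c, c^3 and c^5 with
    weights proportional to j, j^3 and j^5. The coefficients 13, -8, 1 at j = 1, 2, 3 cancel the
    first and the last kind, and those of a^3 c^3 add up to -960. In \<open>p4\<close> the
    coefficients 8, -1 cancel c^3 in the same way.\<close>
  have p6: "a ^ 3 * c ^ 3 = (-1/960) * (13 * ((a + 1 * c) ^ 6 - (a + (-1) * c) ^ 6) - 8 * ((a + 2 * c) ^ 6 - (a + (-2) * c) ^ 6)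
      + ((a + 3 * c) ^ 6 - (a + (-3) * c) ^ 6))" for a c :: real
    by (simp add: eval_nat_numeral field_simps)
  have p4: "a ^ 3 * c = (1/48) * (8 * ((a + 1 * c) ^ 4 - (a + (-1) * c) ^ 4) - ((a + 2 * c) ^ 4 - (a + (-2) * c) ^ 4))" for a c :: real
    by (simp add: eval_nat_numeral field_simps)
  have p2: "a * c = (1/4) * ((a + 1 * c)\<^sup>2 - (a + (-1) * c)\<^sup>2)" for a c :: real
    by (simp add: eval_nat_numeral field_simps)
  let ?q = "sqn d x" and ?q' = "sqn d y" and ?c = "dot d x y"
  have "has_bochner_integral (std_gauss d) (\<lambda>g. (-1/960) * (13 * ((w g + 1 * w' g) ^ 6 - (w g + (-1) * w' g) ^ 6)
      - 8 * ((w g + 2 * w' g) ^ 6 - (w g + (-2) * w' g) ^ 6) + ((w g + 3 * w' g) ^ 6 - (w g + (-3) * w' g) ^ 6)))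
     ((-1/960) * (13 * (15 * (?q + 2 * 1 * ?c + 1\<^sup>2 * ?q') ^ 3 - 15 * (?q + 2 * (-1) * ?c + (-1)\<^sup>2 * ?q') ^ 3)
      - 8 * (15 * (?q + 2 * 2 * ?c + 2\<^sup>2 * ?q') ^ 3 - 15 * (?q + 2 * (-2) * ?c + (-2)\<^sup>2 * ?q') ^ 3)
      + (15 * (?q + 2 * 3 * ?c + 3\<^sup>2 * ?q') ^ 3 - 15 * (?q + 2 * (-3) * ?c + (-3)\<^sup>2 * ?q') ^ 3)))"
    by (intro has_bochner_integral_mult_right has_bochner_integral_add has_bochner_integral_diff B6)
  moreover have "(-1/960) * (13 * (15 * (q + 2 * 1 * c + 1\<^sup>2 * q') ^ 3 - 15 * (q + 2 * (-1) * c + (-1)\<^sup>2 * q') ^ 3)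
      - 8 * (15 * (q + 2 * 2 * c + 2\<^sup>2 * q') ^ 3 - 15 * (q + 2 * (-2) * c + (-2)\<^sup>2 * q') ^ 3)
      + (15 * (q + 2 * 3 * c + 3\<^sup>2 * q') ^ 3 - 15 * (q + 2 * (-3) * c + (-3)\<^sup>2 * q') ^ 3)) = 6 * c ^ 3 + 9 * q * q' * c" for q q' c :: real
    by (simp add: eval_nat_numeral field_simps)
  ultimately show "has_bochner_integral (std_gauss d) (\<lambda>g. w g ^ 3 * w' g ^ 3) (6 * ?c ^ 3 + 9 * ?q * ?q' * ?c)"
    unfolding p6[symmetric] by simp
  have "has_bochner_integral (std_gauss d) (\<lambda>g. (1/48) * (8 * ((w g + 1 * w' g) ^ 4 - (w g + (-1) * w' g) ^ 4) - ((w g + 2 * w' g) ^ 4 - (w g + (-2) * w' g) ^ 4)))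
     ((1/48) * (8 * (3 * (?q + 2 * 1 * ?c + 1\<^sup>2 * ?q')\<^sup>2 - 3 * (?q + 2 * (-1) * ?c + (-1)\<^sup>2 * ?q')\<^sup>2)
       - (3 * (?q + 2 * 2 * ?c + 2\<^sup>2 * ?q')\<^sup>2 - 3 * (?q + 2 * (-2) * ?c + (-2)\<^sup>2 * ?q')\<^sup>2)))"
    by (intro has_bochner_integral_mult_right has_bochner_integral_add has_bochner_integral_diff B4)
  moreover have "(1/48) * (8 * (3 * (q + 2 * 1 * c + 1\<^sup>2 * q')\<^sup>2 - 3 * (q + 2 * (-1) * c + (-1)\<^sup>2 * q')\<^sup>2)
       - (3 * (q + 2 * 2 * c + 2\<^sup>2 * q')\<^sup>2 - 3 * (q + 2 * (-2) * c + (-2)\<^sup>2 * q')\<^sup>2)) = 3 * q * c" for q q' c :: real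
    by (simp add: eval_nat_numeral field_simps)
  ultimately show "has_bochner_integral (std_gauss d) (\<lambda>g. w g ^ 3 * w' g) (3 * ?q * ?c)"
    unfolding p4[symmetric] by (simp only:)
  have "has_bochner_integral (std_gauss d) (\<lambda>g. (1/4) * ((w g + 1 * w' g)\<^sup>2 - (w g + (-1) * w' g)\<^sup>2))
     ((1/4) * ((?q + 2 * 1 * ?c + 1\<^sup>2 * ?q') - (?q + 2 * (-1) * ?c + (-1)\<^sup>2 * ?q')))"
    by (intro has_bochner_integral_mult_right has_bochner_integral_diff B2)
  then show "has_bochner_integral (std_gauss d) (\<lambda>g. w g * w' g) ?c"
    unfolding p2[symmetric] by simp
qed

definition herm3 :: "nat \<Rightarrow> (nat \<Rightarrow> real) \<Rightarrow> (nat \<Rightarrow> real) \<Rightarrow> real" where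
  "herm3 d x g = (dot d x g) ^ 3 - 3 * sqn d x * dot d x g"

lemma dot_commute: "dot d x y = dot d y x"
  unfolding dot_def by (simp add: mult.commute)

text \<open>The term 3 |x|^2 x.g in \<open>herm3\<close> removes the pairings of x with itself: all
  multiples of |x|^2 |y|^2 x.y cancel, and only the 3! complete pairings of x with y remain.\<close>

lemma herm3_orthogonality:
  "has_bochner_integral (std_gauss d) (\<lambda>g. herm3 d x g * herm3 d y g) (6 * dot d x y ^ 3)"
proof -
  let ?w = "dot d x" and ?w' = "dot d y" and ?q = "sqn d x" and ?q' = "sqn d y" and ?c = "dot d x y"
  have "has_bochner_integral (std_gauss d) (\<lambda>g. ?w g ^ 3 * ?w' g ^ 3 - (3 * ?q') * (?w g ^ 3 * ?w' g)
      - (3 * ?q) * (?w' g ^ 3 * ?w g) + (9 * ?q * ?q') * (?w g * ?w' g))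
     ((6 * ?c ^ 3 + 9 * ?q * ?q' * ?c) - (3 * ?q') * (3 * ?q * ?c) - (3 * ?q) * (3 * ?q' * dot d y x) + (9 * ?q * ?q') * ?c)"
    by (intro has_bochner_integral_add has_bochner_integral_diff has_bochner_integral_mult_right std_gauss_mixed_moments)
  moreover have "?w g ^ 3 * ?w' g ^ 3 - (3 * ?q') * (?w g ^ 3 * ?w' g)
      - (3 * ?q) * (?w' g ^ 3 * ?w g) + (9 * ?q * ?q') * (?w g * ?w' g) = herm3 d x g * herm3 d y g" for g
    unfolding herm3_def by (simp add: algebra_simps)
  ultimately show ?thesis by (simp add: dot_commute[of d y x] algebra_simps)
qed

section \<open>Isotropic random vectors\<close>

lemma dot_square_le: "(dot d x y)\<^sup>2 \<le> sqn d x * sqn d y"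
  unfolding dot_def sqn_def using Cauchy_Schwarz_ineq_sum[of x y "{..<d}"] .

lemma abs_dot_le: "\<bar>dot d x y\<bar> \<le> sqrt (sqn d x) * sqrt (sqn d y)"
  using real_sqrt_le_mono[OF dot_square_le[of d x y]] by (simp add: real_sqrt_mult)

lemma cube_le_one_plus_square: "0 \<le> a \<Longrightarrow> a ^ 3 \<le> (1 + a\<^sup>2)\<^sup>2" "0 \<le> a \<Longrightarrow> a \<le> (1 + a\<^sup>2)\<^sup>2" for a :: real
proof -
  assume a: "0 \<le> a"
  have p: "0 \<le> (a - 1)\<^sup>2" "0 \<le> a\<^sup>2" "0 \<le> a ^ 4" "0 \<le> a\<^sup>2 * (a - 1)\<^sup>2" by simp_all
  have "(1 + a\<^sup>2)\<^sup>2 = 1 + 2 * a\<^sup>2 + a ^ 4" by (simp add: power2_eq_square power4_eq_xxxx algebra_simps)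
  moreover have "(a - 1)\<^sup>2 = a\<^sup>2 - 2 * a + 1" by (simp add: power2_eq_square algebra_simps)
  moreover have "a\<^sup>2 * (a - 1)\<^sup>2 = a ^ 4 - 2 * a ^ 3 + a\<^sup>2" by (simp add: eval_nat_numeral algebra_simps)
  ultimately show "a ^ 3 \<le> (1 + a\<^sup>2)\<^sup>2" "a \<le> (1 + a\<^sup>2)\<^sup>2" using p by linarith+
qed

text \<open>A crude bound in product form, for integrability and the exchange of integrals.\<close>

lemma abs_herm3_le: "\<bar>herm3 d x g\<bar> \<le> 4 * ((1 + sqn d x)\<^sup>2 * (1 + sqn d g)\<^sup>2)"
proof -
  define a b where "a = sqrt (sqn d x)" and "b = sqrt (sqn d g)"
  have ab: "0 \<le> a" "0 \<le> b" "sqn d x = a\<^sup>2" "sqn d g = b\<^sup>2" by (simp_all add: a_def b_def)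
  have w: "\<bar>dot d x g\<bar> \<le> a * b" using abs_dot_le[of d x g] by (simp add: a_def b_def)
  have "\<bar>herm3 d x g\<bar> \<le> \<bar>dot d x g\<bar> ^ 3 + 3 * a\<^sup>2 * \<bar>dot d x g\<bar>"
    unfolding herm3_def ab(3) using abs_triangle_ineq4[of "dot d x g ^ 3" "3 * a\<^sup>2 * dot d x g"] by (simp add: abs_mult power_abs)
  also have "\<dots> \<le> (a * b) ^ 3 + 3 * a\<^sup>2 * (a * b)"
    using w by (intro add_mono power_mono mult_left_mono) auto
  also have "\<dots> = a ^ 3 * (b ^ 3 + 3 * b)" by (simp add: power_mult_distrib power2_eq_square power3_eq_cube algebra_simps)
  also have "\<dots> \<le> (1 + a\<^sup>2)\<^sup>2 * ((1 + b\<^sup>2)\<^sup>2 + 3 * (1 + b\<^sup>2)\<^sup>2)"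
    using cube_le_one_plus_square[of a] cube_le_one_plus_square[of b] ab
    by (intro mult_mono add_mono) auto
  finally show ?thesis by (simp add: ab)
qed

text \<open>exp(|g|^2 / 4) leaves half of the Gaussian decay, is a product of integrable functions
  of the coordinates, and dominates every power.\<close>

lemma integrable_std_gauss_sqn_power: "integrable (std_gauss d) (\<lambda>g. (1 + sqn d g) ^ k)"
proof (cases "k = 0")
  case True then show ?thesis by simp
next
  case False
  have e: "integrable stdN (\<lambda>x. exp (x\<^sup>2 / 4))"
  proof -
    have "std_normal_density x * exp (x\<^sup>2 / 4) = sqrt 2 * normal_density 0 (sqrt 2) x" for x
    proof -
      have "sqrt 2 * sqrt 2 = (2 :: real)" by simp
      then show ?thesis by (simp add: normal_density_def exp_add[symmetric] real_sqrt_mult divide_simps)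
    qed
    then show ?thesis by (subst integral_stdN(2)) auto
  qed
  have "integrable (PiM {..<d} (\<lambda>_. stdN)) (\<lambda>g. \<Prod>i<d. exp ((g i)\<^sup>2 / 4))"
    by (rule stdNs.product_integrable_prod[OF _ e]) auto
  then have E: "integrable (std_gauss d) (\<lambda>g. exp (sqn d g / 4))"
    unfolding std_gauss_def by (simp add: exp_sum[symmetric] sqn_def sum_divide_distrib)
  show ?thesis
  proof (rule Bochner_Integration.integrable_bound)
    show "integrable (std_gauss d) (\<lambda>g. (4 * real k) ^ k * exp (sqn d g / 4))" using E by simp
    show "AE g in std_gauss d. norm ((1 + sqn d g) ^ k) \<le> norm ((4 * real k) ^ k * exp (sqn d g / 4))"
    proof (intro AE_I2)
      fix g
      have k: "1 \<le> real k" using False by simp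
      have "1 + sqn d g \<le> 4 * real k * (1 + sqn d g / (4 * real k))"
        using k by (simp add: distrib_left)
      also have "\<dots> \<le> 4 * real k * exp (sqn d g / (4 * real k))"
        using k by (intro mult_left_mono exp_ge_add_one_self) auto
      finally have "(1 + sqn d g) ^ k \<le> (4 * real k * exp (sqn d g / (4 * real k))) ^ k"
        by (intro power_mono) auto
      also have "\<dots> = (4 * real k) ^ k * exp (sqn d g / 4)"
        using False by (simp add: power_mult_distrib exp_of_nat_mult[symmetric])
      finally show "norm ((1 + sqn d g) ^ k) \<le> norm ((4 * real k) ^ k * exp (sqn d g / 4))" by simp
    qed
  qed measurable
qed

lemma integrable_pair_dominated:
  fixes F :: "'a \<times> 'b \<Rightarrow> real"
  assumes "sigma_finite_measure N" "sigma_finite_measure K"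
    and F[measurable]: "F \<in> borel_measurable (N \<Otimes>\<^sub>M K)"
    and f: "integrable N f" and h: "integrable K h"
    and le: "\<And>x y. x \<in> space N \<Longrightarrow> y \<in> space K \<Longrightarrow> \<bar>F (x, y)\<bar> \<le> f x * h y"
  shows "integrable (N \<Otimes>\<^sub>M K) F"
proof -
  interpret NK: pair_sigma_finite N K using assms by (simp add: pair_sigma_finite_def)
  have sec: "integrable K (\<lambda>y. F (x, y))" if x: "x \<in> space N" for x
  proof (rule Bochner_Integration.integrable_bound)
    show "integrable K (\<lambda>y. f x * h y)" using h by simp
    show "(\<lambda>y. F (x, y)) \<in> borel_measurable K" using x by measurable
    show "AE y in K. norm (F (x, y)) \<le> norm (f x * h y)" using le[OF x] by (intro AE_I2) (force simp: abs_le_iff)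
  qed
  show ?thesis
  proof (rule NK.Fubini_integrable[OF F])
    show "AE x in N. integrable K (\<lambda>y. F (x, y))" using sec by auto
    show "integrable N (\<lambda>x. \<integral>y. norm (F (x, y)) \<partial>K)"
    proof (rule Bochner_Integration.integrable_bound)
      show "integrable N (\<lambda>x. f x * (\<integral>y. h y \<partial>K))" using f by simp
      show "(\<lambda>x. \<integral>y. norm (F (x, y)) \<partial>K) \<in> borel_measurable N" by measurable
      show "AE x in N. norm (\<integral>y. norm (F (x, y)) \<partial>K) \<le> norm (f x * (\<integral>y. h y \<partial>K))"
      proof (intro AE_I2)
        fix x assume x: "x \<in> space N"
        have "(\<integral>y. norm (F (x, y)) \<partial>K) \<le> (\<integral>y. f x * h y \<partial>K)"
          using sec[OF x] h le[OF x] by (intro integral_mono) auto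
        moreover have "0 \<le> (\<integral>y. norm (F (x, y)) \<partial>K)" by (simp add: integral_nonneg_AE)
        ultimately show "norm (\<integral>y. norm (F (x, y)) \<partial>K) \<le> norm (f x * (\<integral>y. h y \<partial>K))" by simp
      qed
    qed
  qed
qed

text \<open>Interpreted twice, for the standardised score and for the Gaussian vector itself, so
  that both sides of an exchange are governed by the same expansion.\<close>

locale isotropic = prob_space M for M :: "'a measure" +
  fixes d :: nat and X :: "'a \<Rightarrow> nat \<Rightarrow> real"
  assumes X_measurable [measurable]: "\<And>i. i < d \<Longrightarrow> (\<lambda>w. X w i) \<in> borel_measurable M"
    and fourth_moment: "integrable M (\<lambda>w. (sqn d (X w))\<^sup>2)"
    and mean_zero: "\<And>i. i < d \<Longrightarrow> (\<integral>w. X w i \<partial>M) = 0"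
    and unit_covariance: "\<And>i j. i < d \<Longrightarrow> j < d \<Longrightarrow> (\<integral>w. X w i * X w j \<partial>M) = (if i = j then 1 else 0)"
begin

definition "m4 = (\<integral>w. (sqn d (X w))\<^sup>2 \<partial>M)"

lemma integrable_dominated:
  fixes f :: "'a \<Rightarrow> real"
  assumes [measurable]: "f \<in> borel_measurable M" and le: "\<And>w. \<bar>f w\<bar> \<le> c * (1 + (sqn d (X w))\<^sup>2)"
  shows "integrable M f"
proof (rule Bochner_Integration.integrable_bound)
  show "integrable M (\<lambda>w. c * (1 + (sqn d (X w))\<^sup>2))" using fourth_moment by simp
  show "AE w in M. norm (f w) \<le> norm (c * (1 + (sqn d (X w))\<^sup>2))"
    using le by (intro AE_I2) (metis abs_ge_self order_trans real_norm_def)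
qed measurable

lemma coord_le: "i < d \<Longrightarrow> (x i)\<^sup>2 \<le> sqn d x"
  unfolding sqn_def by (rule member_le_sum) auto

lemma sqn_le: "sqn d x \<le> 1 + (sqn d x)\<^sup>2"
proof -
  have "0 \<le> (sqn d x - 1)\<^sup>2 + 1" by (intro add_nonneg_nonneg) auto
  also have "\<dots> = (sqn d x)\<^sup>2 - 2 * sqn d x + 2" by (simp add: power2_eq_square algebra_simps)
  finally have "2 * sqn d x \<le> (sqn d x)\<^sup>2 + 2" by simp
  then show ?thesis using zero_le_power2[of "sqn d x"] by linarith
qed

lemma integrable_coord: "i < d \<Longrightarrow> integrable M (\<lambda>w. X w i)"
proof (rule integrable_dominated[where c = 2])
  fix w assume i: "i < d"
  have "0 \<le> (\<bar>X w i\<bar> - 1)\<^sup>2" by simp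
  then have "2 * \<bar>X w i\<bar> \<le> 1 + (X w i)\<^sup>2" by (simp add: power2_eq_square algebra_simps)
  also have "\<dots> \<le> 1 + (1 + (sqn d (X w))\<^sup>2)" using coord_le[OF i, of "X w"] sqn_le[of "X w"] by simp
  also have "\<dots> \<le> 2 * (1 + (sqn d (X w))\<^sup>2)" by simp
  finally show "\<bar>X w i\<bar> \<le> 2 * (1 + (sqn d (X w))\<^sup>2)" by linarith
qed simp

lemma abs_mult_le: "i < d \<Longrightarrow> j < d \<Longrightarrow> \<bar>x i * x j\<bar> \<le> sqn d x"
proof -
  assume i: "i < d" and j: "j < d"
  have "0 \<le> (\<bar>x i\<bar> - \<bar>x j\<bar>)\<^sup>2" by simp
  then have "2 * \<bar>x i * x j\<bar> \<le> (x i)\<^sup>2 + (x j)\<^sup>2" by (simp add: power2_eq_square algebra_simps abs_mult)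
  then show ?thesis using coord_le[OF i, of x] coord_le[OF j, of x] by simp
qed

lemma integrable_coord2: "i < d \<Longrightarrow> j < d \<Longrightarrow> integrable M (\<lambda>w. X w i * X w j)"
  by (rule integrable_dominated[where c = 1])
     (use abs_mult_le order_trans[OF _ sqn_le] in auto)

lemma integrable_coord4: "i < d \<Longrightarrow> j < d \<Longrightarrow> k < d \<Longrightarrow> l < d \<Longrightarrow> integrable M (\<lambda>w. X w i * X w j * (X w k * X w l))"
proof (rule integrable_dominated[where c = 1])
  fix w assume *: "i < d" "j < d" "k < d" "l < d"
  have "\<bar>X w i * X w j * (X w k * X w l)\<bar> \<le> sqn d (X w) * sqn d (X w)"
    unfolding abs_mult[of "X w i * X w j"] using abs_mult_le * by (intro mult_mono) auto
  then show "\<bar>X w i * X w j * (X w k * X w l)\<bar> \<le> 1 * (1 + (sqn d (X w))\<^sup>2)" by (simp add: power2_eq_square)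
qed simp

lemma integrable_coord3: "i < d \<Longrightarrow> j < d \<Longrightarrow> k < d \<Longrightarrow> integrable M (\<lambda>w. X w i * (X w j * X w k))"
proof (rule integrable_dominated[where c = 1])
  fix w assume *: "i < d" "j < d" "k < d"
  have "\<bar>X w i * (X w j * X w k)\<bar> \<le> ((X w i)\<^sup>2 + (X w j * X w k)\<^sup>2) / 2"
  proof -
    have "0 \<le> (\<bar>X w i\<bar> - \<bar>X w j * X w k\<bar>)\<^sup>2" by simp
    then show ?thesis by (simp add: power2_eq_square algebra_simps abs_mult)
  qed
  moreover have "(X w j * X w k)\<^sup>2 \<le> (sqn d (X w))\<^sup>2"
    using power_mono[OF abs_mult_le[of j k "X w"], of 2] * by simp
  ultimately show "\<bar>X w i * (X w j * X w k)\<bar> \<le> 1 * (1 + (sqn d (X w))\<^sup>2)"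
    using coord_le[OF *(1), of "X w"] sqn_le[of "X w"] by simp
qed simp

lemma integrable_sqn: "integrable M (\<lambda>w. sqn d (X w))"
  by (rule integrable_dominated[where c = 1]) (use sqn_le in auto)

lemma expectation_sqn: "(\<integral>w. sqn d (X w) \<partial>M) = d"
proof -
  have "(\<integral>w. sqn d (X w) \<partial>M) = (\<Sum>i<d. \<integral>w. X w i * X w i \<partial>M)"
    unfolding sqn_def power2_eq_square by (rule Bochner_Integration.integral_sum) (auto intro: integrable_coord2)
  also have "\<dots> = d" by (simp add: unit_covariance)
  finally show ?thesis .
qed

text \<open>The variance of |X|^2, whose mean is \<open>d\<close>, is nonnegative. Therefore powers
  of the dimension, such as the fourth moment of the Gaussian vector, can be absorbed into
  \<open>m4\<close>.\<close>

lemma m4_ge: "(real d)\<^sup>2 \<le> m4"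
proof -
  have "0 \<le> (\<integral>w. (sqn d (X w) - d)\<^sup>2 \<partial>M)" by (simp add: integral_nonneg_AE)
  also have "(\<integral>w. (sqn d (X w) - d)\<^sup>2 \<partial>M) = (\<integral>w. (sqn d (X w))\<^sup>2 - 2 * d * sqn d (X w) + d\<^sup>2 \<partial>M)"
    by (simp add: power2_eq_square algebra_simps)
  also have "\<dots> = m4 - 2 * d * d + d\<^sup>2"
    unfolding m4_def using fourth_moment integrable_sqn by (simp add: expectation_sqn prob_space)
  finally show ?thesis by (simp add: power2_eq_square)
qed

lemma integrable_dot: "integrable M (\<lambda>w. dot d (X w) g)"
  and expectation_dot: "(\<integral>w. dot d (X w) g \<partial>M) = 0"
  unfolding dot_def using integrable_coord mean_zero
  by (auto intro!: Bochner_Integration.integrable_sum simp: Bochner_Integration.integral_sum)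

lemma dot_square: "(dot d x g)\<^sup>2 = (\<Sum>i<d. \<Sum>j<d. g i * g j * (x i * x j))"
  unfolding dot_def power2_eq_square sum_product by (intro sum.cong) auto

lemma integrable_dot_square: "integrable M (\<lambda>w. (dot d (X w) g)\<^sup>2)"
  unfolding dot_square by (intro Bochner_Integration.integrable_sum integrable_mult_right integrable_coord2) auto

lemma expectation_dot_square: "(\<integral>w. (dot d (X w) g)\<^sup>2 \<partial>M) = sqn d g"
proof -
  have "(\<integral>w. (dot d (X w) g)\<^sup>2 \<partial>M) = (\<Sum>i<d. \<Sum>j<d. g i * g j * (if i = j then 1 else 0))"
    unfolding dot_square
    by (subst Bochner_Integration.integral_sum, intro Bochner_Integration.integrable_sum integrable_mult_right integrable_coord2, simp, simp,
        intro sum.cong refl, subst Bochner_Integration.integral_sum) (auto intro!: integrable_coord2 sum.cong simp: unit_covariance)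
  also have "\<dots> = sqn d g" unfolding sqn_def by (simp add: power2_eq_square if_distrib[of "\<lambda>x. _ * x"] cong: if_cong)
  finally show ?thesis .
qed

definition "third_moment i j k = (\<integral>w. X w i * (X w j * X w k) \<partial>M)"

text \<open>The coordinates \<open>X w i\<close> are orthonormal in \<open>L\<^sup>2\<close>.\<close>

lemma bessel:
  assumes j: "j < d" and k: "k < d"
  shows "(\<Sum>i<d. (third_moment i j k)\<^sup>2) \<le> (\<integral>w. (X w j * X w k)\<^sup>2 \<partial>M)"
proof -
  define c where "c i = third_moment i j k" for i
  let ?Y = "\<lambda>w. X w j * X w k"
  have iY: "integrable M (\<lambda>w. (?Y w)\<^sup>2)" unfolding power2_eq_square using integrable_coord4[of j k j k] j k by simp
  have dY: "dot d (X w) c * ?Y w = (\<Sum>i<d. c i * (X w i * ?Y w))" for w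
    unfolding dot_def by (simp add: sum_distrib_left sum_distrib_right ac_simps)
  have idY: "integrable M (\<lambda>w. dot d (X w) c * ?Y w)"
    unfolding dY using j k by (intro Bochner_Integration.integrable_sum integrable_mult_right integrable_coord3) auto
  have edY: "(\<integral>w. dot d (X w) c * ?Y w \<partial>M) = sqn d c"
    unfolding dY using j k integrable_coord3
    by (subst Bochner_Integration.integral_sum) (auto simp: sqn_def c_def third_moment_def power2_eq_square)
  have "0 \<le> (\<integral>w. (?Y w - dot d (X w) c)\<^sup>2 \<partial>M)" by (simp add: integral_nonneg_AE)
  also have "\<dots> = (\<integral>w. (?Y w)\<^sup>2 - 2 * (dot d (X w) c * ?Y w) + (dot d (X w) c)\<^sup>2 \<partial>M)"
    by (simp add: power2_eq_square algebra_simps)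
  also have "\<dots> = (\<integral>w. (?Y w)\<^sup>2 \<partial>M) - 2 * sqn d c + sqn d c"
    using iY idY integrable_dot_square[of c] by (simp add: edY expectation_dot_square)
  finally show ?thesis by (simp add: sqn_def c_def)
qed

text \<open>Bessel's inequality for each product \<open>X w j * X w k\<close>, summed over j and k,
  since the squares of these products add up to |X|^4. Estimating every entry of the tensor by
  itself would cost a factor \<open>d\<close>.\<close>

lemma sum_third_moment_le: "(\<Sum>i<d. \<Sum>j<d. \<Sum>k<d. (third_moment i j k)\<^sup>2) \<le> m4"
proof -
  have "(\<Sum>i<d. \<Sum>j<d. \<Sum>k<d. (third_moment i j k)\<^sup>2) = (\<Sum>j<d. \<Sum>i<d. \<Sum>k<d. (third_moment i j k)\<^sup>2)"
    by (rule sum.swap)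
  also have "\<dots> = (\<Sum>j<d. \<Sum>k<d. \<Sum>i<d. (third_moment i j k)\<^sup>2)"
    by (rule sum.cong[OF refl], rule sum.swap)
  also have "\<dots> \<le> (\<Sum>j<d. \<Sum>k<d. (\<integral>w. (X w j * X w k)\<^sup>2 \<partial>M))"
    by (intro sum_mono bessel) auto
  also have "\<dots> = m4"
  proof -
    have "m4 = (\<integral>w. (\<Sum>j<d. \<Sum>k<d. (X w j * X w k)\<^sup>2) \<partial>M)"
      unfolding m4_def sqn_def by (intro Bochner_Integration.integral_cong refl)
        (simp add: power2_eq_square sum_product ac_simps)
    also have "\<dots> = (\<Sum>j<d. \<Sum>k<d. (\<integral>w. (X w j * X w k)\<^sup>2 \<partial>M))"
      unfolding power2_eq_square using integrable_coord4
      by (subst Bochner_Integration.integral_sum, force intro!: Bochner_Integration.integrable_sum,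
          intro sum.cong refl, subst Bochner_Integration.integral_sum) auto
    finally show ?thesis ..
  qed
  finally show ?thesis .
qed

lemma dot_cube: "(dot d x y) ^ 3 = (\<Sum>i<d. \<Sum>j<d. \<Sum>k<d. x i * (x j * x k) * (y i * (y j * y k)))"
proof -
  have "(dot d x y) ^ 3 = (\<Sum>i<d. x i * y i) * ((\<Sum>j<d. x j * y j) * (\<Sum>k<d. x k * y k))"
    by (simp add: dot_def power3_eq_cube)
  also have "\<dots> = (\<Sum>i<d. \<Sum>j<d. \<Sum>k<d. x i * y i * ((x j * y j) * (x k * y k)))"
    by (simp only: sum_product) (simp add: sum_distrib_left)
  finally show ?thesis by (simp add: ac_simps)
qed

lemma expectation_dot_cube:
  "integrable M (\<lambda>w. (dot d x (X w)) ^ 3)"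
  "(\<integral>w. (dot d x (X w)) ^ 3 \<partial>M) = (\<Sum>i<d. \<Sum>j<d. \<Sum>k<d. x i * (x j * x k) * third_moment i j k)"
proof -
  show "integrable M (\<lambda>w. (dot d x (X w)) ^ 3)" unfolding dot_cube
    by (intro Bochner_Integration.integrable_sum integrable_mult_right integrable_coord3) auto
  show "(\<integral>w. (dot d x (X w)) ^ 3 \<partial>M) = (\<Sum>i<d. \<Sum>j<d. \<Sum>k<d. x i * (x j * x k) * third_moment i j k)"
    unfolding dot_cube third_moment_def
    by (subst Bochner_Integration.integral_sum, intro Bochner_Integration.integrable_sum integrable_mult_right integrable_coord3, simp, simp, simp,
        intro sum.cong refl,
        subst Bochner_Integration.integral_sum, intro Bochner_Integration.integrable_sum integrable_mult_right integrable_coord3, simp, simp, simp,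
        intro sum.cong refl,
        subst Bochner_Integration.integral_sum, intro integrable_mult_right integrable_coord3, simp, simp, simp,
        intro sum.cong refl integral_mult_right_zero)
qed

text \<open>For an independent copy X' the cube of X.X' is a sum over index triples of products of a
  term in X and a term in X', so its mean is the squared Frobenius norm of the third moment
  tensor.\<close>

lemma expectation_dot_cube_twice:
  "integrable M (\<lambda>w. \<integral>w'. (dot d (X w) (X w')) ^ 3 \<partial>M)"
  "(\<integral>w. (\<integral>w'. (dot d (X w) (X w')) ^ 3 \<partial>M) \<partial>M) \<le> m4"
proof -
  show "integrable M (\<lambda>w. \<integral>w'. (dot d (X w) (X w')) ^ 3 \<partial>M)"
    unfolding expectation_dot_cube
    by (intro Bochner_Integration.integrable_sum integrable_mult_left integrable_coord3) auto
  have "(\<integral>w. (\<integral>w'. (dot d (X w) (X w')) ^ 3 \<partial>M) \<partial>M) = (\<Sum>i<d. \<Sum>j<d. \<Sum>k<d. (third_moment i j k)\<^sup>2)"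
    unfolding expectation_dot_cube
    by (subst Bochner_Integration.integral_sum, intro Bochner_Integration.integrable_sum integrable_mult_left integrable_coord3, simp, simp, simp,
        intro sum.cong refl,
        subst Bochner_Integration.integral_sum, intro Bochner_Integration.integrable_sum integrable_mult_left integrable_coord3, simp, simp, simp,
        intro sum.cong refl,
        subst Bochner_Integration.integral_sum, intro integrable_mult_left integrable_coord3, simp, simp, simp,
        intro sum.cong refl) (simp add: power2_eq_square third_moment_def)
  then show "(\<integral>w. (\<integral>w'. (dot d (X w) (X w')) ^ 3 \<partial>M) \<partial>M) \<le> m4"
    using sum_third_moment_le by simp
qed

end

lemma square_mean_le:
  fixes Y :: "'a \<Rightarrow> real"
  assumes "prob_space N" and Y: "integrable N Y" and Y2: "integrable N (\<lambda>x. (Y x)\<^sup>2)"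
  shows "(\<integral>x. Y x \<partial>N)\<^sup>2 \<le> (\<integral>x. (Y x)\<^sup>2 \<partial>N)"
proof -
  interpret N: prob_space N by fact
  define c where "c = (\<integral>x. Y x \<partial>N)"
  have "0 \<le> (\<integral>x. (Y x - c)\<^sup>2 \<partial>N)" by (simp add: integral_nonneg_AE)
  also have "\<dots> = (\<integral>x. (Y x)\<^sup>2 - 2 * c * Y x + c\<^sup>2 \<partial>N)" by (simp add: power2_eq_square algebra_simps)
  also have "\<dots> = (\<integral>x. (Y x)\<^sup>2 \<partial>N) - 2 * c * c + c\<^sup>2"
    using Y Y2 by (simp add: N.prob_space c_def)
  finally show ?thesis by (simp add: c_def power2_eq_square)
qed

section \<open>The averaged third Hermite polynomial and the error of the likelihood ratio\<close>

context isotropic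
begin

lemma herm3_measurable_pair:
  "(\<lambda>p. herm3 d (X (snd p)) (fst p)) \<in> borel_measurable (std_gauss d \<Otimes>\<^sub>M M)"
  unfolding herm3_def by measurable

definition "herm3_mean g = (\<integral>w. herm3 d (X w) g \<partial>M)"

lemma herm3_mean_measurable: "herm3_mean \<in> borel_measurable (std_gauss d)"
  unfolding herm3_mean_def[abs_def]
  using borel_measurable_lebesgue_integral[of "\<lambda>g w. herm3 d (X w) g" "std_gauss d"] herm3_measurable_pair
  by (simp add: case_prod_beta')

lemma integrable_herm3: "integrable M (\<lambda>w. herm3 d (X w) g)"
proof (rule integrable_dominated[where c = "8 * (1 + sqn d g)\<^sup>2"])
  show "(\<lambda>w. herm3 d (X w) g) \<in> borel_measurable M" unfolding herm3_def by measurable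
  fix w
  have "(1 + s)\<^sup>2 \<le> 2 * (1 + s\<^sup>2)" for s :: real
  proof -
    have "0 \<le> (s - 1)\<^sup>2" by simp
    then show ?thesis by (simp add: power2_eq_square algebra_simps)
  qed
  then have "4 * ((1 + sqn d (X w))\<^sup>2 * (1 + sqn d g)\<^sup>2) \<le> 4 * ((2 * (1 + (sqn d (X w))\<^sup>2)) * (1 + sqn d g)\<^sup>2)"
    by (intro mult_left_mono mult_right_mono) auto
  also have "4 * ((2 * a) * b) = 8 * b * a" for a b :: real by simp
  finally show "\<bar>herm3 d (X w) g\<bar> \<le> 8 * (1 + sqn d g)\<^sup>2 * (1 + (sqn d (X w))\<^sup>2)"
    by (rule order_trans[OF abs_herm3_le])
qed

lemma integrable_one_sqn: "integrable M (\<lambda>w. (1 + sqn d (X w))\<^sup>2)"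
proof -
  have "(1 + sqn d (X w))\<^sup>2 = 1 + 2 * sqn d (X w) + (sqn d (X w))\<^sup>2" for w by (simp add: power2_eq_square algebra_simps)
  then show ?thesis using fourth_moment integrable_sqn by simp
qed

lemma abs_herm3_mean_le: "\<bar>herm3_mean g\<bar> \<le> 4 * (\<integral>w. (1 + sqn d (X w))\<^sup>2 \<partial>M) * (1 + sqn d g)\<^sup>2"
proof -
  have "\<bar>herm3_mean g\<bar> \<le> (\<integral>w. \<bar>herm3 d (X w) g\<bar> \<partial>M)"
    unfolding herm3_mean_def by (rule integral_abs_bound)
  also have "\<dots> \<le> (\<integral>w. 4 * ((1 + sqn d (X w))\<^sup>2 * (1 + sqn d g)\<^sup>2) \<partial>M)"
    using integrable_herm3[of g] integrable_one_sqn by (intro integral_mono abs_herm3_le) auto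
  also have "\<dots> = 4 * (\<integral>w. (1 + sqn d (X w))\<^sup>2 \<partial>M) * (1 + sqn d g)\<^sup>2" by simp
  finally show ?thesis .
qed

lemma gauss_sigma_finite: "sigma_finite_measure (std_gauss d)"
  by (rule prob_space_imp_sigma_finite[OF prob_space_std_gauss])

lemma M_sigma_finite: "sigma_finite_measure M"
  by (rule prob_space_imp_sigma_finite) unfold_locales

lemma integral_herm3_herm3_mean:
  "(\<integral>g. herm3 d x g * herm3_mean g \<partial>std_gauss d) = (\<integral>w. 6 * (dot d x (X w)) ^ 3 \<partial>M)"
proof -
  interpret P: pair_sigma_finite "std_gauss d" M
    using gauss_sigma_finite M_sigma_finite by (simp add: pair_sigma_finite_def)
  have int: "integrable (std_gauss d \<Otimes>\<^sub>M M) (\<lambda>p. herm3 d x (fst p) * herm3 d (X (snd p)) (fst p))"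
  proof (rule integrable_pair_dominated[OF gauss_sigma_finite M_sigma_finite])
    show "(\<lambda>p. herm3 d x (fst p) * herm3 d (X (snd p)) (fst p)) \<in> borel_measurable (std_gauss d \<Otimes>\<^sub>M M)"
      unfolding herm3_def by measurable
    show "integrable (std_gauss d) (\<lambda>g. 16 * (1 + sqn d x)\<^sup>2 * (1 + sqn d g) ^ 4)"
      by (intro integrable_mult_right integrable_std_gauss_sqn_power)
    show "integrable M (\<lambda>w. (1 + sqn d (X w))\<^sup>2)" by (rule integrable_one_sqn)
    fix g w
    have "\<bar>herm3 d x g * herm3 d (X w) g\<bar> \<le> (4 * ((1 + sqn d x)\<^sup>2 * (1 + sqn d g)\<^sup>2)) * (4 * ((1 + sqn d (X w))\<^sup>2 * (1 + sqn d g)\<^sup>2))"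
      unfolding abs_mult by (intro mult_mono abs_herm3_le) auto
    moreover have "(4 * (a\<^sup>2 * b\<^sup>2)) * (4 * (c\<^sup>2 * b\<^sup>2)) = 16 * a\<^sup>2 * b ^ 4 * c\<^sup>2" for a b c :: real
      by (simp add: eval_nat_numeral)
    ultimately show "\<bar>herm3 d x (fst (g, w)) * herm3 d (X (snd (g, w))) (fst (g, w))\<bar> \<le> 16 * (1 + sqn d x)\<^sup>2 * (1 + sqn d g) ^ 4 * (1 + sqn d (X w))\<^sup>2"
      by simp
  qed
  have "(\<integral>g. herm3 d x g * herm3_mean g \<partial>std_gauss d) = (\<integral>g. \<integral>w. herm3 d x g * herm3 d (X w) g \<partial>M \<partial>std_gauss d)"
    unfolding herm3_mean_def by simp
  also have "\<dots> = (\<integral>w. \<integral>g. herm3 d x g * herm3 d (X w) g \<partial>std_gauss d \<partial>M)"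
    using P.Fubini_integral[of "\<lambda>g w. herm3 d x g * herm3 d (X w) g"] int by (simp add: case_prod_beta')
  also have "\<dots> = (\<integral>w. 6 * (dot d x (X w)) ^ 3 \<partial>M)"
    using has_bochner_integral_integral_eq[OF herm3_orthogonality] by simp
  finally show ?thesis .
qed

lemma integrable_herm3_mean_square: "integrable (std_gauss d) (\<lambda>g. (herm3_mean g)\<^sup>2)"
proof (rule Bochner_Integration.integrable_bound)
  let ?A = "4 * (\<integral>w. (1 + sqn d (X w))\<^sup>2 \<partial>M)"
  show "integrable (std_gauss d) (\<lambda>g. ?A\<^sup>2 * (1 + sqn d g) ^ 4)"
    by (intro integrable_mult_right integrable_std_gauss_sqn_power)
  show "(\<lambda>g. (herm3_mean g)\<^sup>2) \<in> borel_measurable (std_gauss d)" using herm3_mean_measurable by simp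
  show "AE g in std_gauss d. norm ((herm3_mean g)\<^sup>2) \<le> norm (?A\<^sup>2 * (1 + sqn d g) ^ 4)"
  proof (intro AE_I2)
    fix g
    have "\<bar>herm3_mean g\<bar>\<^sup>2 \<le> (?A * (1 + sqn d g)\<^sup>2)\<^sup>2" by (intro power_mono abs_herm3_mean_le) auto
    then show "norm ((herm3_mean g)\<^sup>2) \<le> norm (?A\<^sup>2 * (1 + sqn d g) ^ 4)"
      by (simp add: power_mult_distrib power2_eq_square power4_eq_xxxx ac_simps)
  qed
qed

text \<open>One of the two factors is written as a mean over X; orthogonality then leaves 6 E
  (X.X')^3, to which Bessel's inequality applies.\<close>

lemma integral_herm3_mean_square_le: "(\<integral>g. (herm3_mean g)\<^sup>2 \<partial>std_gauss d) \<le> 6 * m4"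
proof -
  interpret P: pair_sigma_finite "std_gauss d" M
    using gauss_sigma_finite M_sigma_finite by (simp add: pair_sigma_finite_def)
  let ?A = "4 * (\<integral>w. (1 + sqn d (X w))\<^sup>2 \<partial>M)"
  have int: "integrable (std_gauss d \<Otimes>\<^sub>M M) (\<lambda>p. herm3 d (X (snd p)) (fst p) * herm3_mean (fst p))"
  proof (rule integrable_pair_dominated[OF gauss_sigma_finite M_sigma_finite])
    show "(\<lambda>p. herm3 d (X (snd p)) (fst p) * herm3_mean (fst p)) \<in> borel_measurable (std_gauss d \<Otimes>\<^sub>M M)"
      by (intro borel_measurable_times herm3_measurable_pair measurable_compose[OF measurable_fst herm3_mean_measurable])
    show "integrable (std_gauss d) (\<lambda>g. ?A * 4 * (1 + sqn d g) ^ 4)"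
      by (intro integrable_mult_right integrable_std_gauss_sqn_power)
    show "integrable M (\<lambda>w. (1 + sqn d (X w))\<^sup>2)" by (rule integrable_one_sqn)
    fix g w
    have "\<bar>herm3 d (X w) g * herm3_mean g\<bar> \<le> (4 * ((1 + sqn d (X w))\<^sup>2 * (1 + sqn d g)\<^sup>2)) * (?A * (1 + sqn d g)\<^sup>2)"
      unfolding abs_mult by (intro mult_mono abs_herm3_le abs_herm3_mean_le) auto
    then show "\<bar>herm3 d (X (snd (g, w))) (fst (g, w)) * herm3_mean (fst (g, w))\<bar> \<le> ?A * 4 * (1 + sqn d g) ^ 4 * (1 + sqn d (X w))\<^sup>2"
      by (simp add: ac_simps power4_eq_xxxx power2_eq_square)
  qed
  have "(\<integral>g. (herm3_mean g)\<^sup>2 \<partial>std_gauss d) = (\<integral>g. \<integral>w. herm3 d (X w) g * herm3_mean g \<partial>M \<partial>std_gauss d)"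
    by (simp add: herm3_mean_def[symmetric] power2_eq_square)
  also have "\<dots> = (\<integral>w. \<integral>g. herm3 d (X w) g * herm3_mean g \<partial>std_gauss d \<partial>M)"
    using P.Fubini_integral[of "\<lambda>g w. herm3 d (X w) g * herm3_mean g"] int by (simp add: case_prod_beta')
  also have "\<dots> = 6 * (\<integral>w. \<integral>w'. (dot d (X w) (X w')) ^ 3 \<partial>M \<partial>M)"
    by (simp add: integral_herm3_herm3_mean)
  also have "\<dots> \<le> 6 * m4" using expectation_dot_cube_twice(2) by simp
  finally show ?thesis .
qed

lemma integral_abs_herm3_mean_le:
  "integrable (std_gauss d) (\<lambda>g. \<bar>herm3_mean g\<bar>)" "(\<integral>g. \<bar>herm3_mean g\<bar> \<partial>std_gauss d) \<le> 6 * sqrt m4"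
proof -
  have m4: "0 \<le> m4" unfolding m4_def by (simp add: integral_nonneg_AE)
  show i: "integrable (std_gauss d) (\<lambda>g. \<bar>herm3_mean g\<bar>)"
    by (rule integrable_abs, rule gauss.square_integrable_imp_integrable[OF herm3_mean_measurable integrable_herm3_mean_square])
  have "(\<integral>g. \<bar>herm3_mean g\<bar> \<partial>std_gauss d)\<^sup>2 \<le> (\<integral>g. \<bar>herm3_mean g\<bar>\<^sup>2 \<partial>std_gauss d)"
    by (rule square_mean_le[OF prob_space_std_gauss i]) (simp add: integrable_herm3_mean_square)
  \<comment> \<open>The square root of 6 is rounded up to 6, which cancels the 3! of the expansion
    in \<open>nn_integral_tilt_error_le\<close>.\<close>
  also have "\<dots> \<le> 6\<^sup>2 * m4" using integral_herm3_mean_square_le m4 by simp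
  finally have "(\<integral>g. \<bar>herm3_mean g\<bar> \<partial>std_gauss d) \<le> sqrt (6\<^sup>2 * m4)"
    by (rule real_le_rsqrt)
  also have "\<dots> = 6 * sqrt m4" by (simp add: real_sqrt_mult)
  finally show "(\<integral>g. \<bar>herm3_mean g\<bar> \<partial>std_gauss d) \<le> 6 * sqrt m4" .
qed

text \<open>The mean likelihood ratio of the translations of \<open>N(0, \<tau>\<^sup>2)\<close> by \<open>X\<close>, at the point \<open>\<tau> g\<close>.\<close>

definition tilt :: "real \<Rightarrow> (nat \<Rightarrow> real) \<Rightarrow> real" where
  "tilt \<tau> g = (\<integral>w. exp (dot d (\<lambda>i. X w i / \<tau>) g - sqn d (\<lambda>i. X w i / \<tau>) / 2) \<partial>M)"

lemma dot_div: "dot d (\<lambda>i. x i / \<tau>) g = dot d x g / \<tau>"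
  unfolding dot_def by (simp add: sum_divide_distrib)

lemma sqn_div: "sqn d (\<lambda>i. x i / \<tau>) = sqn d x / \<tau>\<^sup>2"
  unfolding sqn_def by (simp add: sum_divide_distrib power_divide)

lemma exp_tilt_le: "exp (dot d x g - sqn d x / 2) \<le> exp (sqn d g / 2)"
proof -
  have "0 \<le> (\<Sum>i<d. (x i - g i)\<^sup>2)" by (simp add: sum_nonneg)
  also have "\<dots> = sqn d x - 2 * dot d x g + sqn d g"
    unfolding sqn_def dot_def by (simp add: power2_diff sum.distrib sum_subtractf sum_distrib_left algebra_simps)
  finally show ?thesis by simp
qed

lemma integrable_exp_tilt: "integrable M (\<lambda>w. exp (dot d (\<lambda>i. X w i / \<tau>) g - sqn d (\<lambda>i. X w i / \<tau>) / 2))"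
  by (rule integrable_const_bound[where B = "exp (sqn d g / 2)"])
     (use exp_tilt_le in auto)

lemma tilt_measurable: "tilt \<tau> \<in> borel_measurable (std_gauss d)"
  unfolding tilt_def[abs_def]
  by (rule borel_measurable_lebesgue_integral) (simp add: case_prod_beta', measurable)

text \<open>The linear Hermite term vanishes as X has mean zero, and unit covariance turns the
  quadratic one into (|g|^2 - d) / (2 \<tau>^2). What is subtracted is thus the same for every
  isotropic vector and drops out when X is exchanged for a Gaussian vector.\<close>

definition "tilt_error \<tau> g = tilt \<tau> g - 1 - (sqn d g - d) / (2 * \<tau>\<^sup>2)"

lemma tilt_error_eq:
  assumes \<tau>: "0 < \<tau>"
  shows "integrable M (\<lambda>w. exp_rem (dot d (\<lambda>i. X w i / \<tau>) g) (sqn d (\<lambda>i. X w i / \<tau>)))"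
    and "tilt_error \<tau> g = herm3_mean g / (6 * \<tau> ^ 3) + (\<integral>w. exp_rem (dot d (\<lambda>i. X w i / \<tau>) g) (sqn d (\<lambda>i. X w i / \<tau>)) \<partial>M)"
proof -
  let ?R = "\<lambda>w. exp_rem (dot d (\<lambda>i. X w i / \<tau>) g) (sqn d (\<lambda>i. X w i / \<tau>))"
  let ?E = "\<lambda>w. exp (dot d (\<lambda>i. X w i / \<tau>) g - sqn d (\<lambda>i. X w i / \<tau>) / 2)"
  have R: "?R w = ?E w - 1 - (1 / \<tau>) * dot d (X w) g - (1 / (2 * \<tau>\<^sup>2)) * ((dot d (X w) g)\<^sup>2 - sqn d (X w)) - (1 / (6 * \<tau> ^ 3)) * herm3 d (X w) g" for w
    unfolding exp_rem_def herm3_def dot_div sqn_div using \<tau> by (simp add: field_simps power2_eq_square power3_eq_cube)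
  have h: "has_bochner_integral M (\<lambda>w. ?E w - 1 - (1 / \<tau>) * dot d (X w) g - (1 / (2 * \<tau>\<^sup>2)) * ((dot d (X w) g)\<^sup>2 - sqn d (X w)) - (1 / (6 * \<tau> ^ 3)) * herm3 d (X w) g)
    (tilt \<tau> g - 1 - (1 / \<tau>) * 0 - (1 / (2 * \<tau>\<^sup>2)) * (sqn d g - d) - (1 / (6 * \<tau> ^ 3)) * herm3_mean g)"
    unfolding tilt_def herm3_mean_def
    by (intro has_bochner_integral_diff has_bochner_integral_mult_right)
       (auto simp: has_bochner_integral_iff integrable_exp_tilt integrable_dot integrable_dot_square integrable_sqn integrable_herm3
         expectation_dot expectation_dot_square expectation_sqn prob_space)
  show "integrable M ?R" unfolding R using h by (simp only: has_bochner_integral_iff)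
  have "(\<integral>w. ?R w \<partial>M) = tilt \<tau> g - 1 - (1 / \<tau>) * 0 - (1 / (2 * \<tau>\<^sup>2)) * (sqn d g - d) - (1 / (6 * \<tau> ^ 3)) * herm3_mean g"
    unfolding R by (rule has_bochner_integral_integral_eq[OF h])
  then show "tilt_error \<tau> g = herm3_mean g / (6 * \<tau> ^ 3) + (\<integral>w. ?R w \<partial>M)"
    unfolding tilt_error_def by simp
qed

lemma tilt_error_measurable: "tilt_error \<tau> \<in> borel_measurable (std_gauss d)"
  unfolding tilt_error_def[abs_def] using tilt_measurable by measurable

text \<open>The third-order part is bounded in L1 by its L2 norm; the remainder is integrated over g
  before X, which leaves fourth moments. Neither estimate has a factor depending on the
  dimension.\<close>

lemma nn_integral_tilt_error_le:
  assumes \<tau>: "0 < \<tau>"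
  shows "(\<integral>\<^sup>+g. ennreal \<bar>tilt_error \<tau> g\<bar> \<partial>std_gauss d) \<le> ennreal (sqrt m4 / \<tau> ^ 3 + C_rem * m4 / \<tau> ^ 4)"
proof -
  interpret P: pair_sigma_finite "std_gauss d" M
    using gauss_sigma_finite M_sigma_finite by (simp add: pair_sigma_finite_def)
  note herm3_mean_measurable[measurable]
  have m4: "0 \<le> m4" unfolding m4_def by (simp add: integral_nonneg_AE)
  let ?R = "\<lambda>g w. exp_rem (dot d (\<lambda>i. X w i / \<tau>) g) (sqn d (\<lambda>i. X w i / \<tau>))"
  have "(\<integral>\<^sup>+g. ennreal \<bar>tilt_error \<tau> g\<bar> \<partial>std_gauss d) \<le>
    (\<integral>\<^sup>+g. ennreal (\<bar>herm3_mean g\<bar> / (6 * \<tau> ^ 3)) + (\<integral>\<^sup>+w. ennreal \<bar>?R g w\<bar> \<partial>M) \<partial>std_gauss d)"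
  proof (intro nn_integral_mono)
    fix g
    have "\<bar>tilt_error \<tau> g\<bar> \<le> \<bar>herm3_mean g\<bar> / (6 * \<tau> ^ 3) + (\<integral>w. \<bar>?R g w\<bar> \<partial>M)"
    proof -
      have "\<bar>herm3_mean g / (6 * \<tau> ^ 3)\<bar> = \<bar>herm3_mean g\<bar> / (6 * \<tau> ^ 3)" using \<tau> by (simp add: abs_divide)
      then show ?thesis unfolding tilt_error_eq(2)[OF \<tau>]
        using abs_triangle_ineq[of "herm3_mean g / (6 * \<tau> ^ 3)" "\<integral>w. ?R g w \<partial>M"] integral_abs_bound[of M "?R g"]
        by linarith
    qed
    then have "ennreal \<bar>tilt_error \<tau> g\<bar> \<le> ennreal (\<bar>herm3_mean g\<bar> / (6 * \<tau> ^ 3)) + ennreal (\<integral>w. \<bar>?R g w\<bar> \<partial>M)"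
    proof -
      assume "\<bar>tilt_error \<tau> g\<bar> \<le> \<bar>herm3_mean g\<bar> / (6 * \<tau> ^ 3) + (\<integral>w. \<bar>?R g w\<bar> \<partial>M)"
      then have "ennreal \<bar>tilt_error \<tau> g\<bar> \<le> ennreal (\<bar>herm3_mean g\<bar> / (6 * \<tau> ^ 3) + (\<integral>w. \<bar>?R g w\<bar> \<partial>M))"
        by (rule ennreal_leI)
      also have "\<dots> = ennreal (\<bar>herm3_mean g\<bar> / (6 * \<tau> ^ 3)) + ennreal (\<integral>w. \<bar>?R g w\<bar> \<partial>M)"
        using \<tau> by (intro ennreal_plus integral_nonneg_AE) auto
      finally show ?thesis .
    qed
    moreover have "ennreal (\<integral>w. \<bar>?R g w\<bar> \<partial>M) = (\<integral>\<^sup>+w. ennreal \<bar>?R g w\<bar> \<partial>M)"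
      by (rule nn_integral_eq_integral[symmetric]) (use tilt_error_eq(1)[OF \<tau>, of g] in auto)
    ultimately show "ennreal \<bar>tilt_error \<tau> g\<bar> \<le> ennreal (\<bar>herm3_mean g\<bar> / (6 * \<tau> ^ 3)) + (\<integral>\<^sup>+w. ennreal \<bar>?R g w\<bar> \<partial>M)"
      by simp
  qed
  also have "\<dots> = (\<integral>\<^sup>+g. ennreal (\<bar>herm3_mean g\<bar> / (6 * \<tau> ^ 3)) \<partial>std_gauss d) + (\<integral>\<^sup>+g. \<integral>\<^sup>+w. ennreal \<bar>?R g w\<bar> \<partial>M \<partial>std_gauss d)"
    by (intro nn_integral_add) measurable
  also have "(\<integral>\<^sup>+g. ennreal (\<bar>herm3_mean g\<bar> / (6 * \<tau> ^ 3)) \<partial>std_gauss d) = ennreal ((\<integral>g. \<bar>herm3_mean g\<bar> \<partial>std_gauss d) / (6 * \<tau> ^ 3))"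
    using integral_abs_herm3_mean_le(1) \<tau> by (subst nn_integral_eq_integral) auto
  also have "\<dots> \<le> ennreal (sqrt m4 / \<tau> ^ 3)"
    using integral_abs_herm3_mean_le(2) \<tau> by (intro ennreal_leI) (simp add: field_simps)
  also have "(\<integral>\<^sup>+g. \<integral>\<^sup>+w. ennreal \<bar>?R g w\<bar> \<partial>M \<partial>std_gauss d) = (\<integral>\<^sup>+w. \<integral>\<^sup>+g. ennreal \<bar>?R g w\<bar> \<partial>std_gauss d \<partial>M)"
    by (rule P.Fubini'[symmetric]) (simp add: case_prod_beta', measurable)
  also have "\<dots> \<le> (\<integral>\<^sup>+w. ennreal (C_rem * (sqn d (\<lambda>i. X w i / \<tau>))\<^sup>2) \<partial>M)"
    by (intro nn_integral_mono nn_integral_exp_rem_dot)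
  also have "\<dots> = (\<integral>\<^sup>+w. ennreal (C_rem / \<tau> ^ 4 * (sqn d (X w))\<^sup>2) \<partial>M)"
    by (simp add: sqn_div power_divide flip: power_mult)
  also have "\<dots> = ennreal (C_rem / \<tau> ^ 4 * m4)"
    unfolding m4_def using fourth_moment C_rem_ge_1 by (subst nn_integral_eq_integral) auto
  finally show ?thesis using m4 \<tau> C_rem_ge_1 by (simp add: add_left_mono add_right_mono flip: ennreal_plus)
qed

lemma integrable_tilt_error:
  assumes \<tau>: "0 < \<tau>"
  shows "integrable (std_gauss d) (tilt_error \<tau>)"
    and "(\<integral>g. \<bar>tilt_error \<tau> g\<bar> \<partial>std_gauss d) \<le> sqrt m4 / \<tau> ^ 3 + C_rem * m4 / \<tau> ^ 4"
proof -
  have m4: "0 \<le> m4" unfolding m4_def by (simp add: integral_nonneg_AE)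
  have b: "0 \<le> sqrt m4 / \<tau> ^ 3 + C_rem * m4 / \<tau> ^ 4" using m4 \<tau> C_rem_ge_1 by simp
  show i: "integrable (std_gauss d) (tilt_error \<tau>)"
    by (rule integrableI_bounded[OF tilt_error_measurable])
       (use nn_integral_tilt_error_le[OF \<tau>] in \<open>simp add: le_less_trans\<close>)
  have "ennreal (\<integral>g. \<bar>tilt_error \<tau> g\<bar> \<partial>std_gauss d) = (\<integral>\<^sup>+g. ennreal \<bar>tilt_error \<tau> g\<bar> \<partial>std_gauss d)"
    using i by (intro nn_integral_eq_integral[symmetric]) auto
  then have "ennreal (\<integral>g. \<bar>tilt_error \<tau> g\<bar> \<partial>std_gauss d) \<le> ennreal (sqrt m4 / \<tau> ^ 3 + C_rem * m4 / \<tau> ^ 4)"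
    using nn_integral_tilt_error_le[OF \<tau>] by simp
  then show "(\<integral>g. \<bar>tilt_error \<tau> g\<bar> \<partial>std_gauss d) \<le> sqrt m4 / \<tau> ^ 3 + C_rem * m4 / \<tau> ^ 4"
    using b by (simp add: ennreal_le_iff)
qed

end

section \<open>Lindeberg exchange for balls\<close>

lemma dot_unit: "i < d \<Longrightarrow> dot d (\<lambda>k. if k = i then 1 else 0) g = g i"
  unfolding dot_def by (simp add: if_distrib[of "\<lambda>x. x * _"] cong: if_cong)

lemma sqn_mult: "sqn d (\<lambda>i. c * x i) = c\<^sup>2 * sqn d x"
  unfolding sqn_def by (simp add: sum_distrib_left power_mult_distrib)

lemma std_gauss_isotropic: "isotropic (std_gauss d) d (\<lambda>g. g)"
proof
  show "\<And>i. i < d \<Longrightarrow> (\<lambda>g. g i) \<in> borel_measurable (std_gauss d)" by measurable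
  show "integrable (std_gauss d) (\<lambda>g. (sqn d g)\<^sup>2)"
  proof (rule Bochner_Integration.integrable_bound[OF integrable_std_gauss_sqn_power[of d 2]])
    show "(\<lambda>g. (sqn d g)\<^sup>2) \<in> borel_measurable (std_gauss d)" by measurable
    show "AE g in std_gauss d. norm ((sqn d g)\<^sup>2) \<le> norm ((1 + sqn d g)\<^sup>2)"
      by (intro AE_I2) (auto intro!: power_mono)
  qed
  fix i assume i: "i < d"
  then show "(\<integral>g. g i \<partial>std_gauss d) = 0"
    using integral_std_gauss_dot_power(4)[of d "\<lambda>k. if k = i then 1 else 0"] by (simp add: dot_unit)
  fix j assume j: "j < d"
  show "(\<integral>g. g i * g j \<partial>std_gauss d) = (if i = j then 1 else 0)"
    using has_bochner_integral_integral_eq[OF std_gauss_mixed_moments(3)[of d "\<lambda>k. if k = i then 1 else 0" "\<lambda>k. if k = j then 1 else 0"]] i j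
    by (simp add: dot_unit)
qed

interpretation Z: isotropic "std_gauss d" d "\<lambda>g. g" for d
  by (rule std_gauss_isotropic)

lemma m4_std_gauss_le: "Z.m4 d \<le> 3 * (real d)\<^sup>2"
proof -
  have i4: "integrable (std_gauss d) (\<lambda>g. (g i) ^ 4)" "(\<integral>g. (g i) ^ 4 \<partial>std_gauss d) = 3" if i: "i < d" for i
    using integrable_std_gauss_dot_power[of d "\<lambda>k. if k = i then 1 else 0" 4]
      integral_std_gauss_dot_power(2)[of d "\<lambda>k. if k = i then 1 else 0"] i
    by (simp_all add: dot_unit sqn_def if_distrib[of "\<lambda>x. x\<^sup>2"] cong: if_cong)
  have "Z.m4 d \<le> (\<integral>g. real d * (\<Sum>i<d. (g i) ^ 4) \<partial>std_gauss d)"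
    unfolding Z.m4_def
  proof (rule integral_mono)
    show "integrable (std_gauss d) (\<lambda>g. real d * (\<Sum>i<d. (g i) ^ 4))" using i4 by (intro integrable_mult_right Bochner_Integration.integrable_sum) auto
    fix g :: "nat \<Rightarrow> real"
    show "(sqn d g)\<^sup>2 \<le> real d * (\<Sum>i<d. (g i) ^ 4)"
      using sum_squared_le_sum_of_squares[of "\<lambda>i. (g i)\<^sup>2" "{..<d}"] by (simp add: sqn_def power_mult[symmetric] mult.commute)
  qed (rule Z.fourth_moment)
  also have "\<dots> = 3 * (real d)\<^sup>2"
    using i4 by (simp add: Bochner_Integration.integral_sum power2_eq_square)
  finally show ?thesis .
qed

section \<open>Noisy ball probabilities and the exchange of one summand\<close>

definition ballind :: "nat \<Rightarrow> real \<Rightarrow> (nat \<Rightarrow> real) \<Rightarrow> real" where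
  "ballind d t y = indicator {..t} (sqn d y)"

lemma ballind_bounds: "0 \<le> ballind d t y" "ballind d t y \<le> 1" "\<bar>ballind d t y\<bar> \<le> 1"
  unfolding ballind_def by (auto simp: indicator_def)

lemma ballind_measurable [measurable]:
  assumes "\<And>i. i < d \<Longrightarrow> (\<lambda>w. X w i) \<in> borel_measurable M"
  shows "(\<lambda>w. ballind d t (X w)) \<in> borel_measurable M"
  unfolding ballind_def using sqn_measurable[OF assms] by measurable

lemma ballind_cong: "(\<And>i. i < d \<Longrightarrow> x i = y i) \<Longrightarrow> ballind d t x = ballind d t y"
  unfolding ballind_def by (simp cong: sqn_cong)

definition bprob :: "nat \<Rightarrow> real \<Rightarrow> (nat \<Rightarrow> real) \<Rightarrow> real \<Rightarrow> real" where
  "bprob d t y \<tau> = (\<integral>g. ballind d t (\<lambda>i. y i + \<tau> * g i) \<partial>std_gauss d)"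

lemma integrable_ballind:
  assumes "prob_space N" "\<And>i. i < d \<Longrightarrow> (\<lambda>w. X w i) \<in> borel_measurable N"
  shows "integrable N (\<lambda>w. ballind d t (X w))"
proof -
  interpret N: prob_space N by fact
  show ?thesis using assms by (intro N.integrable_const_bound[where B = 1]) (auto simp: ballind_bounds)
qed

lemma bprob_bounds: "0 \<le> bprob d t y \<tau>" "bprob d t y \<tau> \<le> 1"
proof -
  show "0 \<le> bprob d t y \<tau>" unfolding bprob_def by (simp add: integral_nonneg_AE ballind_bounds)
  have "bprob d t y \<tau> \<le> (\<integral>g. 1 \<partial>std_gauss d)" unfolding bprob_def
    by (intro integral_mono integrable_ballind prob_space_std_gauss) (auto simp: ballind_bounds)
  then show "bprob d t y \<tau> \<le> 1" by (simp add: gauss.prob_space)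
qed

lemma bprob_measurable [measurable]:
  assumes [measurable]: "\<And>i. i < d \<Longrightarrow> (\<lambda>w. V w i) \<in> borel_measurable N"
  shows "(\<lambda>w. bprob d t (V w) \<tau>) \<in> borel_measurable N"
  unfolding bprob_def
  by (rule sigma_finite_measure.borel_measurable_lebesgue_integral[OF prob_space_imp_sigma_finite[OF prob_space_std_gauss]]) (simp add: case_prod_beta', measurable)

lemma integrable_bprob:
  assumes "prob_space N" "\<And>i. i < d \<Longrightarrow> (\<lambda>w. V w i) \<in> borel_measurable N"
  shows "integrable N (\<lambda>w. bprob d t (V w) \<tau>)"
proof -
  interpret N: prob_space N by fact
  show ?thesis using assms
    by (intro N.integrable_const_bound[where B = 1]) (auto simp: bprob_bounds abs_of_nonneg)
qed

text \<open>Semigroup property of Gaussian noise: \<open>std_gauss_add\<close> read on the indicator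
  of a ball.\<close>

lemma bprob_add:
  assumes "0 \<le> b" "0 < \<tau>"
  shows "(\<integral>h. bprob d t (\<lambda>i. y i + b * h i) \<tau> \<partial>std_gauss d) = bprob d t y (sqrt (b\<^sup>2 + \<tau>\<^sup>2))"
proof -
  interpret P: pair_prob_space "std_gauss d" "std_gauss d" by unfold_locales
  let ?F = "\<lambda>u. ballind d t (\<lambda>i. y i + u i)"
  have F[measurable]: "?F \<in> borel_measurable (PiM {..<d} (\<lambda>_. borel))" by measurable
  have Fr: "?F (\<lambda>i\<in>{..<d}. u i) = ?F u" for u by (rule ballind_cong) auto
  have m2: "(\<lambda>(g, h). \<lambda>i\<in>{..<d}. b * g i + \<tau> * h i) \<in> (std_gauss d \<Otimes>\<^sub>M std_gauss d) \<rightarrow>\<^sub>M PiM {..<d} (\<lambda>_. borel)"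
    unfolding case_prod_beta' by (intro measurable_restrict) measurable
  have m1: "(\<lambda>g. \<lambda>i\<in>{..<d}. sqrt (b\<^sup>2 + \<tau>\<^sup>2) * g i) \<in> std_gauss d \<rightarrow>\<^sub>M PiM {..<d} (\<lambda>_. borel)"
    by (intro measurable_restrict) measurable
  have "(\<integral>h. bprob d t (\<lambda>i. y i + b * h i) \<tau> \<partial>std_gauss d) = (\<integral>g. \<integral>h. ballind d t (\<lambda>i. y i + (b * g i + \<tau> * h i)) \<partial>std_gauss d \<partial>std_gauss d)"
    unfolding bprob_def by (simp add: add.assoc)
  also have "\<dots> = (\<integral>p. ballind d t (\<lambda>i. y i + (b * fst p i + \<tau> * snd p i)) \<partial>(std_gauss d \<Otimes>\<^sub>M std_gauss d))"
    using P.integral_fst'[of "\<lambda>p. ballind d t (\<lambda>i. y i + (b * fst p i + \<tau> * snd p i))"]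
    by (simp add: integrable_ballind P.prob_space_axioms)
  also have "\<dots> = (\<integral>p. ?F ((\<lambda>(g, h). \<lambda>i\<in>{..<d}. b * g i + \<tau> * h i) p) \<partial>(std_gauss d \<Otimes>\<^sub>M std_gauss d))"
    by (simp only: case_prod_beta' Fr)
  also have "\<dots> = (\<integral>u. ?F u \<partial>distr (std_gauss d \<Otimes>\<^sub>M std_gauss d) (PiM {..<d} (\<lambda>_. borel)) (\<lambda>(g, h). \<lambda>i\<in>{..<d}. b * g i + \<tau> * h i))"
    by (rule integral_distr[symmetric, OF m2 F])
  also have "\<dots> = (\<integral>u. ?F u \<partial>distr (std_gauss d) (PiM {..<d} (\<lambda>_. borel)) (\<lambda>g. \<lambda>i\<in>{..<d}. sqrt (b\<^sup>2 + \<tau>\<^sup>2) * g i))"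
    using std_gauss_add[of \<tau> b d] assms by simp
  also have "\<dots> = (\<integral>g. ?F (\<lambda>i\<in>{..<d}. sqrt (b\<^sup>2 + \<tau>\<^sup>2) * g i) \<partial>std_gauss d)"
    by (rule integral_distr[OF m1 F])
  also have "\<dots> = bprob d t y (sqrt (b\<^sup>2 + \<tau>\<^sup>2))" unfolding bprob_def by (simp only: Fr)
  finally show ?thesis .
qed

context isotropic
begin

text \<open>Cameron-Martin moves the translation by X from the ball to a weight, and the mean over X
  of this weight is \<open>tilt \<tau>\<close>. Fubini applies because each likelihood ratio has
  integral 1 over g.\<close>

lemma integral_bprob_shift:
  assumes \<tau>: "0 < \<tau>"
  shows "(\<integral>w. bprob d t (\<lambda>i. y i + X w i) \<tau> \<partial>M) = (\<integral>g. ballind d t (\<lambda>i. y i + \<tau> * g i) * tilt \<tau> g \<partial>std_gauss d)"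
proof -
  interpret P: pair_sigma_finite M "std_gauss d"
    using gauss_sigma_finite M_sigma_finite by (simp add: pair_sigma_finite_def)
  let ?E = "\<lambda>w g. exp (dot d (\<lambda>i. X w i / \<tau>) g - sqn d (\<lambda>i. X w i / \<tau>) / 2)"
  let ?b = "\<lambda>g. ballind d t (\<lambda>i. y i + \<tau> * g i)"
  have "bprob d t (\<lambda>i. y i + X w i) \<tau> = (\<integral>g. ?E w g * ?b g \<partial>std_gauss d)" for w
  proof -
    have "bprob d t (\<lambda>i. y i + X w i) \<tau> = (\<integral>g. ?b (\<lambda>i. g i + X w i / \<tau>) \<partial>std_gauss d)"
      unfolding bprob_def using \<tau> by (simp add: algebra_simps)
    also have "\<dots> = (\<integral>g. ?E w g * ?b g \<partial>std_gauss d)"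
      by (rule integral_std_gauss_shift) (measurable, auto intro: ballind_cong)
    finally show ?thesis .
  qed
  then have "(\<integral>w. bprob d t (\<lambda>i. y i + X w i) \<tau> \<partial>M) = (\<integral>w. \<integral>g. ?E w g * ?b g \<partial>std_gauss d \<partial>M)" by simp
  also have "\<dots> = (\<integral>g. \<integral>w. ?E w g * ?b g \<partial>M \<partial>std_gauss d)"
  proof (rule P.Fubini_integral[symmetric])
    have m: "(\<lambda>(w, g). ?E w g * ?b g) \<in> borel_measurable (M \<Otimes>\<^sub>M std_gauss d)"
      by (simp add: case_prod_beta', measurable)
    have nn: "(\<integral>\<^sup>+g. ennreal (?E w g) \<partial>std_gauss d) = 1" for w
    proof -
      interpret D: prob_space "density (std_gauss d) (\<lambda>g. ennreal (?E w g))"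
        unfolding std_gauss_shift[symmetric] by (intro gauss.prob_space_distr measurable_restrict) measurable
      show ?thesis using D.emeasure_space_1 by (subst (asm) emeasure_density) (auto cong: nn_integral_cong)
    qed
    show "integrable (M \<Otimes>\<^sub>M std_gauss d) (\<lambda>(w, g). ?E w g * ?b g)"
    proof (rule integrableI_bounded[OF m])
      have "(\<integral>\<^sup>+p. ennreal (norm (case p of (w, g) \<Rightarrow> ?E w g * ?b g)) \<partial>(M \<Otimes>\<^sub>M std_gauss d))
        \<le> (\<integral>\<^sup>+p. ennreal (?E (fst p) (snd p)) \<partial>(M \<Otimes>\<^sub>M std_gauss d))"
        by (intro nn_integral_mono ennreal_leI) (auto simp: abs_mult ballind_bounds mult_left_le split: prod.splits)
      also have "\<dots> = (\<integral>\<^sup>+w. \<integral>\<^sup>+g. ennreal (?E w g) \<partial>std_gauss d \<partial>M)"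
        by (subst sigma_finite_measure.nn_integral_fst[OF gauss_sigma_finite, symmetric]) auto
      also have "\<dots> = 1" by (simp add: nn emeasure_space_1)
      finally show "(\<integral>\<^sup>+p. ennreal (norm (case p of (w, g) \<Rightarrow> ?E w g * ?b g)) \<partial>(M \<Otimes>\<^sub>M std_gauss d)) < \<infinity>"
        by (simp add: le_less_trans)
    qed
  qed
  also have "\<dots> = (\<integral>g. ?b g * tilt \<tau> g \<partial>std_gauss d)"
    unfolding tilt_def by (simp add: mult.commute)
  finally show ?thesis .
qed

definition tilt_diff :: "real \<Rightarrow> (nat \<Rightarrow> real) \<Rightarrow> real" where
  "tilt_diff \<tau> g = tilt_error \<tau> g - Z.tilt_error d \<tau> g"

definition "tilt_bound \<tau> = (sqrt m4 / \<tau> ^ 3 + C_rem * m4 / \<tau> ^ 4) + (sqrt (Z.m4 d) / \<tau> ^ 3 + C_rem * Z.m4 d / \<tau> ^ 4)"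

lemma tilt_diff_measurable [measurable]: "tilt_diff \<tau> \<in> borel_measurable (std_gauss d)"
  unfolding tilt_diff_def[abs_def] using tilt_error_measurable Z.tilt_error_measurable by measurable

lemma integrable_tilt_diff:
  assumes \<tau>: "0 < \<tau>"
  shows "integrable (std_gauss d) (tilt_diff \<tau>)" "(\<integral>g. \<bar>tilt_diff \<tau> g\<bar> \<partial>std_gauss d) \<le> tilt_bound \<tau>"
proof -
  note i = integrable_tilt_error[OF \<tau>] Z.integrable_tilt_error[OF \<tau>, of d]
  show "integrable (std_gauss d) (tilt_diff \<tau>)"
    unfolding tilt_diff_def[abs_def] using i by simp
  have "(\<integral>g. \<bar>tilt_diff \<tau> g\<bar> \<partial>std_gauss d) \<le> (\<integral>g. \<bar>tilt_error \<tau> g\<bar> + \<bar>Z.tilt_error d \<tau> g\<bar> \<partial>std_gauss d)"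
    using i unfolding tilt_diff_def by (intro integral_mono) auto
  also have "\<dots> \<le> tilt_bound \<tau>"
    unfolding tilt_bound_def using i by simp
  finally show "(\<integral>g. \<bar>tilt_diff \<tau> g\<bar> \<partial>std_gauss d) \<le> tilt_bound \<tau>" .
qed

lemma integrable_tilt: "0 < \<tau> \<Longrightarrow> integrable (std_gauss d) (tilt \<tau>)"
proof -
  assume \<tau>: "0 < \<tau>"
  have "tilt \<tau> g = tilt_error \<tau> g + 1 + (sqn d g - d) / (2 * \<tau>\<^sup>2)" for g unfolding tilt_error_def by simp
  then have e: "tilt \<tau> = (\<lambda>g. tilt_error \<tau> g + 1 + (sqn d g - d) / (2 * \<tau>\<^sup>2))" by auto
  show ?thesis unfolding e using integrable_tilt_error(1)[OF \<tau>] Z.integrable_sqn[of d] by simp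
qed

text \<open>Both expectations integrate the same indicator, against the weights \<open>tilt\<close>
  of X and of the Gaussian vector. Their Hermite terms up to order two coincide, so the difference
  of the weights is that of the errors.\<close>

lemma bprob_swap:
  assumes \<tau>: "0 < \<tau>"
  shows "(\<integral>w. bprob d t (\<lambda>i. y i + X w i) \<tau> \<partial>M) - (\<integral>h. bprob d t (\<lambda>i. y i + h i) \<tau> \<partial>std_gauss d)
    = (\<integral>g. ballind d t (\<lambda>i. y i + \<tau> * g i) * tilt_diff \<tau> g \<partial>std_gauss d)"
proof -
  have ib: "integrable (std_gauss d) (\<lambda>g. ballind d t (\<lambda>i. y i + \<tau> * g i) * f g)" if f: "integrable (std_gauss d) f" for f
  proof -
    note [measurable] = borel_measurable_integrable[OF f]
    show ?thesis
      by (rule Bochner_Integration.integrable_bound[OF f]) (measurable, auto simp: abs_mult ballind_bounds mult_left_le_one_le)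
  qed
  have td: "tilt_diff \<tau> g = tilt \<tau> g - Z.tilt d \<tau> g" for g unfolding tilt_diff_def tilt_error_def Z.tilt_error_def by simp
  show ?thesis
    unfolding integral_bprob_shift[OF \<tau>] Z.integral_bprob_shift[OF \<tau>] td
    using ib[OF integrable_tilt[OF \<tau>]] ib[OF Z.integrable_tilt[OF \<tau>]] by (simp add: right_diff_distrib)
qed

lemma bprob_swap_bound:
  assumes \<tau>: "0 < \<tau>"
  shows "\<bar>(\<integral>w. bprob d t (\<lambda>i. y i + X w i) \<tau> \<partial>M) - (\<integral>h. bprob d t (\<lambda>i. y i + h i) \<tau> \<partial>std_gauss d)\<bar> \<le> tilt_bound \<tau>"
proof -
  note i = integrable_tilt_diff[OF \<tau>]
  have "\<bar>\<integral>g. ballind d t (\<lambda>i. y i + \<tau> * g i) * tilt_diff \<tau> g \<partial>std_gauss d\<bar> \<le> (\<integral>g. \<bar>ballind d t (\<lambda>i. y i + \<tau> * g i) * tilt_diff \<tau> g\<bar> \<partial>std_gauss d)"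
    by (rule integral_abs_bound)
  also have "\<dots> \<le> (\<integral>g. \<bar>tilt_diff \<tau> g\<bar> \<partial>std_gauss d)"
  proof (rule integral_mono')
    show "integrable (std_gauss d) (\<lambda>g. \<bar>tilt_diff \<tau> g\<bar>)" using i(1) by simp
  qed (auto simp: abs_mult ballind_bounds mult_left_le_one_le)
  also have "\<dots> \<le> tilt_bound \<tau>" by (rule i(2))
  finally show ?thesis unfolding bprob_swap[OF \<tau>] .
qed

lemma bprob_swap_mean:
  fixes N :: "'b measure" and V :: "'b \<Rightarrow> nat \<Rightarrow> real"
  assumes N: "prob_space N" and V[measurable]: "\<And>i. i < d \<Longrightarrow> (\<lambda>v. V v i) \<in> borel_measurable N" and \<tau>: "0 < \<tau>"
  shows "(\<integral>v. (\<integral>w. bprob d t (\<lambda>i. V v i + X w i) \<tau> \<partial>M) - (\<integral>h. bprob d t (\<lambda>i. V v i + h i) \<tau> \<partial>std_gauss d) \<partial>N)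
    = (\<integral>g. (\<integral>v. ballind d t (\<lambda>i. V v i + \<tau> * g i) \<partial>N) * tilt_diff \<tau> g \<partial>std_gauss d)"
proof -
  interpret N: prob_space N by fact
  interpret P: pair_sigma_finite N "std_gauss d"
    using gauss_sigma_finite N.sigma_finite_measure_axioms by (simp add: pair_sigma_finite_def)
  have "(\<integral>v. (\<integral>w. bprob d t (\<lambda>i. V v i + X w i) \<tau> \<partial>M) - (\<integral>h. bprob d t (\<lambda>i. V v i + h i) \<tau> \<partial>std_gauss d) \<partial>N)
    = (\<integral>v. \<integral>g. ballind d t (\<lambda>i. V v i + \<tau> * g i) * tilt_diff \<tau> g \<partial>std_gauss d \<partial>N)"
    unfolding bprob_swap[OF \<tau>] ..
  also have "\<dots> = (\<integral>g. \<integral>v. ballind d t (\<lambda>i. V v i + \<tau> * g i) * tilt_diff \<tau> g \<partial>N \<partial>std_gauss d)"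
  proof (rule P.Fubini_integral[symmetric])
    have m: "(\<lambda>p. ballind d t (\<lambda>i. V (fst p) i + \<tau> * snd p i) * tilt_diff \<tau> (snd p)) \<in> borel_measurable (N \<Otimes>\<^sub>M std_gauss d)"
      by measurable
    have "integrable (N \<Otimes>\<^sub>M std_gauss d) (\<lambda>p. ballind d t (\<lambda>i. V (fst p) i + \<tau> * snd p i) * tilt_diff \<tau> (snd p))"
    proof (rule integrable_pair_dominated[OF N.sigma_finite_measure_axioms gauss_sigma_finite m])
      show "integrable N (\<lambda>_. 1 :: real)" by simp
      show "integrable (std_gauss d) (\<lambda>g. \<bar>tilt_diff \<tau> g\<bar>)" using integrable_tilt_diff(1)[OF \<tau>] by simp
    qed (auto simp: abs_mult ballind_bounds mult_left_le_one_le)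
    then show "integrable (N \<Otimes>\<^sub>M std_gauss d) (\<lambda>(v, g). ballind d t (\<lambda>i. V v i + \<tau> * g i) * tilt_diff \<tau> g)"
      by (simp add: case_prod_beta')
  qed
  finally show ?thesis by simp
qed

text \<open>The kernel \<open>tilt_diff \<tau>\<close> depends on neither \<open>V\<close> nor
  \<open>V'\<close>. So the effects of one exchange on top of \<open>V\<close> and on top of
  \<open>V'\<close> differ by at most the L1 norm of the kernel times the distance
  \<open>\<Delta>\<close> of \<open>V\<close> and \<open>V'\<close> on balls. Through this product
  of two small factors the induction hypothesis enters.\<close>

lemma bprob_swap_mean_diff:
  fixes N :: "'b measure" and V :: "'b \<Rightarrow> nat \<Rightarrow> real" and N' :: "'c measure" and V' :: "'c \<Rightarrow> nat \<Rightarrow> real"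
  assumes N: "prob_space N" and V[measurable]: "\<And>i. i < d \<Longrightarrow> (\<lambda>v. V v i) \<in> borel_measurable N" and \<tau>: "0 < \<tau>"
    and N': "prob_space N'" and V'[measurable]: "\<And>i. i < d \<Longrightarrow> (\<lambda>v. V' v i) \<in> borel_measurable N'"
    and close: "\<And>a. \<bar>(\<integral>v. ballind d t (\<lambda>i. V v i + a i) \<partial>N) - (\<integral>v. ballind d t (\<lambda>i. V' v i + a i) \<partial>N')\<bar> \<le> \<Delta>"
  shows "\<bar>(\<integral>v. (\<integral>w. bprob d t (\<lambda>i. V v i + X w i) \<tau> \<partial>M) - (\<integral>h. bprob d t (\<lambda>i. V v i + h i) \<tau> \<partial>std_gauss d) \<partial>N) -
    (\<integral>v. (\<integral>w. bprob d t (\<lambda>i. V' v i + X w i) \<tau> \<partial>M) - (\<integral>h. bprob d t (\<lambda>i. V' v i + h i) \<tau> \<partial>std_gauss d) \<partial>N')\<bar> \<le> \<Delta> * tilt_bound \<tau>"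
proof -
  interpret N: prob_space N by fact
  interpret N': prob_space N' by fact
  have \<Delta>: "0 \<le> \<Delta>" using close[of "\<lambda>_. 0"] by linarith
  let ?p = "\<lambda>g. \<integral>v. ballind d t (\<lambda>i. V v i + \<tau> * g i) \<partial>N" and ?p' = "\<lambda>g. \<integral>v. ballind d t (\<lambda>i. V' v i + \<tau> * g i) \<partial>N'"
  have b: "\<bar>?p g\<bar> \<le> 1" "\<bar>?p' g\<bar> \<le> 1" for g
  proof -
    have "(\<integral>v. ballind d t (\<lambda>i. V v i + \<tau> * g i) \<partial>N) \<le> (\<integral>v. 1 \<partial>N)"
      by (intro integral_mono integrable_ballind N) (auto simp: ballind_bounds)
    moreover have "0 \<le> ?p g" by (simp add: integral_nonneg_AE ballind_bounds)
    ultimately show "\<bar>?p g\<bar> \<le> 1" by (simp add: N.prob_space)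
    have "(\<integral>v. ballind d t (\<lambda>i. V' v i + \<tau> * g i) \<partial>N') \<le> (\<integral>v. 1 \<partial>N')"
      by (intro integral_mono integrable_ballind N') (auto simp: ballind_bounds)
    moreover have "0 \<le> ?p' g" by (simp add: integral_nonneg_AE ballind_bounds)
    ultimately show "\<bar>?p' g\<bar> \<le> 1" by (simp add: N'.prob_space)
  qed
  have m1: "?p \<in> borel_measurable (std_gauss d)"
    by (rule N.borel_measurable_lebesgue_integral) (simp add: case_prod_beta', measurable)
  have m2: "?p' \<in> borel_measurable (std_gauss d)"
    by (rule N'.borel_measurable_lebesgue_integral) (simp add: case_prod_beta', measurable)
  note m = m1 m2
  note td = integrable_tilt_diff[OF \<tau>]
  have i: "integrable (std_gauss d) (\<lambda>g. ?p g * tilt_diff \<tau> g)" "integrable (std_gauss d) (\<lambda>g. ?p' g * tilt_diff \<tau> g)"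
    using m b by (auto intro!: Bochner_Integration.integrable_bound[OF td(1)] simp: abs_mult mult_left_le_one_le)
  have "\<bar>(\<integral>g. ?p g * tilt_diff \<tau> g \<partial>std_gauss d) - (\<integral>g. ?p' g * tilt_diff \<tau> g \<partial>std_gauss d)\<bar>
     = \<bar>\<integral>g. (?p g - ?p' g) * tilt_diff \<tau> g \<partial>std_gauss d\<bar>"
    using i by (simp add: left_diff_distrib)
  also have "\<dots> \<le> (\<integral>g. \<bar>(?p g - ?p' g) * tilt_diff \<tau> g\<bar> \<partial>std_gauss d)" by (rule integral_abs_bound)
  also have "\<dots> \<le> (\<integral>g. \<Delta> * \<bar>tilt_diff \<tau> g\<bar> \<partial>std_gauss d)"
  proof (rule integral_mono')
    show "integrable (std_gauss d) (\<lambda>g. \<Delta> * \<bar>tilt_diff \<tau> g\<bar>)" using td by simp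
    fix g show "\<bar>(?p g - ?p' g) * tilt_diff \<tau> g\<bar> \<le> \<Delta> * \<bar>tilt_diff \<tau> g\<bar>"
      unfolding abs_mult by (intro mult_right_mono close) simp
  qed (use \<Delta> in simp)
  also have "\<dots> \<le> \<Delta> * tilt_bound \<tau>" using td(2) \<Delta> by (simp add: mult_left_mono)
  finally show ?thesis
    using bprob_swap_mean[where N = N and V = V and t = t, OF N V \<tau>]
      bprob_swap_mean[where N = N' and V = V' and t = t, OF N' V' \<tau>] by (simp only:)
qed

end

text \<open>1 + \<open>C_rem\<close> comes from X and 2 + 3 \<open>C_rem\<close> from the Gaussian
  vector, whose fourth moment is at most 3 \<open>m4\<close>, with the root of 3 rounded up to 2;
  see \<open>tilt_bound_le\<close>.\<close>

definition C_tilt :: real where "C_tilt = 3 + 4 * C_rem"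

text \<open>Telescoping: x^(-3/2) \<le> 2 ((x - 1)^(-1/2) - x^(-1/2)). The hypothesis on m gives
  sqrt(m - 1) \<ge> sqrt(m) / 2, hence the factor 4.\<close>

lemma sum_inverse_three_halves_le:
  fixes m :: real
  assumes m: "4 \<le> m"
  shows "(\<Sum>j<n. 1 / ((real j + m) * sqrt (real j + m))) \<le> 4 / sqrt m"
proof -
  have step: "1 / (x * sqrt x) \<le> 2 * (1 / sqrt (x - 1) - 1 / sqrt x)" if x: "1 < x" for x :: real
  proof -
    define a b where "a = sqrt (x - 1)" and "b = sqrt x"
    have ab: "0 < a" "a \<le> b" "b\<^sup>2 - a\<^sup>2 = 1" "x = b * b" using x by (simp_all add: a_def b_def)
    have "(b - a) * (b + a) = 1" using ab(3) by (simp add: power2_eq_square algebra_simps)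
    then have "b - a = 1 / (b + a)" using ab by (simp add: field_simps)
    then have "1 / a - 1 / b = 1 / ((a * b) * (b + a))" using ab by (simp add: diff_frac_eq)
    also have "\<dots> \<ge> 1 / ((b * b) * (b + b))"
      using ab by (intro divide_left_mono mult_mono mult_pos_pos add_mono) auto
    finally have "1 / ((b * b) * (2 * b)) \<le> 1 / a - 1 / b" by simp
    then have "1 / ((b * b) * b) \<le> 2 * (1 / a - 1 / b)" by simp
    then have "1 / (x * b) \<le> 2 * (1 / a - 1 / b)" by (subst ab(4))
    then show ?thesis by (simp only: a_def b_def)
  qed
  have "(\<Sum>j<n. 1 / ((real j + m) * sqrt (real j + m))) \<le> (\<Sum>j<n. 2 * (1 / sqrt (real j + m - 1) - 1 / sqrt (real (Suc j) + m - 1)))"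
  proof (rule sum_mono)
    fix j
    show "1 / ((real j + m) * sqrt (real j + m)) \<le> 2 * (1 / sqrt (real j + m - 1) - 1 / sqrt (real (Suc j) + m - 1))"
      using step[of "real j + m"] m by simp
  qed
  also have "\<dots> = 2 * (1 / sqrt (m - 1) - 1 / sqrt (real n + m - 1))"
    using sum_lessThan_telescope'[of "\<lambda>j. 1 / sqrt (real j + m - 1)" n] unfolding sum_distrib_left[symmetric] by simp
  also have "\<dots> \<le> 2 / sqrt (m - 1)" using m by simp
  also have "\<dots> \<le> 2 / (sqrt m / 2)"
  proof (rule divide_left_mono)
    have "sqrt m / 2 = sqrt (m / 4)" by (simp add: real_sqrt_divide)
    also have "\<dots> \<le> sqrt (m - 1)" using m by simp
    finally show "sqrt m / 2 \<le> sqrt (m - 1)" .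
  qed (use m in auto)
  finally show ?thesis by simp
qed

section \<open>Lindeberg's telescoping sum\<close>

context isotropic
begin

definition "prodM k = PiM {..<k} (\<lambda>_::nat. M)"

definition psum :: "nat \<Rightarrow> (nat \<Rightarrow> 'a) \<Rightarrow> nat \<Rightarrow> real" where
  "psum k y i = (\<Sum>j<k. X (y j) i)"

lemma prob_space_prodM: "prob_space (prodM k)"
  unfolding prodM_def by (intro prob_space_PiM) unfold_locales

lemma psum_measurable [measurable]: "i < d \<Longrightarrow> (\<lambda>y. psum k y i) \<in> borel_measurable (prodM k)"
  unfolding psum_def prodM_def
  by (intro borel_measurable_sum, rule measurable_compose[OF measurable_component_singleton]) auto

lemma integral_prodM_Suc:
  fixes f :: "(nat \<Rightarrow> 'a) \<Rightarrow> real"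
  assumes "integrable (prodM (Suc k)) f"
  shows "(\<integral>y. f y \<partial>prodM (Suc k)) = (\<integral>y. \<integral>w. f (y(k := w)) \<partial>M \<partial>prodM k)"
proof -
  interpret Ms: product_prob_space "\<lambda>_::nat. M" by (rule product_prob_spaceI) unfold_locales
  show ?thesis using assms unfolding prodM_def lessThan_Suc by (intro Ms.product_integral_insert) auto
qed

lemma psum_Suc: "psum (Suc k) (y(k := w)) i = psum k y i + X w i"
proof -
  have "(\<Sum>j<k. X ((y(k := w)) j) i) = (\<Sum>j<k. X (y j) i)" by (rule sum.cong) auto
  then show ?thesis unfolding psum_def by simp
qed

lemma integral_bprob_psum_Suc:
  "(\<integral>y. bprob d t (\<lambda>i. psum (Suc k) y i - a i) \<tau> \<partial>prodM (Suc k)) =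
   (\<integral>y. \<integral>w. bprob d t (\<lambda>i. (psum k y i - a i) + X w i) \<tau> \<partial>M \<partial>prodM k)"
proof -
  have "psum (Suc k) (y(k := w)) i - a i = (psum k y i - a i) + X w i" for y w i by (simp add: psum_Suc)
  then have e: "(\<lambda>i. psum (Suc k) (y(k := w)) i - a i) = (\<lambda>i. (psum k y i - a i) + X w i)" for y w by auto
  have "(\<integral>y. bprob d t (\<lambda>i. psum (Suc k) y i - a i) \<tau> \<partial>prodM (Suc k)) =
    (\<integral>y. \<integral>w. bprob d t (\<lambda>i. psum (Suc k) (y(k := w)) i - a i) \<tau> \<partial>M \<partial>prodM k)"
    by (rule integral_prodM_Suc) (intro integrable_bprob prob_space_prodM, measurable)
  then show ?thesis unfolding e .
qed

lemma integrable_mean_bprob: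
  fixes N :: "'b measure" and V :: "'b \<Rightarrow> nat \<Rightarrow> real" and N' :: "'c measure" and W :: "'c \<Rightarrow> nat \<Rightarrow> real"
  assumes "prob_space N" and [measurable]: "\<And>i. i < d \<Longrightarrow> (\<lambda>v. V v i) \<in> borel_measurable N"
    and "prob_space N'" and [measurable]: "\<And>i. i < d \<Longrightarrow> (\<lambda>v. W v i) \<in> borel_measurable N'"
  shows "integrable N (\<lambda>v. \<integral>w. bprob d t (\<lambda>i. V v i + W w i) \<tau> \<partial>N')"
    and "(\<integral>v. \<integral>w. bprob d t (\<lambda>i. V v i + W w i) \<tau> \<partial>N' \<partial>N) = (\<integral>w. \<integral>v. bprob d t (\<lambda>i. V v i + W w i) \<tau> \<partial>N \<partial>N')"
proof -
  interpret N: prob_space N by fact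
  interpret N': prob_space N' by fact
  interpret P: pair_prob_space N N' by unfold_locales
  have "integrable (N \<Otimes>\<^sub>M N') (\<lambda>p. bprob d t (\<lambda>i. V (fst p) i + W (snd p) i) \<tau>)"
    by (intro integrable_bprob P.prob_space_axioms) measurable
  then have i: "integrable (N \<Otimes>\<^sub>M N') (\<lambda>(v, w). bprob d t (\<lambda>i. V v i + W w i) \<tau>)" by (simp add: case_prod_beta')
  show "integrable N (\<lambda>v. \<integral>w. bprob d t (\<lambda>i. V v i + W w i) \<tau> \<partial>N')"
    using P.integrable_fst[OF i] by simp
  show "(\<integral>v. \<integral>w. bprob d t (\<lambda>i. V v i + W w i) \<tau> \<partial>N' \<partial>N) = (\<integral>w. \<integral>v. bprob d t (\<lambda>i. V v i + W w i) \<tau> \<partial>N \<partial>N')"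
    using P.Fubini_integral[OF i] by simp
qed

text \<open>The exchange of the summand with index \<open>k\<close> after the genuine past
  (\<open>?A\<close>) is compared with the same exchange after a Gaussian past (\<open>?B\<close>).
  The difference is a product of two small factors by \<open>bprob_swap_mean_diff\<close>, and
  \<open>?B\<close> is small by itself because a Gaussian past acts as further noise of variance
  \<open>k\<close>.\<close>

lemma lindeberg_step:
  assumes \<tau>: "0 < \<tau>"
    and close: "\<And>a. \<bar>(\<integral>y. ballind d t (\<lambda>i. psum k y i - a i) \<partial>prodM k) - (\<integral>z. ballind d t (\<lambda>i. sqrt k * z i - a i) \<partial>std_gauss d)\<bar> \<le> \<Delta>"
  shows "\<bar>(\<integral>y. bprob d t (\<lambda>i. psum (Suc k) y i - a i) \<tau> \<partial>prodM (Suc k)) - (\<integral>y. bprob d t (\<lambda>i. psum k y i - a i) (sqrt (1 + \<tau>\<^sup>2)) \<partial>prodM k)\<bar>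
    \<le> \<Delta> * tilt_bound \<tau> + tilt_bound (sqrt (k + \<tau>\<^sup>2))"
proof -
  let ?V = "\<lambda>y i. psum k y i - a i" and ?V' = "\<lambda>z i. sqrt k * z i - a i"
  let ?A = "\<integral>v. (\<integral>w. bprob d t (\<lambda>i. ?V v i + X w i) \<tau> \<partial>M) - (\<integral>h. bprob d t (\<lambda>i. ?V v i + h i) \<tau> \<partial>std_gauss d) \<partial>prodM k"
  let ?B = "\<integral>v. (\<integral>w. bprob d t (\<lambda>i. ?V' v i + X w i) \<tau> \<partial>M) - (\<integral>h. bprob d t (\<lambda>i. ?V' v i + h i) \<tau> \<partial>std_gauss d) \<partial>std_gauss d"
  have pM: "prob_space M" by unfold_locales
  have mV: "i < d \<Longrightarrow> (\<lambda>v. ?V v i) \<in> borel_measurable (prodM k)" for i by measurable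
  have mV': "i < d \<Longrightarrow> (\<lambda>v. ?V' v i) \<in> borel_measurable (std_gauss d)" for i by measurable
  have mZ: "i < d \<Longrightarrow> (\<lambda>v. v i) \<in> borel_measurable (std_gauss d)" for i by measurable
  note iA = integrable_mean_bprob[where V = ?V and N = "prodM k" and W = X and N' = M and t = t and \<tau> = \<tau>, OF prob_space_prodM mV pM X_measurable]
  note iA' = integrable_mean_bprob[where V = ?V and N = "prodM k" and W = "\<lambda>h. h" and N' = "std_gauss d" and t = t and \<tau> = \<tau>, OF prob_space_prodM mV prob_space_std_gauss mZ]
  note iB = integrable_mean_bprob[where V = ?V' and N = "std_gauss d" and W = X and N' = M and t = t and \<tau> = \<tau>, OF prob_space_std_gauss mV' pM X_measurable]
  note iB' = integrable_mean_bprob[where V = ?V' and N = "std_gauss d" and W = "\<lambda>h. h" and N' = "std_gauss d" and t = t and \<tau> = \<tau>, OF prob_space_std_gauss mV' prob_space_std_gauss mZ]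
  have add1: "(\<integral>h. bprob d t (\<lambda>i. u i + h i) \<tau> \<partial>std_gauss d) = bprob d t u (sqrt (1 + \<tau>\<^sup>2))" for u
    using bprob_add[of 1 \<tau> d t u] \<tau> by simp
  have A: "?A = (\<integral>y. bprob d t (\<lambda>i. psum (Suc k) y i - a i) \<tau> \<partial>prodM (Suc k)) - (\<integral>y. bprob d t (\<lambda>i. psum k y i - a i) (sqrt (1 + \<tau>\<^sup>2)) \<partial>prodM k)"
    unfolding integral_bprob_psum_Suc using iA(1) iA'(1) by (simp add: add1)
  have addk: "(\<integral>z. bprob d t (\<lambda>i. (sqrt k * z i - a i) + u i) \<tau> \<partial>std_gauss d) = bprob d t (\<lambda>i. - a i + u i) (sqrt (k + \<tau>\<^sup>2))" for u
    using bprob_add[of "sqrt k" \<tau> d t "\<lambda>i. - a i + u i"] \<tau> by (simp add: algebra_simps)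
  \<comment> \<open>Fubini brings the Gaussian past to the inside, where \<open>addk\<close> merges
    it with the noise.\<close>
  have B: "?B = (\<integral>w. bprob d t (\<lambda>i. - a i + X w i) (sqrt (k + \<tau>\<^sup>2)) \<partial>M) - (\<integral>h. bprob d t (\<lambda>i. - a i + h i) (sqrt (k + \<tau>\<^sup>2)) \<partial>std_gauss d)"
    using iB(1) iB'(1) by (simp only: Bochner_Integration.integral_diff iB(2) iB'(2) addk)
  have B_le: "\<bar>?B\<bar> \<le> tilt_bound (sqrt (k + \<tau>\<^sup>2))"
    unfolding B using \<tau> by (intro bprob_swap_bound) (simp add: add_nonneg_pos)
  have "\<bar>?A - ?B\<bar> \<le> \<Delta> * tilt_bound \<tau>"
  proof (rule bprob_swap_mean_diff[OF prob_space_prodM mV \<tau> prob_space_std_gauss mV'])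
    fix b
    show "\<bar>(\<integral>v. ballind d t (\<lambda>i. (psum k v i - a i) + b i) \<partial>prodM k) - (\<integral>v. ballind d t (\<lambda>i. (sqrt k * v i - a i) + b i) \<partial>std_gauss d)\<bar> \<le> \<Delta>"
      using close[of "\<lambda>i. a i - b i"] by (simp add: algebra_simps)
  qed
  then show ?thesis using B_le unfolding A by linarith
qed

lemma lindeberg_sum:
  assumes m: "0 < m"
    and close: "\<And>k a. k < n \<Longrightarrow> \<bar>(\<integral>y. ballind d t (\<lambda>i. psum k y i - a i) \<partial>prodM k) - (\<integral>z. ballind d t (\<lambda>i. sqrt k * z i - a i) \<partial>std_gauss d)\<bar> \<le> \<Delta> k"
  shows "\<bar>(\<integral>y. bprob d t (\<lambda>i. psum n y i - a i) (sqrt m) \<partial>prodM n) - (\<integral>z. bprob d t (\<lambda>i. sqrt n * z i - a i) (sqrt m) \<partial>std_gauss d)\<bar>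
    \<le> (\<Sum>k<n. \<Delta> k * tilt_bound (sqrt (real (n - Suc k) + m)) + tilt_bound (sqrt (real n - 1 + m)))"
proof -
  \<comment> \<open>There are \<open>k\<close> genuine summands; the other \<open>n - k\<close>,
    Gaussian ones, are merged with the noise of variance \<open>m\<close>, so the total variance
    stays at \<open>n + m\<close> along the path.\<close>
  define G where "G k = (\<integral>y. bprob d t (\<lambda>i. psum k y i - a i) (sqrt (real (n - k) + m)) \<partial>prodM k)" for k
  have step: "\<bar>G (Suc k) - G k\<bar> \<le> \<Delta> k * tilt_bound (sqrt (real (n - Suc k) + m)) + tilt_bound (sqrt (real n - 1 + m))" if k: "k < n" for k
  proof -
    define \<tau> where "\<tau> = sqrt (real (n - Suc k) + m)"
    have \<tau>: "0 < \<tau>" "\<tau>\<^sup>2 = real (n - Suc k) + m" using m by (simp_all add: \<tau>_def add_nonneg_pos)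
    \<comment> \<open>The exchange at \<open>k\<close> happens under noise of variance n - (k + 1) +
      m, to which a Gaussian past adds \<open>k\<close>; the sum n - 1 + m is the same for all
      \<open>k\<close>.\<close>
    have 1: "1 + \<tau>\<^sup>2 = real (n - k) + m" "k + \<tau>\<^sup>2 = real n - 1 + m" using k \<tau> by (simp_all add: of_nat_diff)
    show ?thesis using lindeberg_step[OF \<tau>(1) close[OF k], of a] unfolding 1 G_def \<tau>_def[symmetric] .
  qed
  have "\<bar>G n - G 0\<bar> = \<bar>\<Sum>k<n. G (Suc k) - G k\<bar>" by (simp add: sum_lessThan_telescope)
  also have "\<dots> \<le> (\<Sum>k<n. \<bar>G (Suc k) - G k\<bar>)" by (rule sum_abs)
  also have "\<dots> \<le> (\<Sum>k<n. \<Delta> k * tilt_bound (sqrt (real (n - Suc k) + m)) + tilt_bound (sqrt (real n - 1 + m)))"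
    by (intro sum_mono step) auto
  finally have *: "\<bar>G n - G 0\<bar> \<le> \<dots>" .
  have G0: "G 0 = (\<integral>z. bprob d t (\<lambda>i. sqrt n * z i - a i) (sqrt m) \<partial>std_gauss d)"
  proof -
    interpret P0: prob_space "prodM 0" by (rule prob_space_prodM)
    have "G 0 = bprob d t (\<lambda>i. - a i) (sqrt (real n + m))" unfolding G_def by (simp add: psum_def P0.prob_space)
    also have "\<dots> = (\<integral>z. bprob d t (\<lambda>i. sqrt n * z i - a i) (sqrt m) \<partial>std_gauss d)"
      using bprob_add[of "sqrt n" "sqrt m" d t "\<lambda>i. - a i"] m by (simp add: algebra_simps)
    finally show ?thesis .
  qed
  show ?thesis using * unfolding G0 by (simp add: G_def)
qed

text \<open>Once the noise variance \<open>u\<close> reaches \<open>m4\<close>, the fourth-order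
  term m4 / u^2 is dominated by the third-order term sqrt(m4) / u^(3/2). This is why the scale of
  the noise is a multiple of \<open>sqrt m4\<close>.\<close>

lemma tilt_bound_le:
  assumes d: "1 \<le> d" and u: "m4 \<le> u"
  shows "tilt_bound (sqrt u) \<le> C_tilt * sqrt m4 / (u * sqrt u)"
proof -
  have "1 \<le> (real d)\<^sup>2" using d by (intro one_le_power) simp
  then have m4: "1 \<le> m4" using m4_ge by linarith
  define r s where "r = sqrt m4" and "s = sqrt u"
  have r: "1 \<le> r" "m4 = r * r" and s: "r \<le> s" "u = s * s" using m4 u by (simp_all add: r_def s_def)
  have Z1: "Z.m4 d \<le> 3 * m4" using m4_std_gauss_le[of d] m4_ge by simp
  have Z2: "sqrt (Z.m4 d) \<le> 2 * r"
  proof -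
    have "sqrt (Z.m4 d) \<le> sqrt (4 * m4)" using Z1 m4 by (intro real_sqrt_le_mono) simp
    then show ?thesis by (simp add: real_sqrt_mult r_def)
  qed
  have m4s: "m4 / s ^ 4 \<le> r / s ^ 3"
  proof -
    have "m4 / s ^ 4 = (r / s) * (r / s ^ 3)" by (simp add: r(2) eval_nat_numeral)
    also have "\<dots> \<le> 1 * (r / s ^ 3)" using r s by (intro mult_right_mono) auto
    finally show ?thesis by simp
  qed
  have "tilt_bound s = sqrt m4 / s ^ 3 + C_rem * (m4 / s ^ 4) + sqrt (Z.m4 d) / s ^ 3 + C_rem * (Z.m4 d / s ^ 4)"
    unfolding tilt_bound_def by simp
  also have "\<dots> \<le> r / s ^ 3 + C_rem * (r / s ^ 3) + 2 * r / s ^ 3 + C_rem * (3 * (r / s ^ 3))"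
  proof (intro add_mono mult_left_mono)
    show "Z.m4 d / s ^ 4 \<le> 3 * (r / s ^ 3)"
    proof -
      have "Z.m4 d / s ^ 4 \<le> 3 * m4 / s ^ 4" using Z1 r s by (intro divide_right_mono) auto
      then show ?thesis using m4s by simp
    qed
    show "sqrt (Z.m4 d) / s ^ 3 \<le> 2 * r / s ^ 3" using Z2 r s by (intro divide_right_mono) auto
  qed (use m4s C_rem_ge_1 r_def in auto)
  also have "\<dots> = C_tilt * r / s ^ 3"
  proof -
    have "x + C_rem * x + 2 * x + C_rem * (3 * x) = (3 + 4 * C_rem) * x" for x by (simp add: algebra_simps)
    from this[of "r / s ^ 3"] show ?thesis by (simp only: C_tilt_def times_divide_eq_right)
  qed
  also have "s ^ 3 = u * s" by (simp add: s(2) power3_eq_cube)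
  finally show ?thesis unfolding r_def s_def .
qed

text \<open>The first half of the exchanges takes place under noise of variance at least n / 2, so
  the trivial bound 1 on the distance of the two pasts suffices. In the second half the assumed
  bound gives a distance of at most 2 K sqrt(m4 / n), and the sum of the (j + m)^(-3/2) contributes
  4 / (\<kappa> sqrt m4). Thus K returns divided by \<kappa>, with the order n^(-1/2)
  intact.\<close>

lemma lindeberg_bound:
  assumes d: "1 \<le> d" and n: "2 \<le> n" and \<kappa>: "2 \<le> \<kappa>" and K: "0 \<le> K"
    and close1: "\<And>k a. \<bar>(\<integral>y. ballind d t (\<lambda>i. psum k y i - a i) \<partial>prodM k) - (\<integral>z. ballind d t (\<lambda>i. sqrt k * z i - a i) \<partial>std_gauss d)\<bar> \<le> 1"
    and close: "\<And>k a. 1 \<le> k \<Longrightarrow> k < n \<Longrightarrow> \<bar>(\<integral>y. ballind d t (\<lambda>i. psum k y i - a i) \<partial>prodM k) - (\<integral>z. ballind d t (\<lambda>i. sqrt k * z i - a i) \<partial>std_gauss d)\<bar> \<le> K * sqrt (m4 / k)"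
  shows "\<bar>(\<integral>y. bprob d t (\<lambda>i. psum n y i - a i) (\<kappa> * sqrt m4) \<partial>prodM n) - (\<integral>z. bprob d t (\<lambda>i. sqrt n * z i - a i) (\<kappa> * sqrt m4) \<partial>std_gauss d)\<bar>
    \<le> (4 * C_tilt + 8 * K * C_tilt / \<kappa>) * sqrt (m4 / n)"
proof -
  define m where "m = \<kappa>\<^sup>2 * m4"
  have "1 \<le> (real d)\<^sup>2" using d by (intro one_le_power) simp
  then have m4: "1 \<le> m4" using m4_ge by linarith
  define r where "r = sqrt m4"
  have r: "1 \<le> r" using m4 by (simp add: r_def)
  have sm: "sqrt m = \<kappa> * r" using \<kappa> by (simp add: m_def r_def real_sqrt_mult)
  have \<kappa>2: "4 \<le> \<kappa>\<^sup>2" using power_mono[of 2 \<kappa> 2] \<kappa> by simp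
  have m: "4 \<le> m" "m4 \<le> m"
  proof -
    have "4 * 1 \<le> \<kappa>\<^sup>2 * m4" using \<kappa>2 m4 by (intro mult_mono) auto
    then show "4 \<le> m" by (simp add: m_def)
    have "1 * m4 \<le> \<kappa>\<^sup>2 * m4" using \<kappa>2 m4 by (intro mult_right_mono) auto
    then show "m4 \<le> m" by (simp add: m_def)
  qed
  have Ct: "0 \<le> C_tilt" using C_rem_ge_1 by (simp add: C_tilt_def)
  define \<Delta> where "\<Delta> k = (if 2 * (k + 1) \<le> n then 1 else 2 * K * r / sqrt n)" for k
  have cl: "\<bar>(\<integral>y. ballind d t (\<lambda>i. psum k y i - a i) \<partial>prodM k) - (\<integral>z. ballind d t (\<lambda>i. sqrt k * z i - a i) \<partial>std_gauss d)\<bar> \<le> \<Delta> k" if k: "k < n" for k a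
  proof (cases "2 * (k + 1) \<le> n")
    case True then show ?thesis using close1 by (simp add: \<Delta>_def)
  next
    case False
    then have k1: "1 \<le> k" using n by simp
    \<comment> \<open>As 2 (k + 1) > n, k is at least (n - 1) / 2, and this is at least n / 4
      because n \<ge> 2.\<close>
    have "real n / 4 \<le> real k" using False n by simp
    then have "m4 / k \<le> m4 / (real n / 4)" using m4 n by (intro divide_left_mono) auto
    then have "sqrt (m4 / k) \<le> sqrt (4 * (m4 / n))" by (intro real_sqrt_le_mono) (simp add: mult.commute)
    also have "\<dots> = 2 * (r / sqrt n)" by (simp add: real_sqrt_mult real_sqrt_divide r_def)
    finally have "K * sqrt (m4 / k) \<le> K * (2 * (r / sqrt n))" using K by (intro mult_left_mono)
    moreover have "K * (2 * (r / sqrt n)) = \<Delta> k" using False by (simp add: \<Delta>_def)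
    ultimately show ?thesis using close[OF k1 k, of a] by linarith
  qed
  have \<Delta>0: "0 \<le> \<Delta> k" for k using K r by (simp add: \<Delta>_def)
  have sn: "0 < sqrt n" "sqrt n * sqrt n = n" using n by auto
  have t1: "tilt_bound (sqrt (real n - 1 + m)) \<le> C_tilt * r / (n * sqrt n)"
  proof -
    have "tilt_bound (sqrt (real n - 1 + m)) \<le> C_tilt * r / ((real n - 1 + m) * sqrt (real n - 1 + m))"
      unfolding r_def using n m by (intro tilt_bound_le d) auto
    also have "\<dots> \<le> C_tilt * r / (n * sqrt n)"
      using n m Ct r by (intro divide_left_mono mult_mono mult_pos_pos) auto
    finally show ?thesis .
  qed
  \<comment> \<open>The 3 bounds 2 sqrt 2, the factor from (n / 2)^(-3/2); with the 1 of
    \<open>t1\<close> it makes up the 4 of the result.\<close>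
  have t2: "\<Delta> k * tilt_bound (sqrt (real (n - Suc k) + m)) \<le> 3 * C_tilt * r / (n * sqrt n) +
      2 * K * r / sqrt n * (C_tilt * r * (1 / ((real (n - Suc k) + m) * sqrt (real (n - Suc k) + m))))" if k: "k < n" for k
  proof -
    let ?u = "real (n - Suc k) + m"
    have b: "tilt_bound (sqrt ?u) \<le> C_tilt * r / (?u * sqrt ?u)"
      unfolding r_def using m by (intro tilt_bound_le d) auto
    have nn: "0 \<le> 3 * C_tilt * r / (n * sqrt n)" "0 \<le> 2 * K * r / sqrt n * (C_tilt * r * (1 / (?u * sqrt ?u)))"
      using Ct r K m by auto
    show ?thesis
    proof (cases "2 * (k + 1) \<le> n")
      case True
      then have u: "real n / 2 \<le> ?u" using m k by (simp add: of_nat_diff)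
      have "C_tilt * r / (?u * sqrt ?u) \<le> C_tilt * r / (real n / 2 * sqrt (real n / 2))"
        using n m Ct r u by (intro divide_left_mono mult_mono mult_pos_pos real_sqrt_le_mono) auto
      also have "\<dots> = (2 * sqrt 2) * (C_tilt * r / (n * sqrt n))" by (simp add: real_sqrt_divide)
      also have "\<dots> \<le> 3 * (C_tilt * r / (n * sqrt n))"
      proof (rule mult_right_mono)
        have "sqrt 2 \<le> sqrt (9 / 4)" by (rule real_sqrt_le_mono) simp
        then show "2 * sqrt 2 \<le> (3 :: real)" by (simp add: real_sqrt_divide)
      qed (use Ct r in auto)
      finally show ?thesis using b nn True by (simp add: \<Delta>_def)
    next
      case False
      have "\<Delta> k * tilt_bound (sqrt ?u) \<le> \<Delta> k * (C_tilt * r / (?u * sqrt ?u))" using b \<Delta>0 by (intro mult_left_mono)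
      then show ?thesis using nn False by (simp add: \<Delta>_def)
    qed
  qed
  have "\<bar>(\<integral>y. bprob d t (\<lambda>i. psum n y i - a i) (sqrt m) \<partial>prodM n) - (\<integral>z. bprob d t (\<lambda>i. sqrt n * z i - a i) (sqrt m) \<partial>std_gauss d)\<bar>
     \<le> (\<Sum>k<n. \<Delta> k * tilt_bound (sqrt (real (n - Suc k) + m)) + tilt_bound (sqrt (real n - 1 + m)))"
    using m by (intro lindeberg_sum cl) auto
  also have "\<dots> \<le> (\<Sum>k<n. (3 * C_tilt * r / (n * sqrt n) + 2 * K * r / sqrt n * (C_tilt * r * (1 / ((real (n - Suc k) + m) * sqrt (real (n - Suc k) + m))))) + C_tilt * r / (n * sqrt n))"
    by (intro sum_mono add_mono t1 t2) auto
  also have "\<dots> = 4 * C_tilt * r / sqrt n + 2 * K * r / sqrt n * (C_tilt * r * (\<Sum>k<n. 1 / ((real (n - Suc k) + m) * sqrt (real (n - Suc k) + m))))"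
  proof -
    have "(\<Sum>k<n. (3 * A + B * (E * x k)) + A) = 4 * (real n * A) + B * (E * (\<Sum>k<n. x k))" for A B E :: real and x
      by (simp add: sum.distrib sum_distrib_left)
    from this[of "C_tilt * r / (n * sqrt n)" "2 * K * r / sqrt n" "C_tilt * r" "\<lambda>k. 1 / ((real (n - Suc k) + m) * sqrt (real (n - Suc k) + m))"]
    have "(\<Sum>k<n. (3 * (C_tilt * r / (n * sqrt n)) + 2 * K * r / sqrt n * (C_tilt * r * (1 / ((real (n - Suc k) + m) * sqrt (real (n - Suc k) + m))))) + C_tilt * r / (n * sqrt n)) =
      4 * (real n * (C_tilt * r / (n * sqrt n))) + 2 * K * r / sqrt n * (C_tilt * r * (\<Sum>k<n. 1 / ((real (n - Suc k) + m) * sqrt (real (n - Suc k) + m))))" .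
    moreover have "4 * (real n * (C_tilt * r / (n * sqrt n))) = 4 * C_tilt * r / sqrt n" using n by simp
    moreover have "3 * (C_tilt * r / (n * sqrt n)) = 3 * C_tilt * r / (n * sqrt n)" by simp
    ultimately show ?thesis by (simp only:)
  qed
  also have "(\<Sum>k<n. 1 / ((real (n - Suc k) + m) * sqrt (real (n - Suc k) + m))) = (\<Sum>j<n. 1 / ((real j + m) * sqrt (real j + m)))"
    by (rule sum.nat_diff_reindex)
  also have "4 * C_tilt * r / sqrt n + 2 * K * r / sqrt n * (C_tilt * r * (\<Sum>j<n. 1 / ((real j + m) * sqrt (real j + m))))
     \<le> 4 * C_tilt * r / sqrt n + 2 * K * r / sqrt n * (C_tilt * r * (4 / sqrt m))"
    using Ct r K m by (intro add_left_mono mult_left_mono sum_inverse_three_halves_le) auto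
  also have "\<dots> = (4 * C_tilt + 8 * K * C_tilt / \<kappa>) * sqrt (m4 / n)"
    unfolding sm using r \<kappa> sn by (simp add: real_sqrt_divide r_def[symmetric] field_simps)
  finally show ?thesis unfolding sm r_def .
qed

end

section \<open>Removing the Gaussian noise\<close>

lemma std_gauss_square_mixed_moment:
  "has_bochner_integral (std_gauss d) (\<lambda>g. (dot d x g)\<^sup>2 * (dot d y g)\<^sup>2) (sqn d x * sqn d y + 2 * (dot d x y)\<^sup>2)"
proof -
  let ?w = "dot d x" and ?w' = "dot d y" and ?q = "sqn d x" and ?q' = "sqn d y" and ?c = "dot d x y"
  have B4: "has_bochner_integral (std_gauss d) (\<lambda>g. (?w g + b * ?w' g) ^ 4) (3 * (?q + 2 * b * ?c + b\<^sup>2 * ?q')\<^sup>2)" for b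
    using integrable_std_gauss_dot_power[of d "\<lambda>i. x i + b * y i" 4] integral_std_gauss_dot_power(2)[of d "\<lambda>i. x i + b * y i"]
    by (simp add: has_bochner_integral_iff dot_add_scaled sqn_add_scaled)
  have B: "has_bochner_integral (std_gauss d) (\<lambda>g. (dot d z g) ^ 4) (3 * (sqn d z)\<^sup>2)" for z
    using integrable_std_gauss_dot_power[of d z 4] integral_std_gauss_dot_power(2)[of d z]
    by (simp add: has_bochner_integral_iff)
  have "has_bochner_integral (std_gauss d) (\<lambda>g. (1 / 12) * ((?w g + 1 * ?w' g) ^ 4 + (?w g + (- 1) * ?w' g) ^ 4 - 2 * (?w g) ^ 4 - 2 * (?w' g) ^ 4))
    ((1 / 12) * (3 * (?q + 2 * 1 * ?c + 1\<^sup>2 * ?q')\<^sup>2 + 3 * (?q + 2 * (- 1) * ?c + (- 1)\<^sup>2 * ?q')\<^sup>2 - 2 * (3 * ?q\<^sup>2) - 2 * (3 * ?q'\<^sup>2)))"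
    by (intro has_bochner_integral_mult_right has_bochner_integral_add has_bochner_integral_diff B4 B)
  moreover have "(1 / 12) * ((a + 1 * b) ^ 4 + (a + (- 1) * b) ^ 4 - 2 * a ^ 4 - 2 * b ^ 4) = a\<^sup>2 * b\<^sup>2" for a b :: real
    by (simp add: eval_nat_numeral field_simps)
  moreover have "(1 / 12) * (3 * (q + 2 * 1 * c + 1\<^sup>2 * q')\<^sup>2 + 3 * (q + 2 * (- 1) * c + (- 1)\<^sup>2 * q')\<^sup>2 - 2 * (3 * q\<^sup>2) - 2 * (3 * q'\<^sup>2)) = q * q' + 2 * c\<^sup>2" for q q' c :: real
    by (simp add: eval_nat_numeral field_simps)
  ultimately show ?thesis by (simp only:)
qed

text \<open>The exact value matters: it makes the variance of |g|^2 equal to 2 d. The bound 3 d^2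
  would only show fluctuations of order d instead of sqrt d, and the smoothing window would grow
  with the dimension.\<close>

lemma m4_std_gauss: "Z.m4 d = (real d)\<^sup>2 + 2 * real d"
proof -
  let ?e = "\<lambda>i k. if k = i then 1 else (0 :: real)"
  have B: "has_bochner_integral (std_gauss d) (\<lambda>g. (g i)\<^sup>2 * (g j)\<^sup>2) (if i = j then 3 else 1)" if "i < d" "j < d" for i j
    using std_gauss_square_mixed_moment[of d "?e i" "?e j"] that
    by (simp add: dot_unit sqn_def if_distrib[of "\<lambda>x. x\<^sup>2"] cong: if_cong split: if_splits)
  have "Z.m4 d = (\<integral>g. (\<Sum>i<d. \<Sum>j<d. (g i)\<^sup>2 * (g j)\<^sup>2) \<partial>std_gauss d)"
    unfolding Z.m4_def by (simp add: sqn_def power2_eq_square[of "sum _ _"] sum_product)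
  also have "\<dots> = (\<Sum>i<d. \<Sum>j<d. (if i = j then 3 else 1))"
    by (rule has_bochner_integral_integral_eq) (intro has_bochner_integral_sum B, auto)
  also have "\<dots> = (\<Sum>i<d. \<Sum>j<d. 1 + 2 * (if i = j then 1 else 0))" by (intro sum.cong refl) auto
  also have "\<dots> = (real d)\<^sup>2 + 2 * real d"
    by (simp add: sum.distrib sum_distrib_left[symmetric] power2_eq_square algebra_simps)
  finally show ?thesis .
qed

text \<open>Chebyshev's inequality applied to \<open>|y + \<tau> g|\<^sup>2 - |y|\<^sup>2 - \<tau>\<^sup>2 d = 2 \<tau> y \<cdot> g + \<tau>\<^sup>2 (|g|\<^sup>2 - d)\<close>.\<close>

lemma noisy_sqn_deviation:
  fixes y :: "nat \<Rightarrow> real" and \<tau> :: real and d :: nat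
  assumes \<tau>: "0 < \<tau>" and d: "1 \<le> d"
  defines "s \<equiv> 3 * \<tau> * sqrt (sqn d y) + 2 * \<tau>\<^sup>2 * sqrt d"
  shows "measure (std_gauss d) {g \<in> space (std_gauss d). 3 * s \<le> \<bar>sqn d (\<lambda>i. y i + \<tau> * g i) - sqn d y - \<tau>\<^sup>2 * d\<bar>} \<le> 1 / 8"
proof -
  let ?V = "\<lambda>g. sqn d (\<lambda>i. y i + \<tau> * g i) - sqn d y - \<tau>\<^sup>2 * d"
  have s0: "0 < s" unfolding s_def using \<tau> d by (intro add_nonneg_pos) auto
  have V: "?V g = 2 * \<tau> * dot d y g + \<tau>\<^sup>2 * (sqn d g - d)" for g
    by (simp add: sqn_add_scaled algebra_simps)
  have Vsq: "(?V g)\<^sup>2 \<le> 8 * \<tau>\<^sup>2 * (dot d y g)\<^sup>2 + 2 * \<tau> ^ 4 * (sqn d g - d)\<^sup>2" for g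
  proof -
    have "0 \<le> (2 * \<tau> * dot d y g - \<tau>\<^sup>2 * (sqn d g - d))\<^sup>2" by simp
    moreover have "\<tau> ^ 4 = \<tau>\<^sup>2 * \<tau>\<^sup>2" by (simp add: eval_nat_numeral)
    ultimately show ?thesis unfolding V by (simp add: power2_eq_square algebra_simps)
  qed
  have i1: "integrable (std_gauss d) (\<lambda>g. (dot d y g)\<^sup>2)" by (rule integrable_std_gauss_dot_power)
  have e2: "(sqn d g - d)\<^sup>2 = (sqn d g)\<^sup>2 - 2 * d * sqn d g + (real d)\<^sup>2" for g :: "nat \<Rightarrow> real"
    by (simp add: power2_eq_square algebra_simps)
  have i2: "integrable (std_gauss d) (\<lambda>g. (sqn d g - d)\<^sup>2)"
    unfolding e2 using Z.fourth_moment[of d] Z.integrable_sqn[of d] by simp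
  have E2: "(\<integral>g. (sqn d g - d)\<^sup>2 \<partial>std_gauss d) = 2 * d"
  proof -
    have "(\<integral>g. (sqn d g)\<^sup>2 - 2 * d * sqn d g + (real d)\<^sup>2 \<partial>std_gauss d) = Z.m4 d - 2 * d * d + (real d)\<^sup>2"
      unfolding Z.m4_def using Z.fourth_moment[of d] Z.integrable_sqn[of d] by (simp add: gauss.prob_space Z.expectation_sqn)
    then show ?thesis unfolding e2 m4_std_gauss by (simp add: power2_eq_square)
  qed
  have iV: "integrable (std_gauss d) (\<lambda>g. (?V g)\<^sup>2)"
  proof (rule Bochner_Integration.integrable_bound)
    show "integrable (std_gauss d) (\<lambda>g. 8 * \<tau>\<^sup>2 * (dot d y g)\<^sup>2 + 2 * \<tau> ^ 4 * (sqn d g - d)\<^sup>2)" using i1 i2 by simp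
    show "AE g in std_gauss d. norm ((?V g)\<^sup>2) \<le> norm (8 * \<tau>\<^sup>2 * (dot d y g)\<^sup>2 + 2 * \<tau> ^ 4 * (sqn d g - d)\<^sup>2)"
    proof (intro AE_I2)
      fix g
      have "norm ((?V g)\<^sup>2) = (?V g)\<^sup>2" by simp
      also note Vsq[of g]
      also note abs_ge_self
      finally show "norm ((?V g)\<^sup>2) \<le> norm (8 * \<tau>\<^sup>2 * (dot d y g)\<^sup>2 + 2 * \<tau> ^ 4 * (sqn d g - d)\<^sup>2)" by simp
    qed
  qed measurable
  have "(\<integral>g. (?V g)\<^sup>2 \<partial>std_gauss d) \<le> (\<integral>g. 8 * \<tau>\<^sup>2 * (dot d y g)\<^sup>2 + 2 * \<tau> ^ 4 * (sqn d g - d)\<^sup>2 \<partial>std_gauss d)"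
    using i1 i2 iV Vsq by (intro integral_mono) auto
  also have "\<dots> = 8 * \<tau>\<^sup>2 * sqn d y + 4 * \<tau> ^ 4 * d"
    using i1 i2 by (simp add: E2 integral_std_gauss_dot_power)
  \<comment> \<open>So \<open>s\<close> bounds the root mean square of the deviation, and
    Chebyshev's inequality at 3 s gives 1 / 9.\<close>
  also have "\<dots> \<le> s\<^sup>2"
  proof -
    define a b where "a = sqrt (sqn d y)" and "b = sqrt (real d)"
    have ab: "0 \<le> a" "0 \<le> b" "sqn d y = a\<^sup>2" "real d = b\<^sup>2" by (simp_all add: a_def b_def)
    have "s\<^sup>2 - (8 * \<tau>\<^sup>2 * a\<^sup>2 + 4 * \<tau> ^ 4 * b\<^sup>2) = \<tau>\<^sup>2 * a\<^sup>2 + 12 * \<tau> ^ 3 * (a * b)"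
      unfolding s_def a_def[symmetric] b_def[symmetric] by (simp add: eval_nat_numeral algebra_simps)
    moreover have "0 \<le> \<tau>\<^sup>2 * a\<^sup>2 + 12 * \<tau> ^ 3 * (a * b)" using ab \<tau> by simp
    ultimately show ?thesis unfolding ab(3,4) by linarith
  qed
  finally have EV: "(\<integral>g. (?V g)\<^sup>2 \<partial>std_gauss d) \<le> s\<^sup>2" .
  have "measure (std_gauss d) {g \<in> space (std_gauss d). 3 * s \<le> \<bar>?V g\<bar>} \<le> (\<integral>g. (?V g)\<^sup>2 / (3 * s)\<^sup>2 \<partial>std_gauss d)"
  proof -
    have "measure (std_gauss d) {g \<in> space (std_gauss d). 3 * s \<le> \<bar>?V g\<bar>} = (\<integral>g. indicator {g \<in> space (std_gauss d). 3 * s \<le> \<bar>?V g\<bar>} g \<partial>std_gauss d)"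
      by simp
    also have "\<dots> \<le> (\<integral>g. (?V g)\<^sup>2 / (3 * s)\<^sup>2 \<partial>std_gauss d)"
    proof (rule integral_mono)
      show "integrable (std_gauss d) (\<lambda>g. indicator {g \<in> space (std_gauss d). 3 * s \<le> \<bar>?V g\<bar>} g :: real)"
        by (rule integrable_real_indicator) (measurable, simp add: gauss.emeasure_eq_measure)
      show "integrable (std_gauss d) (\<lambda>g. (?V g)\<^sup>2 / (3 * s)\<^sup>2)" using iV by simp
      fix g
      have "1 \<le> (?V g)\<^sup>2 / (3 * s)\<^sup>2" if "3 * s \<le> \<bar>?V g\<bar>"
        using power_mono[OF that, of 2] s0 by simp
      then show "indicator {g \<in> space (std_gauss d). 3 * s \<le> \<bar>?V g\<bar>} g \<le> (?V g)\<^sup>2 / (3 * s)\<^sup>2"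
        by (auto simp: indicator_def)
    qed
    finally show ?thesis .
  qed
  also have "\<dots> = (\<integral>g. (?V g)\<^sup>2 \<partial>std_gauss d) / (9 * s\<^sup>2)" by (simp add: power_mult_distrib)
  also have "\<dots> \<le> s\<^sup>2 / (9 * s\<^sup>2)" using EV s0 by (intro divide_right_mono) auto
  also have "\<dots> \<le> 1 / 8" using s0 by simp
  finally show ?thesis .
qed

lemma bprob_eq_measure: "bprob d t y \<tau> = measure (std_gauss d) {g \<in> space (std_gauss d). sqn d (\<lambda>i. y i + \<tau> * g i) \<le> t}"
proof -
  have "bprob d t y \<tau> = (\<integral>g. indicator {g \<in> space (std_gauss d). sqn d (\<lambda>i. y i + \<tau> * g i) \<le> t} g \<partial>std_gauss d)"
    unfolding bprob_def ballind_def by (intro Bochner_Integration.integral_cong refl) (auto simp: indicator_def)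
  then show ?thesis by simp
qed

text \<open>The threshold is the mean of |y + \<tau> g|^2 plus three units 3 \<tau> |y| + 2 \<tau>^2
  sqrt d at |y| = \<rho>. At |y| = \<rho> + 15 \<tau> even the mean minus three units lies above it.
  The hypothesis on \<rho> bounds \<tau>^2 sqrt d by \<tau> \<rho>, so that a window proportional to
  \<tau> in the distance suffices.\<close>

lemma bprob_thresholds:
  assumes d: "1 \<le> d" and \<tau>: "0 < \<tau>" and \<rho>: "\<tau> * sqrt d \<le> \<rho>"
  shows "\<exists>t. (\<forall>y. sqn d y \<le> \<rho>\<^sup>2 \<longrightarrow> 7 / 8 \<le> bprob d t y \<tau>) \<and> (\<forall>y. (\<rho> + 15 * \<tau>)\<^sup>2 \<le> sqn d y \<longrightarrow> bprob d t y \<tau> \<le> 1 / 8)"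
proof -
  define t where "t = \<rho>\<^sup>2 + \<tau>\<^sup>2 * d + 3 * (3 * \<tau> * \<rho> + 2 * \<tau>\<^sup>2 * sqrt d)"
  have \<rho>0: "0 \<le> \<rho>" using \<tau> \<rho> by (meson less_imp_le mult_nonneg_nonneg order_trans real_sqrt_ge_zero of_nat_0_le_iff)
  show ?thesis
  proof (intro exI[of _ t] conjI allI impI)
    fix y assume y: "sqn d y \<le> \<rho>\<^sup>2"
    then have sy: "sqrt (sqn d y) \<le> \<rho>" using \<rho>0 real_le_lsqrt by blast
    let ?s = "3 * \<tau> * sqrt (sqn d y) + 2 * \<tau>\<^sup>2 * sqrt d"
    have "3 * ?s \<le> 3 * (3 * \<tau> * \<rho> + 2 * \<tau>\<^sup>2 * sqrt d)"
      using sy \<tau> by (intro mult_left_mono add_mono) auto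
    then have le: "sqn d y + \<tau>\<^sup>2 * d + 3 * ?s \<le> t" using y unfolding t_def by linarith
    have "1 - bprob d t y \<tau> = measure (std_gauss d) {g \<in> space (std_gauss d). \<not> sqn d (\<lambda>i. y i + \<tau> * g i) \<le> t}"
      unfolding bprob_eq_measure by (rule gauss.prob_neg[symmetric]) measurable
    also have "\<dots> \<le> measure (std_gauss d) {g \<in> space (std_gauss d). 3 * ?s \<le> \<bar>sqn d (\<lambda>i. y i + \<tau> * g i) - sqn d y - \<tau>\<^sup>2 * d\<bar>}"
      using le by (intro gauss.finite_measure_mono) (auto, measurable)
    also have "\<dots> \<le> 1 / 8" by (rule noisy_sqn_deviation[OF \<tau> d])
    finally show "7 / 8 \<le> bprob d t y \<tau>" by simp
  next
    fix y assume y: "(\<rho> + 15 * \<tau>)\<^sup>2 \<le> sqn d y"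
    define x where "x = sqrt (sqn d y)"
    have x: "\<rho> + 15 * \<tau> \<le> x" using y \<rho>0 \<tau> by (simp add: x_def real_le_rsqrt)
    have x2: "sqn d y = x\<^sup>2" by (simp add: x_def)
    \<comment> \<open>Three units on either side require x^2 - 9 \<tau> x > \<rho>^2 + 9 \<tau>
      \<rho> + 12 \<tau>^2 sqrt d, and the right side is at most \<rho>^2 + 21 \<tau> \<rho>. The
      width 15 is found from 15 + (15 - 9) = 21.\<close>
    have "(\<rho> + 15 * \<tau>) * (\<rho> + 6 * \<tau>) \<le> x * (x - 9 * \<tau>)"
      using x \<rho>0 \<tau> by (intro mult_mono) auto
    moreover have "(\<rho> + 15 * \<tau>) * (\<rho> + 6 * \<tau>) = \<rho>\<^sup>2 + 21 * (\<tau> * \<rho>) + 90 * \<tau>\<^sup>2" by (simp add: power2_eq_square algebra_simps)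
    moreover have "\<tau>\<^sup>2 * sqrt d \<le> \<tau> * \<rho>" using \<rho> \<tau> by (simp add: power2_eq_square)
    moreover have "0 < \<tau>\<^sup>2" using \<tau> by simp
    moreover have "x * (x - 9 * \<tau>) = x\<^sup>2 - 9 * (\<tau> * x)" by (simp add: power2_eq_square algebra_simps)
    moreover have e: "3 * (3 * \<tau> * z + 2 * \<tau>\<^sup>2 * sqrt d) = 9 * (\<tau> * z) + 6 * (\<tau>\<^sup>2 * sqrt d)" for z by simp
    ultimately have lt: "t < sqn d y + \<tau>\<^sup>2 * d - 3 * (3 * \<tau> * sqrt (sqn d y) + 2 * \<tau>\<^sup>2 * sqrt d)"
      unfolding t_def x_def[symmetric] unfolding x2 using e[of \<rho>] e[of x] by linarith
    have "bprob d t y \<tau> \<le> measure (std_gauss d) {g \<in> space (std_gauss d). 3 * (3 * \<tau> * sqrt (sqn d y) + 2 * \<tau>\<^sup>2 * sqrt d) \<le> \<bar>sqn d (\<lambda>i. y i + \<tau> * g i) - sqn d y - \<tau>\<^sup>2 * d\<bar>}"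
      unfolding bprob_eq_measure using lt by (intro gauss.finite_measure_mono) (auto, measurable)
    also have "\<dots> \<le> 1 / 8" by (rule noisy_sqn_deviation[OF \<tau> d])
    finally show "bprob d t y \<tau> \<le> 1 / 8" .
  qed
qed

section \<open>From noisy probabilities back to probabilities of balls\<close>

lemma bprob_antimono:
  assumes d: "1 \<le> d" and \<tau>: "0 < \<tau>" and le: "sqn d y \<le> sqn d y'"
  shows "bprob d t y' \<tau> \<le> bprob d t y \<tau>"
proof -
  have e: "bprob d t y \<tau> = gball d (\<lambda>i. y i / \<tau>) (t / \<tau>\<^sup>2)" for y
  proof -
    have "sqn d (\<lambda>i. y i + \<tau> * g i) = \<tau>\<^sup>2 * sqn d (\<lambda>i. g i + y i / \<tau>)" for g
      unfolding sqn_mult[symmetric] using \<tau> by (simp add: algebra_simps)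
    then show ?thesis unfolding bprob_eq_measure gball_def using \<tau> by (simp add: pos_le_divide_eq mult.commute)
  qed
  show ?thesis unfolding e using le \<tau> by (intro gball_antimono d) (simp add: Z.sqn_div divide_right_mono)
qed

text \<open>A nonempty proper down-closed set of reals is a closed or an open half-line, and the
  measure of the open one is a left limit of those of closed ones, under which the bound
  survives.\<close>

lemma downset_prob_close:
  fixes f :: "'b \<Rightarrow> real" and f' :: "'c \<Rightarrow> real"
  assumes N: "prob_space N" and N': "prob_space N'"
    and [measurable]: "f \<in> borel_measurable N" "f' \<in> borel_measurable N'"
    and close: "\<And>t. \<bar>measure N {v \<in> space N. f v \<le> t} - measure N' {v \<in> space N'. f' v \<le> t}\<bar> \<le> \<Delta>"
    and T: "\<And>x y. x \<in> T \<Longrightarrow> y \<le> x \<Longrightarrow> y \<in> T"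
  shows "\<bar>measure N {v \<in> space N. f v \<in> T} - measure N' {v \<in> space N'. f' v \<in> T}\<bar> \<le> \<Delta>"
proof -
  interpret N: prob_space N by fact
  interpret N': prob_space N' by fact
  have \<Delta>: "0 \<le> \<Delta>" using close[of 0] by linarith
  show ?thesis
  proof (cases "T = {} \<or> T = UNIV")
    case True then show ?thesis using \<Delta> by (auto simp: N.prob_space N'.prob_space)
  next
    case False
    then obtain x z where x: "x \<in> T" and z: "z \<notin> T" by auto
    have "y < z" if "y \<in> T" for y using T[OF that, of z] z by (metis not_le)
    then have bdd: "bdd_above T" by (intro bdd_aboveI[of _ z]) (auto simp: less_imp_le)
    define s where "s = Sup T"
    have lt: "y \<in> T" if "y < s" for y
      using less_cSupD[of T y] that x T unfolding s_def by (metis empty_iff less_imp_le)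
    have ge: "y \<le> s" if "y \<in> T" for y using cSup_upper[OF that bdd] by (simp add: s_def)
    show ?thesis
    proof (cases "s \<in> T")
      case True
      then have "T = {..s}" using T ge by auto
      then show ?thesis using close[of s] by simp
    next
      case F: False
      then have T': "T = {..<s}" using lt ge by (auto simp: less_le)
      interpret R: real_distribution "distr N borel f" unfolding real_distribution_def real_distribution_axioms_def by (simp add: N.prob_space_distr)
      interpret R': real_distribution "distr N' borel f'" unfolding real_distribution_def real_distribution_axioms_def by (simp add: N'.prob_space_distr)
      have c: "cdf (distr N borel f) t = measure N {v \<in> space N. f v \<le> t}" for t
        unfolding cdf_def by (subst measure_distr) (auto intro!: arg_cong[where f = "measure N"])
      have c': "cdf (distr N' borel f') t = measure N' {v \<in> space N'. f' v \<le> t}" for t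
        unfolding cdf_def by (subst measure_distr) (auto intro!: arg_cong[where f = "measure N'"])
      have o: "measure (distr N borel f) {..<s} = measure N {v \<in> space N. f v \<in> T}"
        unfolding T' by (subst measure_distr) (auto intro!: arg_cong[where f = "measure N"])
      have o': "measure (distr N' borel f') {..<s} = measure N' {v \<in> space N'. f' v \<in> T}"
        unfolding T' by (subst measure_distr) (auto intro!: arg_cong[where f = "measure N'"])
      have "((\<lambda>t. \<bar>cdf (distr N borel f) t - cdf (distr N' borel f') t\<bar>) \<longlongrightarrow> \<bar>measure N {v \<in> space N. f v \<in> T} - measure N' {v \<in> space N'. f' v \<in> T}\<bar>) (at_left s)"
        unfolding o[symmetric] o'[symmetric] by (intro tendsto_rabs tendsto_diff R.cdf_at_left R'.cdf_at_left)
      then show ?thesis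
        by (rule tendsto_upperbound) (auto simp: c c' close)
    qed
  qed
qed

text \<open>Layer-cake formula with the level as a uniformly distributed variable, so that Fubini
  for probability spaces applies.\<close>

lemma integral_eq_integral_superlevel:
  fixes q :: "'b \<Rightarrow> real"
  assumes N: "prob_space N" and q[measurable]: "q \<in> borel_measurable N" and b: "\<And>v. 0 \<le> q v" "\<And>v. q v \<le> 1"
  defines "U \<equiv> uniform_measure lborel {0..1 :: real}"
  shows "integrable U (\<lambda>u. measure N {v \<in> space N. u < q v})"
    and "(\<integral>v. q v \<partial>N) = (\<integral>u. measure N {v \<in> space N. u < q v} \<partial>U)"
proof -
  interpret N: prob_space N by fact
  have U: "prob_space U" unfolding U_def by (rule prob_space_uniform_measure) auto
  interpret U: prob_space U by fact
  interpret P: pair_prob_space N U by unfold_locales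
  have [measurable_cong]: "sets U = sets borel" unfolding U_def by simp
  let ?f = "\<lambda>(v, u). of_bool (u < q v) :: real"
  have "integrable (N \<Otimes>\<^sub>M U) ?f"
    by (rule P.integrable_const_bound[where B = 1]) (auto simp: case_prod_beta', measurable)
  note i = this
  have inner: "(\<integral>v. of_bool (u < q v) \<partial>N) = measure N {v \<in> space N. u < q v}" for u
  proof -
    have "(\<integral>v. of_bool (u < q v) \<partial>N) = (\<integral>v. indicator {v \<in> space N. u < q v} v \<partial>N)"
      by (intro Bochner_Integration.integral_cong refl) (auto simp: indicator_def)
    also have "\<dots> = measure N {v \<in> space N. u < q v}" by simp
    finally show ?thesis .
  qed
  have outer: "(\<integral>u. of_bool (u < q v) \<partial>U) = q v" for v
  proof -
    have "(\<integral>u. of_bool (u < q v) \<partial>U) = (\<integral>u. indicator {..<q v} u \<partial>U)"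
      by (intro Bochner_Integration.integral_cong refl) (auto simp: indicator_def)
    also have "\<dots> = measure U {..<q v}" by (simp add: U_def)
    also have "\<dots> = measure lborel ({0..1} \<inter> {..<q v}) / measure lborel {0..1 :: real}"
      unfolding U_def by (rule measure_uniform_measure) auto
    also have "{0..1} \<inter> {..<q v} = {0..<q v}" using b[of v] by auto
    finally show ?thesis using b[of v] by simp
  qed
  show "integrable U (\<lambda>u. measure N {v \<in> space N. u < q v})"
    using P.integrable_snd[OF i] by (simp add: inner)
  show "(\<integral>v. q v \<partial>N) = (\<integral>u. measure N {v \<in> space N. u < q v} \<partial>U)"
    using P.Fubini_integral[OF i] by (simp add: inner outer)
qed

text \<open>In the layer-cake formula the levels in [1/8, 7/8) have weight 3/4 and contribute at
  least \<delta> each; the other levels, of weight 1/4, contribute at least - \<Delta>.\<close>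

lemma smoothing_step:
  fixes q :: "'b \<Rightarrow> real" and q' :: "'c \<Rightarrow> real"
  assumes N: "prob_space N" and N': "prob_space N'"
    and q[measurable]: "q \<in> borel_measurable N" and b: "\<And>v. 0 \<le> q v" "\<And>v. q v \<le> 1"
    and q'[measurable]: "q' \<in> borel_measurable N'" and b': "\<And>v. 0 \<le> q' v" "\<And>v. q' v \<le> 1"
    and all: "\<And>u. \<bar>measure N {v \<in> space N. u < q v} - measure N' {v \<in> space N'. u < q' v}\<bar> \<le> \<Delta>"
    and mid: "\<And>u. 1 / 8 \<le> u \<Longrightarrow> u < 7 / 8 \<Longrightarrow> \<delta> \<le> measure N {v \<in> space N. u < q v} - measure N' {v \<in> space N'. u < q' v}"
  shows "3 / 4 * \<delta> - \<Delta> / 4 \<le> (\<integral>v. q v \<partial>N) - (\<integral>v. q' v \<partial>N')"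
proof -
  define U where "U = uniform_measure lborel {0..1 :: real}"
  have U: "prob_space U" unfolding U_def by (rule prob_space_uniform_measure) auto
  interpret U: prob_space U by fact
  note L = integral_eq_integral_superlevel[OF N q b, folded U_def]
  note L' = integral_eq_integral_superlevel[OF N' q' b', folded U_def]
  have mU: "measure U {1/8..<7/8 :: real} = 3 / 4"
  proof -
    have "measure U {1/8..<7/8 :: real} = measure lborel ({0..1} \<inter> {1/8..<7/8 :: real}) / measure lborel {0..1 :: real}"
      unfolding U_def by (rule measure_uniform_measure) auto
    also have "{0..1} \<inter> {1/8..<7/8} = {1/8..<7/8 :: real}" by auto
    finally show ?thesis by simp
  qed
  have iI: "integrable U (\<lambda>u. indicator {1/8..<7/8} u :: real)"
    by (rule integrable_real_indicator) (auto simp: U_def U.emeasure_eq_measure[unfolded U_def])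
  have "3 / 4 * \<delta> - \<Delta> / 4 = (\<integral>u. - \<Delta> + (\<delta> + \<Delta>) * indicator {1/8..<7/8} u \<partial>U)"
    using iI mU by (simp add: U.prob_space) (simp add: U_def field_simps)
  also have "\<dots> \<le> (\<integral>u. measure N {v \<in> space N. u < q v} - measure N' {v \<in> space N'. u < q' v} \<partial>U)"
  proof (rule integral_mono)
    fix u
    show "- \<Delta> + (\<delta> + \<Delta>) * indicator {1/8..<7/8} u \<le> measure N {v \<in> space N. u < q v} - measure N' {v \<in> space N'. u < q' v}"
      using all[of u] mid[of u] by (cases "u \<in> {1/8..<7/8}") (auto simp: abs_le_iff)
  qed (use iI L(1) L'(1) in auto)
  also have "\<dots> = (\<integral>v. q v \<partial>N) - (\<integral>v. q' v \<partial>N')"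
    using L L' by simp
  finally show ?thesis .
qed

definition sqn_le_prob :: "'b measure \<Rightarrow> nat \<Rightarrow> ('b \<Rightarrow> nat \<Rightarrow> real) \<Rightarrow> (nat \<Rightarrow> real) \<Rightarrow> real \<Rightarrow> real" where
  "sqn_le_prob N d V a t = measure N {v \<in> space N. sqn d (\<lambda>i. V v i - a i) \<le> t}"

text \<open>The smoothing inequality: Gaussian noise of scale \<open>\<tau>\<close> spreads the squared distance of a point to \<open>a\<close>, up to
  its mean shift \<open>\<tau>\<^sup>2 d\<close>, over a window of width \<open>O(\<tau>)\<close> in the distance itself.\<close>

lemma smoothing_inequality:
  fixes N :: "'b measure" and V :: "'b \<Rightarrow> nat \<Rightarrow> real" and N' :: "'c measure" and V' :: "'c \<Rightarrow> nat \<Rightarrow> real"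
  assumes d: "1 \<le> d" and \<tau>: "0 < \<tau>" and N: "prob_space N" and N': "prob_space N'"
    and V[measurable]: "\<And>i. i < d \<Longrightarrow> (\<lambda>v. V v i) \<in> borel_measurable N"
    and V'[measurable]: "\<And>i. i < d \<Longrightarrow> (\<lambda>v. V' v i) \<in> borel_measurable N'"
    and smooth: "\<And>a t. \<bar>(\<integral>v. bprob d t (\<lambda>i. V v i - a i) \<tau> \<partial>N) - (\<integral>v. bprob d t (\<lambda>i. V' v i - a i) \<tau> \<partial>N')\<bar> \<le> D"
    and A: "0 \<le> A"
    and anti: "\<And>a (r :: real) (e :: real). 0 \<le> r \<Longrightarrow> 0 \<le> e \<Longrightarrow> sqn_le_prob N' d V' a ((r + e)\<^sup>2) - sqn_le_prob N' d V' a (r\<^sup>2) \<le> A * e"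
    and small: "\<And>a (\<rho> :: real). 0 \<le> \<rho> \<Longrightarrow> sqn_le_prob N' d V' a (\<rho>\<^sup>2 * d) \<le> A * \<rho>"
  shows "\<bar>sqn_le_prob N d V a t - sqn_le_prob N' d V' a t\<bar> \<le> 2 * D + 47 * A * \<tau>"
proof -
  interpret N: prob_space N by fact
  interpret N': prob_space N' by fact
  let ?p = "sqn_le_prob N d V" and ?p' = "sqn_le_prob N' d V'"
  have m: "(\<lambda>v. sqn d (\<lambda>i. V v i - a i)) \<in> borel_measurable N" "(\<lambda>v. sqn d (\<lambda>i. V' v i - a i)) \<in> borel_measurable N'" for a
    by measurable
  have p01: "0 \<le> ?p a t" "?p a t \<le> 1" "0 \<le> ?p' a t" "?p' a t \<le> 1" for a t unfolding sqn_le_prob_def by auto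
  \<comment> \<open>The supremum runs over all centres and thresholds. It will be bounded by an
    expression that contains one third of it, and the inequality is then solved for it.\<close>
  define S where "S = range (\<lambda>(a, t). \<bar>?p a t - ?p' a t\<bar>)"
  have bdd: "bdd_above S" unfolding S_def
  proof (rule bdd_aboveI)
    fix x assume "x \<in> range (\<lambda>(a, t). \<bar>?p a t - ?p' a t\<bar>)"
    then obtain a t where "x = \<bar>?p a t - ?p' a t\<bar>" by auto
    then show "x \<le> 1" using p01[of a t] by (simp add: abs_le_iff)
  qed
  define \<Delta> where "\<Delta> = Sup S"
  have \<Delta>: "\<bar>?p a t - ?p' a t\<bar> \<le> \<Delta>" for a t unfolding \<Delta>_def by (rule cSup_upper[OF _ bdd]) (auto simp: S_def)
  have mono: "?p a s \<le> ?p a t" "?p' a s \<le> ?p' a t" if "s \<le> t" for a s t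
    unfolding sqn_le_prob_def using that m[of a]
    by (auto intro!: N.finite_measure_mono N'.finite_measure_mono)
  \<comment> \<open>By \<open>bprob_antimono\<close> a superlevel set of the noisy probability is a
    down-closed condition on |y|^2, so it is again governed by \<open>\<Delta>\<close>.\<close>
  have levels: "\<bar>measure N {v \<in> space N. u < bprob d t (\<lambda>i. V v i - a i) \<tau>} - measure N' {v \<in> space N'. u < bprob d t (\<lambda>i. V' v i - a i) \<tau>}\<bar> \<le> \<Delta>" for a t u
  proof -
    define T where "T = {s. \<exists>y. u < bprob d t y \<tau> \<and> s \<le> sqn d y}"
    have T: "u < bprob d t y \<tau> \<longleftrightarrow> sqn d y \<in> T" for y
      unfolding T_def using bprob_antimono[OF d \<tau>, of y _ t] by (auto intro: less_le_trans)
    show ?thesis unfolding T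
      by (rule downset_prob_close[OF N N' m]) (use \<Delta>[of a] in \<open>auto simp: sqn_le_prob_def T_def intro: order_trans\<close>)
  qed
  have bm: "(\<lambda>v. bprob d t (\<lambda>i. V v i - a i) \<tau>) \<in> borel_measurable N" "(\<lambda>v. bprob d t (\<lambda>i. V' v i - a i) \<tau>) \<in> borel_measurable N'" for a t
    by measurable
  \<comment> \<open>This is the inequality of \<open>smoothing_step\<close> times 4/3, which turns
    \<Delta> / 4 into \<Delta> / 3; anticoncentration of \<open>V'\<close> then undoes the widening
    of the radius by 15 \<tau>.\<close>
  have key1: "?p a (\<rho>\<^sup>2) - ?p' a (\<rho>\<^sup>2) \<le> 4 / 3 * D + 15 * A * \<tau> + \<Delta> / 3" if \<rho>: "\<tau> * sqrt d \<le> \<rho>" for a \<rho>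
  proof -
    obtain t where t: "\<And>y. sqn d y \<le> \<rho>\<^sup>2 \<Longrightarrow> 7 / 8 \<le> bprob d t y \<tau>" "\<And>y. (\<rho> + 15 * \<tau>)\<^sup>2 \<le> sqn d y \<Longrightarrow> bprob d t y \<tau> \<le> 1 / 8"
      using bprob_thresholds[OF d \<tau> \<rho>] by blast
    have \<rho>0: "0 \<le> \<rho>" using \<tau> \<rho> by (meson less_imp_le mult_nonneg_nonneg order_trans real_sqrt_ge_zero of_nat_0_le_iff)
    have "3 / 4 * (?p a (\<rho>\<^sup>2) - ?p' a ((\<rho> + 15 * \<tau>)\<^sup>2)) - \<Delta> / 4 \<le> (\<integral>v. bprob d t (\<lambda>i. V v i - a i) \<tau> \<partial>N) - (\<integral>v. bprob d t (\<lambda>i. V' v i - a i) \<tau> \<partial>N')"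
    proof (rule smoothing_step[OF N N' bm(1) bprob_bounds bm(2) bprob_bounds levels])
      fix u :: real assume u: "1 / 8 \<le> u" "u < 7 / 8"
      have t2': "sqn d y \<le> (\<rho> + 15 * \<tau>)\<^sup>2" if "u < bprob d t y \<tau>" for y
        by (rule ccontr) (use t(2)[of y] that u in auto)
      have "?p a (\<rho>\<^sup>2) \<le> measure N {v \<in> space N. u < bprob d t (\<lambda>i. V v i - a i) \<tau>}"
        unfolding sqn_le_prob_def using bm(1)[of t a] by (intro N.finite_measure_mono) (auto intro: order.strict_trans2[OF u(2) t(1)])
      moreover have "measure N' {v \<in> space N'. u < bprob d t (\<lambda>i. V' v i - a i) \<tau>} \<le> ?p' a ((\<rho> + 15 * \<tau>)\<^sup>2)"
        unfolding sqn_le_prob_def using m(2)[of a] by (intro N'.finite_measure_mono) (auto intro: t2')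
      ultimately show "?p a (\<rho>\<^sup>2) - ?p' a ((\<rho> + 15 * \<tau>)\<^sup>2) \<le> measure N {v \<in> space N. u < bprob d t (\<lambda>i. V v i - a i) \<tau>} - measure N' {v \<in> space N'. u < bprob d t (\<lambda>i. V' v i - a i) \<tau>}"
        by linarith
    qed
    moreover have "?p' a ((\<rho> + 15 * \<tau>)\<^sup>2) - ?p' a (\<rho>\<^sup>2) \<le> A * (15 * \<tau>)" using anti[of \<rho> "15 * \<tau>" a] \<rho>0 \<tau> by simp
    ultimately show ?thesis using smooth[where a = a and t = t] by (simp add: abs_le_iff algebra_simps)
  qed
  have key2: "?p' a ((\<rho> + 15 * \<tau>)\<^sup>2) - ?p a ((\<rho> + 15 * \<tau>)\<^sup>2) \<le> 4 / 3 * D + 15 * A * \<tau> + \<Delta> / 3" if \<rho>: "\<tau> * sqrt d \<le> \<rho>" for a \<rho>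
  proof -
    obtain t where t: "\<And>y. sqn d y \<le> \<rho>\<^sup>2 \<Longrightarrow> 7 / 8 \<le> bprob d t y \<tau>" "\<And>y. (\<rho> + 15 * \<tau>)\<^sup>2 \<le> sqn d y \<Longrightarrow> bprob d t y \<tau> \<le> 1 / 8"
      using bprob_thresholds[OF d \<tau> \<rho>] by blast
    have \<rho>0: "0 \<le> \<rho>" using \<tau> \<rho> by (meson less_imp_le mult_nonneg_nonneg order_trans real_sqrt_ge_zero of_nat_0_le_iff)
    have "3 / 4 * (?p' a (\<rho>\<^sup>2) - ?p a ((\<rho> + 15 * \<tau>)\<^sup>2)) - \<Delta> / 4 \<le> (\<integral>v. bprob d t (\<lambda>i. V' v i - a i) \<tau> \<partial>N') - (\<integral>v. bprob d t (\<lambda>i. V v i - a i) \<tau> \<partial>N)"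
    proof (rule smoothing_step[OF N' N bm(2) bprob_bounds bm(1) bprob_bounds])
      show "\<bar>measure N' {v \<in> space N'. u < bprob d t (\<lambda>i. V' v i - a i) \<tau>} - measure N {v \<in> space N. u < bprob d t (\<lambda>i. V v i - a i) \<tau>}\<bar> \<le> \<Delta>" for u
        using levels[of u t a] by (simp add: abs_minus_commute)
      fix u :: real assume u: "1 / 8 \<le> u" "u < 7 / 8"
      have t2': "sqn d y \<le> (\<rho> + 15 * \<tau>)\<^sup>2" if "u < bprob d t y \<tau>" for y
        by (rule ccontr) (use t(2)[of y] that u in auto)
      have "?p' a (\<rho>\<^sup>2) \<le> measure N' {v \<in> space N'. u < bprob d t (\<lambda>i. V' v i - a i) \<tau>}"
        unfolding sqn_le_prob_def using bm(2)[of t a] by (intro N'.finite_measure_mono) (auto intro: order.strict_trans2[OF u(2) t(1)])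
      moreover have "measure N {v \<in> space N. u < bprob d t (\<lambda>i. V v i - a i) \<tau>} \<le> ?p a ((\<rho> + 15 * \<tau>)\<^sup>2)"
        unfolding sqn_le_prob_def using m(1)[of a] by (intro N.finite_measure_mono) (auto intro: t2')
      ultimately show "?p' a (\<rho>\<^sup>2) - ?p a ((\<rho> + 15 * \<tau>)\<^sup>2) \<le> measure N' {v \<in> space N'. u < bprob d t (\<lambda>i. V' v i - a i) \<tau>} - measure N {v \<in> space N. u < bprob d t (\<lambda>i. V v i - a i) \<tau>}"
        by linarith
    qed
    moreover have "?p' a ((\<rho> + 15 * \<tau>)\<^sup>2) - ?p' a (\<rho>\<^sup>2) \<le> A * (15 * \<tau>)" using anti[of \<rho> "15 * \<tau>" a] \<rho>0 \<tau> by simp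
    ultimately show ?thesis using smooth[where a = a and t = t] by (simp add: abs_le_iff algebra_simps)
  qed
  have sd: "1 \<le> sqrt d" using d by simp
  \<comment> \<open>Radii too small for \<open>bprob_thresholds\<close> are left to the small ball
    bound. As 1 \<le> sqrt d, every radius below \<tau> sqrt d + 15 \<tau> is at most 16 \<tau> sqrt
    d; in \<open>?B\<close> below, 31 = 15 + 16.\<close>
  have small': "?p' a t \<le> 16 * A * \<tau>" if t: "t \<le> (16 * \<tau> * sqrt d)\<^sup>2" for a t
  proof -
    have "?p' a t \<le> ?p' a ((16 * \<tau>)\<^sup>2 * d)" using t by (intro mono) (simp add: power_mult_distrib)
    also have "\<dots> \<le> A * (16 * \<tau>)" using \<tau> by (intro small) simp
    finally show ?thesis by simp
  qed
  let ?B = "4 / 3 * D + 31 * A * \<tau> + \<Delta> / 3"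
  have nonneg: "0 \<le> D" "0 \<le> \<Delta>" "0 \<le> A * \<tau>" using smooth[of 0 "\<lambda>_. 0"] \<Delta>[of "\<lambda>_. 0" 0] A \<tau> by (auto intro: order_trans[OF abs_ge_zero])
  have B: "?p a t - ?p' a t \<le> ?B \<and> ?p' a t - ?p a t \<le> ?B" for a t
  proof (cases "t < 0")
    case True
    then have "{v \<in> space N. sqn d (\<lambda>i. V v i - a i) \<le> t} = {}" "{v \<in> space N'. sqn d (\<lambda>i. V' v i - a i) \<le> t} = {}"
      using sqn_nonneg by (auto simp: not_le intro: less_le_trans)
    then have "?p a t = 0" "?p' a t = 0" unfolding sqn_le_prob_def by (simp_all only: measure_empty)
    then show ?thesis using nonneg by simp
  next
    case t0: False
    define \<rho> where "\<rho> = sqrt t"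
    have \<rho>: "0 \<le> \<rho>" "t = \<rho>\<^sup>2" using t0 by (simp_all add: \<rho>_def)
    have "?p a t - ?p' a t \<le> ?B"
    proof (cases "\<tau> * sqrt d \<le> \<rho>")
      case True then show ?thesis using key1[of \<rho> a] nonneg unfolding \<rho>(2) by linarith
    next
      case False
      have "?p a t \<le> ?p a ((\<tau> * sqrt d)\<^sup>2)" using False \<rho> by (intro mono) (auto intro: power_mono)
      moreover have "?p' a ((\<tau> * sqrt d)\<^sup>2) \<le> 16 * A * \<tau>" using \<tau> by (intro small') (simp add: power_mult_distrib)
      ultimately show ?thesis using key1[of "\<tau> * sqrt d" a] p01[of a t] by linarith
    qed
    moreover have "?p' a t - ?p a t \<le> ?B"
    proof (cases "\<tau> * sqrt d \<le> \<rho> - 15 * \<tau>")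
      case True then show ?thesis using key2[of "\<rho> - 15 * \<tau>" a] nonneg unfolding \<rho>(2) by simp
    next
      case False
      have "15 * \<tau> * 1 \<le> 15 * \<tau> * sqrt d" using sd \<tau> by (intro mult_left_mono) auto
      then have "\<rho> \<le> 16 * \<tau> * sqrt d" using False by simp
      then have "t \<le> (16 * \<tau> * sqrt d)\<^sup>2" unfolding \<rho>(2) using \<rho>(1) by (intro power_mono)
      from small'[OF this, of a] show ?thesis using p01[of a t] nonneg by linarith
    qed
    ultimately show ?thesis ..
  qed
  have "\<Delta> \<le> ?B" unfolding \<Delta>_def
  proof (rule cSup_least)
    fix x assume "x \<in> S"
    then obtain a t where x: "x = \<bar>?p a t - ?p' a t\<bar>" by (auto simp: S_def)
    show "x \<le> 4 / 3 * D + 31 * A * \<tau> + Sup S / 3" using B[of a t] unfolding x \<Delta>_def[symmetric] by (simp add: abs_le_iff)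
  qed (auto simp: S_def)
  \<comment> \<open>Two thirds of \<Delta> are bounded by 4/3 D + 31 A \<tau>; the resulting 46.5 is
    rounded up to 47.\<close>
  then have "\<Delta> \<le> 2 * D + 47 * A * \<tau>" using nonneg by (simp add: algebra_simps)
  then show ?thesis using \<Delta>[of a t] by linarith
qed

section \<open>Anticoncentration of Gaussian quadratic forms\<close>

lemma one_plus_power_le_exp:
  assumes s: "0 \<le> (s :: real)"
  shows "(1 + s) ^ p \<le> (4 * real (Suc p)) ^ Suc p * exp (s / 4)"
proof -
  let ?k = "real (Suc p)"
  have "1 + s \<le> 4 * ?k * (1 + s / (4 * ?k))" using s by (simp add: distrib_left)
  also have "\<dots> \<le> 4 * ?k * exp (s / (4 * ?k))" by (intro mult_left_mono exp_ge_add_one_self) auto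
  finally have "(1 + s) ^ Suc p \<le> (4 * ?k * exp (s / (4 * ?k))) ^ Suc p" using s by (intro power_mono) auto
  also have "\<dots> = (4 * ?k) ^ Suc p * exp (s / (4 * ?k)) ^ Suc p" by (rule power_mult_distrib)
  also have "exp (s / (4 * ?k)) ^ Suc p = exp (s / 4)" by (simp only: exp_of_nat_mult[symmetric]) (simp add: field_simps del: of_nat_Suc)
  finally show ?thesis using s power_increasing[of p "Suc p" "1 + s"] by linarith
qed

text \<open>With \<phi> the normal density, the derivative of \<phi> f is \<phi> f' - x \<phi> f.
  Growth of at most exp(x^2 / 4) is beaten by \<phi>, so the boundary terms at both infinities
  vanish.\<close>

lemma stein_stdN:
  assumes F: "\<And>x. (f has_real_derivative f' x) (at x)" and c: "\<And>x. isCont f' x"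
    and le: "\<And>x. \<bar>f x\<bar> \<le> C * exp (x\<^sup>2 / 4)"
    and i1: "integrable stdN (\<lambda>x. x * f x)" and i2: "integrable stdN f'"
  shows "(\<integral>x. x * f x \<partial>stdN) = (\<integral>x. f' x \<partial>stdN)"
proof -
  let ?\<phi> = std_normal_density
  have f[measurable]: "f \<in> borel_measurable borel"
    using F by (intro borel_measurable_continuous_onI continuous_at_imp_continuous_on) (auto intro: DERIV_isCont)
  have f'[measurable]: "f' \<in> borel_measurable borel"
    using c by (intro borel_measurable_continuous_onI continuous_at_imp_continuous_on) auto
  have C: "0 \<le> C" using le[of 0] by simp
  have d\<phi>: "(?\<phi> has_real_derivative - x * ?\<phi> x) (at x)" for x
  proof -
    define c where "c = 1 / sqrt (2 * pi)"
    have e: "?\<phi> = (\<lambda>x. c * exp (- x\<^sup>2 / 2))" by (auto simp: std_normal_density_def c_def)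
    show ?thesis unfolding e by (auto intro!: derivative_eq_intros)
  qed
  have int: "integrable lborel (\<lambda>x. ?\<phi> x * f' x - ?\<phi> x * (x * f x))"
    using i1 i2 by (simp add: integral_stdN(2))
  have b: "\<bar>?\<phi> x * f x\<bar> \<le> C * exp (- (x\<^sup>2 / 4))" for x
  proof -
    have "?\<phi> x \<le> exp (- x\<^sup>2 / 2)"
      using pi_ge_two unfolding std_normal_density_def by (simp add: divide_le_eq real_le_rsqrt)
    then have "?\<phi> x * \<bar>f x\<bar> \<le> exp (- x\<^sup>2 / 2) * (C * exp (x\<^sup>2 / 4))"
      by (intro mult_mono le) auto
    also have "\<dots> = C * exp (- (x\<^sup>2 / 4))" by (simp add: exp_add[symmetric])
    finally show ?thesis by (simp add: abs_mult)
  qed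
  have lim: "((\<lambda>x. ?\<phi> x * f x) \<longlongrightarrow> 0) at_top" "((\<lambda>x. ?\<phi> x * f x) \<longlongrightarrow> 0) at_bot"
  proof -
    have "((\<lambda>x. C * exp (- (x\<^sup>2 / 4))) \<longlongrightarrow> 0) at_top" by real_asymp
    then show "((\<lambda>x. ?\<phi> x * f x) \<longlongrightarrow> 0) at_top"
      by (rule Lim_null_comparison[rotated]) (use b in auto)
    have "((\<lambda>x. C * exp (- (x\<^sup>2 / 4))) \<longlongrightarrow> 0) at_bot" by real_asymp
    then show "((\<lambda>x. ?\<phi> x * f x) \<longlongrightarrow> 0) at_bot"
      by (rule Lim_null_comparison[rotated]) (use b in auto)
  qed
  have "(LBINT x=-\<infinity>..\<infinity>. ?\<phi> x * f' x - ?\<phi> x * (x * f x)) = 0 - 0"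
  proof (rule interval_integral_FTC_integrable[where F = "\<lambda>x. ?\<phi> x * f x"])
    fix x
    have "((\<lambda>x. ?\<phi> x * f x) has_real_derivative ?\<phi> x * f' x - ?\<phi> x * (x * f x)) (at x)"
      using DERIV_mult[OF d\<phi>[of x] F[of x]] by (simp add: algebra_simps)
    then show "((\<lambda>x. ?\<phi> x * f x) has_vector_derivative ?\<phi> x * f' x - ?\<phi> x * (x * f x)) (at x)"
      by (simp add: has_real_derivative_iff_has_vector_derivative)
    show "isCont (\<lambda>x. ?\<phi> x * f' x - ?\<phi> x * (x * f x)) x"
      using c[of x] DERIV_isCont[OF F[of x]] DERIV_isCont[OF d\<phi>[of x]] by (intro continuous_intros)
  next
    show "set_integrable lborel (einterval (- \<infinity>) \<infinity>) (\<lambda>x. ?\<phi> x * f' x - ?\<phi> x * (x * f x))"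
      using int by (simp add: set_integrable_def einterval_def)
    show "(((\<lambda>x. ?\<phi> x * f x) \<circ> real_of_ereal) \<longlongrightarrow> 0) (at_right (- \<infinity>))"
      using lim(2) by (simp add: ereal_tendsto_simps)
    show "(((\<lambda>x. ?\<phi> x * f x) \<circ> real_of_ereal) \<longlongrightarrow> 0) (at_left \<infinity>)"
      using lim(1) by (simp add: ereal_tendsto_simps)
  qed simp
  then have "(\<integral>x. ?\<phi> x * f' x - ?\<phi> x * (x * f x) \<partial>lborel) = 0"
    by (simp add: interval_lebesgue_integral_def set_lebesgue_integral_def einterval_def)
  moreover have "(\<integral>x. ?\<phi> x * f' x - ?\<phi> x * (x * f x) \<partial>lborel) = (\<integral>x. ?\<phi> x * f' x \<partial>lborel) - (\<integral>x. ?\<phi> x * (x * f x) \<partial>lborel)"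
    using i1 i2 by (intro Bochner_Integration.integral_diff) (simp_all add: integral_stdN(2))
  ultimately show ?thesis by (simp add: integral_stdN(1))
qed

text \<open>This class contains coordinates and bounded functions, is closed under sums and
  products, and implies integrability for measurable functions. Integrability of the integrands
  below thus follows from their shape.\<close>

definition poly_growth :: "nat \<Rightarrow> ((nat \<Rightarrow> real) \<Rightarrow> real) \<Rightarrow> bool" where
  "poly_growth d f \<longleftrightarrow> (\<exists>c p. 0 \<le> c \<and> (\<forall>g. \<bar>f g\<bar> \<le> c * (1 + sqn d g) ^ p))"

lemma poly_growth_const: "poly_growth d (\<lambda>_. c)"
  unfolding poly_growth_def by (intro exI[of _ "\<bar>c\<bar>"] exI[of _ 0]) simp

lemma poly_growth_bounded: "(\<And>g. \<bar>f g\<bar> \<le> c) \<Longrightarrow> poly_growth d f"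
  unfolding poly_growth_def by (intro exI[of _ c] exI[of _ 0]) (use order_trans[OF abs_ge_zero] in auto)

lemma poly_growth_coord: "i < d \<Longrightarrow> poly_growth d (\<lambda>g. g i)"
  unfolding poly_growth_def
proof (intro exI[of _ 1] exI[of _ 1] conjI allI)
  fix g :: "nat \<Rightarrow> real" assume i: "i < d"
  have "0 \<le> (\<bar>g i\<bar> - 1)\<^sup>2" by simp
  then have "2 * \<bar>g i\<bar> \<le> 1 + (g i)\<^sup>2" by (simp add: power2_eq_square algebra_simps)
  moreover have "(g i)\<^sup>2 \<le> sqn d g" using Z.coord_le[OF i, of g] .
  ultimately show "\<bar>g i\<bar> \<le> 1 * (1 + sqn d g) ^ 1" using zero_le_power2[of "g i"] by simp
qed simp

lemma poly_growth_mult: "poly_growth d f \<Longrightarrow> poly_growth d h \<Longrightarrow> poly_growth d (\<lambda>g. f g * h g)"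
proof -
  assume "poly_growth d f" "poly_growth d h"
  then obtain c p c' p' where c: "0 \<le> c" "\<And>g. \<bar>f g\<bar> \<le> c * (1 + sqn d g) ^ p" and c': "0 \<le> c'" "\<And>g. \<bar>h g\<bar> \<le> c' * (1 + sqn d g) ^ p'"
    unfolding poly_growth_def by auto
  have "\<bar>f g * h g\<bar> \<le> (c * c') * (1 + sqn d g) ^ (p + p')" for g
  proof -
    have "\<bar>f g * h g\<bar> \<le> (c * (1 + sqn d g) ^ p) * (c' * (1 + sqn d g) ^ p')"
      unfolding abs_mult using c c' by (intro mult_mono) auto
    then show ?thesis by (simp add: power_add ac_simps)
  qed
  then show ?thesis unfolding poly_growth_def using c(1) c'(1) by (intro exI[of _ "c * c'"] exI[of _ "p + p'"]) auto
qed

lemma poly_growth_add: "poly_growth d f \<Longrightarrow> poly_growth d h \<Longrightarrow> poly_growth d (\<lambda>g. f g + h g)"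
proof -
  assume "poly_growth d f" "poly_growth d h"
  then obtain c p c' p' where c: "0 \<le> c" "\<And>g. \<bar>f g\<bar> \<le> c * (1 + sqn d g) ^ p" and c': "0 \<le> c'" "\<And>g. \<bar>h g\<bar> \<le> c' * (1 + sqn d g) ^ p'"
    unfolding poly_growth_def by auto
  have "\<bar>f g + h g\<bar> \<le> (c + c') * (1 + sqn d g) ^ (p + p')" for g
  proof -
    have "(1 + sqn d g) ^ p \<le> (1 + sqn d g) ^ (p + p')" "(1 + sqn d g) ^ p' \<le> (1 + sqn d g) ^ (p + p')"
      by (intro power_increasing; simp)+
    then have "c * (1 + sqn d g) ^ p \<le> c * (1 + sqn d g) ^ (p + p')" "c' * (1 + sqn d g) ^ p' \<le> c' * (1 + sqn d g) ^ (p + p')"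
      using c(1) c'(1) by (auto intro: mult_left_mono)
    then show ?thesis using c(2)[of g] c'(2)[of g] abs_triangle_ineq[of "f g" "h g"] by (simp add: distrib_right)
  qed
  then show ?thesis unfolding poly_growth_def using c(1) c'(1) by (intro exI[of _ "c + c'"] exI[of _ "p + p'"]) auto
qed

lemma poly_growth_diff: "poly_growth d f \<Longrightarrow> poly_growth d h \<Longrightarrow> poly_growth d (\<lambda>g. f g - h g)"
  using poly_growth_add[of d f "\<lambda>g. (- 1) * h g"] poly_growth_mult[OF poly_growth_const[of d "- 1"], of h] by simp

lemma poly_growth_sum:
  fixes n :: nat
  shows "(\<And>i. i < n \<Longrightarrow> poly_growth d (f i)) \<Longrightarrow> poly_growth d (\<lambda>g. \<Sum>i<n. f i g)"
  by (induction n) (auto intro: poly_growth_add poly_growth_const)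

lemma poly_growth_power: "poly_growth d f \<Longrightarrow> poly_growth d (\<lambda>g. (f g) ^ n)"
  by (induction n) (auto intro: poly_growth_mult poly_growth_const)

lemmas poly_growth_intros = poly_growth_const poly_growth_coord poly_growth_mult poly_growth_add poly_growth_diff
  poly_growth_sum poly_growth_power

lemma integrable_poly_growth:
  assumes "f \<in> borel_measurable (std_gauss d)" "poly_growth d f"
  shows "integrable (std_gauss d) f"
proof -
  obtain c p where c: "\<And>g. \<bar>f g\<bar> \<le> c * (1 + sqn d g) ^ p" using assms(2) unfolding poly_growth_def by auto
  show ?thesis
  proof (rule Bochner_Integration.integrable_bound)
    show "integrable (std_gauss d) (\<lambda>g. c * (1 + sqn d g) ^ p)" by (intro integrable_mult_right integrable_std_gauss_sqn_power)
    show "AE g in std_gauss d. norm (f g) \<le> norm (c * (1 + sqn d g) ^ p)"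
      using c by (intro AE_I2) (metis abs_ge_self order_trans real_norm_def)
  qed fact
qed

lemma sqn_fun_upd_le: "i < d \<Longrightarrow> sqn d (g(i := x)) \<le> sqn d g + x\<^sup>2"
proof -
  assume i: "i < d"
  have "sqn d (g(i := x)) = (\<Sum>j<d. if j = i then x\<^sup>2 else (g j)\<^sup>2)" unfolding sqn_def by (intro sum.cong) auto
  also have "\<dots> \<le> (\<Sum>j<d. (g j)\<^sup>2 + (if j = i then x\<^sup>2 else 0))" by (intro sum_mono) auto
  also have "\<dots> = sqn d g + x\<^sup>2" using i by (simp add: sum.distrib sqn_def)
  finally show ?thesis .
qed

text \<open>Fubini isolates coordinate \<open>i\<close>, and \<open>stein_stdN\<close> is applied to
  each section. Polynomial growth passes to the sections, with a constant that depends on the other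
  coordinates.\<close>

lemma stein_coordinate:
  assumes i: "i < d"
    and m: "f \<in> borel_measurable (std_gauss d)" "f' \<in> borel_measurable (std_gauss d)"
    and g: "poly_growth d f" "poly_growth d f'"
    and D: "\<And>g x. ((\<lambda>x. f (g(i := x))) has_real_derivative f' (g(i := x))) (at x)"
    and c: "\<And>g x. isCont (\<lambda>x. f' (g(i := x))) x"
  shows "(\<integral>g. g i * f g \<partial>std_gauss d) = (\<integral>g. f' g \<partial>std_gauss d)"
proof -
  define J where "J = {..<d} - {i}"
  have J: "finite J" "i \<notin> J" "insert i J = {..<d}" using i by (auto simp: J_def)
  have I1: "integrable (std_gauss d) (\<lambda>g. g i * f g)"
    using i by (intro integrable_poly_growth poly_growth_intros g borel_measurable_times m) measurable
  have I2: "integrable (std_gauss d) f'" by (intro integrable_poly_growth m g)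
  obtain k p where k: "0 \<le> k" "\<And>g. \<bar>f g\<bar> \<le> k * (1 + sqn d g) ^ p" using g(1) unfolding poly_growth_def by auto
  obtain k' p' where k': "0 \<le> k'" "\<And>g. \<bar>f' g\<bar> \<le> k' * (1 + sqn d g) ^ p'" using g(2) unfolding poly_growth_def by auto
  have sec: "\<exists>C. \<forall>x. \<bar>h (g(i := x))\<bar> \<le> C * (1 + x\<^sup>2) ^ p"
    if h: "\<And>g. \<bar>h g\<bar> \<le> k * (1 + sqn d g) ^ p" "0 \<le> k" for h :: "(nat \<Rightarrow> real) \<Rightarrow> real" and k p g
  proof (intro exI allI)
    fix x
    have "1 + sqn d (g(i := x)) \<le> (1 + sqn d g) * (1 + x\<^sup>2)"
    proof -
      have "(1 + sqn d g) * (1 + x\<^sup>2) = 1 + (sqn d g + x\<^sup>2) + sqn d g * x\<^sup>2" by (simp add: algebra_simps)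
      then show ?thesis
        using sqn_fun_upd_le[OF i, of g x] mult_nonneg_nonneg[OF sqn_nonneg[of d g] zero_le_power2[of x]] by linarith
    qed
    then have "(1 + sqn d (g(i := x))) ^ p \<le> ((1 + sqn d g) * (1 + x\<^sup>2)) ^ p" by (intro power_mono) auto
    then have "k * (1 + sqn d (g(i := x))) ^ p \<le> k * ((1 + sqn d g) * (1 + x\<^sup>2)) ^ p" using h(2) by (intro mult_left_mono)
    then show "\<bar>h (g(i := x))\<bar> \<le> (k * (1 + sqn d g) ^ p) * (1 + x\<^sup>2) ^ p"
      using h(1)[of "g(i := x)"] by (simp add: power_mult_distrib ac_simps)
  qed
  have poly_int: "integrable stdN (\<lambda>x. (1 + x\<^sup>2) ^ p)" for p
  proof -
    have "1 + x\<^sup>2 \<le> exp (x\<^sup>2)" for x :: real by (rule exp_ge_add_one_self)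
    have "integrable (std_gauss 1) (\<lambda>g. (1 + sqn 1 g) ^ p)" by (rule integrable_std_gauss_sqn_power)
    then have "integrable (std_gauss 1) (\<lambda>g. (1 + (g 0)\<^sup>2) ^ p)" by (simp add: sqn_def)
    then have "integrable (distr (std_gauss 1) borel (\<lambda>g. g 0)) (\<lambda>x. (1 + x\<^sup>2) ^ p)"
      by (subst integrable_distr_eq) auto
    then have "integrable (distr stdN borel (\<lambda>x. x)) (\<lambda>x. (1 + x\<^sup>2) ^ p)"
      using distr_std_gauss_coord[of "\<lambda>x. x" 0 1] by simp
    then show ?thesis by (subst (asm) integrable_distr_eq) auto
  qed
  have inner: "(\<integral>x. x * f (g(i := x)) \<partial>stdN) = (\<integral>x. f' (g(i := x)) \<partial>stdN)" for g
  proof -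
    have "\<exists>C. \<forall>x. \<bar>f (g(i := x))\<bar> \<le> C * (1 + x\<^sup>2) ^ p" by (rule sec[OF k(2) k(1)])
    then obtain C where C: "\<And>x. \<bar>f (g(i := x))\<bar> \<le> C * (1 + x\<^sup>2) ^ p" by blast
    have "\<exists>C. \<forall>x. \<bar>f' (g(i := x))\<bar> \<le> C * (1 + x\<^sup>2) ^ p'" by (rule sec[OF k'(2) k'(1)])
    then obtain C' where C': "\<And>x. \<bar>f' (g(i := x))\<bar> \<le> C' * (1 + x\<^sup>2) ^ p'" by blast
    have C0: "0 \<le> C" using C[of 0] by simp
    have mf: "(\<lambda>x. f (g(i := x))) \<in> borel_measurable borel"
      by (intro borel_measurable_continuous_onI continuous_at_imp_continuous_on ballI DERIV_isCont[OF D])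
    have mf': "(\<lambda>x. f' (g(i := x))) \<in> borel_measurable borel"
      by (intro borel_measurable_continuous_onI continuous_at_imp_continuous_on ballI c)
    show ?thesis
    proof (rule stein_stdN[OF D c])
      fix x
      have "C * (1 + x\<^sup>2) ^ p \<le> C * ((4 * real (Suc p)) ^ Suc p * exp (x\<^sup>2 / 4))"
        using C0 by (intro mult_left_mono one_plus_power_le_exp) auto
      then show "\<bar>f (g(i := x))\<bar> \<le> (C * (4 * real (Suc p)) ^ Suc p) * exp (x\<^sup>2 / 4)"
        using C[of x] unfolding mult.assoc by (rule order_trans[rotated])
    next
      show "integrable stdN (\<lambda>x. x * f (g(i := x)))"
      proof (rule Bochner_Integration.integrable_bound)
        show "integrable stdN (\<lambda>x. C * (1 + x\<^sup>2) ^ Suc p)" by (intro integrable_mult_right poly_int)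
        show "(\<lambda>x. x * f (g(i := x))) \<in> borel_measurable stdN" using mf by simp
        show "AE x in stdN. norm (x * f (g(i := x))) \<le> norm (C * (1 + x\<^sup>2) ^ Suc p)"
        proof (intro AE_I2)
          fix x :: real
          have "0 \<le> (\<bar>x\<bar> - 1)\<^sup>2" by simp
          then have "2 * \<bar>x\<bar> \<le> 1 + x\<^sup>2" by (simp add: power2_eq_square algebra_simps)
          then have "\<bar>x\<bar> * \<bar>f (g(i := x))\<bar> \<le> (1 + x\<^sup>2) * (C * (1 + x\<^sup>2) ^ p)"
            using C[of x] by (intro mult_mono) auto
          then show "norm (x * f (g(i := x))) \<le> norm (C * (1 + x\<^sup>2) ^ Suc p)"
            using C0 by (simp add: abs_mult ac_simps)
        qed
      qed
      show "integrable stdN (\<lambda>x. f' (g(i := x)))"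
      proof (rule Bochner_Integration.integrable_bound)
        show "integrable stdN (\<lambda>x. C' * (1 + x\<^sup>2) ^ p')" by (intro integrable_mult_right poly_int)
        show "(\<lambda>x. f' (g(i := x))) \<in> borel_measurable stdN" using mf' by simp
        show "AE x in stdN. norm (f' (g(i := x))) \<le> norm (C' * (1 + x\<^sup>2) ^ p')"
          using C' by (intro AE_I2) (metis abs_ge_self order_trans real_norm_def)
      qed
    qed
  qed
  have ins: "(\<integral>g. h g \<partial>std_gauss d) = (\<integral>g. \<integral>x. h (g(i := x)) \<partial>stdN \<partial>PiM J (\<lambda>_. stdN))"
    if "integrable (std_gauss d) h" for h :: "(nat \<Rightarrow> real) \<Rightarrow> real"
    using stdNs.product_integral_insert[OF J(1,2), of h] that unfolding J(3) std_gauss_def by simp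
  show ?thesis unfolding ins[OF I1] ins[OF I2] using inner by simp
qed

text \<open>The field \<open>v \<mapsto> v\<close>, \<open>v = g + b\<close>, generates the dilations about the centre \<open>- b\<close>.  Integration by parts along it
  only involves the quadratic form \<open>N\<close> and \<open>Q = g \<cdot> v\<close>.\<close>

locale quadratic_form =
  fixes d :: nat and A :: "nat \<Rightarrow> nat \<Rightarrow> real" and b :: "nat \<Rightarrow> real" and lam :: real
  assumes lam: "0 < lam"
    and coercive: "\<And>v. lam\<^sup>2 * sqn d v \<le> (\<Sum>k<d. (\<Sum>j<d. A k j * v j)\<^sup>2)"
begin

definition vec :: "(nat \<Rightarrow> real) \<Rightarrow> nat \<Rightarrow> real" where "vec g i = g i + b i"
definition lin :: "nat \<Rightarrow> (nat \<Rightarrow> real) \<Rightarrow> real" where "lin k g = (\<Sum>j<d. A k j * vec g j)"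
definition N :: "(nat \<Rightarrow> real) \<Rightarrow> real" where "N g = (\<Sum>k<d. (lin k g)\<^sup>2)"
definition Q :: "(nat \<Rightarrow> real) \<Rightarrow> real" where "Q g = (\<Sum>i<d. g i * vec g i)"
definition gradN :: "nat \<Rightarrow> (nat \<Rightarrow> real) \<Rightarrow> real" where "gradN i g = 2 * (\<Sum>k<d. lin k g * A k i)"

lemma N_nonneg: "0 \<le> N g"
  unfolding N_def by (simp add: sum_nonneg)

lemma N_ge: "lam\<^sup>2 * sqn d (vec g) \<le> N g"
  unfolding N_def lin_def by (rule coercive)

lemma vec_measurable [measurable]: "i < d \<Longrightarrow> (\<lambda>g. vec g i) \<in> borel_measurable (std_gauss d)"
  unfolding vec_def by measurable

lemma lin_measurable [measurable]: "lin k \<in> borel_measurable (std_gauss d)"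
  unfolding lin_def[abs_def] by (intro borel_measurable_sum borel_measurable_times borel_measurable_const vec_measurable) auto

lemma N_measurable [measurable]: "N \<in> borel_measurable (std_gauss d)"
  unfolding N_def[abs_def] by measurable

lemma Q_measurable [measurable]: "Q \<in> borel_measurable (std_gauss d)"
  unfolding Q_def[abs_def] by (intro borel_measurable_sum borel_measurable_times vec_measurable) (auto intro: measurable_std_gauss_coord)

lemma gradN_measurable [measurable]: "gradN i \<in> borel_measurable (std_gauss d)"
  unfolding gradN_def[abs_def] by measurable

lemma poly_growth_vec: "i < d \<Longrightarrow> poly_growth d (\<lambda>g. vec g i)"
  unfolding vec_def by (intro poly_growth_intros)

lemma poly_growth_lin: "poly_growth d (lin k)"
  unfolding lin_def[abs_def] by (intro poly_growth_intros poly_growth_vec)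

lemma poly_growth_Q: "poly_growth d Q"
  unfolding Q_def[abs_def] by (intro poly_growth_intros poly_growth_vec)

lemma poly_growth_gradN: "poly_growth d (gradN i)"
  unfolding gradN_def[abs_def] by (intro poly_growth_intros poly_growth_lin)

text \<open>Euler's identity: \<open>N\<close> is homogeneous of degree 2 about the point -
  b.\<close>

lemma euler_N: "(\<Sum>i<d. vec g i * gradN i g) = 2 * N g"
proof -
  have "(\<Sum>i<d. vec g i * gradN i g) = (\<Sum>i<d. \<Sum>k<d. 2 * (lin k g * (A k i * vec g i)))"
    unfolding gradN_def by (simp add: sum_distrib_left ac_simps)
  also have "\<dots> = (\<Sum>k<d. \<Sum>i<d. 2 * (lin k g * (A k i * vec g i)))" by (rule sum.swap)
  also have "\<dots> = 2 * N g" unfolding N_def by (simp add: sum_distrib_left[symmetric] lin_def[symmetric] power2_eq_square)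
  finally show ?thesis .
qed

lemma DERIV_vec: "((\<lambda>x. vec (g(i := x)) j) has_real_derivative (if j = i then 1 else 0)) (at x)"
  unfolding vec_def by (cases "j = i") (auto intro!: derivative_eq_intros)

lemma DERIV_lin: "i < d \<Longrightarrow> ((\<lambda>x. lin k (g(i := x))) has_real_derivative A k i) (at x)"
proof -
  assume i: "i < d"
  have "((\<lambda>x. lin k (g(i := x))) has_real_derivative (\<Sum>j<d. A k j * (if j = i then 1 else 0))) (at x)"
    unfolding lin_def by (intro DERIV_sum DERIV_cmult DERIV_vec)
  then show ?thesis using i by (simp add: if_distrib[of "\<lambda>x. _ * x"] cong: if_cong)
qed

lemma DERIV_N: "i < d \<Longrightarrow> ((\<lambda>x. N (g(i := x))) has_real_derivative gradN i (g(i := x))) (at x)"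
proof -
  assume i: "i < d"
  have "((\<lambda>x. N (g(i := x))) has_real_derivative (\<Sum>k<d. 2 * (lin k (g(i := x)) * A k i))) (at x)"
    unfolding N_def power2_eq_square
    by (intro DERIV_sum) (auto intro!: derivative_eq_intros DERIV_lin[OF i])
  then show ?thesis by (simp add: gradN_def sum_distrib_left)
qed

lemma DERIV_Q: "i < d \<Longrightarrow> ((\<lambda>x. Q (g(i := x))) has_real_derivative vec (g(i := x)) i + x) (at x)"
proof -
  assume i: "i < d"
  have "((\<lambda>x. Q (g(i := x))) has_real_derivative (\<Sum>j<d. if j = i then vec (g(i := x)) i + x else 0)) (at x)"
    unfolding Q_def
  proof (intro DERIV_sum)
    fix j assume "j \<in> {..<d}"
    show "((\<lambda>x. (g(i := x)) j * vec (g(i := x)) j) has_real_derivative (if j = i then vec (g(i := x)) i + x else 0)) (at x)"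
      unfolding vec_def by (cases "j = i") (auto intro!: derivative_eq_intros)
  qed
  then show ?thesis using i by simp
qed

lemma isCont_vec: "isCont (\<lambda>x. vec (g(i := x)) j) x"
  by (rule DERIV_isCont[OF DERIV_vec])

lemma isCont_gradN: "i < d \<Longrightarrow> isCont (\<lambda>x. gradN j (g(i := x))) x"
  unfolding gradN_def by (intro continuous_intros DERIV_isCont[OF DERIV_lin])

text \<open>Stein's identity for the field \<open>vec\<close> times a function, summed over the
  coordinates. The divergence of \<open>vec\<close> is \<open>d\<close>, hence
  \<open>Q g - d\<close> on the left; along the field the derivative of \<open>Q\<close> is |v|^2 +
  \<open>Q\<close> and that of \<open>N\<close> is 2 \<open>N\<close>. So nothing but |v|^2,
  \<open>Q\<close> and \<open>N\<close> arises.\<close>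

lemma integration_by_parts:
  assumes D\<alpha>: "\<And>t. 0 \<le> t \<Longrightarrow> (\<alpha> has_real_derivative \<alpha>' t) (at t)" and D\<beta>: "\<And>t. 0 \<le> t \<Longrightarrow> (\<beta> has_real_derivative \<beta>' t) (at t)"
    and c: "\<And>t. 0 \<le> t \<Longrightarrow> isCont \<alpha>' t" "\<And>t. 0 \<le> t \<Longrightarrow> isCont \<beta>' t"
    and [measurable]: "\<alpha> \<in> borel_measurable borel" "\<beta> \<in> borel_measurable borel" "\<alpha>' \<in> borel_measurable borel" "\<beta>' \<in> borel_measurable borel"
    and bd: "\<And>t. 0 \<le> t \<Longrightarrow> \<bar>\<alpha> t\<bar> \<le> B" "\<And>t. 0 \<le> t \<Longrightarrow> \<bar>\<beta> t\<bar> \<le> B" "\<And>t. 0 \<le> t \<Longrightarrow> \<bar>\<alpha>' t\<bar> \<le> B" "\<And>t. 0 \<le> t \<Longrightarrow> \<bar>\<beta>' t\<bar> \<le> B"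
  shows "(\<integral>g. (Q g - d) * (Q g * \<alpha> (N g) + \<beta> (N g)) \<partial>std_gauss d) =
    (\<integral>g. (sqn d (vec g) + Q g) * \<alpha> (N g) + 2 * N g * (Q g * \<alpha>' (N g) + \<beta>' (N g)) \<partial>std_gauss d)"
proof -
  define F where "F g = Q g * \<alpha> (N g) + \<beta> (N g)" for g
  define F' where "F' i g = (vec g i + g i) * \<alpha> (N g) + (Q g * \<alpha>' (N g) + \<beta>' (N g)) * gradN i g" for i g
  have pg: "poly_growth d (\<lambda>g. \<alpha> (N g))" "poly_growth d (\<lambda>g. \<beta> (N g))" "poly_growth d (\<lambda>g. \<alpha>' (N g))" "poly_growth d (\<lambda>g. \<beta>' (N g))"
    by (rule poly_growth_bounded, rule bd, rule N_nonneg)+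
  have pgF: "poly_growth d F" unfolding F_def[abs_def] by (intro poly_growth_intros poly_growth_Q pg)
  have pgF': "i < d \<Longrightarrow> poly_growth d (F' i)" for i
    unfolding F'_def[abs_def] by (intro poly_growth_intros poly_growth_Q pg poly_growth_vec poly_growth_gradN)
  have mF[measurable]: "F \<in> borel_measurable (std_gauss d)" unfolding F_def[abs_def] by measurable
  have mF': "i < d \<Longrightarrow> F' i \<in> borel_measurable (std_gauss d)" for i unfolding F'_def[abs_def] by measurable
  have DF: "((\<lambda>x. F (g(i := x))) has_real_derivative F' i (g(i := x))) (at x)" if i: "i < d" for g i x
  proof -
    have "((\<lambda>x. \<alpha> (N (g(i := x)))) has_real_derivative \<alpha>' (N (g(i := x))) * gradN i (g(i := x))) (at x)"
      by (rule DERIV_chain2[OF D\<alpha>[OF N_nonneg] DERIV_N[OF i]])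
    moreover have "((\<lambda>x. \<beta> (N (g(i := x)))) has_real_derivative \<beta>' (N (g(i := x))) * gradN i (g(i := x))) (at x)"
      by (rule DERIV_chain2[OF D\<beta>[OF N_nonneg] DERIV_N[OF i]])
    ultimately have "((\<lambda>x. F (g(i := x))) has_real_derivative ((vec (g(i := x)) i + x) * \<alpha> (N (g(i := x))) + \<alpha>' (N (g(i := x))) * gradN i (g(i := x)) * Q (g(i := x)))
        + \<beta>' (N (g(i := x))) * gradN i (g(i := x))) (at x)"
      unfolding F_def by (intro DERIV_add DERIV_mult DERIV_Q[OF i])
    then show ?thesis by (simp add: F'_def algebra_simps)
  qed
  have cN: "isCont (\<lambda>x. N (g(i := x))) x" "isCont (\<lambda>x. Q (g(i := x))) x" if "i < d" for g i x
    using DERIV_isCont[OF DERIV_N[OF that]] DERIV_isCont[OF DERIV_Q[OF that]] by auto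
  have c\<alpha>: "isCont (\<lambda>x. \<alpha>' (N (g(i := x)))) x" "isCont (\<lambda>x. \<beta>' (N (g(i := x)))) x" "isCont (\<lambda>x. \<alpha> (N (g(i := x)))) x" if "i < d" for g i x
    by (rule isCont_o2[OF cN(1)[OF that] c(1)[OF N_nonneg]], rule isCont_o2[OF cN(1)[OF that] c(2)[OF N_nonneg]],
        rule isCont_o2[OF cN(1)[OF that] DERIV_isCont[OF D\<alpha>[OF N_nonneg]]])
  have cF': "isCont (\<lambda>x. F' i (g(i := x))) x" if "i < d" for g i x
    unfolding F'_def using that
    by (intro continuous_intros isCont_vec isCont_gradN cN c\<alpha>) (auto)
  have st: "(\<integral>g. g i * (vec g i * F g) \<partial>std_gauss d) = (\<integral>g. F g + vec g i * F' i g \<partial>std_gauss d)" if i: "i < d" for i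
  proof (rule stein_coordinate[OF i])
    show "(\<lambda>g. vec g i * F g) \<in> borel_measurable (std_gauss d)" "(\<lambda>g. F g + vec g i * F' i g) \<in> borel_measurable (std_gauss d)"
      using i by (intro borel_measurable_times borel_measurable_add vec_measurable mF mF'; simp)+
    show "poly_growth d (\<lambda>g. vec g i * F g)" "poly_growth d (\<lambda>g. F g + vec g i * F' i g)"
      using i by (intro poly_growth_intros poly_growth_vec pgF pgF'; simp)+
    fix g x
    show "((\<lambda>x. vec (g(i := x)) i * F (g(i := x))) has_real_derivative F (g(i := x)) + vec (g(i := x)) i * F' i (g(i := x))) (at x)"
      using DERIV_mult[OF DERIV_vec[of g i i x] DF[OF i, of g x]] by (simp add: algebra_simps)
    show "isCont (\<lambda>x. F (g(i := x)) + vec (g(i := x)) i * F' i (g(i := x))) x"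
      by (intro continuous_intros isCont_vec cF' i DERIV_isCont[OF DF[OF i]])
  qed
  have int1: "integrable (std_gauss d) (\<lambda>g. g i * (vec g i * F g))" if "i < d" for i
    using that by (intro integrable_poly_growth poly_growth_intros poly_growth_vec pgF) measurable
  have int2: "integrable (std_gauss d) F" by (intro integrable_poly_growth pgF mF)
  have int3: "integrable (std_gauss d) (\<lambda>g. vec g i * F' i g)" if "i < d" for i
    using that by (intro integrable_poly_growth poly_growth_intros poly_growth_vec pgF' borel_measurable_times vec_measurable mF')
  have "(\<integral>g. Q g * F g \<partial>std_gauss d) = (\<integral>g. (\<Sum>i<d. g i * (vec g i * F g)) \<partial>std_gauss d)"
    unfolding Q_def sum_distrib_right mult.assoc ..
  also have "\<dots> = (\<Sum>i<d. (\<integral>g. g i * (vec g i * F g) \<partial>std_gauss d))"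
    using int1 by (intro Bochner_Integration.integral_sum) auto
  also have "\<dots> = (\<Sum>i<d. (\<integral>g. F g \<partial>std_gauss d) + (\<integral>g. vec g i * F' i g \<partial>std_gauss d))"
    using int2 int3 by (intro sum.cong refl) (simp add: st)
  also have "\<dots> = d * (\<integral>g. F g \<partial>std_gauss d) + (\<integral>g. (\<Sum>i<d. vec g i * F' i g) \<partial>std_gauss d)"
    using int3 by (subst Bochner_Integration.integral_sum) (auto simp: sum.distrib)
  also have "(\<lambda>g. \<Sum>i<d. vec g i * F' i g) = (\<lambda>g. (sqn d (vec g) + Q g) * \<alpha> (N g) + 2 * N g * (Q g * \<alpha>' (N g) + \<beta>' (N g)))"
  proof
    fix g
    have "(\<Sum>i<d. vec g i * F' i g) = (\<Sum>i<d. ((vec g i)\<^sup>2 + g i * vec g i) * \<alpha> (N g) + (Q g * \<alpha>' (N g) + \<beta>' (N g)) * (vec g i * gradN i g))"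
      unfolding F'_def by (intro sum.cong refl) (simp add: power2_eq_square algebra_simps)
    also have "\<dots> = (sqn d (vec g) + Q g) * \<alpha> (N g) + (Q g * \<alpha>' (N g) + \<beta>' (N g)) * (2 * N g)"
      by (simp add: sum.distrib sum_distrib_left[symmetric] sum_distrib_right[symmetric] euler_N sqn_def Q_def)
    finally show "(\<Sum>i<d. vec g i * F' i g) = (sqn d (vec g) + Q g) * \<alpha> (N g) + 2 * N g * (Q g * \<alpha>' (N g) + \<beta>' (N g))"
      by (simp add: ac_simps)
  qed
  finally have *: "(\<integral>g. Q g * F g \<partial>std_gauss d) = d * (\<integral>g. F g \<partial>std_gauss d) + (\<integral>g. (sqn d (vec g) + Q g) * \<alpha> (N g) + 2 * N g * (Q g * \<alpha>' (N g) + \<beta>' (N g)) \<partial>std_gauss d)" .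
  have iQF: "integrable (std_gauss d) (\<lambda>g. Q g * F g)" by (intro integrable_poly_growth poly_growth_intros poly_growth_Q pgF) measurable
  have "(\<integral>g. (Q g - d) * F g \<partial>std_gauss d) = (\<integral>g. Q g * F g - d * F g \<partial>std_gauss d)" by (simp add: left_diff_distrib)
  also have "\<dots> = (\<integral>g. Q g * F g \<partial>std_gauss d) - d * (\<integral>g. F g \<partial>std_gauss d)" using iQF int2 by simp
  finally have "(\<integral>g. (Q g - d) * F g \<partial>std_gauss d) = (\<integral>g. (sqn d (vec g) + Q g) * \<alpha> (N g) + 2 * N g * (Q g * \<alpha>' (N g) + \<beta>' (N g)) \<partial>std_gauss d)"
    unfolding * by simp
  then show ?thesis unfolding F_def .
qed

end

text \<open>2 / x is the integral of exp(- t x / 2) over t \<ge> 0, and the Laplace transform of |g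
  + b|^2 is at most (1 + t)^(-d / 2), whose integral is 1 / (d / 2 - 1) for d \<ge> 3. The summand e
  keeps the integrand bounded and disappears from the estimate.\<close>

lemma expectation_inverse_sqn_le:
  assumes d: "3 \<le> d" and e: "0 < e"
  shows "integrable (std_gauss d) (\<lambda>g. 1 / (sqn d (\<lambda>i. g i + b i) + e))"
    and "(\<integral>g. 1 / (sqn d (\<lambda>i. g i + b i) + e) \<partial>std_gauss d) \<le> 1 / (real d - 2)"
proof -
  let ?s = "\<lambda>g. sqn d (\<lambda>i. g i + b i)"
  have pos: "0 < ?s g + e" for g using e sqn_nonneg[of d "\<lambda>i. g i + b i"] by linarith
  show i: "integrable (std_gauss d) (\<lambda>g. 1 / (?s g + e))"
  proof (rule gauss.integrable_const_bound[where B = "1 / e"])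
    show "AE g in std_gauss d. norm (1 / (?s g + e)) \<le> 1 / e"
    proof (intro AE_I2)
      fix g
      have "1 / (?s g + e) \<le> 1 / e" using e by (intro divide_left_mono) (auto simp: add_nonneg_pos)
      then show "norm (1 / (?s g + e)) \<le> 1 / e" using pos[of g] by simp
    qed
  qed measurable
  have lap: "(\<integral>\<^sup>+t. ennreal (exp (- t * x / 2)) * indicator {0..} t \<partial>lborel) = ennreal (2 / x)" if x: "0 < x" for x :: real
  proof -
    have "(\<integral>\<^sup>+t. ennreal (exp (- t * x / 2)) * indicator {0..} t \<partial>lborel) = ennreal (0 - (- (2 / x) * exp (- 0 * x / 2)))"
    proof (rule nn_integral_FTC_atLeast)
      show "((\<lambda>t. - (2 / x) * exp (- t * x / 2)) has_real_derivative exp (- t * x / 2)) (at t)" for t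
        using x by (auto intro!: derivative_eq_intros)
      show "((\<lambda>t. - (2 / x) * exp (- t * x / 2)) \<longlongrightarrow> 0) at_top" using x by real_asymp
    qed auto
    then show ?thesis by simp
  qed
  define p where "p = real d / 2 - 1"
  have p: "0 < p" using d by (simp add: p_def)
  have pw: "(\<integral>\<^sup>+t. ennreal ((1 + t) powr (- p - 1)) * indicator {0..} t \<partial>lborel) = ennreal (1 / p)"
  proof -
    have "(\<integral>\<^sup>+t. ennreal ((1 + t) powr (- p - 1)) * indicator {0..} t \<partial>lborel) = ennreal (0 - (- (1 / p) * (1 + 0) powr (- p)))"
    proof (rule nn_integral_FTC_atLeast)
      show "((\<lambda>t. - (1 / p) * (1 + t) powr (- p)) has_real_derivative (1 + t) powr (- p - 1)) (at t)" if "0 \<le> t" for t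
        using p that by (auto intro!: derivative_eq_intros)
      show "((\<lambda>t. - (1 / p) * (1 + t) powr (- p)) \<longlongrightarrow> 0) at_top" using p by real_asymp
    qed auto
    then show ?thesis by simp
  qed
  interpret P: pair_sigma_finite "std_gauss d" "lborel :: real measure"
    by (simp add: pair_sigma_finite_def Z.gauss_sigma_finite lborel.sigma_finite_measure_axioms)
  have "ennreal 2 * ennreal (\<integral>g. 1 / (?s g + e) \<partial>std_gauss d) = ennreal 2 * (\<integral>\<^sup>+g. ennreal (1 / (?s g + e)) \<partial>std_gauss d)"
    using i pos by (subst nn_integral_eq_integral) (auto simp: less_imp_le)
  also have "\<dots> = (\<integral>\<^sup>+g. ennreal (2 / (?s g + e)) \<partial>std_gauss d)"
  proof (subst nn_integral_cmult[symmetric])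
    have "ennreal 2 * ennreal (1 / x) = ennreal (2 / x)" if "0 < x" for x
      using that by (subst ennreal_mult[symmetric]) auto
    then show "(\<integral>\<^sup>+g. ennreal 2 * ennreal (1 / (?s g + e)) \<partial>std_gauss d) = (\<integral>\<^sup>+g. ennreal (2 / (?s g + e)) \<partial>std_gauss d)"
      using pos by (simp only:)
  qed measurable
  also have "\<dots> = (\<integral>\<^sup>+g. \<integral>\<^sup>+t. ennreal (exp (- t * (?s g + e) / 2)) * indicator {0..} t \<partial>lborel \<partial>std_gauss d)"
    by (rule nn_integral_cong) (rule lap[OF pos, symmetric])
  also have "\<dots> = (\<integral>\<^sup>+t. \<integral>\<^sup>+g. ennreal (exp (- t * (?s g + e) / 2)) * indicator {0..} t \<partial>std_gauss d \<partial>lborel)"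
    by (rule P.Fubini'[symmetric]) (simp add: case_prod_beta', measurable)
  also have "\<dots> \<le> (\<integral>\<^sup>+t. ennreal ((1 + t) powr (- p - 1)) * indicator {0..} t \<partial>lborel)"
  proof (intro nn_integral_mono)
    fix t :: real
    show "(\<integral>\<^sup>+g. ennreal (exp (- t * (?s g + e) / 2)) * indicator {0..} t \<partial>std_gauss d) \<le> ennreal ((1 + t) powr (- p - 1)) * indicator {0..} t"
    proof (cases "0 \<le> t")
      case True
      have "(\<integral>\<^sup>+g. ennreal (exp (- t * (?s g + e) / 2)) * indicator {0..} t \<partial>std_gauss d) \<le> (\<integral>\<^sup>+g. ennreal (exp (- t * ?s g / 2)) \<partial>std_gauss d)"
      proof (rule nn_integral_mono)
        fix g
        have "0 \<le> t * e" using True e by simp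
        then have "- t * (?s g + e) / 2 \<le> - t * ?s g / 2" by (simp add: algebra_simps)
        then have "exp (- t * (?s g + e) / 2) \<le> exp (- t * ?s g / 2)" by (simp only: exp_le_cancel_iff)
        then have "ennreal (exp (- t * (?s g + e) / 2)) \<le> ennreal (exp (- t * ?s g / 2))" by (rule ennreal_leI)
        then show "ennreal (exp (- t * (?s g + e) / 2)) * indicator {0..} t \<le> ennreal (exp (- t * ?s g / 2))"
          by (cases "t \<in> {0..}") simp_all
      qed
      also have "\<dots> \<le> ennreal ((1 / sqrt (1 + t)) ^ d)" by (rule nn_integral_std_gauss_exp_sqn_le[OF True])
      also have "(1 / sqrt (1 + t)) ^ d = (1 + t) powr (- p - 1)"
      proof -
        have "1 / sqrt (1 + t) = (1 + t) powr (- (1 / 2))" using True by (simp only: powr_minus_divide) (simp add: powr_half_sqrt)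
        then have "(1 / sqrt (1 + t)) ^ d = (1 + t) powr (- (1 / 2) * d)"
        proof -
          assume e: "1 / sqrt (1 + t) = (1 + t) powr (- (1 / 2))"
          have "((1 + t) powr (- (1 / 2))) ^ d = ((1 + t) powr (- (1 / 2))) powr real d"
            by (rule powr_realpow[symmetric]) (use True in simp)
          then show ?thesis unfolding e powr_powr .
        qed
        then show ?thesis by (simp add: p_def)
      qed
      finally show ?thesis using True by simp
    qed simp
  qed
  also have "\<dots> = ennreal (1 / p)" by (rule pw)
  finally have "ennreal (2 * (\<integral>g. 1 / (?s g + e) \<partial>std_gauss d)) \<le> ennreal (1 / p)" by (simp add: ennreal_mult')
  then have "2 * (\<integral>g. 1 / (?s g + e) \<partial>std_gauss d) \<le> 1 / p" using p by (simp add: ennreal_le_iff)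
  also have "1 / p = 2 / (real d - 2)" using d by (simp add: p_def field_simps)
  finally show "(\<integral>g. 1 / (?s g + e) \<partial>std_gauss d) \<le> 1 / (real d - 2)" by simp
qed

section \<open>The adjoint weight of the normalised dilation field\<close>

locale regularized_quadratic_form = quadratic_form +
  fixes e2 :: real
  assumes e2: "0 < e2"
begin

text \<open>The summand \<open>e2\<close> keeps negative powers of \<open>S\<close> bounded and
  smooth where \<open>N\<close> vanishes. In \<open>anticoncentration\<close> it is the square of
  the inner radius of the shell.\<close>

definition S :: "(nat \<Rightarrow> real) \<Rightarrow> real" where "S g = N g + e2"
text \<open>The adjoint of differentiation along v / sqrt S, applied to 1: g.v / sqrt S minus the
  divergence of v / sqrt S, which is d / sqrt S - N / S^(3/2).\<close>

definition \<delta> :: "(nat \<Rightarrow> real) \<Rightarrow> real" where "\<delta> g = (Q g - d) / sqrt (S g) + N g / (S g * sqrt (S g))"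

lemma S_pos: "0 < S g" "e2 \<le> S g" "N g \<le> S g"
  using N_nonneg[of g] e2 by (auto simp: S_def)

lemma S_measurable [measurable]: "S \<in> borel_measurable (std_gauss d)"
  unfolding S_def[abs_def] by measurable

lemma \<delta>_measurable [measurable]: "\<delta> \<in> borel_measurable (std_gauss d)"
  unfolding \<delta>_def[abs_def] by measurable

lemma ratio_le: "0 \<le> t \<Longrightarrow> \<bar>t / (t + e2)\<bar> \<le> 1" "0 \<le> t \<Longrightarrow> \<bar>1 / (t + e2)\<bar> \<le> 1 / e2"
  using e2 by (auto simp: divide_simps)

lemma power_ratio_le:
  assumes t: "0 \<le> t" and jk: "j \<le> k"
  shows "\<bar>t ^ j / (t + e2) ^ k\<bar> \<le> (1 / e2) ^ (k - j)"
proof -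
  have "t ^ j / (t + e2) ^ k = (t / (t + e2)) ^ j * (1 / (t + e2)) ^ (k - j)"
  proof -
    have "(t + e2) ^ k = (t + e2) ^ j * (t + e2) ^ (k - j)" using jk by (simp add: power_add[symmetric])
    then show ?thesis by (simp add: power_divide)
  qed
  also have "\<bar>\<dots>\<bar> \<le> 1 ^ j * (1 / e2) ^ (k - j)"
    unfolding abs_mult power_abs using ratio_le[OF t] by (intro mult_mono power_mono) auto
  finally show ?thesis by simp
qed

lemma DERIV_inverse_shift: "0 \<le> t \<Longrightarrow> ((\<lambda>t. 1 / (t + e2)) has_real_derivative - (1 / (t + e2)\<^sup>2)) (at t)"
  using e2 by (auto intro!: derivative_eq_intros simp: power2_eq_square)

lemma DERIV_ratio_shift: "0 \<le> t \<Longrightarrow> ((\<lambda>t. t / (t + e2)\<^sup>2) has_real_derivative 1 / (t + e2)\<^sup>2 - 2 * t / (t + e2) ^ 3) (at t)"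
proof -
  assume "0 \<le> t"
  then have t0: "t + e2 \<noteq> 0" using e2 by simp
  show ?thesis
    using t0 by (auto intro!: derivative_eq_intros simp: power2_eq_square power3_eq_cube divide_simps) (simp add: algebra_simps)?
qed

text \<open>Together with \<open>parts_ratio\<close> and \<open>parts_delta\<close> this is what
  allows the second moment of \<open>\<delta>\<close> to be expressed by |v|^2, \<open>N\<close> and
  \<open>S\<close> without \<open>Q\<close>.\<close>

lemma parts_inverse:
  "(\<integral>g. (Q g - d) * (1 / S g) \<partial>std_gauss d) = (\<integral>g. - 2 * N g / (S g)\<^sup>2 \<partial>std_gauss d)"
proof -
  have "(\<integral>g. (Q g - d) * (Q g * 0 + 1 / (N g + e2)) \<partial>std_gauss d) =
    (\<integral>g. (sqn d (vec g) + Q g) * 0 + 2 * N g * (Q g * 0 + (- (1 / (N g + e2)\<^sup>2))) \<partial>std_gauss d)"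
  proof (rule integration_by_parts[where B = "1 / e2 + (1 / e2)\<^sup>2"])
    fix t :: real assume t: "0 \<le> t"
    show "((\<lambda>t. 1 / (t + e2)) has_real_derivative - (1 / (t + e2)\<^sup>2)) (at t)"
      by (rule DERIV_inverse_shift[OF t])
    show "isCont (\<lambda>t. - (1 / (t + e2)\<^sup>2)) t" using t e2 by (intro continuous_intros) auto
    show "\<bar>1 / (t + e2)\<bar> \<le> 1 / e2 + (1 / e2)\<^sup>2" using power_ratio_le[OF t, of 0 1] by (simp add: add_increasing2)
    show "\<bar>- (1 / (t + e2)\<^sup>2)\<bar> \<le> 1 / e2 + (1 / e2)\<^sup>2" using power_ratio_le[OF t, of 0 2] e2 by (simp add: add_increasing)
  qed (use e2 in auto)
  then show ?thesis by (simp add: S_def)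
qed

lemma parts_ratio:
  "(\<integral>g. (Q g - d) * (N g / (S g)\<^sup>2) \<partial>std_gauss d) = (\<integral>g. 2 * N g * (1 / (S g)\<^sup>2 - 2 * N g / (S g) ^ 3) \<partial>std_gauss d)"
proof -
  have "(\<integral>g. (Q g - d) * (Q g * 0 + N g / (N g + e2)\<^sup>2) \<partial>std_gauss d) =
    (\<integral>g. (sqn d (vec g) + Q g) * 0 + 2 * N g * (Q g * 0 + (1 / (N g + e2)\<^sup>2 - 2 * N g / (N g + e2) ^ 3)) \<partial>std_gauss d)"
  proof (rule integration_by_parts[where B = "1 / e2 + 3 * (1 / e2)\<^sup>2"])
    fix t :: real assume t: "0 \<le> t"
    then have t0: "t + e2 \<noteq> 0" using e2 by simp
    show "((\<lambda>t. t / (t + e2)\<^sup>2) has_real_derivative 1 / (t + e2)\<^sup>2 - 2 * t / (t + e2) ^ 3) (at t)"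
      by (rule DERIV_ratio_shift[OF t])
    show "isCont (\<lambda>t. 1 / (t + e2)\<^sup>2 - 2 * t / (t + e2) ^ 3) t" using t0 by (intro continuous_intros) auto
    show "\<bar>t / (t + e2)\<^sup>2\<bar> \<le> 1 / e2 + 3 * (1 / e2)\<^sup>2" using power_ratio_le[OF t, of 1 2] e2 by (simp add: add_increasing2)
    have "\<bar>1 / (t + e2)\<^sup>2 - 2 * t / (t + e2) ^ 3\<bar> \<le> \<bar>1 / (t + e2)\<^sup>2\<bar> + 2 * \<bar>t / (t + e2) ^ 3\<bar>"
      using abs_triangle_ineq4[of "1 / (t + e2)\<^sup>2" "2 * (t / (t + e2) ^ 3)"] by (simp add: abs_mult)
    also have "\<dots> \<le> (1 / e2)\<^sup>2 + 2 * (1 / e2)\<^sup>2" using power_ratio_le[OF t, of 0 2] power_ratio_le[OF t, of 1 3] by simp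
    finally show "\<bar>1 / (t + e2)\<^sup>2 - 2 * t / (t + e2) ^ 3\<bar> \<le> 1 / e2 + 3 * (1 / e2)\<^sup>2" using e2 by (simp add: add_increasing)
  qed (use e2 in auto)
  then show ?thesis by (simp add: S_def)
qed

lemma parts_delta:
  "(\<integral>g. (Q g - d) * (Q g * (1 / S g) + (N g / (S g)\<^sup>2 - d / S g)) \<partial>std_gauss d) =
   (\<integral>g. (sqn d (vec g) + Q g) * (1 / S g) + 2 * N g * (Q g * (- (1 / (S g)\<^sup>2)) + (1 / (S g)\<^sup>2 - 2 * N g / (S g) ^ 3 + d / (S g)\<^sup>2)) \<partial>std_gauss d)"
proof -
  let ?B = "(1 + real d) * (1 / e2) + (3 + real d) * (1 / e2)\<^sup>2"
  have "(\<integral>g. (Q g - d) * (Q g * (1 / (N g + e2)) + (N g / (N g + e2)\<^sup>2 - d / (N g + e2))) \<partial>std_gauss d) =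
   (\<integral>g. (sqn d (vec g) + Q g) * (1 / (N g + e2)) + 2 * N g * (Q g * (- (1 / (N g + e2)\<^sup>2)) + (1 / (N g + e2)\<^sup>2 - 2 * N g / (N g + e2) ^ 3 + d / (N g + e2)\<^sup>2)) \<partial>std_gauss d)"
  proof (rule integration_by_parts[where B = ?B])
    fix t :: real assume t: "0 \<le> t"
    then have t0: "t + e2 \<noteq> 0" using e2 by simp
    have b: "\<bar>1 / (t + e2)\<bar> \<le> 1 / e2" "\<bar>t / (t + e2)\<^sup>2\<bar> \<le> 1 / e2" "\<bar>1 / (t + e2)\<^sup>2\<bar> \<le> (1 / e2)\<^sup>2" "\<bar>t / (t + e2) ^ 3\<bar> \<le> (1 / e2)\<^sup>2"
      using power_ratio_le[OF t, of 0 1] power_ratio_le[OF t, of 1 2] power_ratio_le[OF t, of 0 2] power_ratio_le[OF t, of 1 3] by simp_all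
    have e0: "0 \<le> 1 / e2" "0 \<le> (1 / e2)\<^sup>2" using e2 by auto
    have db: "d * \<bar>1 / (t + e2)\<bar> \<le> d * (1 / e2)" "d * \<bar>1 / (t + e2)\<^sup>2\<bar> \<le> d * (1 / e2)\<^sup>2"
      using b by (intro mult_left_mono; simp)+
    have nn: "0 \<le> d * (1 / e2)" "0 \<le> d * (1 / e2)\<^sup>2" using e0 by simp_all
    have eB: "?B = 1 / e2 + d * (1 / e2) + 3 * (1 / e2)\<^sup>2 + d * (1 / e2)\<^sup>2" by (simp add: algebra_simps)
    show "((\<lambda>t. 1 / (t + e2)) has_real_derivative - (1 / (t + e2)\<^sup>2)) (at t)"
      by (rule DERIV_inverse_shift[OF t])
    show "((\<lambda>t. t / (t + e2)\<^sup>2 - d / (t + e2)) has_real_derivative 1 / (t + e2)\<^sup>2 - 2 * t / (t + e2) ^ 3 + d / (t + e2)\<^sup>2) (at t)"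
      using DERIV_diff[OF DERIV_ratio_shift[OF t] DERIV_cmult[OF DERIV_inverse_shift[OF t], of "real d"]] by simp
    show "isCont (\<lambda>t. - (1 / (t + e2)\<^sup>2)) t" using t0 by (intro continuous_intros) auto
    show "isCont (\<lambda>t. 1 / (t + e2)\<^sup>2 - 2 * t / (t + e2) ^ 3 + d / (t + e2)\<^sup>2) t" using t0 by (intro continuous_intros) auto
    show "\<bar>1 / (t + e2)\<bar> \<le> ?B" unfolding eB using b(1) e0 nn by linarith
    show "\<bar>- (1 / (t + e2)\<^sup>2)\<bar> \<le> ?B" unfolding eB abs_minus_cancel using b(3) e0 nn by linarith
    have "\<bar>t / (t + e2)\<^sup>2 - d / (t + e2)\<bar> \<le> \<bar>t / (t + e2)\<^sup>2\<bar> + d * \<bar>1 / (t + e2)\<bar>"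
      using abs_triangle_ineq4[of "t / (t + e2)\<^sup>2" "d * (1 / (t + e2))"] by (simp add: abs_mult)
    then show "\<bar>t / (t + e2)\<^sup>2 - d / (t + e2)\<bar> \<le> ?B" unfolding eB using b(2) db(1) e0 nn by linarith
    have "\<bar>1 / (t + e2)\<^sup>2 - 2 * t / (t + e2) ^ 3 + d / (t + e2)\<^sup>2\<bar> \<le> \<bar>1 / (t + e2)\<^sup>2\<bar> + 2 * \<bar>t / (t + e2) ^ 3\<bar> + d * \<bar>1 / (t + e2)\<^sup>2\<bar>"
      using abs_triangle_ineq4[of "1 / (t + e2)\<^sup>2" "2 * (t / (t + e2) ^ 3)"] abs_triangle_ineq[of "1 / (t + e2)\<^sup>2 - 2 * (t / (t + e2) ^ 3)" "d * (1 / (t + e2)\<^sup>2)"]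
      by (simp add: abs_mult)
    then show "\<bar>1 / (t + e2)\<^sup>2 - 2 * t / (t + e2) ^ 3 + d / (t + e2)\<^sup>2\<bar> \<le> ?B" unfolding eB using b(3,4) db(2) e0 nn by linarith
  qed (use e2 in auto)
  then show ?thesis by (simp add: S_def)
qed

lemma poly_growth_S_ratio:
  assumes jk: "j \<le> k"
  shows "poly_growth d (\<lambda>g. N g ^ j / S g ^ k)"
  by (rule poly_growth_bounded[where c = "(1 / e2) ^ (k - j)"]) (use power_ratio_le[OF N_nonneg jk] in \<open>simp add: S_def\<close>)

lemma sqn_vec_poly: "poly_growth d (\<lambda>g. sqn d (vec g))"
  unfolding sqn_def by (intro poly_growth_intros poly_growth_vec)

lemma integrable_Q_ratio: "j \<le> k \<Longrightarrow> integrable (std_gauss d) (\<lambda>g. Q g * (N g ^ j / S g ^ k))"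
  by (intro integrable_poly_growth poly_growth_intros poly_growth_Q poly_growth_S_ratio) measurable

lemma integrable_ratio: "j \<le> k \<Longrightarrow> integrable (std_gauss d) (\<lambda>g. N g ^ j / S g ^ k)"
  by (intro integrable_poly_growth poly_growth_intros poly_growth_S_ratio) measurable

lemma integrable_Q2_inverse: "integrable (std_gauss d) (\<lambda>g. Q g * Q g * (1 / S g))"
  using poly_growth_S_ratio[of 0 1] by (intro integrable_poly_growth poly_growth_intros poly_growth_Q) auto

lemma integrable_sqn_inverse: "integrable (std_gauss d) (\<lambda>g. sqn d (vec g) * (1 / S g))"
  using poly_growth_S_ratio[of 0 1] by (intro integrable_poly_growth poly_growth_intros sqn_vec_poly) auto

text \<open>Grouped so that the first two summands are the integrands on the left sides of
  \<open>parts_delta\<close> and \<open>parts_ratio\<close>.\<close>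

lemma delta_square_expand:
  "(\<delta> g)\<^sup>2 = (Q g - d) * (Q g * (1 / S g) + (N g / (S g)\<^sup>2 - d / S g)) + (Q g - d) * (N g / (S g)\<^sup>2) + N g ^ 2 / S g ^ 3"
proof -
  define s where "s = sqrt (S g)"
  have s: "s \<noteq> 0" "S g = s\<^sup>2" using S_pos(1)[of g] by (auto simp: s_def)
  have "\<delta> g = (Q g - d) / s + N g / s ^ 3" unfolding \<delta>_def s_def[symmetric] unfolding s(2) by (simp add: power2_eq_square power3_eq_cube)
  moreover have "(a / s + n / s ^ 3)\<^sup>2 = a * ((a + k) * (1 / s\<^sup>2) + (n / (s\<^sup>2)\<^sup>2 - k / s\<^sup>2)) + a * (n / (s\<^sup>2)\<^sup>2) + n ^ 2 / (s\<^sup>2) ^ 3" for a n k :: real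
    using s(1) by (simp add: eval_nat_numeral field_simps)
  from this[of "Q g - d" "N g" "real d"] have "((Q g - d) / s + N g / s ^ 3)\<^sup>2 = (Q g - d) * (Q g * (1 / s\<^sup>2) + (N g / (s\<^sup>2)\<^sup>2 - d / s\<^sup>2)) + (Q g - d) * (N g / (s\<^sup>2)\<^sup>2) + N g ^ 2 / (s\<^sup>2) ^ 3"
    by simp
  ultimately show ?thesis unfolding s(2) by (simp only:)
qed

lemma integrable_delta_square: "integrable (std_gauss d) (\<lambda>g. (\<delta> g)\<^sup>2)"
proof -
  have "(\<delta> g)\<^sup>2 = Q g * Q g * (1 / S g) + 2 * (Q g * (N g ^ 1 / S g ^ 2)) - 2 * d * (Q g * (N g ^ 0 / S g ^ 1))
      - 2 * d * (N g ^ 1 / S g ^ 2) + d * d * (N g ^ 0 / S g ^ 1) + N g ^ 2 / S g ^ 3" for g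
  proof -
    have "(q - k) * (q * (1 / s) + (n / s\<^sup>2 - k / s)) + (q - k) * (n / s\<^sup>2) + n ^ 2 / s ^ 3 =
      q * q * (1 / s) + 2 * (q * (n ^ 1 / s ^ 2)) - 2 * k * (q * (n ^ 0 / s ^ 1)) - 2 * k * (n ^ 1 / s ^ 2) + k * k * (n ^ 0 / s ^ 1) + n ^ 2 / s ^ 3"
      if "s \<noteq> 0" for q k n s :: real
      using that by (simp add: field_simps power2_eq_square)
    then show ?thesis unfolding delta_square_expand using S_pos(1)[of g] by simp
  qed
  then show ?thesis
    by (simp only:) (intro Bochner_Integration.integrable_add Bochner_Integration.integrable_diff integrable_mult_right integrable_Q_ratio integrable_ratio integrable_Q2_inverse; simp)
qed

end

context regularized_quadratic_form
begin

text \<open>All terms in \<open>Q\<close> can be integrated away: the second moment equals the mean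
  of |v|^2 / S + d / S - 2 N / S^2 + N^2 / S^3, and the last two terms are nonpositive together as N
  \<le> S.\<close>

lemma expectation_delta_square_le:
  "(\<integral>g. (\<delta> g)\<^sup>2 \<partial>std_gauss d) \<le> (\<integral>g. sqn d (vec g) * (1 / S g) \<partial>std_gauss d) + d * (\<integral>g. 1 / S g \<partial>std_gauss d)"
proof -
  define a where "a = (\<integral>g. 1 / S g \<partial>std_gauss d)"
  define u where "u = (\<integral>g. N g / (S g)\<^sup>2 \<partial>std_gauss d)"
  define w where "w = (\<integral>g. N g ^ 2 / S g ^ 3 \<partial>std_gauss d)"
  define z where "z = (\<integral>g. sqn d (vec g) * (1 / S g) \<partial>std_gauss d)"
  define q1 where "q1 = (\<integral>g. Q g * (1 / S g) \<partial>std_gauss d)"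
  define q2 where "q2 = (\<integral>g. Q g * (N g / (S g)\<^sup>2) \<partial>std_gauss d)"
  define p2 where "p2 = (\<integral>g. (Q g - d) * (Q g * (1 / S g) + (N g / (S g)\<^sup>2 - d / S g)) \<partial>std_gauss d)"
  have i: "integrable (std_gauss d) (\<lambda>g. 1 / S g)" "integrable (std_gauss d) (\<lambda>g. N g / (S g)\<^sup>2)" "integrable (std_gauss d) (\<lambda>g. N g ^ 2 / S g ^ 3)"
    "integrable (std_gauss d) (\<lambda>g. Q g * (1 / S g))" "integrable (std_gauss d) (\<lambda>g. Q g * (N g / (S g)\<^sup>2))"
    using integrable_ratio[of 0 1] integrable_ratio[of 1 2] integrable_ratio[of 2 3] integrable_Q_ratio[of 0 1] integrable_Q_ratio[of 1 2]
    by simp_all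
  note iz = integrable_sqn_inverse
  have hb: "has_bochner_integral (std_gauss d) (\<lambda>g. 1 / S g) a" "has_bochner_integral (std_gauss d) (\<lambda>g. N g / (S g)\<^sup>2) u"
    "has_bochner_integral (std_gauss d) (\<lambda>g. N g ^ 2 / S g ^ 3) w" "has_bochner_integral (std_gauss d) (\<lambda>g. Q g * (1 / S g)) q1"
    "has_bochner_integral (std_gauss d) (\<lambda>g. Q g * (N g / (S g)\<^sup>2)) q2" "has_bochner_integral (std_gauss d) (\<lambda>g. sqn d (vec g) * (1 / S g)) z"
    using i iz by (auto simp: has_bochner_integral_iff a_def u_def w_def q1_def q2_def z_def)
  have e1: "q1 - d * a = - 2 * u"
  proof -
    have "has_bochner_integral (std_gauss d) (\<lambda>g. Q g * (1 / S g) - d * (1 / S g)) (q1 - d * a)"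
      by (intro has_bochner_integral_diff has_bochner_integral_mult_right hb)
    then have "(\<integral>g. (Q g - d) * (1 / S g) \<partial>std_gauss d) = q1 - d * a"
      by (subst left_diff_distrib) (rule has_bochner_integral_integral_eq)
    moreover have "has_bochner_integral (std_gauss d) (\<lambda>g. - 2 * (N g / (S g)\<^sup>2)) (- 2 * u)"
      by (intro has_bochner_integral_mult_right hb)
    then have "(\<integral>g. - 2 * N g / (S g)\<^sup>2 \<partial>std_gauss d) = - 2 * u" using has_bochner_integral_integral_eq by fastforce
    ultimately show ?thesis using parts_inverse by simp
  qed
  have p3: "(\<integral>g. (Q g - d) * (N g / (S g)\<^sup>2) \<partial>std_gauss d) = q2 - d * u"
  proof -
    have "has_bochner_integral (std_gauss d) (\<lambda>g. Q g * (N g / (S g)\<^sup>2) - d * (N g / (S g)\<^sup>2)) (q2 - d * u)"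
      by (intro has_bochner_integral_diff has_bochner_integral_mult_right hb)
    then show ?thesis
      by (subst left_diff_distrib) (rule has_bochner_integral_integral_eq)
  qed
  have e2: "q2 - d * u = 2 * u - 4 * w"
  proof -
    have "has_bochner_integral (std_gauss d) (\<lambda>g. 2 * (N g / (S g)\<^sup>2) - 4 * (N g ^ 2 / S g ^ 3)) (2 * u - 4 * w)"
      by (intro has_bochner_integral_diff has_bochner_integral_mult_right hb)
    then have "(\<integral>g. 2 * (N g / (S g)\<^sup>2) - 4 * (N g ^ 2 / S g ^ 3) \<partial>std_gauss d) = 2 * u - 4 * w" by (rule has_bochner_integral_integral_eq)
    moreover have "2 * N g * (1 / (S g)\<^sup>2 - 2 * N g / (S g) ^ 3) = 2 * (N g / (S g)\<^sup>2) - 4 * (N g ^ 2 / S g ^ 3)" for g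
      by (simp add: algebra_simps power2_eq_square)
    ultimately show ?thesis using parts_ratio p3 by simp
  qed
  have e3: "p2 = z + q1 - 2 * q2 + 2 * u - 4 * w + 2 * d * u"
  proof -
    have "has_bochner_integral (std_gauss d) (\<lambda>g. sqn d (vec g) * (1 / S g) + Q g * (1 / S g) - 2 * (Q g * (N g / (S g)\<^sup>2)) + 2 * (N g / (S g)\<^sup>2) - 4 * (N g ^ 2 / S g ^ 3) + 2 * d * (N g / (S g)\<^sup>2))
      (z + q1 - 2 * q2 + 2 * u - 4 * w + 2 * d * u)"
      by (intro has_bochner_integral_add has_bochner_integral_diff has_bochner_integral_mult_right hb)
    then have "(\<integral>g. sqn d (vec g) * (1 / S g) + Q g * (1 / S g) - 2 * (Q g * (N g / (S g)\<^sup>2)) + 2 * (N g / (S g)\<^sup>2) - 4 * (N g ^ 2 / S g ^ 3) + 2 * d * (N g / (S g)\<^sup>2) \<partial>std_gauss d)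
      = z + q1 - 2 * q2 + 2 * u - 4 * w + 2 * d * u" by (rule has_bochner_integral_integral_eq)
    moreover have "(sqn d (vec g) + Q g) * (1 / S g) + 2 * N g * (Q g * (- (1 / (S g)\<^sup>2)) + (1 / (S g)\<^sup>2 - 2 * N g / (S g) ^ 3 + d / (S g)\<^sup>2)) =
      sqn d (vec g) * (1 / S g) + Q g * (1 / S g) - 2 * (Q g * (N g / (S g)\<^sup>2)) + 2 * (N g / (S g)\<^sup>2) - 4 * (N g ^ 2 / S g ^ 3) + 2 * d * (N g / (S g)\<^sup>2)" for g
      by (simp add: algebra_simps power2_eq_square add_divide_distrib)
    ultimately show ?thesis using parts_delta unfolding p2_def by simp
  qed
  have int_p2: "integrable (std_gauss d) (\<lambda>g. (Q g - d) * (Q g * (1 / S g) + (N g / (S g)\<^sup>2 - d / S g)))"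
  proof -
    have i4: "integrable (std_gauss d) (\<lambda>g. (\<delta> g)\<^sup>2 - (Q g * (N g / (S g)\<^sup>2) - d * (N g / (S g)\<^sup>2)) - N g ^ 2 / S g ^ 3)"
      using i integrable_delta_square by (intro Bochner_Integration.integrable_diff integrable_mult_right) auto
    show ?thesis
    proof (rule Bochner_Integration.integrable_cong[THEN iffD1, OF refl _ i4])
      have "x + (q - k) * r + y - (q * r - k * r) - y = x" for x q k r y :: real by (simp add: algebra_simps)
      then show "(\<delta> g)\<^sup>2 - (Q g * (N g / (S g)\<^sup>2) - d * (N g / (S g)\<^sup>2)) - N g ^ 2 / S g ^ 3 = (Q g - d) * (Q g * (1 / S g) + (N g / (S g)\<^sup>2 - d / S g))" for g
        unfolding delta_square_expand .
    qed
  qed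
  have "(\<integral>g. (\<delta> g)\<^sup>2 \<partial>std_gauss d) = p2 + (q2 - d * u) + w"
  proof -
    have "has_bochner_integral (std_gauss d) (\<lambda>g. (Q g - d) * (Q g * (1 / S g) + (N g / (S g)\<^sup>2 - d / S g))
        + (Q g * (N g / (S g)\<^sup>2) - d * (N g / (S g)\<^sup>2)) + N g ^ 2 / S g ^ 3) (p2 + (q2 - d * u) + w)"
      using int_p2 by (intro has_bochner_integral_add has_bochner_integral_diff has_bochner_integral_mult_right hb)
        (auto simp: has_bochner_integral_iff p2_def)
    then have "(\<integral>g. (Q g - d) * (Q g * (1 / S g) + (N g / (S g)\<^sup>2 - d / S g))
        + (Q g * (N g / (S g)\<^sup>2) - d * (N g / (S g)\<^sup>2)) + N g ^ 2 / S g ^ 3 \<partial>std_gauss d) = p2 + (q2 - d * u) + w"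
      by (rule has_bochner_integral_integral_eq)
    then show ?thesis unfolding delta_square_expand left_diff_distrib[of "Q _" "real d" "N _ / (S _)\<^sup>2"] .
  qed
  also have "\<dots> = z + d * a - 2 * u + w" using e1 e2 e3 by (simp add: algebra_simps)
  also have "\<dots> \<le> z + d * a"
  proof -
    have "w \<le> u" unfolding w_def u_def
    proof (rule integral_mono[OF i(3) i(2)])
      fix g
      have "N g ^ 2 / S g ^ 3 = (N g / (S g)\<^sup>2) * (N g / S g)" by (simp add: power2_eq_square power3_eq_cube)
      also have "\<dots> \<le> (N g / (S g)\<^sup>2) * 1" using N_nonneg[of g] S_pos[of g] by (intro mult_left_mono) auto
      finally show "N g ^ 2 / S g ^ 3 \<le> N g / (S g)\<^sup>2" by simp
    qed
    moreover have "0 \<le> u" unfolding u_def using N_nonneg by (simp add: integral_nonneg_AE)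
    ultimately show ?thesis by simp
  qed
  finally show ?thesis unfolding z_def a_def .
qed

lemma vec_ratio_le: "sqn d (vec g) * (1 / S g) \<le> 1 / lam\<^sup>2"
proof -
  have "lam\<^sup>2 * sqn d (vec g) \<le> S g" using N_ge[of g] S_pos(3)[of g] by simp
  then show ?thesis using S_pos(1)[of g] lam by (simp add: divide_simps mult.commute)
qed

lemma expectation_abs_delta_le:
  assumes d: "3 \<le> d"
  shows "integrable (std_gauss d) (\<lambda>g. \<bar>\<delta> g\<bar>)" "(\<integral>g. \<bar>\<delta> g\<bar> \<partial>std_gauss d) \<le> 2 / lam"
proof -
  show i: "integrable (std_gauss d) (\<lambda>g. \<bar>\<delta> g\<bar>)"
    by (rule integrable_abs, rule gauss.square_integrable_imp_integrable[OF \<delta>_measurable integrable_delta_square])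
  have z: "(\<integral>g. sqn d (vec g) * (1 / S g) \<partial>std_gauss d) \<le> 1 / lam\<^sup>2"
  proof -
    have "(\<integral>g. sqn d (vec g) * (1 / S g) \<partial>std_gauss d) \<le> (\<integral>g. 1 / lam\<^sup>2 \<partial>std_gauss d)"
      by (intro integral_mono integrable_sqn_inverse vec_ratio_le) simp
    then show ?thesis by (simp add: gauss.prob_space)
  qed
  have e: "0 < e2 / lam\<^sup>2" using e2 lam by simp
  have a: "(\<integral>g. 1 / S g \<partial>std_gauss d) \<le> 1 / lam\<^sup>2 * (1 / (real d - 2))"
  proof -
    have "(\<integral>g. 1 / S g \<partial>std_gauss d) \<le> (\<integral>g. 1 / lam\<^sup>2 * (1 / (sqn d (\<lambda>i. g i + b i) + e2 / lam\<^sup>2)) \<partial>std_gauss d)"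
    proof (rule integral_mono)
      show "integrable (std_gauss d) (\<lambda>g. 1 / S g)" using integrable_ratio[of 0 1] by simp
      show "integrable (std_gauss d) (\<lambda>g. 1 / lam\<^sup>2 * (1 / (sqn d (\<lambda>i. g i + b i) + e2 / lam\<^sup>2)))"
        by (intro integrable_mult_right expectation_inverse_sqn_le(1) d e)
      fix g
      have "lam\<^sup>2 * (sqn d (\<lambda>i. g i + b i) + e2 / lam\<^sup>2) \<le> S g"
        using N_ge[of g] lam unfolding S_def vec_def by (simp add: distrib_left)
      moreover have "0 < lam\<^sup>2 * (sqn d (\<lambda>i. g i + b i) + e2 / lam\<^sup>2)" using e lam by (intro mult_pos_pos add_nonneg_pos) auto
      ultimately have "1 / S g \<le> 1 / (lam\<^sup>2 * (sqn d (\<lambda>i. g i + b i) + e2 / lam\<^sup>2))"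
        using S_pos(1)[of g] by (intro divide_left_mono) auto
      then show "1 / S g \<le> 1 / lam\<^sup>2 * (1 / (sqn d (\<lambda>i. g i + b i) + e2 / lam\<^sup>2))" by simp
    qed
    also have "\<dots> = 1 / lam\<^sup>2 * (\<integral>g. 1 / (sqn d (\<lambda>i. g i + b i) + e2 / lam\<^sup>2) \<partial>std_gauss d)"
      by (rule integral_mult_right_zero)
    also have "\<dots> \<le> 1 / lam\<^sup>2 * (1 / (real d - 2))"
      using expectation_inverse_sqn_le(2)[OF d e, of b] by (intro mult_left_mono) auto
    finally show ?thesis .
  qed
  have "real d * (\<integral>g. 1 / S g \<partial>std_gauss d) \<le> real d * (1 / lam\<^sup>2 * (1 / (real d - 2)))" using a by (intro mult_left_mono) auto
  also have "\<dots> = 1 / lam\<^sup>2 * (real d / (real d - 2))" by simp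
  \<comment> \<open>d / (d - 2) \<le> 3 for d \<ge> 3; with the bound 1 / lam^2 for the mean of
    |v|^2 / S the sum is 4 / lam^2, the square of 2 / lam.\<close>
  also have "\<dots> \<le> 1 / lam\<^sup>2 * 3" using d by (intro mult_left_mono) (auto simp: divide_simps)
  finally have "(\<integral>g. (\<delta> g)\<^sup>2 \<partial>std_gauss d) \<le> (2 / lam)\<^sup>2"
    using expectation_delta_square_le z by (simp add: power_divide)
  moreover have "(\<integral>g. \<bar>\<delta> g\<bar> \<partial>std_gauss d)\<^sup>2 \<le> (\<integral>g. \<bar>\<delta> g\<bar>\<^sup>2 \<partial>std_gauss d)"
    by (rule square_mean_le[OF prob_space_std_gauss i]) (simp add: integrable_delta_square)
  ultimately have "(\<integral>g. \<bar>\<delta> g\<bar> \<partial>std_gauss d)\<^sup>2 \<le> (2 / lam)\<^sup>2" by simp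
  then show "(\<integral>g. \<bar>\<delta> g\<bar> \<partial>std_gauss d) \<le> 2 / lam" using lam by (simp add: power2_le_iff_abs_le)
qed

text \<open>Integration by parts for f(sqrt S) / sqrt S. Differentiating the denominator yields a
  term with N / S^(3/2), which is moved to the other side and completes
  \<open>\<delta>\<close>.\<close>

lemma parts_test_function:
  assumes D: "\<And>s. (f has_real_derivative f' s) (at s)" and c: "\<And>s. isCont f' s"
    and bf: "\<And>s. \<bar>f s\<bar> \<le> B" and bf': "\<And>s. \<bar>f' s\<bar> \<le> B"
  shows "(\<integral>g. f (sqrt (S g)) * \<delta> g \<partial>std_gauss d) = (\<integral>g. f' (sqrt (S g)) * (N g / S g) \<partial>std_gauss d)"
    and "integrable (std_gauss d) (\<lambda>g. f (sqrt (S g)) * \<delta> g)"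
    and "integrable (std_gauss d) (\<lambda>g. f' (sqrt (S g)) * (N g / S g))"
proof -
  have fm[measurable]: "f \<in> borel_measurable borel" "f' \<in> borel_measurable borel"
    by (intro borel_measurable_continuous_onI continuous_at_imp_continuous_on ballI DERIV_isCont[OF D])
       (intro borel_measurable_continuous_onI continuous_at_imp_continuous_on ballI c)
  have B: "0 \<le> B" using bf[of 0] by linarith
  define h where "h t = sqrt (t + e2)" for t
  define \<beta> where "\<beta> t = f (h t) / h t" for t
  define \<beta>' where "\<beta>' t = f' (h t) / (2 * (t + e2)) - f (h t) / (2 * ((t + e2) * h t))" for t
  have h: "0 < h t" "h t * h t = t + e2" "sqrt e2 \<le> h t" if "0 \<le> t" for t using that e2 by (auto simp: h_def)
  have Dh: "(h has_real_derivative 1 / (2 * h t)) (at t)" if "0 \<le> t" for t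
    unfolding h_def[abs_def] using that e2 by (auto intro!: derivative_eq_intros simp: divide_simps)
  have cont_h: "isCont h t" if "0 \<le> t" for t using DERIV_isCont[OF Dh[OF that]] .
  let ?s = "sqrt e2"
  have s0: "0 < ?s" using e2 by simp
  let ?B = "B / ?s + B / (2 * e2) + B / (2 * (e2 * ?s))"
  have Bp: "0 \<le> B / ?s" "0 \<le> B / (2 * e2)" "0 \<le> B / (2 * (e2 * ?s))" using B s0 e2 by auto
  have main: "(\<integral>g. (Q g - d) * (Q g * 0 + \<beta> (N g)) \<partial>std_gauss d) =
    (\<integral>g. (sqn d (vec g) + Q g) * 0 + 2 * N g * (Q g * 0 + \<beta>' (N g)) \<partial>std_gauss d)"
  proof (rule integration_by_parts[where B = ?B])
    fix t :: real assume t: "0 \<le> t"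
    have nz: "h t \<noteq> 0" "t + e2 \<noteq> 0" using h(1)[OF t] t e2 by auto
    have "(\<beta> has_real_derivative (f' (h t) * (1 / (2 * h t)) * h t - f (h t) * (1 / (2 * h t))) / (h t * h t)) (at t)"
      unfolding \<beta>_def[abs_def] by (intro DERIV_divide DERIV_chain2[OF D] Dh t nz(1))
    moreover have "(f' (h t) * (1 / (2 * h t)) * h t - f (h t) * (1 / (2 * h t))) / (h t * h t) = \<beta>' t"
      unfolding \<beta>'_def h(2)[OF t, symmetric] using nz(1) by (simp add: field_simps)
    ultimately show "(\<beta> has_real_derivative \<beta>' t) (at t)" by simp
    show "isCont \<beta>' t" unfolding \<beta>'_def
      using nz by (intro continuous_intros isCont_o2[OF cont_h[OF t] c] isCont_o2[OF cont_h[OF t] DERIV_isCont[OF D]] cont_h[OF t]) auto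
    have "\<bar>f (h t) / h t\<bar> \<le> B / ?s"
      unfolding abs_divide using bf[of "h t"] h[OF t] s0 B by (intro frac_le) auto
    then show "\<bar>\<beta> t\<bar> \<le> ?B" unfolding \<beta>_def using Bp by linarith
    have "\<bar>f' (h t) / (2 * (t + e2))\<bar> \<le> B / (2 * e2)"
      unfolding abs_divide using bf'[of "h t"] t e2 B by (intro frac_le) auto
    moreover have "\<bar>f (h t) / (2 * ((t + e2) * h t))\<bar> \<le> B / (2 * (e2 * ?s))"
      unfolding abs_divide using bf[of "h t"] t e2 h[OF t] s0 B by (intro frac_le) (auto simp: abs_mult intro!: mult_mono)
    ultimately show "\<bar>\<beta>' t\<bar> \<le> ?B" unfolding \<beta>'_def
      using Bp abs_triangle_ineq4[of "f' (h t) / (2 * (t + e2))" "f (h t) / (2 * ((t + e2) * h t))"] by linarith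
  next
    show "\<beta> \<in> borel_measurable borel" "\<beta>' \<in> borel_measurable borel" unfolding \<beta>_def[abs_def] \<beta>'_def[abs_def] h_def by measurable
  qed (use Bp in auto)
  have hS: "h (N g) = sqrt (S g)" for g by (simp add: h_def S_def)
  have i\<delta>: "integrable (std_gauss d) \<delta>" by (rule gauss.square_integrable_imp_integrable[OF \<delta>_measurable integrable_delta_square])
  have bd: "integrable (std_gauss d) (\<lambda>g. k (sqrt (S g)) * F g)" if F: "integrable (std_gauss d) F" and [measurable]: "k \<in> borel_measurable borel" and k: "\<And>s. \<bar>k s\<bar> \<le> B" for k :: "real \<Rightarrow> real" and F
  proof -
    note [measurable] = borel_measurable_integrable[OF F]
    show ?thesis
    proof (rule Bochner_Integration.integrable_bound)
      show "integrable (std_gauss d) (\<lambda>g. B * F g)" using F by simp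
      show "AE g in std_gauss d. norm (k (sqrt (S g)) * F g) \<le> norm (B * F g)"
        using k B by (intro AE_I2) (auto simp: abs_mult intro!: mult_right_mono)
    qed measurable
  qed
  have iR: "integrable (std_gauss d) (\<lambda>g. N g / S g)" using integrable_ratio[of 1 1] by simp
  show i1: "integrable (std_gauss d) (\<lambda>g. f (sqrt (S g)) * \<delta> g)" by (rule bd[OF i\<delta> fm(1) bf])
  show i2: "integrable (std_gauss d) (\<lambda>g. f' (sqrt (S g)) * (N g / S g))" by (rule bd[OF iR fm(2) bf'])
  have iR2: "integrable (std_gauss d) (\<lambda>g. N g / (S g * sqrt (S g)))"
  proof (rule gauss.integrable_const_bound[where B = "1 / ?s"])
    show "AE g in std_gauss d. norm (N g / (S g * sqrt (S g))) \<le> 1 / ?s"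
    proof (intro AE_I2)
      fix g
      have "N g / (S g * sqrt (S g)) = (N g / S g) * (1 / sqrt (S g))" by simp
      also have "\<dots> \<le> 1 * (1 / ?s)" using N_nonneg[of g] S_pos[of g] s0 by (intro mult_mono divide_left_mono) auto
      finally show "norm (N g / (S g * sqrt (S g))) \<le> 1 / ?s" using N_nonneg[of g] S_pos(1)[of g] by simp
    qed
  qed measurable
  have i3: "integrable (std_gauss d) (\<lambda>g. f (sqrt (S g)) * (N g / (S g * sqrt (S g))))" by (rule bd[OF iR2 fm(1) bf])
  have l: "(Q g - d) * (Q g * 0 + \<beta> (N g)) = f (sqrt (S g)) * \<delta> g - f (sqrt (S g)) * (N g / (S g * sqrt (S g)))" for g
    unfolding \<beta>_def hS \<delta>_def by (simp add: algebra_simps diff_divide_distrib add_divide_distrib)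
  have r: "(sqn d (vec g) + Q g) * 0 + 2 * N g * (Q g * 0 + \<beta>' (N g)) = f' (sqrt (S g)) * (N g / S g) - f (sqrt (S g)) * (N g / (S g * sqrt (S g)))" for g
    unfolding \<beta>'_def hS S_def[symmetric] by (simp add: algebra_simps)
  show "(\<integral>g. f (sqrt (S g)) * \<delta> g \<partial>std_gauss d) = (\<integral>g. f' (sqrt (S g)) * (N g / S g) \<partial>std_gauss d)"
    using main i1 i2 i3 unfolding l r by simp
qed

end

section \<open>Measure of thin shells\<close>

lemma abs_arctan_le_2: "\<bar>arctan x\<bar> \<le> 2"
  using arctan_bounded[of x] pi_less_4 by (simp add: abs_le_iff)

text \<open>f is an antiderivative of the bump f', which is at least 1/2 on the window; as N / S
  \<ge> 1/2 there, the indicator is at most 4 f' N / S. \<open>parts_test_function\<close> trades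
  this for f \<delta> with f of order eps. For d \<ge> 3 the first moment of \<delta> is available;
  for d \<le> 2, where 1 / |v|^2 is not integrable, a pointwise upper bound of \<delta> replaces
  it.\<close>

lemma (in regularized_quadratic_form) window_bound:
  assumes eps: "0 < eps" and r: "e2 = r\<^sup>2" "0 < r" and d: "1 \<le> d"
  shows "measure (std_gauss d) {g \<in> space (std_gauss d). r\<^sup>2 < N g \<and> N g \<le> (r + eps)\<^sup>2} \<le> 24 * eps / lam"
proof -
  define \<rho> where "\<rho> = sqrt (r\<^sup>2 + e2)"
  \<comment> \<open>For d \<le> 2 the shift by pi / 2 makes f nonnegative, so that an upper bound of
    \<delta> suffices; for d \<ge> 3 the unshifted f has the smaller bound 2 eps.\<close>
  define c where "c = (if 3 \<le> d then 0 else pi / 2)"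
  define f where "f s = eps * (arctan ((s - \<rho>) / eps) + c)" for s
  define f' where "f' s = 1 / (1 + ((s - \<rho>) / eps)\<^sup>2)" for s
  have c: "0 \<le> c" "c \<le> 2" using pi_less_4 by (auto simp: c_def)
  have D: "(f has_real_derivative f' s) (at s)" for s
    unfolding f_def[abs_def] f'_def using eps by (auto intro!: derivative_eq_intros simp: divide_simps)
  have pos: "0 < 1 + ((s - \<rho>) / eps)\<^sup>2" for s by (simp add: add_pos_nonneg)
  have cf': "isCont f' s" for s unfolding f'_def using pos[of s] eps by (intro continuous_intros) auto
  have f'01: "0 \<le> f' s" "f' s \<le> 1" for s unfolding f'_def using pos[of s] by (simp_all add: divide_le_eq)
  have arct: "\<bar>arctan x + c\<bar> \<le> 4" for x using abs_arctan_le_2[of x] c abs_triangle_ineq[of "arctan x" c] by linarith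
  have bf: "\<bar>f s\<bar> \<le> 4 * eps" for s
  proof -
    have "\<bar>f s\<bar> = eps * \<bar>arctan ((s - \<rho>) / eps) + c\<bar>" using eps by (simp add: f_def abs_mult)
    also have "\<dots> \<le> eps * 4" using eps arct by (intro mult_left_mono) auto
    finally show ?thesis by simp
  qed
  have bf0: "\<bar>f s\<bar> \<le> 4 * eps + 1" for s using bf[of s] by simp
  have bf1: "\<bar>f' s\<bar> \<le> 4 * eps + 1" for s using f'01[of s] eps by simp
  note T = parts_test_function[of f f' "4 * eps + 1", OF D cf' bf0 bf1]
  let ?E = "{g \<in> space (std_gauss d). r\<^sup>2 < N g \<and> N g \<le> (r + eps)\<^sup>2}"
  have "measure (std_gauss d) ?E = (\<integral>g. indicator ?E g \<partial>std_gauss d)" by simp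
  also have "\<dots> \<le> (\<integral>g. 4 * (f' (sqrt (S g)) * (N g / S g)) \<partial>std_gauss d)"
  proof (rule integral_mono)
    show "integrable (std_gauss d) (\<lambda>g. indicator ?E g :: real)"
      by (rule integrable_real_indicator) (measurable, simp add: gauss.emeasure_eq_measure)
    show "integrable (std_gauss d) (\<lambda>g. 4 * (f' (sqrt (S g)) * (N g / S g)))" by (rule integrable_mult_right[OF T(3)])
    fix g
    show "indicator ?E g \<le> 4 * (f' (sqrt (S g)) * (N g / S g))"
    proof (cases "g \<in> ?E")
      case True
      define n where "n = sqrt (N g)"
      have n: "0 \<le> n" "N g = n\<^sup>2" using N_nonneg[of g] by (simp_all add: n_def)
      have rn: "r < n" "n \<le> r + eps"
      proof -
        have "r\<^sup>2 < N g" "N g \<le> (r + eps)\<^sup>2" using True by blast+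
        then show "r < n" "n \<le> r + eps" unfolding n_def using r(2) eps
          by (auto intro!: real_less_rsqrt real_le_lsqrt simp del: power2_eq_square)
      qed
      \<comment> \<open>On the window N > r^2 = e2, so at least half of S = N + e2 is N.\<close>
      have half: "1 / 2 \<le> N g / S g"
      proof -
        have "e2 < N g" using True unfolding r(1) by blast
        then show ?thesis using S_pos(1)[of g] by (simp add: S_def divide_simps)
      qed
      have \<rho>: "\<rho>\<^sup>2 = r\<^sup>2 + e2" "r \<le> \<rho>" "0 < \<rho>" using r e2 by (auto simp: \<rho>_def intro: real_le_rsqrt)
      define s where "s = sqrt (S g)"
      have s: "s\<^sup>2 = N g + e2" "n \<le> s" using S_pos(1)[of g] n e2 by (auto simp: s_def S_def intro!: real_le_rsqrt)
      have le: "\<rho> \<le> s" unfolding \<rho>_def s_def S_def using True by (intro real_sqrt_le_mono) auto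
      \<comment> \<open>Passing from sqrt N to sqrt (N + e2) does not lengthen the window: the
        differences of squares agree, while the sum of the two radii has grown.\<close>
      have "(s - \<rho>) * (s + \<rho>) = (n - r) * (n + r)" using s(1) \<rho>(1) n(2) by (simp add: power2_eq_square algebra_simps)
      also have "\<dots> \<le> (n - r) * (s + \<rho>)" using rn s \<rho> by (intro mult_left_mono) auto
      finally have "s - \<rho> \<le> n - r" using s \<rho> n by (simp add: mult_le_cancel_right)
      then have "0 \<le> (s - \<rho>) / eps" "(s - \<rho>) / eps \<le> 1" using le rn eps by (auto simp: divide_simps)
      then have "((s - \<rho>) / eps)\<^sup>2 \<le> 1" by (simp add: power_le_one)
      then have "1 / 2 \<le> f' s" unfolding f'_def using pos[of s] by (simp only: le_divide_eq) simp
      then have "1 / 2 * (1 / 2) \<le> f' s * (N g / S g)" using half by (intro mult_mono) auto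
      moreover have "indicator ?E g = (1 :: real)" using True by (rule indicator_eq_1_iff[THEN iffD2])
      ultimately show ?thesis unfolding s_def by linarith
    next
      case False
      then show ?thesis using f'01(1) N_nonneg[of g] S_pos(1)[of g] by simp
    qed
  qed
  also have "\<dots> = 4 * (\<integral>g. f (sqrt (S g)) * \<delta> g \<partial>std_gauss d)" by (simp only: integral_mult_right_zero T(1))
  also have "\<dots> \<le> 24 * eps / lam"
  proof (cases "3 \<le> d")
    case True
    note A = expectation_abs_delta_le[OF True]
    have bf2: "\<bar>f s\<bar> \<le> 2 * eps" for s
    proof -
      have "\<bar>f s\<bar> = eps * \<bar>arctan ((s - \<rho>) / eps)\<bar>" using eps True by (simp add: f_def c_def abs_mult)
      also have "\<dots> \<le> eps * 2" using eps abs_arctan_le_2 by (intro mult_left_mono) auto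
      finally show ?thesis by simp
    qed
    have "(\<integral>g. f (sqrt (S g)) * \<delta> g \<partial>std_gauss d) \<le> (\<integral>g. 2 * eps * \<bar>\<delta> g\<bar> \<partial>std_gauss d)"
    proof (rule integral_mono[OF T(2)])
      show "integrable (std_gauss d) (\<lambda>g. 2 * eps * \<bar>\<delta> g\<bar>)" using A(1) by simp
      fix g
      have "f (sqrt (S g)) * \<delta> g \<le> \<bar>f (sqrt (S g))\<bar> * \<bar>\<delta> g\<bar>" unfolding abs_mult[symmetric] by (rule abs_ge_self)
      also have "\<dots> \<le> 2 * eps * \<bar>\<delta> g\<bar>" by (intro mult_right_mono bf2) simp
      finally show "f (sqrt (S g)) * \<delta> g \<le> 2 * eps * \<bar>\<delta> g\<bar>" .
    qed
    also have "\<dots> = 2 * eps * (\<integral>g. \<bar>\<delta> g\<bar> \<partial>std_gauss d)" by simp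
    also have "\<dots> \<le> 2 * eps * (2 / lam)" using A(2) eps by (intro mult_left_mono) auto
    finally show ?thesis using eps lam by (simp add: field_simps)
  next
    case False
    have f0: "0 \<le> f s" "f s \<le> 4 * eps" for s
    proof -
      have "- (pi / 2) < arctan ((s - \<rho>) / eps)" by (rule arctan_lbound)
      then show "0 \<le> f s" using eps False by (simp add: f_def c_def)
      show "f s \<le> 4 * eps" using bf[of s] by simp
    qed
    have i: "integrable (std_gauss d) (\<lambda>g. sqn d g)" by (rule Z.integrable_sqn)
    have "(\<integral>g. f (sqrt (S g)) * \<delta> g \<partial>std_gauss d) \<le> (\<integral>g. 4 * eps / lam * ((1 + sqn d g) / 2) \<partial>std_gauss d)"
    proof (rule integral_mono[OF T(2)])
      show "integrable (std_gauss d) (\<lambda>g. 4 * eps / lam * ((1 + sqn d g) / 2))" using i by simp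
      fix g
      define s where "s = sqrt (S g)"
      have s: "0 < s" "S g = s * s" using S_pos(1)[of g] by (simp_all add: s_def)
      have "\<delta> g \<le> \<bar>Q g\<bar> / s"
      proof -
        \<comment> \<open>The positive term N / S^(3/2) is at most d / sqrt S, which leaves |Q| /
          sqrt S; by Cauchy-Schwarz and coercivity this is at most |g| / lam.\<close>
        have "N g / (S g * s) \<le> 1 / s" using S_pos[of g] s(1) by (simp add: divide_simps)
        moreover have "1 / s \<le> d / s" using d s(1) by (intro divide_right_mono) auto
        moreover have "Q g / s \<le> \<bar>Q g\<bar> / s" using s(1) by (intro divide_right_mono) auto
        ultimately show ?thesis unfolding \<delta>_def s_def[symmetric] diff_divide_distrib by linarith
      qed
      moreover have "\<bar>Q g\<bar> \<le> sqrt (sqn d g) * (s / lam)"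
      proof -
        have "\<bar>Q g\<bar> \<le> sqrt (sqn d g) * sqrt (sqn d (vec g))" using abs_dot_le[of d g "vec g"] unfolding Q_def dot_def .
        also have "sqrt (sqn d (vec g)) \<le> s / lam"
        proof -
          have "sqn d (vec g) \<le> S g / lam\<^sup>2" using N_ge[of g] S_pos(3)[of g] lam by (simp add: divide_simps mult.commute)
          then have "sqrt (sqn d (vec g)) \<le> sqrt (S g / lam\<^sup>2)" by (rule real_sqrt_le_mono)
          then show ?thesis using lam by (simp add: real_sqrt_divide s_def)
        qed
        finally show ?thesis by (simp add: mult_left_mono)
      qed
      ultimately have "\<delta> g \<le> sqrt (sqn d g) / lam"
      proof -
        assume 1: "\<delta> g \<le> \<bar>Q g\<bar> / s" and 2: "\<bar>Q g\<bar> \<le> sqrt (sqn d g) * (s / lam)"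
        have "\<bar>Q g\<bar> / s \<le> sqrt (sqn d g) * (s / lam) / s" using 2 s(1) by (intro divide_right_mono) auto
        also have "\<dots> = sqrt (sqn d g) / lam" using s(1) by simp
        finally show ?thesis using 1 by linarith
      qed
      also have "sqrt (sqn d g) / lam \<le> (1 + sqn d g) / 2 / lam"
      proof (rule divide_right_mono)
        have "0 \<le> (sqrt (sqn d g) - 1)\<^sup>2" by simp
        also have "(sqrt (sqn d g) - 1)\<^sup>2 = sqn d g - 2 * sqrt (sqn d g) + 1" by (simp add: power2_eq_square algebra_simps)
        finally show "sqrt (sqn d g) \<le> (1 + sqn d g) / 2" by simp
      qed (use lam in simp)
      finally have "f s * \<delta> g \<le> f s * ((1 + sqn d g) / 2 / lam)" using f0(1) by (rule mult_left_mono)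
      also have "\<dots> \<le> 4 * eps * ((1 + sqn d g) / 2 / lam)" using f0(2) lam by (intro mult_right_mono) auto
      finally show "f (sqrt (S g)) * \<delta> g \<le> 4 * eps / lam * ((1 + sqn d g) / 2)" unfolding s_def by simp
    qed
    also have "\<dots> = 4 * eps / lam * ((1 + d) / 2)"
      using i by (simp add: Z.expectation_sqn gauss.prob_space)
    \<comment> \<open>As d \<le> 2. The constant 24 is 4 * 4 * 3/2; the case d \<ge> 3 needs only
      16.\<close>
    also have "\<dots> \<le> 4 * eps / lam * (3 / 2)" using False eps lam by (intro mult_left_mono) auto
    finally show ?thesis by simp
  qed
  finally show ?thesis .
qed

lemma (in quadratic_form) anticoncentration:
  assumes eps: "0 < eps" and r: "0 \<le> r" and d: "1 \<le> d"
  shows "measure (std_gauss d) {g \<in> space (std_gauss d). r\<^sup>2 < N g \<and> N g \<le> (r + eps)\<^sup>2} \<le> 24 * eps / lam"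
proof -
  have pos: "measure (std_gauss d) {g \<in> space (std_gauss d). r\<^sup>2 < N g \<and> N g \<le> (r + eps)\<^sup>2} \<le> 24 * eps / lam"
    if "0 < r" "0 < eps" for r eps
  proof -
    interpret R: regularized_quadratic_form d A b lam "r\<^sup>2" by unfold_locales (use that in auto)
    show ?thesis by (rule R.window_bound[OF that(2) refl that(1) d])
  qed
  show ?thesis
  proof (cases "r = 0")
    case False then show ?thesis using pos[of r eps] r eps by simp
  next
    case True
    \<comment> \<open>The regularization by r^2 needs r > 0. The window at r = 0 is the increasing
      union of windows that start at eps / (k + 2), where k + 2 keeps the start strictly between 0
      and eps.\<close>
    define E where "E k = {g \<in> space (std_gauss d). (eps / real (k + 2))\<^sup>2 < N g \<and> N g \<le> eps\<^sup>2}" for k :: nat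
    have m: "E k \<in> sets (std_gauss d)" for k unfolding E_def by measurable
    have bound: "measure (std_gauss d) (E k) \<le> 24 * eps / lam" for k
    proof -
      let ?\<eta> = "eps / real (k + 2)"
      have \<eta>: "0 < ?\<eta>" "?\<eta> < eps" using eps by (auto simp: divide_simps)
      have "measure (std_gauss d) (E k) \<le> 24 * (eps - ?\<eta>) / lam" using pos[of ?\<eta> "eps - ?\<eta>"] \<eta> by (simp add: E_def)
      also have "\<dots> \<le> 24 * eps / lam" using \<eta> lam by (intro divide_right_mono) auto
      finally show ?thesis .
    qed
    have inc: "incseq E"
    proof (rule incseq_SucI)
      fix k
      have "(eps / real (Suc k + 2))\<^sup>2 \<le> (eps / real (k + 2))\<^sup>2" using eps by (intro power_mono divide_left_mono) auto
      then show "E k \<le> E (Suc k)" unfolding E_def by auto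
    qed
    have U: "(\<Union>k. E k) = {g \<in> space (std_gauss d). 0 < N g \<and> N g \<le> eps\<^sup>2}"
    proof (rule equalityI; rule subsetI)
      fix g assume "g \<in> (\<Union>k. E k)"
      then show "g \<in> {g \<in> space (std_gauss d). 0 < N g \<and> N g \<le> eps\<^sup>2}"
        unfolding E_def by (auto intro: le_less_trans[OF zero_le_power2])
    next
      fix g assume g: "g \<in> {g \<in> space (std_gauss d). 0 < N g \<and> N g \<le> eps\<^sup>2}"
      define n where "n = sqrt (N g)"
      have n: "0 < n" "N g = n\<^sup>2" using g by (simp_all add: n_def)
      obtain k :: nat where k: "eps / n < real k" using reals_Archimedean2 by blast
      then have "eps / real (k + 2) < n" using n eps by (simp add: divide_simps mult.commute) (simp add: algebra_simps)
      then have "(eps / real (k + 2))\<^sup>2 < N g" unfolding n(2) using eps by (intro power_strict_mono) auto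
      then show "g \<in> (\<Union>k. E k)" using g unfolding E_def by auto
    qed
    have "(\<lambda>k. measure (std_gauss d) (E k)) \<longlonglongrightarrow> measure (std_gauss d) (\<Union>k. E k)"
      using m inc by (intro gauss.finite_Lim_measure_incseq) auto
    then have "measure (std_gauss d) (\<Union>k. E k) \<le> 24 * eps / lam"
      by (rule LIMSEQ_le_const2) (use bound in auto)
    then show ?thesis unfolding U using True by simp
  qed
qed

lemma std_gauss_ball_anticoncentration:
  assumes d: "1 \<le> d" and r: "0 \<le> r" and e: "0 \<le> e"
  shows "measure (std_gauss d) {g \<in> space (std_gauss d). sqn d (\<lambda>i. g i - a i) \<le> (r + e)\<^sup>2} -
    measure (std_gauss d) {g \<in> space (std_gauss d). sqn d (\<lambda>i. g i - a i) \<le> r\<^sup>2} \<le> 24 * e"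
proof (cases "e = 0")
  case True then show ?thesis by simp
next
  case False
  define A :: "nat \<Rightarrow> nat \<Rightarrow> real" where "A = (\<lambda>k j. if k = j then 1 else 0)"
  have A: "(\<Sum>j<d. A k j * v j) = v k" if "k < d" for k v
    using that by (simp add: A_def if_distrib[of "\<lambda>x. x * _"] cong: if_cong)
  interpret I: quadratic_form d A "\<lambda>i. - a i" 1
    by unfold_locales (auto simp: sqn_def A)
  have N: "I.N g = sqn d (\<lambda>i. g i - a i)" for g
    unfolding I.N_def I.lin_def I.vec_def sqn_def by (intro sum.cong refl) (simp add: A)
  have "measure (std_gauss d) {g \<in> space (std_gauss d). sqn d (\<lambda>i. g i - a i) \<le> (r + e)\<^sup>2} -
    measure (std_gauss d) {g \<in> space (std_gauss d). sqn d (\<lambda>i. g i - a i) \<le> r\<^sup>2} =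
    measure (std_gauss d) ({g \<in> space (std_gauss d). sqn d (\<lambda>i. g i - a i) \<le> (r + e)\<^sup>2} - {g \<in> space (std_gauss d). sqn d (\<lambda>i. g i - a i) \<le> r\<^sup>2})"
  proof (rule gauss.finite_measure_Diff[symmetric])
    have "r\<^sup>2 \<le> (r + e)\<^sup>2" using r e by (intro power_mono) auto
    then show "{g \<in> space (std_gauss d). sqn d (\<lambda>i. g i - a i) \<le> r\<^sup>2} \<subseteq> {g \<in> space (std_gauss d). sqn d (\<lambda>i. g i - a i) \<le> (r + e)\<^sup>2}" by auto
  qed measurable
  also have "\<dots> = measure (std_gauss d) {g \<in> space (std_gauss d). r\<^sup>2 < I.N g \<and> I.N g \<le> (r + e)\<^sup>2}"
    unfolding N by (rule arg_cong[where f = "measure (std_gauss d)"]) auto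
  also have "\<dots> \<le> 24 * e / 1" using False e by (intro I.anticoncentration r d) simp
  finally show ?thesis by simp
qed

section \<open>The Berry-Esseen bound for balls\<close>

lemma integral_ballind:
  "(\<integral>v. ballind d t (\<lambda>i. V v i - a i) \<partial>N) = sqn_le_prob N d V a t"
proof -
  have "(\<integral>v. ballind d t (\<lambda>i. V v i - a i) \<partial>N) = (\<integral>v. indicator {v \<in> space N. sqn d (\<lambda>i. V v i - a i) \<le> t} v \<partial>N)"
    by (rule Bochner_Integration.integral_cong) (auto simp: ballind_def indicator_def)
  also have "\<dots> = measure N ({v \<in> space N. sqn d (\<lambda>i. V v i - a i) \<le> t} \<inter> space N)" by simp
  finally show ?thesis unfolding sqn_le_prob_def by (simp add: Int_def conj_commute)
qed

lemma sqn_le_prob_bounds: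
  assumes "prob_space N" shows "0 \<le> sqn_le_prob N d V a t" "sqn_le_prob N d V a t \<le> 1"
  using prob_space.prob_le_1[OF assms] by (simp_all add: sqn_le_prob_def)

lemma sqn_le_prob_scaled_gauss:
  assumes s: "0 < s"
  shows "sqn_le_prob (std_gauss d) d (\<lambda>z i. s * z i) a t =
    measure (std_gauss d) {z \<in> space (std_gauss d). sqn d (\<lambda>i. z i - a i / s) \<le> t / s\<^sup>2}"
proof -
  have "sqn d (\<lambda>i. s * z i - a i) = s\<^sup>2 * sqn d (\<lambda>i. z i - a i / s)" for z
    unfolding sqn_def sum_distrib_left using s by (intro sum.cong refl) (simp add: power_mult_distrib[symmetric] algebra_simps)
  then show ?thesis unfolding sqn_le_prob_def using s by (simp add: le_divide_eq mult.commute)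
qed

lemma scaled_gauss_anticoncentration:
  assumes d: "1 \<le> d" and r: "0 \<le> r" and e: "0 \<le> e" and s: "0 < s"
  shows "sqn_le_prob (std_gauss d) d (\<lambda>z i. s * z i) a ((r + e)\<^sup>2) - sqn_le_prob (std_gauss d) d (\<lambda>z i. s * z i) a (r\<^sup>2) \<le> 24 / s * e"
  using std_gauss_ball_anticoncentration[OF d, of "r / s" "e / s" "\<lambda>i. a i / s"] r e s
  unfolding sqn_le_prob_scaled_gauss[OF s] by (simp add: power_divide add_divide_distrib[symmetric])

lemma scaled_gauss_small_ball:
  fixes \<rho> :: real
  assumes d: "1 \<le> d" and \<rho>: "0 \<le> \<rho>" and s: "0 < s"
  shows "sqn_le_prob (std_gauss d) d (\<lambda>z i. s * z i) a (\<rho>\<^sup>2 * d) \<le> 24 / s * \<rho>"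
proof -
  \<comment> \<open>The weaker constant 24 lets one and the same A serve both Gaussian hypotheses of
    \<open>smoothing_inequality\<close>.\<close>
  have "exp 1 \<le> (24 :: real)\<^sup>2" using exp_le by simp
  then have "sqrt (exp 1) \<le> 24" by (intro real_le_lsqrt) auto
  then have "sqrt (exp 1) * (\<rho> / s) \<le> 24 * (\<rho> / s)" using \<rho> s by (intro mult_right_mono) auto
  moreover have "gball d (\<lambda>i. - (a i / s)) ((\<rho> / s)\<^sup>2 * d) \<le> sqrt (exp 1) * (\<rho> / s)"
    using \<rho> s by (intro gball_small d) auto
  ultimately show ?thesis unfolding sqn_le_prob_scaled_gauss[OF s] gball_def by (simp add: power_divide)
qed

text \<open>Chosen so that the self-referential term 16 K C_tilt / \<kappa> is at most K / 2;
  \<open>K_BE\<close> is then at least twice the rest of the bound, in which 1128 = 47 * 24 comes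
  from the smoothing inequality with A = 24 / sqrt n. The lower bounds 2 serve
  \<open>lindeberg_bound\<close> and the case of a single summand.\<close>

definition kappa_BE :: real where "kappa_BE = max 2 (32 * C_tilt)"
definition K_BE :: real where "K_BE = max 2 (2 * (8 * C_tilt + 1128 * kappa_BE))"

lemma K_BE_closed: "8 * C_tilt + 16 * K_BE * C_tilt / kappa_BE + 1128 * kappa_BE \<le> K_BE"
proof -
  have k: "2 \<le> kappa_BE" "32 * C_tilt \<le> kappa_BE" "0 < kappa_BE" by (auto simp: kappa_BE_def)
  have K: "0 \<le> K_BE" "2 * (8 * C_tilt + 1128 * kappa_BE) \<le> K_BE" by (auto simp: K_BE_def)
  have "16 * K_BE * C_tilt / kappa_BE = K_BE / 2 * (32 * C_tilt / kappa_BE)" by simp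
  also have "\<dots> \<le> K_BE / 2 * 1" using k K by (intro mult_left_mono) (auto simp: divide_le_eq)
  finally have "16 * K_BE * C_tilt / kappa_BE \<le> K_BE / 2" by simp
  moreover have "8 * C_tilt + 1128 * kappa_BE \<le> K_BE / 2" using K(2) by simp
  ultimately show ?thesis by simp
qed

text \<open>By strong induction the partial sums of fewer terms are almost as anticoncentrated as Gaussian vectors; this enters
  the bound for \<open>n\<close> terms with a factor \<open>1 / kappa_BE\<close>, so the constant reproduces itself.\<close>

theorem (in isotropic) ball_berry_esseen:
  assumes d: "1 \<le> d" and n: "1 \<le> n"
  shows "\<bar>sqn_le_prob (prodM n) d (psum n) a t - sqn_le_prob (std_gauss d) d (\<lambda>z i. sqrt n * z i) a t\<bar> \<le> K_BE * sqrt (m4 / n)"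
  using n
proof (induction n arbitrary: a t rule: less_induct)
  case (less n)
  have "1 \<le> (real d)\<^sup>2" using d by (simp add: one_le_power)
  then have m4: "1 \<le> m4" using m4_ge by linarith
  have K: "2 \<le> K_BE" "2 \<le> kappa_BE" by (auto simp: K_BE_def kappa_BE_def)
  have le1: "\<bar>sqn_le_prob (prodM k) d (psum k) a t - sqn_le_prob (std_gauss d) d (\<lambda>z i. sqrt k * z i) a t\<bar> \<le> 1" for k a t
    using sqn_le_prob_bounds[OF prob_space_prodM, of k d "psum k" a t]
      sqn_le_prob_bounds[OF gauss.prob_space_axioms, of d d "\<lambda>z i. sqrt k * z i" a t] by linarith
  show ?case
  proof (cases "n = 1")
    case True
    have "1 \<le> sqrt (m4 / n)" using m4 True by simp
    then have "2 * 1 \<le> K_BE * sqrt (m4 / n)" using K by (intro mult_mono) auto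
    then show ?thesis using le1[of n a t] by linarith
  next
    case False
    then have n2: "2 \<le> n" using less.prems by simp
    have n0: "0 < sqrt (real n)" using n2 by simp
    let ?D = "(4 * C_tilt + 8 * K_BE * C_tilt / kappa_BE) * sqrt (m4 / n)"
    have "\<bar>sqn_le_prob (prodM n) d (psum n) a t - sqn_le_prob (std_gauss d) d (\<lambda>z i. sqrt n * z i) a t\<bar>
      \<le> 2 * ?D + 47 * (24 / sqrt n) * (kappa_BE * sqrt m4)"
    proof (rule smoothing_inequality[OF d _ prob_space_prodM gauss.prob_space_axioms])
      show "0 < kappa_BE * sqrt m4" using K m4 by (intro mult_pos_pos) auto
      show "\<bar>(\<integral>v. bprob d t (\<lambda>i. psum n v i - a i) (kappa_BE * sqrt m4) \<partial>prodM n) -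
          (\<integral>v. bprob d t (\<lambda>i. sqrt n * v i - a i) (kappa_BE * sqrt m4) \<partial>std_gauss d)\<bar> \<le> ?D" for a t
      proof (rule lindeberg_bound[OF d n2 K(2)])
        show "0 \<le> K_BE" using K by simp
        fix k :: nat and a
        show "\<bar>(\<integral>y. ballind d t (\<lambda>i. psum k y i - a i) \<partial>prodM k) - (\<integral>z. ballind d t (\<lambda>i. sqrt k * z i - a i) \<partial>std_gauss d)\<bar> \<le> 1"
          using le1[of k a t] unfolding integral_ballind .
        assume k: "1 \<le> k" "k < n"
        show "\<bar>(\<integral>y. ballind d t (\<lambda>i. psum k y i - a i) \<partial>prodM k) - (\<integral>z. ballind d t (\<lambda>i. sqrt k * z i - a i) \<partial>std_gauss d)\<bar> \<le> K_BE * sqrt (m4 / k)"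
          using less.IH[OF k(2,1), of a t] unfolding integral_ballind .
      qed
      show "0 \<le> 24 / sqrt (real n)" by simp
      show "sqn_le_prob (std_gauss d) d (\<lambda>z i. sqrt n * z i) a ((r + e)\<^sup>2) -
          sqn_le_prob (std_gauss d) d (\<lambda>z i. sqrt n * z i) a (r\<^sup>2) \<le> 24 / sqrt n * e" if "0 \<le> r" "0 \<le> e" for a and r e :: real
        by (rule scaled_gauss_anticoncentration[OF d that n0])
      show "sqn_le_prob (std_gauss d) d (\<lambda>z i. sqrt n * z i) a (\<rho>\<^sup>2 * d) \<le> 24 / sqrt n * \<rho>" if "0 \<le> \<rho>" for a and \<rho> :: real
        by (rule scaled_gauss_small_ball[OF d that n0])
    qed measurable
    also have "2 * ?D + 47 * (24 / sqrt n) * (kappa_BE * sqrt m4) = (8 * C_tilt + 16 * K_BE * C_tilt / kappa_BE + 1128 * kappa_BE) * sqrt (m4 / n)"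
      by (simp add: real_sqrt_divide algebra_simps)
    also have "\<dots> \<le> K_BE * sqrt (m4 / n)" using K_BE_closed m4 by (intro mult_right_mono) auto
    finally show ?thesis .
  qed
qed

section \<open>Positive definite matrices\<close>

lemma scalar_prod_eq_dot: "w \<in> carrier_vec d \<Longrightarrow> scalar_prod v w = dot d (vec_index v) (vec_index w)"
  by (simp add: scalar_prod_def dot_def atLeast0LessThan)

lemma scalar_prod_eq_sqn: "v \<in> carrier_vec d \<Longrightarrow> scalar_prod v v = sqn d (vec_index v)"
  by (simp add: scalar_prod_def sqn_def atLeast0LessThan power2_eq_square)

lemma scalar_prod_self_nonneg: "0 \<le> scalar_prod v (v :: real Matrix.vec)"
  by (simp add: scalar_prod_def sum_nonneg)

lemma scalar_prod_self_eq_0_iff: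
  fixes v :: "real Matrix.vec"
  assumes "v \<in> carrier_vec d" shows "scalar_prod v v = 0 \<longleftrightarrow> v = 0\<^sub>v d"
  using assms by (auto simp: scalar_prod_def sum_nonneg_eq_0_iff)

lemma scalar_prod_self_pos:
  fixes v :: "real Matrix.vec"
  assumes "v \<in> carrier_vec d" "v \<noteq> 0\<^sub>v d" shows "0 < scalar_prod v v"
  using scalar_prod_self_nonneg[of v] scalar_prod_self_eq_0_iff[OF assms(1)] assms(2) by linarith

lemma vnorm_sq: "(vnorm v)\<^sup>2 = scalar_prod v v"
  by (simp add: vnorm_def scalar_prod_self_nonneg)

lemma vnorm_nonneg: "0 \<le> vnorm v"
  by (simp add: vnorm_def scalar_prod_self_nonneg)

lemma mult_mat_vec_index_sum:
  "A \<in> carrier_mat d d \<Longrightarrow> v \<in> carrier_vec d \<Longrightarrow> i < d \<Longrightarrow> (A *\<^sub>v v) $ i = (\<Sum>j<d. A $$ (i, j) * v $ j)"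
  by (simp add: scalar_prod_def atLeast0LessThan)

lemma symmetric_scalar_prod:
  fixes A :: "real mat"
  assumes "A \<in> carrier_mat d d" "transpose_mat A = A" "v \<in> carrier_vec d" "w \<in> carrier_vec d"
  shows "scalar_prod (A *\<^sub>v v) w = scalar_prod v (A *\<^sub>v w)"
  using transpose_vec_mult_scalar[OF assms(1,4,3)] assms(2) by simp

text \<open>R^d is embedded as the functions that vanish from \<open>d\<close> on, in the product
  topology of all real sequences. There the sphere is a closed subset of a product of compact
  intervals.\<close>

lemma compact_unit_sphere: "compact {f :: nat \<Rightarrow> real. (\<forall>i\<ge>d. f i = 0) \<and> sqn d f = 1}"
proof -
  let ?B = "\<lambda>i :: nat. if i < d then {-1..1} else {0 :: real}"
  have c: "continuous_on UNIV (sqn d)"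
    unfolding sqn_def[abs_def] by (intro continuous_intros continuous_on_product_coordinates)
  have "compactin (product_topology (\<lambda>i. euclidean) UNIV) (PiE UNIV ?B)"
    unfolding compactin_PiE by simp
  then have 1: "compact (PiE UNIV ?B)" by (simp add: euclidean_product_topology)
  have "closed (sqn d -` {1})" using closed_vimage[OF closed_singleton c] by simp
  then have "compact (PiE UNIV ?B \<inter> sqn d -` {1})" by (rule compact_Int_closed[OF 1])
  moreover have "PiE UNIV ?B \<inter> sqn d -` {1} = {f. (\<forall>i\<ge>d. f i = 0) \<and> sqn d f = 1}"
  proof (rule equalityI; rule subsetI)
    fix f assume f: "f \<in> {f. (\<forall>i\<ge>d. f i = 0) \<and> sqn d f = 1}"
    have "f i \<in> ?B i" for i
    proof (cases "i < d")
      case True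
      then have "(f i)\<^sup>2 \<le> sqn d f" unfolding sqn_def by (intro member_le_sum) auto
      then have "\<bar>f i\<bar> \<le> 1" using f by (simp add: abs_square_le_1)
      then show ?thesis using True by (auto simp: abs_le_iff)
    qed (use f in auto)
    then show "f \<in> PiE UNIV ?B \<inter> sqn d -` {1}" using f by (auto simp: PiE_def extensional_def)
  next
    fix f assume f: "f \<in> PiE UNIV ?B \<inter> sqn d -` {1}"
    then have "f i \<in> ?B i" for i by blast
    then have "f i = 0" if "d \<le> i" for i using that by (metis not_less singletonD)
    then show "f \<in> {f. (\<forall>i\<ge>d. f i = 0) \<and> sqn d f = 1}" using f by simp
  qed
  ultimately show ?thesis by simp
qed

text \<open>Minimum of the Rayleigh quotient on the orthogonal complement of W, attained because the
  unit sphere of the complement is compact; \<open>v0\<close> makes this sphere nonempty.\<close>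

lemma quadratic_form_minimum:
  fixes M :: "real mat"
  assumes M: "M \<in> carrier_mat d d" and W: "W \<subseteq> carrier_vec d"
    and v0: "v0 \<in> carrier_vec d" "v0 \<noteq> 0\<^sub>v d" "\<And>u. u \<in> W \<Longrightarrow> scalar_prod u v0 = 0"
  obtains v where "v \<in> carrier_vec d" "scalar_prod v v = 1" "\<And>u. u \<in> W \<Longrightarrow> scalar_prod u v = 0"
    "\<And>w. w \<in> carrier_vec d \<Longrightarrow> (\<And>u. u \<in> W \<Longrightarrow> scalar_prod u w = 0) \<Longrightarrow>
      scalar_prod v (M *\<^sub>v v) * scalar_prod w w \<le> scalar_prod w (M *\<^sub>v w)"
proof -
  define S where "S = {f :: nat \<Rightarrow> real. (\<forall>i\<ge>d. f i = 0) \<and> sqn d f = 1}"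
  define T where "T = S \<inter> (\<Inter>u\<in>W. (\<lambda>f. dot d (vec_index u) f) -` {0})"
  define q where "q f = (\<Sum>i<d. f i * (\<Sum>j<d. M $$ (i, j) * f j))" for f
  have qM: "scalar_prod (Matrix.vec d f) (M *\<^sub>v Matrix.vec d f) = q f" for f
  proof -
    have "scalar_prod (Matrix.vec d f) (M *\<^sub>v Matrix.vec d f) = (\<Sum>i<d. f i * (M *\<^sub>v Matrix.vec d f) $ i)"
      using M by (simp add: scalar_prod_def atLeast0LessThan)
    also have "\<dots> = q f" unfolding q_def
    proof (intro sum.cong refl arg_cong2[where f = "(*)"])
      fix i assume "i \<in> {..<d}"
      then show "(M *\<^sub>v Matrix.vec d f) $ i = (\<Sum>j<d. M $$ (i, j) * f j)"
        using mult_mat_vec_index_sum[OF M, of "Matrix.vec d f" i] by simp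
    qed
    finally show ?thesis .
  qed
  have vd: "dot d g (vec_index (Matrix.vec d f)) = dot d g f" for g f by (simp add: dot_def)
  have sd: "scalar_prod (Matrix.vec d f) (Matrix.vec d f) = sqn d f" for f
    by (subst scalar_prod_eq_sqn[where d = d]) (simp_all add: sqn_def)
  have "closed (\<Inter>u\<in>W. (\<lambda>f. dot d (vec_index u) f) -` {0})"
  proof (intro closed_INT ballI)
    fix u
    have "continuous_on UNIV (\<lambda>f. dot d (vec_index u) f)"
      unfolding dot_def by (intro continuous_intros continuous_on_product_coordinates)
    then show "closed ((\<lambda>f. dot d (vec_index u) f) -` {0})" using closed_vimage[OF closed_singleton] by blast
  qed
  then have T: "compact T" unfolding T_def S_def by (intro compact_Int_closed compact_unit_sphere)
  have mem: "(\<lambda>i. if i < d then w $ i / sqrt (scalar_prod w w) else 0) \<in> T"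
    if w: "w \<in> carrier_vec d" "w \<noteq> 0\<^sub>v d" "\<And>u. u \<in> W \<Longrightarrow> scalar_prod u w = 0" for w
  proof -
    let ?s = "sqrt (scalar_prod w w)"
    have s: "0 < ?s" using scalar_prod_self_pos[OF w(1,2)] by simp
    have "sqn d (\<lambda>i. if i < d then w $ i / ?s else 0) = sqn d (vec_index w) / ?s\<^sup>2"
      unfolding sqn_def sum_divide_distrib by (intro sum.cong refl) (simp add: power_divide)
    then have "sqn d (\<lambda>i. if i < d then w $ i / ?s else 0) = 1"
      using s by (simp add: scalar_prod_eq_sqn[OF w(1)])
    moreover have "dot d (vec_index u) (\<lambda>i. if i < d then w $ i / ?s else 0) = 0" if "u \<in> W" for u
    proof -
      have "dot d (vec_index u) (\<lambda>i. if i < d then w $ i / ?s else 0) = dot d (vec_index u) (vec_index w) / ?s"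
        unfolding dot_def sum_divide_distrib by (intro sum.cong refl) simp
      then show ?thesis using w(3)[OF that] by (simp add: scalar_prod_eq_dot[OF w(1)])
    qed
    ultimately show ?thesis unfolding T_def S_def by simp
  qed
  have "continuous_on T q"
    unfolding q_def[abs_def] by (rule continuous_on_subset[of UNIV]) (intro continuous_intros continuous_on_product_coordinates, simp)
  moreover have "T \<noteq> {}" using mem[OF v0] by blast
  ultimately obtain f where f: "f \<in> T" "\<And>g. g \<in> T \<Longrightarrow> q f \<le> q g" using continuous_attains_inf[OF T] by blast
  show ?thesis
  proof (rule that[of "Matrix.vec d f"])
    show "scalar_prod (Matrix.vec d f) (Matrix.vec d f) = 1" unfolding sd using f(1) by (simp add: T_def S_def)
    show "scalar_prod u (Matrix.vec d f) = 0" if "u \<in> W" for u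
      using f(1) that by (subst scalar_prod_eq_dot[where d = d]) (auto simp: T_def vd)
    fix w :: "real Matrix.vec" assume w: "w \<in> carrier_vec d" "\<And>u. u \<in> W \<Longrightarrow> scalar_prod u w = 0"
    show "scalar_prod (Matrix.vec d f) (M *\<^sub>v Matrix.vec d f) * scalar_prod w w \<le> scalar_prod w (M *\<^sub>v w)"
    proof (cases "w = 0\<^sub>v d")
      case True then show ?thesis using M by simp
    next
      case False
      let ?s = "sqrt (scalar_prod w w)"
      have s: "0 < scalar_prod w w" by (rule scalar_prod_self_pos[OF w(1) False])
      have "q (\<lambda>i. if i < d then w $ i / ?s else 0) = q (vec_index w) / ?s\<^sup>2"
        unfolding q_def sum_divide_distrib
        by (intro sum.cong refl) (simp add: power2_eq_square sum_divide_distrib[symmetric])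
      also have "Matrix.vec d (vec_index w) = w" using w(1) by auto
      then have "q (vec_index w) = scalar_prod w (M *\<^sub>v w)" using qM[of "vec_index w"] by simp
      finally have "q f \<le> scalar_prod w (M *\<^sub>v w) / scalar_prod w w" using f(2)[OF mem[OF w(1) False w(2)]] s by simp
      then show ?thesis unfolding qM using s by (simp add: le_divide_eq)
    qed
  qed simp
qed

lemma linear_coeff_zero:
  fixes c k :: real
  assumes "\<And>t. 0 \<le> 2 * t * c + t\<^sup>2 * k" shows "c = 0"
proof -
  define m where "m = \<bar>k\<bar> + 1"
  have m: "0 < m" "k < m" by (auto simp: m_def)
  \<comment> \<open>At t = - c / m with m > |k| the linear term outweighs the quadratic one.\<close>
  have "0 \<le> 2 * (- c / m) * c + (- c / m)\<^sup>2 * k" by (rule assms)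
  also have "\<dots> = c\<^sup>2 * (k - 2 * m) / m\<^sup>2" using m by (simp add: field_simps power2_eq_square)
  finally have "0 \<le> c\<^sup>2 * (k - 2 * m)" using m by (simp add: zero_le_divide_iff)
  then show ?thesis using m by (auto simp: zero_le_mult_iff)
qed

text \<open>The minimizer v is stationary. The residual h = M v - l v is orthogonal to v and, since
  M preserves the complement of W, also to W, so v + t h is an admissible competitor; the linear
  coefficient in t is 2 |h|^2 and has to vanish.\<close>

lemma symmetric_minimum_eigenvector:
  fixes M :: "real mat"
  assumes M: "M \<in> carrier_mat d d" "transpose_mat M = M" and W: "W \<subseteq> carrier_vec d"
    and inv: "\<And>u w. u \<in> W \<Longrightarrow> w \<in> carrier_vec d \<Longrightarrow> (\<And>u. u \<in> W \<Longrightarrow> scalar_prod u w = 0) \<Longrightarrow> scalar_prod u (M *\<^sub>v w) = 0"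
    and v0: "v0 \<in> carrier_vec d" "v0 \<noteq> 0\<^sub>v d" "\<And>u. u \<in> W \<Longrightarrow> scalar_prod u v0 = 0"
  obtains v l where "v \<in> carrier_vec d" "scalar_prod v v = 1" "\<And>u. u \<in> W \<Longrightarrow> scalar_prod u v = 0" "M *\<^sub>v v = l \<cdot>\<^sub>v v"
    "\<And>w. w \<in> carrier_vec d \<Longrightarrow> (\<And>u. u \<in> W \<Longrightarrow> scalar_prod u w = 0) \<Longrightarrow> l * scalar_prod w w \<le> scalar_prod w (M *\<^sub>v w)"
proof -
  obtain v where v: "v \<in> carrier_vec d" "scalar_prod v v = 1" "\<And>u. u \<in> W \<Longrightarrow> scalar_prod u v = 0"
    and min: "\<And>w. w \<in> carrier_vec d \<Longrightarrow> (\<And>u. u \<in> W \<Longrightarrow> scalar_prod u w = 0) \<Longrightarrow>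
      scalar_prod v (M *\<^sub>v v) * scalar_prod w w \<le> scalar_prod w (M *\<^sub>v w)"
    using quadratic_form_minimum[OF M(1) W v0] by metis
  define l where "l = scalar_prod v (M *\<^sub>v v)"
  define h where "h = M *\<^sub>v v - l \<cdot>\<^sub>v v"
  have Mv: "M *\<^sub>v v \<in> carrier_vec d" using M v by simp
  have h: "h \<in> carrier_vec d" unfolding h_def using Mv v by simp
  have Mh: "M *\<^sub>v h \<in> carrier_vec d" using M h by simp
  have vh: "scalar_prod v h = 0"
    unfolding h_def using Mv v by (subst scalar_prod_minus_distrib[where n = d]) (auto simp: l_def)
  have hv: "scalar_prod h v = 0" using vh comm_scalar_prod[OF v(1) h] by simp
  have uh: "scalar_prod u h = 0" if "u \<in> W" for u
    unfolding h_def using Mv v inv[OF that v(1) v(3)] v(3)[OF that] W that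
    by (subst scalar_prod_minus_distrib[where n = d]) auto
  have hMv: "scalar_prod h (M *\<^sub>v v) = scalar_prod h h"
  proof -
    have "scalar_prod h h = scalar_prod h (M *\<^sub>v v) - scalar_prod h (l \<cdot>\<^sub>v v)"
      using scalar_prod_minus_distrib[OF h Mv, of "l \<cdot>\<^sub>v v"] v(1) unfolding h_def[symmetric] by simp
    then show ?thesis using h v(1) hv by simp
  qed
  have vMh: "scalar_prod v (M *\<^sub>v h) = scalar_prod h h"
    using symmetric_scalar_prod[OF M v(1) h] comm_scalar_prod[OF Mv h] hMv by simp
  have "scalar_prod h h = 0"
  proof (rule linear_coeff_zero)
    fix t
    have th: "t \<cdot>\<^sub>v h \<in> carrier_vec d" using h by simp
    have MM: "M *\<^sub>v (v + t \<cdot>\<^sub>v h) = M *\<^sub>v v + t \<cdot>\<^sub>v (M *\<^sub>v h)"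
      using mult_add_distrib_mat_vec[OF M(1) v(1) th] mult_mat_vec[OF M(1) h, of t] by simp
    have "l * scalar_prod (v + t \<cdot>\<^sub>v h) (v + t \<cdot>\<^sub>v h) \<le> scalar_prod (v + t \<cdot>\<^sub>v h) (M *\<^sub>v (v + t \<cdot>\<^sub>v h))"
      unfolding l_def
    proof (rule min)
      show "v + t \<cdot>\<^sub>v h \<in> carrier_vec d" using v h by simp
      show "scalar_prod u (v + t \<cdot>\<^sub>v h) = 0" if "u \<in> W" for u
        using that W v h by (subst scalar_prod_add_distrib[where n = d]) (auto simp: uh)
    qed
    also have "scalar_prod (v + t \<cdot>\<^sub>v h) (v + t \<cdot>\<^sub>v h) = 1 + t\<^sup>2 * scalar_prod h h"
      using v(1) h by (simp add: add_scalar_prod_distrib[where n = d] scalar_prod_add_distrib[where n = d] v(2) vh hv power2_eq_square)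
    also have "scalar_prod (v + t \<cdot>\<^sub>v h) (M *\<^sub>v (v + t \<cdot>\<^sub>v h)) = l + 2 * t * scalar_prod h h + t\<^sup>2 * scalar_prod h (M *\<^sub>v h)"
      unfolding MM using v(1) h Mv Mh
      by (simp add: add_scalar_prod_distrib[where n = d] scalar_prod_add_distrib[where n = d] hMv vMh l_def[symmetric] power2_eq_square algebra_simps)
    finally show "0 \<le> 2 * t * scalar_prod h h + t\<^sup>2 * (scalar_prod h (M *\<^sub>v h) - l * scalar_prod h h)"
      by (simp add: algebra_simps)
  qed
  then have "h = 0\<^sub>v d" using scalar_prod_self_eq_0_iff[OF h] by simp
  have "M *\<^sub>v v = l \<cdot>\<^sub>v v"
  proof (rule eq_vecI)
    fix i assume i: "i < dim_vec (l \<cdot>\<^sub>v v)"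
    then have "h $ i = 0" using \<open>h = 0\<^sub>v d\<close> v(1) by simp
    then show "(M *\<^sub>v v) $ i = (l \<cdot>\<^sub>v v) $ i" unfolding h_def using i Mv v(1) by (simp del: index_mult_mat_vec)
  qed (use M v(1) in auto)
  then show ?thesis using that[OF v(1,2,3), of l] min unfolding l_def[symmetric] by blast
qed

text \<open>The minimum of the Rayleigh quotient over the whole space is itself an eigenvalue, so
  the smallest eigenvalue is at most this minimum.\<close>

lemma smallest_eigenvalue_le_quadratic_form:
  fixes M :: "real mat"
  assumes d: "1 \<le> d" and M: "M \<in> carrier_mat d d" "transpose_mat M = M"
    and k: "smallest_eigenvalue M k" and w: "w \<in> carrier_vec d"
  shows "k * scalar_prod w w \<le> scalar_prod w (M *\<^sub>v w)"
proof -
  have "unit_vec d 0 \<noteq> (0\<^sub>v d :: real Matrix.vec)" using d by (metis One_nat_def Suc_le_lessD index_unit_vec(2) index_zero_vec(1) zero_neq_one)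
  then obtain v l where v: "v \<in> carrier_vec d" "scalar_prod v v = 1" "M *\<^sub>v v = l \<cdot>\<^sub>v v"
    and l: "\<And>w. w \<in> carrier_vec d \<Longrightarrow> l * scalar_prod w w \<le> scalar_prod w (M *\<^sub>v w)"
    using symmetric_minimum_eigenvector[OF M, of "{}" "unit_vec d 0"] unit_vec_carrier[of d 0]
    by (metis empty_iff empty_subsetI)
  have "v \<noteq> 0\<^sub>v d" using v(1,2) by auto
  then have "eigenvalue M l" unfolding eigenvalue_def eigenvector_def using v M by auto
  then have "k * scalar_prod w w \<le> l * scalar_prod w w"
    using k scalar_prod_self_nonneg[of w] unfolding smallest_eigenvalue_def by (intro mult_right_mono) auto
  then show ?thesis using l[OF w] by linarith
qed

text \<open>The next vector is the minimizer on the complement of those found so far; M preserves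
  this complement by symmetry.\<close>

lemma orthonormal_eigenvectors:
  fixes M :: "real mat"
  assumes M: "M \<in> carrier_mat d d" "transpose_mat M = M"
  shows "k \<le> d \<Longrightarrow> \<exists>u l. \<forall>i<k. u i \<in> carrier_vec d \<and> M *\<^sub>v u i = l i \<cdot>\<^sub>v u i \<and> (\<forall>j<k. scalar_prod (u i) (u j) = (if i = j then 1 else 0))"
proof (induction k)
  case 0 then show ?case by simp
next
  case (Suc k)
  then obtain u l where u: "\<And>i. i < k \<Longrightarrow> u i \<in> carrier_vec d" "\<And>i. i < k \<Longrightarrow> M *\<^sub>v u i = l i \<cdot>\<^sub>v u i"
    "\<And>i j. i < k \<Longrightarrow> j < k \<Longrightarrow> scalar_prod (u i) (u j) = (if i = j then 1 else 0)" by auto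
  \<comment> \<open>The rows are u 0, ..., u (k - 1) followed by zero rows. Since k < d the matrix
    is singular, and a kernel vector is orthogonal to every u i, which shows that the complement is
    nontrivial.\<close>
  define N where "N = mat d d (\<lambda>(i, j). if i < k then u i $ j else 0)"
  have N: "N \<in> carrier_mat d d" by (simp add: N_def)
  have kd: "k < d" using Suc.prems by simp
  have "transpose_mat N *\<^sub>v unit_vec d k = 0\<^sub>v d" using kd by (intro eq_vecI) (simp_all add: N_def)
  moreover have "unit_vec d k \<noteq> (0\<^sub>v d :: real Matrix.vec)" using kd by (metis index_unit_vec(2) index_zero_vec(1) zero_neq_one)
  ultimately have "det (transpose_mat N) = 0"
    unfolding det_0_iff_vec_prod_zero[OF transpose_carrier_mat[THEN iffD2, OF N]] by (metis unit_vec_carrier)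
  then have "det N = 0" by (simp add: det_transpose[OF N])
  then obtain v0 where v0: "v0 \<in> carrier_vec d" "v0 \<noteq> 0\<^sub>v d" "N *\<^sub>v v0 = 0\<^sub>v d"
    using det_0_iff_vec_prod_zero[OF N] by blast
  have rowN: "row N i = u i" if "i < k" for i using that kd u(1)[OF that] by (intro eq_vecI) (auto simp: N_def)
  have uv0: "scalar_prod (u i) v0 = 0" if "i < k" for i
    using arg_cong[OF v0(3), of "\<lambda>v. v $ i"] rowN[OF that] that kd N by simp
  obtain v m where v: "v \<in> carrier_vec d" "scalar_prod v v = 1" "\<And>w. w \<in> u ` {..<k} \<Longrightarrow> scalar_prod w v = 0" "M *\<^sub>v v = m \<cdot>\<^sub>v v"
  proof (rule symmetric_minimum_eigenvector[OF M, of "u ` {..<k}" v0])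
    show "u ` {..<k} \<subseteq> carrier_vec d" using u(1) by auto
    show "scalar_prod a (M *\<^sub>v w) = 0" if a: "a \<in> u ` {..<k}" and that: "w \<in> carrier_vec d" "\<And>a. a \<in> u ` {..<k} \<Longrightarrow> scalar_prod a w = 0"
      for a w :: "real Matrix.vec"
    proof -
      obtain i where i: "i < k" "a = u i" using a by blast
      have "scalar_prod (u i) (M *\<^sub>v w) = scalar_prod (l i \<cdot>\<^sub>v u i) w"
        using symmetric_scalar_prod[OF M u(1)[OF i(1)] that(1)] u(2)[OF i(1)] by simp
      then show ?thesis using that(1) that(2)[OF a] u(1)[OF i(1)] i by simp
    qed
  qed (use v0 uv0 that in auto)
  have uv: "scalar_prod (u i) v = 0" "scalar_prod v (u i) = 0" if "i < k" for i
    using v(3)[of "u i"] comm_scalar_prod[OF v(1) u(1)[OF that]] that by auto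
  let ?u = "u(k := v)" and ?l = "l(k := m)"
  have "\<forall>i<Suc k. ?u i \<in> carrier_vec d \<and> M *\<^sub>v ?u i = ?l i \<cdot>\<^sub>v ?u i \<and> (\<forall>j<Suc k. scalar_prod (?u i) (?u j) = (if i = j then 1 else 0))"
    using u v uv by (auto simp: less_Suc_eq)
  then show ?case by blast
qed

section \<open>Inverses and square roots of positive definite matrices\<close>

lemma mult_mat_vec_zero: "A \<in> carrier_mat d d \<Longrightarrow> A *\<^sub>v 0\<^sub>v d = (0\<^sub>v d :: real Matrix.vec)"
  by (intro eq_vecI) auto

definition diag_fun :: "nat \<Rightarrow> (nat \<Rightarrow> real) \<Rightarrow> real mat" where
  "diag_fun d g = mat d d (\<lambda>(i, j). if i = j then g i else 0)"

lemma diag_fun_carrier [simp]: "diag_fun d g \<in> carrier_mat d d"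
  by (simp add: diag_fun_def)

lemma diag_fun_mult_mat: "A \<in> carrier_mat d d \<Longrightarrow> diag_fun d g * A = mat d d (\<lambda>(i, j). g i * A $$ (i, j))"
  by (intro eq_matI) (auto simp: diag_fun_def scalar_prod_def if_distrib[of "\<lambda>x. x * _"] cong: if_cong)

lemma mat_mult_diag_fun: "A \<in> carrier_mat d d \<Longrightarrow> A * diag_fun d g = mat d d (\<lambda>(i, j). A $$ (i, j) * g j)"
  by (intro eq_matI) (auto simp: diag_fun_def scalar_prod_def if_distrib[of "\<lambda>x. _ * x"] cong: if_cong)

lemma diag_fun_mult: "diag_fun d g * diag_fun d h = diag_fun d (\<lambda>i. g i * h i)"
  by (subst diag_fun_mult_mat) (auto simp: diag_fun_def intro!: eq_matI)

lemma pos_def_diagonalization: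
  assumes M: "pos_def M" "M \<in> carrier_mat d d"
  obtains U l where "U \<in> carrier_mat d d" "U * transpose_mat U = 1\<^sub>m d" "transpose_mat U * U = 1\<^sub>m d"
    "M = transpose_mat U * (diag_fun d l * U)" "\<And>i. i < d \<Longrightarrow> 0 < l i"
proof -
  have sym: "transpose_mat M = M" using M by (simp add: pos_def_def)
  obtain u l where u: "\<And>i. i < d \<Longrightarrow> u i \<in> carrier_vec d" "\<And>i. i < d \<Longrightarrow> M *\<^sub>v u i = l i \<cdot>\<^sub>v u i"
    "\<And>i j. i < d \<Longrightarrow> j < d \<Longrightarrow> scalar_prod (u i) (u j) = (if i = j then 1 else 0)"
    using orthonormal_eigenvectors[OF M(2) sym order_refl] by blast
  define U where "U = mat d d (\<lambda>(i, j). u i $ j)"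
  have U: "U \<in> carrier_mat d d" "transpose_mat U \<in> carrier_mat d d" by (simp_all add: U_def)
  have row: "row U i = u i" if "i < d" for i using that u(1)[OF that] by (intro eq_vecI) (auto simp: U_def)
  have UU: "U * transpose_mat U = 1\<^sub>m d" using U u by (intro eq_matI) (auto simp: row)
  then have UU': "transpose_mat U * U = 1\<^sub>m d" by (rule mat_mult_left_right_inverse[OF U])
  have "M * transpose_mat U = transpose_mat U * diag_fun d l"
  proof (rule eq_matI)
    fix i j assume "i < dim_row (transpose_mat U * diag_fun d l)" "j < dim_col (transpose_mat U * diag_fun d l)"
    then have ij: "i < d" "j < d" using U by (auto simp: diag_fun_def)
    have "(M * transpose_mat U) $$ (i, j) = (M *\<^sub>v u j) $ i" using ij M(2) U by (simp add: row)
    also have "\<dots> = (transpose_mat U * diag_fun d l) $$ (i, j)"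
      using ij u(1)[OF ij(2)] U by (simp only: u(2)[OF ij(2)] mat_mult_diag_fun[OF U(2)]) (simp add: U_def)
    finally show "(M * transpose_mat U) $$ (i, j) = (transpose_mat U * diag_fun d l) $$ (i, j)" .
  qed (use M(2) U in \<open>auto simp: diag_fun_def\<close>)
  then have "M * transpose_mat U * U = transpose_mat U * (diag_fun d l * U)"
    using assoc_mult_mat[OF U(2) diag_fun_carrier U(1)] by simp
  then have "M = transpose_mat U * (diag_fun d l * U)"
    using assoc_mult_mat[OF M(2) U(2,1)] UU' M(2) by simp
  moreover have "0 < l i" if i: "i < d" for i
  proof -
    have "u i \<noteq> 0\<^sub>v d"
    proof
      assume "u i = 0\<^sub>v d"
      then show False using u(3)[OF i i] by simp
    qed
    then have "0 < scalar_prod (u i) (M *\<^sub>v u i)" using M u(1)[OF i] by (simp add: pos_def_def)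
    then show ?thesis using u(1,3)[OF i] i by (simp add: u(2)[OF i])
  qed
  ultimately show ?thesis by (rule that[OF U(1) UU UU'])
qed

lemma spectral_calculus_mult:
  assumes U: "U \<in> carrier_mat d d" "U * transpose_mat U = 1\<^sub>m d"
  shows "(transpose_mat U * (diag_fun d g * U)) * (transpose_mat U * (diag_fun d h * U)) =
    transpose_mat U * (diag_fun d (\<lambda>i. g i * h i) * U)"
proof -
  have Ut: "transpose_mat U \<in> carrier_mat d d" using U by simp
  let ?G = "diag_fun d g" and ?H = "diag_fun d h"
  have GU: "?G * U \<in> carrier_mat d d" and HU: "?H * U \<in> carrier_mat d d"
    by (rule mult_carrier_mat[OF diag_fun_carrier U(1)])+
  have "(transpose_mat U * (?G * U)) * (transpose_mat U * (?H * U)) = transpose_mat U * ((?G * U) * (transpose_mat U * (?H * U)))"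
    using Ut GU HU by (intro assoc_mult_mat) auto
  also have "(?G * U) * (transpose_mat U * (?H * U)) = ?G * (U * (transpose_mat U * (?H * U)))"
    by (rule assoc_mult_mat[OF diag_fun_carrier U(1) mult_carrier_mat[OF Ut HU]])
  also have "U * (transpose_mat U * (?H * U)) = (U * transpose_mat U) * (?H * U)"
    by (rule assoc_mult_mat[OF U(1) Ut HU, symmetric])
  also have "?G * ((U * transpose_mat U) * (?H * U)) = (?G * ?H) * U"
    unfolding U(2) left_mult_one_mat[OF HU] by (rule assoc_mult_mat[OF diag_fun_carrier diag_fun_carrier U(1), symmetric])
  finally show ?thesis unfolding diag_fun_mult .
qed

lemma pos_def_spectral_calculus:
  assumes U: "U \<in> carrier_mat d d" "transpose_mat U * U = 1\<^sub>m d" and g: "\<And>i. i < d \<Longrightarrow> 0 < g i"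
  shows "pos_def (transpose_mat U * (diag_fun d g * U))"
proof -
  have Ut: "transpose_mat U \<in> carrier_mat d d" using U by simp
  have GU: "diag_fun d g * U \<in> carrier_mat d d" by (rule mult_carrier_mat[OF diag_fun_carrier U(1)])
  have "transpose_mat (diag_fun d g) = diag_fun d g" by (intro eq_matI) (auto simp: diag_fun_def)
  then have t: "transpose_mat (transpose_mat U * (diag_fun d g * U)) = transpose_mat U * (diag_fun d g * U)"
    using transpose_mult[OF Ut GU] transpose_mult[OF diag_fun_carrier U(1), of g] assoc_mult_mat[OF Ut diag_fun_carrier U(1), of g] by simp
  have "0 < scalar_prod v ((transpose_mat U * (diag_fun d g * U)) *\<^sub>v v)" if v: "v \<in> carrier_vec d" "v \<noteq> 0\<^sub>v d" for v
  proof -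
    define w where "w = U *\<^sub>v v"
    have w: "w \<in> carrier_vec d" using U v by (simp add: w_def)
    have Dw: "diag_fun d g *\<^sub>v w \<in> carrier_vec d" by (rule mult_mat_vec_carrier[OF diag_fun_carrier w])
    have "(transpose_mat U * (diag_fun d g * U)) *\<^sub>v v = transpose_mat U *\<^sub>v (diag_fun d g *\<^sub>v w)"
      using assoc_mult_mat_vec[OF Ut GU v(1)] assoc_mult_mat_vec[OF diag_fun_carrier U(1) v(1), of g] by (simp add: w_def)
    then have "scalar_prod v ((transpose_mat U * (diag_fun d g * U)) *\<^sub>v v) = scalar_prod w (diag_fun d g *\<^sub>v w)"
      using transpose_vec_mult_scalar[OF U(1) v(1) Dw] comm_scalar_prod[OF v(1), of "transpose_mat U *\<^sub>v (diag_fun d g *\<^sub>v w)"]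
        comm_scalar_prod[OF Dw w] Ut Dw by (simp add: w_def)
    also have "\<dots> = (\<Sum>i<d. g i * (w $ i)\<^sup>2)"
    proof -
      have "(diag_fun d g *\<^sub>v w) $ i = g i * w $ i" if "i < d" for i
        using that by (subst mult_mat_vec_index_sum[OF diag_fun_carrier w])
          (simp_all add: diag_fun_def if_distrib[of "\<lambda>x. x * _"] cong: if_cong)
      then show ?thesis unfolding scalar_prod_eq_dot[OF Dw] dot_def
        by (intro sum.cong refl) (simp add: power2_eq_square del: index_mult_mat_vec)
    qed
    also have "0 < \<dots>"
    proof -
      have "w \<noteq> 0\<^sub>v d"
      proof
        assume "w = 0\<^sub>v d"
        moreover have "transpose_mat U *\<^sub>v w = v" unfolding w_def using assoc_mult_mat_vec[OF Ut U(1) v(1)] U(2) v(1) by simp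
        ultimately show False using v(2) mult_mat_vec_zero[OF Ut] by simp
      qed
      then obtain i where "i < d" "w $ i \<noteq> 0" using w by (metis carrier_vecD eq_vecI index_zero_vec)
      then show ?thesis
        using g by (intro sum_pos2[of _ i]) (auto intro!: mult_nonneg_nonneg simp: less_imp_le)
    qed
    finally show ?thesis .
  qed
  then show ?thesis unfolding pos_def_def using t Ut GU U by simp
qed

lemma mat_inv_mult:
  assumes "\<And>v. v \<in> carrier_vec d \<Longrightarrow> v \<noteq> 0\<^sub>v d \<Longrightarrow> A *\<^sub>v v \<noteq> 0\<^sub>v d" and A: "A \<in> carrier_mat d d"
  shows "mat_inv A \<in> carrier_mat d d" "A * mat_inv A = 1\<^sub>m d" "mat_inv A * A = 1\<^sub>m d"
proof -
  have "det A \<noteq> 0" using det_0_iff_vec_prod_zero[OF A] assms(1) by blast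
  then have "mat_inverse A \<noteq> None"
    using det_non_zero_imp_unit[OF A, where b = "()"] mat_inverse(1)[OF A, where b = "()"] by blast
  then obtain B where B: "mat_inverse A = Some B" by blast
  show "mat_inv A \<in> carrier_mat d d" "A * mat_inv A = 1\<^sub>m d" "mat_inv A * A = 1\<^sub>m d"
    using mat_inverse(2)[OF A B] by (simp_all add: mat_inv_def B)
qed

lemma pos_def_injective:
  assumes "pos_def A" "A \<in> carrier_mat d d" "v \<in> carrier_vec d" "v \<noteq> 0\<^sub>v d" shows "A *\<^sub>v v \<noteq> 0\<^sub>v d"
  using assms by (auto simp: pos_def_def)

lemma pos_def_mat_inv:
  assumes "pos_def A" "A \<in> carrier_mat d d"
  shows "mat_inv A \<in> carrier_mat d d" "A * mat_inv A = 1\<^sub>m d" "mat_inv A * A = 1\<^sub>m d"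
  using mat_inv_mult[OF pos_def_injective[OF assms] assms(2)] by blast+

text \<open>The choice operator is resolved by exhibiting the root U^T diag(1 / sqrt l) U. Whichever
  root is chosen, its square is the inverse of M; hence B (B M) = 1, and exchanging left and right
  inverses gives B M B = 1.\<close>

lemma mat_inv_sqrt:
  assumes M: "pos_def M" "M \<in> carrier_mat d d"
  defines "B \<equiv> mat_inv_sqrt M"
  shows "B \<in> carrier_mat d d" "pos_def B" "B * B = mat_inv M" "B * (M * B) = 1\<^sub>m d"
proof -
  obtain U l where U: "U \<in> carrier_mat d d" "U * transpose_mat U = 1\<^sub>m d" "transpose_mat U * U = 1\<^sub>m d"
    "M = transpose_mat U * (diag_fun d l * U)" and l: "\<And>i. i < d \<Longrightarrow> 0 < l i"
    by (rule pos_def_diagonalization[OF M]) blast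
  note inv = pos_def_mat_inv[OF M]
  let ?F = "\<lambda>g. transpose_mat U * (diag_fun d g * U)"
  have F: "?F g \<in> carrier_mat d d" for g
    by (intro mult_carrier_mat[of _ _ d] transpose_carrier_mat[THEN iffD2] U(1) diag_fun_carrier)
  have cong: "diag_fun d g = diag_fun d h" if "\<And>i. i < d \<Longrightarrow> g i = h i" for g h
    using that by (auto simp: diag_fun_def intro!: eq_matI)
  have 1: "?F (\<lambda>i. 1 / l i) * M = 1\<^sub>m d"
  proof -
    have "?F (\<lambda>i. 1 / l i) * M = ?F (\<lambda>i. 1 / l i * l i)" unfolding U(4) by (rule spectral_calculus_mult[OF U(1,2)])
    also have "diag_fun d (\<lambda>i. 1 / l i * l i) = 1\<^sub>m d" using l by (auto simp: diag_fun_def less_imp_neq[symmetric] intro!: eq_matI)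
    finally show ?thesis using U by simp
  qed
  have invM: "mat_inv M = ?F (\<lambda>i. 1 / l i)"
    using assoc_mult_mat[OF F M(2) inv(1), of "\<lambda>i. 1 / l i"]
    unfolding 1 inv(2) left_mult_one_mat[OF inv(1)] right_mult_one_mat[OF F] .
  have "?F (\<lambda>i. 1 / sqrt (l i)) * ?F (\<lambda>i. 1 / sqrt (l i)) = mat_inv M"
  proof -
    have "diag_fun d (\<lambda>i. 1 / sqrt (l i) * (1 / sqrt (l i))) = diag_fun d (\<lambda>i. 1 / l i)"
      using l by (intro cong) (simp add: less_imp_le)
    then show ?thesis unfolding invM by (simp only: spectral_calculus_mult[OF U(1,2)])
  qed
  moreover have "pos_def (?F (\<lambda>i. 1 / sqrt (l i)))" using l by (intro pos_def_spectral_calculus U) simp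
  ultimately have "\<exists>B. B \<in> carrier_mat (dim_row M) (dim_row M) \<and> pos_def B \<and> B * B = mat_inv M"
    using F M(2) by (metis carrier_matD(1))
  then have "B \<in> carrier_mat (dim_row M) (dim_row M) \<and> pos_def B \<and> B * B = mat_inv M"
    unfolding B_def mat_inv_sqrt_def by (rule someI_ex)
  then show B: "B \<in> carrier_mat d d" "pos_def B" "B * B = mat_inv M" using M(2) by auto
  have "B * (B * M) = 1\<^sub>m d" using assoc_mult_mat[OF B(1,1) M(2)] B(3) inv(3) by simp
  then have "(B * M) * B = 1\<^sub>m d" using B(1) M(2) by (intro mat_mult_left_right_inverse[OF B(1)]) auto
  then show "B * (M * B) = 1\<^sub>m d" using assoc_mult_mat[OF B(1) M(2) B(1)] by simp
qed

section \<open>The spectral norm\<close>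

lemma vnorm_smult: "vnorm (c \<cdot>\<^sub>v v) = \<bar>c\<bar> * vnorm v"
proof -
  have "scalar_prod (c \<cdot>\<^sub>v v) (c \<cdot>\<^sub>v v) = c\<^sup>2 * scalar_prod v v"
    by (simp add: scalar_prod_def power2_eq_square sum_distrib_left algebra_simps)
  then show ?thesis by (simp add: vnorm_def real_sqrt_mult)
qed

lemma vnorm_mult_mat_vec_le:
  assumes A: "A \<in> carrier_mat d d" and v: "v \<in> carrier_vec d"
  shows "vnorm (A *\<^sub>v v) \<le> spectral_norm A * vnorm v"
proof (cases "v = 0\<^sub>v d")
  case True
  then show ?thesis using mult_mat_vec_zero[OF A] by (simp add: vnorm_def)
next
  case False
  have s: "0 < vnorm v" using scalar_prod_self_pos[OF v False] by (simp add: vnorm_def)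
  \<comment> \<open>The supremum that defines \<open>spectral_norm\<close> is an upper bound only if
    the set is bounded; by Cauchy-Schwarz in each row the Frobenius norm bounds it.\<close>
  have bdd: "bdd_above ((\<lambda>v. vnorm (A *\<^sub>v v)) ` {v \<in> carrier_vec (dim_col A). vnorm v = 1})"
  proof (rule bdd_aboveI2)
    fix w assume "w \<in> {v \<in> carrier_vec (dim_col A). vnorm v = 1}"
    then have w: "w \<in> carrier_vec d" "sqn d (vec_index w) = 1"
      using A vnorm_sq[of w] by (auto simp: scalar_prod_eq_sqn)
    have "((A *\<^sub>v w) $ i)\<^sup>2 \<le> sqn d (\<lambda>j. A $$ (i, j))" if "i < d" for i
      using dot_square_le[of d "\<lambda>j. A $$ (i, j)" "vec_index w"] w(2)
      by (simp add: mult_mat_vec_index_sum[OF A w(1) that] dot_def del: index_mult_mat_vec)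
    then have "scalar_prod (A *\<^sub>v w) (A *\<^sub>v w) \<le> (\<Sum>i<d. sqn d (\<lambda>j. A $$ (i, j)))"
      unfolding scalar_prod_eq_sqn[OF mult_mat_vec_carrier[OF A w(1)]] sqn_def[of d "vec_index (A *\<^sub>v w)"]
      by (intro sum_mono) simp
    then show "vnorm (A *\<^sub>v w) \<le> sqrt (\<Sum>i<d. sqn d (\<lambda>j. A $$ (i, j)))" unfolding vnorm_def by (rule real_sqrt_le_mono)
  qed
  let ?w = "(1 / vnorm v) \<cdot>\<^sub>v v"
  have "vnorm (A *\<^sub>v ?w) \<le> spectral_norm A" unfolding spectral_norm_def
    by (rule cSUP_upper[OF _ bdd]) (use A v s in \<open>auto simp: vnorm_smult\<close>)
  also have "A *\<^sub>v ?w = (1 / vnorm v) \<cdot>\<^sub>v (A *\<^sub>v v)" by (rule mult_mat_vec[OF A v])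
  finally show ?thesis using s by (simp add: vnorm_smult divide_le_eq)
qed

text \<open>Read off on one unit vector v: 1 = |A B v| is at most the product of the norms.\<close>

lemma spectral_norm_inverse_ge_1:
  assumes d: "1 \<le> d" and A: "A \<in> carrier_mat d d" and B: "B \<in> carrier_mat d d" and AB: "A * B = 1\<^sub>m d"
  shows "1 \<le> spectral_norm A * spectral_norm B"
proof -
  let ?v = "unit_vec d 0 :: real Matrix.vec"
  have v: "vnorm ?v = 1" using d by (simp add: vnorm_def)
  have Bv: "vnorm (B *\<^sub>v ?v) \<le> spectral_norm B" using vnorm_mult_mat_vec_le[OF B, of ?v] v by simp
  have "0 \<le> spectral_norm A" using vnorm_mult_mat_vec_le[OF A, of ?v] v vnorm_nonneg[of "A *\<^sub>v ?v"] by simp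
  then have "spectral_norm A * vnorm (B *\<^sub>v ?v) \<le> spectral_norm A * spectral_norm B" using Bv by (rule mult_left_mono[rotated])
  moreover have "vnorm (A *\<^sub>v (B *\<^sub>v ?v)) \<le> spectral_norm A * vnorm (B *\<^sub>v ?v)" using B by (intro vnorm_mult_mat_vec_le[OF A]) simp
  moreover have "A *\<^sub>v (B *\<^sub>v ?v) = ?v" using assoc_mult_mat_vec[OF A B, of ?v] AB by simp
  ultimately show ?thesis using v by simp
qed

section \<open>Anticoncentration for general Gaussian vectors\<close>

lemma mult_mat_vec_Matrix_vec:
  assumes "A \<in> carrier_mat d d" "i < d"
  shows "(A *\<^sub>v Matrix.vec d \<xi>) $ i = (\<Sum>j<d. A $$ (i, j) * \<xi> j)"
  using mult_mat_vec_index_sum[OF assms(1), of "Matrix.vec d \<xi>" i] assms(2) by simp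

lemma cov_mat_gauss_vec:
  assumes m: "m \<in> carrier_vec d" and A: "A \<in> carrier_mat d d"
  shows "cov_mat (std_gauss d) d (gauss_vec d m A) = A * transpose_mat A"
proof (rule eq_matI)
  fix i j assume "i < dim_row (A * transpose_mat A)" "j < dim_col (A * transpose_mat A)"
  then have ij: "i < d" "j < d" using A by auto
  have g: "gauss_vec d m A \<xi> $ k = m $ k + (\<Sum>j<d. A $$ (k, j) * \<xi> j)" if "k < d" for k \<xi>
    unfolding gauss_vec_def using that A m by (simp add: mult_mat_vec_Matrix_vec del: index_mult_mat_vec)
  have I: "(\<integral>\<xi>. gauss_vec d m A \<xi> $ k \<partial>std_gauss d) = m $ k" if "k < d" for k
  proof -
    have i: "integrable (std_gauss d) (\<lambda>\<xi>. A $$ (k, j) * \<xi> j)" if "j \<in> {..<d}" for j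
      using that by (intro integrable_mult_right Z.integrable_coord) simp
    have "(\<integral>\<xi>. (\<Sum>j<d. A $$ (k, j) * \<xi> j) \<partial>std_gauss d) = (\<Sum>j<d. \<integral>\<xi>. A $$ (k, j) * \<xi> j \<partial>std_gauss d)"
      by (rule Bochner_Integration.integral_sum[OF i])
    also have "\<dots> = 0" by (intro sum.neutral ballI) (simp add: Z.mean_zero)
    finally have 0: "(\<integral>\<xi>. (\<Sum>j<d. A $$ (k, j) * \<xi> j) \<partial>std_gauss d) = 0" .
    have "(\<integral>\<xi>. m $ k + (\<Sum>j<d. A $$ (k, j) * \<xi> j) \<partial>std_gauss d) = (\<integral>\<xi>. m $ k \<partial>std_gauss d) + (\<integral>\<xi>. (\<Sum>j<d. A $$ (k, j) * \<xi> j) \<partial>std_gauss d)"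
      by (rule Bochner_Integration.integral_add) (simp, rule Bochner_Integration.integrable_sum[OF i])
    then show ?thesis unfolding g[OF that] 0 by (simp add: gauss.prob_space)
  qed
  have "cov_mat (std_gauss d) d (gauss_vec d m A) $$ (i, j) =
      (\<integral>\<xi>. (\<Sum>k<d. A $$ (i, k) * \<xi> k) * (\<Sum>l<d. A $$ (j, l) * \<xi> l) \<partial>std_gauss d)"
    unfolding cov_mat_def using ij by (simp add: I) (simp add: g)
  also have "\<dots> = (\<integral>\<xi>. (\<Sum>k<d. \<Sum>l<d. A $$ (i, k) * A $$ (j, l) * (\<xi> k * \<xi> l)) \<partial>std_gauss d)"
    unfolding sum_product by (simp add: mult.assoc mult.left_commute)
  also have "\<dots> = (\<Sum>k<d. \<Sum>l<d. A $$ (i, k) * A $$ (j, l) * (if k = l then 1 else 0))"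
  proof -
    have i: "integrable (std_gauss d) (\<lambda>\<xi>. A $$ (i, k) * A $$ (j, l) * (\<xi> k * \<xi> l))" if "k \<in> {..<d}" "l \<in> {..<d}" for k l
      using that by (intro integrable_mult_right Z.integrable_coord2) simp_all
    show ?thesis
      by (subst Bochner_Integration.integral_sum, rule Bochner_Integration.integrable_sum, erule (1) i, intro sum.cong refl,
        subst Bochner_Integration.integral_sum, erule (1) i, intro sum.cong refl) (simp add: Z.unit_covariance)
  qed
  also have "\<dots> = (\<Sum>k<d. A $$ (i, k) * A $$ (j, k))" by (simp add: if_distrib[of "\<lambda>x. _ * x"] cong: if_cong)
  also have "\<dots> = (A * transpose_mat A) $$ (i, j)"
    using ij A by (simp add: scalar_prod_def atLeast0LessThan)
  finally show "cov_mat (std_gauss d) d (gauss_vec d m A) $$ (i, j) = (A * transpose_mat A) $$ (i, j)" .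
qed (use A in \<open>auto simp: cov_mat_def\<close>)

text \<open>The smallest eigenvalue of A A^T bounds |A^T v| from below, whereas
  \<open>quadratic_form\<close> asks for |A w|. As A is invertible, the same bound holds for both.
  The centre is moved inside the linear map: A g + m - x0 = A (g + b) with A b = m - x0.\<close>

lemma anticoncentration_constI:
  assumes c: "24 \<le> c" shows "anticoncentration_const c"
  unfolding anticoncentration_const_def
proof (intro conjI allI impI ballI)
  show "0 < c" using c by simp
  fix d :: nat and m A and sd :: real and \<epsilon> :: real and x0 :: "real Matrix.vec" and r :: real
  assume d: "1 \<le> d" and m: "m \<in> carrier_vec d" and A: "A \<in> carrier_mat d d" and sd: "0 < sd"
    and pd: "pos_def (cov_mat (std_gauss d) d (gauss_vec d m A))"
    and se: "smallest_eigenvalue (cov_mat (std_gauss d) d (gauss_vec d m A)) (sd\<^sup>2)"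
    and \<epsilon>: "0 < \<epsilon>" and x0: "x0 \<in> carrier_vec d" and r: "0 \<le> r"
  let ?M = "A * transpose_mat A"
  have At: "transpose_mat A \<in> carrier_mat d d" using A by simp
  note C = cov_mat_gauss_vec[OF m A]
  have sq: "scalar_prod v (?M *\<^sub>v v) = scalar_prod (transpose_mat A *\<^sub>v v) (transpose_mat A *\<^sub>v v)" if v: "v \<in> carrier_vec d" for v
  proof -
    have w: "transpose_mat A *\<^sub>v v \<in> carrier_vec d" using At v by simp
    show ?thesis using transpose_vec_mult_scalar[OF A w v] assoc_mult_mat_vec[OF A At v] by simp
  qed
  have low: "sd\<^sup>2 * scalar_prod v v \<le> scalar_prod (transpose_mat A *\<^sub>v v) (transpose_mat A *\<^sub>v v)" if v: "v \<in> carrier_vec d" for v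
    using smallest_eigenvalue_le_quadratic_form[OF d _ _ se v] pd A sq[OF v] unfolding C pos_def_def by simp
  have "transpose_mat A *\<^sub>v v \<noteq> 0\<^sub>v d" if v: "v \<in> carrier_vec d" "v \<noteq> 0\<^sub>v d" for v
  proof
    assume "transpose_mat A *\<^sub>v v = 0\<^sub>v d"
    then have "sd\<^sup>2 * scalar_prod v v \<le> 0" using low[OF v(1)] by simp
    then show False using scalar_prod_self_pos[OF v] sd by (simp add: mult_le_0_iff)
  qed
  from mat_inv_mult[OF this At] obtain B where B: "B \<in> carrier_mat d d" "transpose_mat A * B = 1\<^sub>m d" by blast
  define B' where "B' = transpose_mat B"
  have B': "B' \<in> carrier_mat d d" using B by (simp add: B'_def)
  have "B' * A = 1\<^sub>m d" using transpose_mult[OF At B(1)] B(2) by (simp add: B'_def)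
  then have AB': "A * B' = 1\<^sub>m d" by (rule mat_mult_left_right_inverse[OF B' A])
  \<comment> \<open>With w = A^T v, Cauchy-Schwarz gives |w|^2 = v.(A w) \<le> |v| |A w|, and sd |v|
    \<le> |w| by \<open>low\<close>.\<close>
  have lowA: "sd\<^sup>2 * scalar_prod w w \<le> scalar_prod (A *\<^sub>v w) (A *\<^sub>v w)" if w: "w \<in> carrier_vec d" for w
  proof -
    let ?v = "B *\<^sub>v w"
    have v: "?v \<in> carrier_vec d" using B w by simp
    have Aw: "A *\<^sub>v w \<in> carrier_vec d" using A w by simp
    have Av: "transpose_mat A *\<^sub>v ?v = w" using assoc_mult_mat_vec[OF At B(1) w] B(2) w by simp
    have "scalar_prod w w = scalar_prod ?v (A *\<^sub>v w)" using transpose_vec_mult_scalar[OF A w v] Av by simp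
    then have "(scalar_prod w w)\<^sup>2 \<le> scalar_prod ?v ?v * scalar_prod (A *\<^sub>v w) (A *\<^sub>v w)"
      using dot_square_le[of d "vec_index ?v" "vec_index (A *\<^sub>v w)"] scalar_prod_eq_dot[OF Aw, of ?v]
      by (simp only: scalar_prod_eq_sqn[OF v] scalar_prod_eq_sqn[OF Aw])
    then have "sd\<^sup>2 * (scalar_prod w w)\<^sup>2 \<le> sd\<^sup>2 * (scalar_prod ?v ?v * scalar_prod (A *\<^sub>v w) (A *\<^sub>v w))"
      by (intro mult_left_mono) auto
    also have "\<dots> = sd\<^sup>2 * scalar_prod ?v ?v * scalar_prod (A *\<^sub>v w) (A *\<^sub>v w)" by simp
    also have "\<dots> \<le> scalar_prod w w * scalar_prod (A *\<^sub>v w) (A *\<^sub>v w)"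
      using low[OF v] unfolding Av by (intro mult_right_mono scalar_prod_self_nonneg)
    finally have *: "scalar_prod w w * (sd\<^sup>2 * scalar_prod w w) \<le> scalar_prod w w * scalar_prod (A *\<^sub>v w) (A *\<^sub>v w)"
      by (simp add: power2_eq_square mult.assoc mult.left_commute)
    show ?thesis
    proof (cases "scalar_prod w w = 0")
      case True then show ?thesis using scalar_prod_self_nonneg[of "A *\<^sub>v w"] by simp
    next
      case False
      then have "0 < scalar_prod w w" using scalar_prod_self_nonneg[of w] by simp
      then show ?thesis using * by (simp only: mult_le_cancel_left_pos)
    qed
  qed
  have Av: "(\<Sum>k<d. (\<Sum>j<d. A $$ (k, j) * v j)\<^sup>2) = scalar_prod (A *\<^sub>v Matrix.vec d v) (A *\<^sub>v Matrix.vec d v)" for v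
    using A by (subst scalar_prod_eq_sqn[where d = d])
      (auto simp: sqn_def mult_mat_vec_Matrix_vec simp del: index_mult_mat_vec)
  define b where "b = B' *\<^sub>v (m - x0)"
  have b: "b \<in> carrier_vec d" "A *\<^sub>v b = m - x0"
    using B' m x0 assoc_mult_mat_vec[OF A B', of "m - x0"] AB' by (auto simp: b_def)
  interpret Q: quadratic_form d "\<lambda>k j. A $$ (k, j)" "vec_index b" sd
  proof
    show "sd\<^sup>2 * sqn d v \<le> (\<Sum>k<d. (\<Sum>j<d. A $$ (k, j) * v j)\<^sup>2)" for v
    proof -
      have "sqn d v = scalar_prod (Matrix.vec d v) (Matrix.vec d v)" by (subst scalar_prod_eq_sqn[where d = d]) (simp_all add: sqn_def)
      then show ?thesis using lowA[of "Matrix.vec d v"] unfolding Av by simp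
    qed
  qed (rule sd)
  have N: "Q.N \<xi> = (vnorm (gauss_vec d m A \<xi> - x0))\<^sup>2" for \<xi>
  proof -
    have "Q.N \<xi> = scalar_prod (A *\<^sub>v Matrix.vec d (Q.vec \<xi>)) (A *\<^sub>v Matrix.vec d (Q.vec \<xi>))"
      unfolding Q.N_def Q.lin_def Av ..
    also have "Matrix.vec d (Q.vec \<xi>) = Matrix.vec d \<xi> + b" using b(1) by (intro eq_vecI) (auto simp: Q.vec_def)
    also have "A *\<^sub>v (Matrix.vec d \<xi> + b) = gauss_vec d m A \<xi> - x0"
    proof -
      have "A *\<^sub>v Matrix.vec d \<xi> \<in> carrier_vec d" using A by simp
      moreover have "A *\<^sub>v (Matrix.vec d \<xi> + b) = A *\<^sub>v Matrix.vec d \<xi> + (m - x0)"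
        using mult_add_distrib_mat_vec[OF A, of "Matrix.vec d \<xi>" b] b by simp
      moreover have "u + (m - x0) = m + u - x0" if "u \<in> carrier_vec d" for u using that m x0 by (intro eq_vecI) auto
      ultimately show ?thesis unfolding gauss_vec_def by metis
    qed
    finally show ?thesis by (simp only: vnorm_sq)
  qed
  have "{\<xi> \<in> space (std_gauss d). r < vnorm (gauss_vec d m A \<xi> - x0) \<and> vnorm (gauss_vec d m A \<xi> - x0) \<le> r + \<epsilon>}
      = {\<xi> \<in> space (std_gauss d). r\<^sup>2 < Q.N \<xi> \<and> Q.N \<xi> \<le> (r + \<epsilon>)\<^sup>2}"
    unfolding N using r \<epsilon> vnorm_nonneg by (intro Collect_cong conj_cong refl) (auto simp: power_strict_mono power2_le_iff_abs_le intro: power_mono dest: power_less_imp_less_base)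
  then have "measure (std_gauss d) {\<xi> \<in> space (std_gauss d). r < vnorm (gauss_vec d m A \<xi> - x0) \<and> vnorm (gauss_vec d m A \<xi> - x0) \<le> r + \<epsilon>} \<le> 24 * \<epsilon> / sd"
    using Q.anticoncentration[OF \<epsilon> r d] by simp
  also have "\<dots> \<le> \<epsilon> * c / sd" using c \<epsilon> sd by (intro divide_right_mono) auto
  finally show "measure (std_gauss d) {\<xi> \<in> space (std_gauss d). r < vnorm (gauss_vec d m A \<xi> - x0) \<and> vnorm (gauss_vec d m A \<xi> - x0) \<le> r + \<epsilon>} \<le> \<epsilon> * c / sd" .
qed

section \<open>A smooth cutoff\<close>

definition clamp01 :: "real \<Rightarrow> real" where "clamp01 x = max 0 (min 1 x)"

lemma clamp01: "x \<le> 0 \<Longrightarrow> clamp01 x = 0" "0 \<le> x \<Longrightarrow> x \<le> 1 \<Longrightarrow> clamp01 x = x" "1 \<le> x \<Longrightarrow> clamp01 x = 1"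
  "0 \<le> clamp01 x" "clamp01 x \<le> 1"
  by (auto simp: clamp01_def)

text \<open>Away from 0 and 1 one smooth piece is differentiated. At the two joints both one-sided
  derivatives are 0, by the hypotheses on P'; hence the separate treatment of left and
  right.\<close>

lemma DERIV_clamp01:
  assumes D: "\<And>c. (P has_real_derivative P' c) (at c)" and P': "P' 0 = 0" "P' 1 = 0"
  shows "((\<lambda>x. P (clamp01 x)) has_real_derivative P' (clamp01 x)) (at x)"
proof -
  let ?f = "\<lambda>x. P (clamp01 x)"
  have const: "((\<lambda>_. c) has_real_derivative 0) (at x within S)" for c S by simp
  have left: "(?f has_real_derivative P' (clamp01 x)) (at x within {..x})"
  proof -
    consider "x \<le> 0" | "0 < x" "x \<le> 1" | "1 < x" by linarith
    then show ?thesis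
    proof cases
      case 1
      then have "(?f has_real_derivative 0) (at x within {..x})"
        by (intro has_field_derivative_transform_within[OF const[of "P 0"], of 1]) (auto simp: clamp01)
      then show ?thesis using 1 P' by (simp add: clamp01)
    next
      case 2
      have "(?f has_real_derivative P' x) (at x within {..x})"
        by (rule has_field_derivative_transform_within[OF has_field_derivative_at_within[OF D] 2(1)])
          (use 2 in \<open>auto simp: dist_real_def clamp01_def\<close>)
      then show ?thesis using 2 by (simp add: clamp01)
    next
      case 3
      then have "0 < x - 1" by simp
      then have "(?f has_real_derivative 0) (at x within {..x})"
        by (rule has_field_derivative_transform_within[OF const[of "P 1"]]) (use 3 in \<open>auto simp: dist_real_def clamp01_def\<close>)
      then show ?thesis using 3 P' by (simp add: clamp01)
    qed
  qed
  have right: "(?f has_real_derivative P' (clamp01 x)) (at x within {x..})"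
  proof -
    consider "x < 0" | "0 \<le> x" "x < 1" | "1 \<le> x" by linarith
    then show ?thesis
    proof cases
      case 1
      then have "0 < - x" by simp
      then have "(?f has_real_derivative 0) (at x within {x..})"
        by (rule has_field_derivative_transform_within[OF const[of "P 0"]]) (use 1 in \<open>auto simp: dist_real_def clamp01_def\<close>)
      then show ?thesis using 1 P' by (simp add: clamp01)
    next
      case 2
      then have "0 < 1 - x" by simp
      then have "(?f has_real_derivative P' x) (at x within {x..})"
        by (rule has_field_derivative_transform_within[OF has_field_derivative_at_within[OF D]])
          (use 2 in \<open>auto simp: dist_real_def clamp01_def\<close>)
      then show ?thesis using 2 by (simp add: clamp01)
    next
      case 3
      have "(?f has_real_derivative 0) (at x within {x..})"
        by (rule has_field_derivative_transform_within[OF const[of "P 1"], of 1]) (use 3 in \<open>auto simp: clamp01\<close>)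
      then show ?thesis using 3 P' by (simp add: clamp01)
    qed
  qed
  show ?thesis using left right unfolding has_field_derivative_iff filterlim_at_split[of _ _ x]
    by (simp only: at_within_Iic_at_left at_within_Ici_at_right)
qed

text \<open>The polynomial step from 1 to 0 with derivative -140 c^3 (1 - c)^3. Its first three
  derivatives \<open>step1\<close>, \<open>step2\<close>, \<open>step3\<close> vanish at both ends,
  so that clamping the argument keeps it three times continuously differentiable.\<close>

definition step0 :: "real \<Rightarrow> real" where "step0 c = 1 - 35 * c ^ 4 + 84 * c ^ 5 - 70 * c ^ 6 + 20 * c ^ 7"
definition step1 :: "real \<Rightarrow> real" where "step1 c = - 140 * c ^ 3 + 420 * c ^ 4 - 420 * c ^ 5 + 140 * c ^ 6"
definition step2 :: "real \<Rightarrow> real" where "step2 c = - 420 * c ^ 2 + 1680 * c ^ 3 - 2100 * c ^ 4 + 840 * c ^ 5"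
definition step3 :: "real \<Rightarrow> real" where "step3 c = - 840 * c + 5040 * c ^ 2 - 8400 * c ^ 3 + 4200 * c ^ 4"

lemma DERIV_step:
  "((\<lambda>x. step0 (clamp01 x)) has_real_derivative step1 (clamp01 x)) (at x)"
  "((\<lambda>x. step1 (clamp01 x)) has_real_derivative step2 (clamp01 x)) (at x)"
  "((\<lambda>x. step2 (clamp01 x)) has_real_derivative step3 (clamp01 x)) (at x)"
  by (intro DERIV_clamp01, (unfold step0_def[abs_def] step1_def step2_def step3_def, auto intro!: derivative_eq_intros)[3])+

lemma step_clamp_zero:
  assumes "x \<le> 0 \<or> 1 \<le> x"
  shows "step1 (clamp01 x) = 0" "step2 (clamp01 x) = 0" "step3 (clamp01 x) = 0"
  using assms by (auto simp: clamp01 step1_def step2_def step3_def)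

text \<open>Sums of the absolute values of the coefficients, as the powers of
  \<open>clamp01 x\<close> lie in [0, 1].\<close>

lemma step_bounds:
  "\<bar>step1 (clamp01 x)\<bar> \<le> 1120" "\<bar>step2 (clamp01 x)\<bar> \<le> 5040" "\<bar>step3 (clamp01 x)\<bar> \<le> 18480"
proof -
  have c: "0 \<le> clamp01 x ^ k" "clamp01 x ^ k \<le> 1" for k using clamp01(4,5)[of x] by (auto intro: power_le_one)
  show "\<bar>step1 (clamp01 x)\<bar> \<le> 1120" using c[of 3] c[of 4] c[of 5] c[of 6] unfolding step1_def by linarith
  show "\<bar>step2 (clamp01 x)\<bar> \<le> 5040" using c[of 2] c[of 3] c[of 4] c[of 5] unfolding step2_def by linarith
  show "\<bar>step3 (clamp01 x)\<bar> \<le> 18480" using c[of 1] c[of 2] c[of 3] c[of 4] unfolding step3_def power_one_right by linarith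
qed

lemma step0_bounds: "0 \<le> step0 (clamp01 x)" "step0 (clamp01 x) \<le> 1"
proof -
  have neg: "step1 (clamp01 t) \<le> 0" for t
  proof -
    have "step1 c = - (140 * (c * (1 - c)) ^ 3)" for c by (simp add: step1_def power_mult_distrib power3_eq_cube eval_nat_numeral algebra_simps)
    then show ?thesis using clamp01(4,5)[of t] by simp
  qed
  have "step0 (clamp01 b) \<le> step0 (clamp01 a)" if "a \<le> b" for a b
    by (rule DERIV_nonpos_imp_nonincreasing[OF that]) (use DERIV_step(1) neg in blast)
  then have "step0 (clamp01 (max x 1)) \<le> step0 (clamp01 x)" "step0 (clamp01 x) \<le> step0 (clamp01 (min x 0))" by simp_all
  then show "0 \<le> step0 (clamp01 x)" "step0 (clamp01 x) \<le> 1" by (simp_all add: clamp01 step0_def)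
qed

lemma deriv_step: "deriv (\<lambda>x. step0 (clamp01 x)) = (\<lambda>x. step1 (clamp01 x))" "deriv (\<lambda>x. step1 (clamp01 x)) = (\<lambda>x. step2 (clamp01 x))"
  "deriv (\<lambda>x. step2 (clamp01 x)) = (\<lambda>x. step3 (clamp01 x))"
  using DERIV_step by (auto intro!: DERIV_imp_deriv)

lemma cutoff_step: "cutoff (\<lambda>x. step0 (clamp01 x))"
  unfolding cutoff_def
proof (intro conjI allI impI)
  fix k :: nat and x :: real assume "k < 3"
  then have "k = 0 \<or> k = 1 \<or> k = 2" by auto
  then show "(deriv ^^ k) (\<lambda>x. step0 (clamp01 x)) differentiable at x"
    using DERIV_step[of x] by (auto simp: deriv_step eval_nat_numeral real_differentiable_def)
next
  have "(deriv ^^ 3) (\<lambda>x. step0 (clamp01 x)) = (\<lambda>x. step3 (clamp01 x))" by (simp add: deriv_step eval_nat_numeral)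
  then show "continuous_on UNIV ((deriv ^^ 3) (\<lambda>x. step0 (clamp01 x)))"
    by (simp add: step3_def clamp01_def) (intro continuous_intros)
  show "0 \<le> step0 (clamp01 x)" "step0 (clamp01 x) \<le> 1" for x by (rule step0_bounds)+
qed (auto simp: clamp01 step0_def)

section \<open>Directional derivatives of the ball cutoff\<close>

lemma dir_op_eq:
  assumes x: "x \<in> carrier_vec d" and x0: "x0 \<in> carrier_vec d" and h: "h \<in> carrier_vec d"
    and D: "\<And>i. i < d \<Longrightarrow> ((\<lambda>t. g (x + t \<cdot>\<^sub>v unit_vec d i)) has_real_derivative p * (2 * (x - x0) $ i / w) + q * h $ i) (at 0)"
  shows "dir_op h g x = p * (2 * scalar_prod (x - x0) h / w) + q * scalar_prod h h"
proof -
  have "dir_op h g x = (\<Sum>i<d. h $ i * (p * (2 * (x - x0) $ i / w) + q * h $ i))"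
    unfolding dir_op_def partial_deriv_def using x h D by (intro sum.cong) (auto simp: DERIV_imp_deriv)
  also have "\<dots> = p * (2 * (\<Sum>i<d. (x - x0) $ i * h $ i) / w) + q * (\<Sum>i<d. h $ i * h $ i)"
    by (simp add: sum.distrib sum_distrib_left sum_divide_distrib algebra_simps)
  finally show ?thesis using h by (simp add: scalar_prod_def atLeast0LessThan)
qed

lemma scalar_prod_shift_unit:
  fixes y h :: "real Matrix.vec"
  assumes "y \<in> carrier_vec d" "i < d"
  shows "scalar_prod (y + t \<cdot>\<^sub>v unit_vec d i) (y + t \<cdot>\<^sub>v unit_vec d i) = scalar_prod y y + 2 * t * y $ i + t\<^sup>2"
    "h \<in> carrier_vec d \<Longrightarrow> scalar_prod (y + t \<cdot>\<^sub>v unit_vec d i) h = scalar_prod y h + t * h $ i"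
proof -
  show "scalar_prod (y + t \<cdot>\<^sub>v unit_vec d i) h = scalar_prod y h + t * h $ i" if "h \<in> carrier_vec d" for h :: "real Matrix.vec"
    using assms that by (simp add: add_scalar_prod_distrib[where n = d])
  then show "scalar_prod (y + t \<cdot>\<^sub>v unit_vec d i) (y + t \<cdot>\<^sub>v unit_vec d i) = scalar_prod y y + 2 * t * y $ i + t\<^sup>2"
    using assms by (simp add: add_scalar_prod_distrib[where n = d] scalar_prod_add_distrib[where n = d] power2_eq_square algebra_simps)
qed

context
  fixes d :: nat and x0 h :: "real Matrix.vec" and r w :: real
  assumes x0: "x0 \<in> carrier_vec d" and h: "h \<in> carrier_vec d" and w: "0 < w"
begin

text \<open>The argument of the cutoff. Along h its first derivative is \<open>lin\<close>, its
  second the constant 2 |h|^2 / w, and all higher ones vanish.\<close>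

definition sq where "sq x = (scalar_prod (x - x0) (x - x0) - r\<^sup>2) / w"
definition lin where "lin x = 2 * scalar_prod (x - x0) h / w"

lemma shift_sq_lin:
  assumes x: "x \<in> carrier_vec d" and i: "i < d"
  shows "sq (x + t \<cdot>\<^sub>v unit_vec d i) = sq x + t * (2 * (x - x0) $ i / w) + t\<^sup>2 / w"
    "lin (x + t \<cdot>\<^sub>v unit_vec d i) = lin x + t * (2 * h $ i / w)"
proof -
  have e: "x + t \<cdot>\<^sub>v unit_vec d i - x0 = (x - x0) + t \<cdot>\<^sub>v unit_vec d i" using x x0 i by (intro eq_vecI) auto
  have y: "x - x0 \<in> carrier_vec d" using x x0 by simp
  show "sq (x + t \<cdot>\<^sub>v unit_vec d i) = sq x + t * (2 * (x - x0) $ i / w) + t\<^sup>2 / w"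
    unfolding sq_def e scalar_prod_shift_unit(1)[OF y i] by (simp add: add_divide_distrib diff_divide_distrib)
  show "lin (x + t \<cdot>\<^sub>v unit_vec d i) = lin x + t * (2 * h $ i / w)"
    unfolding lin_def e scalar_prod_shift_unit(2)[OF y i h] by (simp add: add_divide_distrib distrib_left)
qed

lemma DERIV_sq_lin:
  assumes x: "x \<in> carrier_vec d" and i: "i < d"
  shows "(F has_real_derivative F' (sq x)) (at (sq x)) \<Longrightarrow> ((\<lambda>t. F (sq (x + t \<cdot>\<^sub>v unit_vec d i))) has_real_derivative F' (sq x) * (2 * (x - x0) $ i / w)) (at 0)"
    "((\<lambda>t. lin (x + t \<cdot>\<^sub>v unit_vec d i)) has_real_derivative 2 * h $ i / w) (at 0)"
proof -
  assume F: "(F has_real_derivative F' (sq x)) (at (sq x))"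
  have "((\<lambda>t. sq x + t * (2 * (x - x0) $ i / w) + t\<^sup>2 / w) has_real_derivative 2 * (x - x0) $ i / w) (at 0)"
    using w by (auto intro!: derivative_eq_intros simp: less_imp_neq[symmetric])
  moreover have "(F has_real_derivative F' (sq x)) (at (sq x + 0 * (2 * (x - x0) $ i / w) + 0\<^sup>2 / w))" using F by simp
  ultimately show "((\<lambda>t. F (sq (x + t \<cdot>\<^sub>v unit_vec d i))) has_real_derivative F' (sq x) * (2 * (x - x0) $ i / w)) (at 0)"
    unfolding shift_sq_lin(1)[OF x i] by (rule DERIV_chain2[rotated])
next
  show "((\<lambda>t. lin (x + t \<cdot>\<^sub>v unit_vec d i)) has_real_derivative 2 * h $ i / w) (at 0)"
    unfolding shift_sq_lin(2)[OF x i] using w by (auto intro!: derivative_eq_intros)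
qed

text \<open>Chain rule with a quadratic inner function: each application of the operator either
  raises the order of the outer derivative, at the price of a factor \<open>lin\<close>, or turns
  one factor \<open>lin\<close> into the constant 2 |h|^2 / w.\<close>

lemma dir_op_step:
  assumes g: "\<And>x. x \<in> carrier_vec d \<Longrightarrow> g x = step0 (clamp01 (sq x))"
  shows "x \<in> carrier_vec d \<Longrightarrow> dir_op h g x = step1 (clamp01 (sq x)) * lin x"
    "x \<in> carrier_vec d \<Longrightarrow> dir_op h (dir_op h g) x =
      step2 (clamp01 (sq x)) * (lin x)\<^sup>2 + step1 (clamp01 (sq x)) * (2 * scalar_prod h h / w)"
    "x \<in> carrier_vec d \<Longrightarrow> dir_op h (dir_op h (dir_op h g)) x =
      step3 (clamp01 (sq x)) * lin x ^ 3 + 3 * (step2 (clamp01 (sq x)) * lin x * (2 * scalar_prod h h / w))"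
proof -
  have c: "x + t \<cdot>\<^sub>v unit_vec d i \<in> carrier_vec d" if "x \<in> carrier_vec d" for x :: "real Matrix.vec" and t i using that by simp
  show 1: "dir_op h g x = step1 (clamp01 (sq x)) * lin x" if x: "x \<in> carrier_vec d" for x
  proof -
    have "dir_op h g x = step1 (clamp01 (sq x)) * (2 * scalar_prod (x - x0) h / w) + 0 * scalar_prod h h"
    proof (rule dir_op_eq[OF x x0 h])
      fix i assume i: "i < d"
      show "((\<lambda>t. g (x + t \<cdot>\<^sub>v unit_vec d i)) has_real_derivative step1 (clamp01 (sq x)) * (2 * (x - x0) $ i / w) + 0 * h $ i) (at 0)"
        unfolding g[OF c[OF x]] using DERIV_sq_lin(1)[OF x i, of "\<lambda>s. step0 (clamp01 s)" "\<lambda>s. step1 (clamp01 s)", OF DERIV_step(1)] by simp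
    qed
    then show ?thesis by (simp add: lin_def)
  qed
  show 2: "dir_op h (dir_op h g) x = step2 (clamp01 (sq x)) * (lin x)\<^sup>2 + step1 (clamp01 (sq x)) * (2 * scalar_prod h h / w)"
    if x: "x \<in> carrier_vec d" for x
  proof -
    have "dir_op h (dir_op h g) x = step2 (clamp01 (sq x)) * lin x * (2 * scalar_prod (x - x0) h / w) + step1 (clamp01 (sq x)) * (2 / w) * scalar_prod h h"
    proof (rule dir_op_eq[OF x x0 h])
      fix i assume i: "i < d"
      show "((\<lambda>t. dir_op h g (x + t \<cdot>\<^sub>v unit_vec d i)) has_real_derivative
          step2 (clamp01 (sq x)) * lin x * (2 * (x - x0) $ i / w) + step1 (clamp01 (sq x)) * (2 / w) * h $ i) (at 0)"
        unfolding 1[OF c[OF x]]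
        by (rule DERIV_cong[OF DERIV_mult[OF DERIV_sq_lin(1)[OF x i, of "\<lambda>s. step1 (clamp01 s)" "\<lambda>s. step2 (clamp01 s)", OF DERIV_step(2)] DERIV_sq_lin(2)[OF x i]]])
          (simp add: shift_sq_lin[OF x i] algebra_simps)
    qed
    then show ?thesis unfolding lin_def[symmetric] by (simp add: power2_eq_square)
  qed
  show "dir_op h (dir_op h (dir_op h g)) x = step3 (clamp01 (sq x)) * lin x ^ 3 + 3 * (step2 (clamp01 (sq x)) * lin x * (2 * scalar_prod h h / w))"
    if x: "x \<in> carrier_vec d" for x
  proof -
    let ?H = "2 * scalar_prod h h / w"
    have "dir_op h (dir_op h (dir_op h g)) x = (step3 (clamp01 (sq x)) * (lin x)\<^sup>2 + step2 (clamp01 (sq x)) * ?H) * (2 * scalar_prod (x - x0) h / w)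
        + 2 * step2 (clamp01 (sq x)) * lin x * (2 / w) * scalar_prod h h"
    proof (rule dir_op_eq[OF x x0 h])
      fix i assume i: "i < d"
      show "((\<lambda>t. dir_op h (dir_op h g) (x + t \<cdot>\<^sub>v unit_vec d i)) has_real_derivative
          (step3 (clamp01 (sq x)) * (lin x)\<^sup>2 + step2 (clamp01 (sq x)) * ?H) * (2 * (x - x0) $ i / w) +
          2 * step2 (clamp01 (sq x)) * lin x * (2 / w) * h $ i) (at 0)"
        unfolding 2[OF c[OF x]]
        by (rule DERIV_cong[OF DERIV_add[OF DERIV_mult[OF DERIV_sq_lin(1)[OF x i, of "\<lambda>s. step2 (clamp01 s)" "\<lambda>s. step3 (clamp01 s)", OF DERIV_step(3)]
              DERIV_power[OF DERIV_sq_lin(2)[OF x i], of 2]] DERIV_cmult_right[OF DERIV_sq_lin(1)[OF x i, of "\<lambda>s. step1 (clamp01 s)" "\<lambda>s. step2 (clamp01 s)", OF DERIV_step(2)]]]])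
          (simp add: shift_sq_lin[OF x i] algebra_simps)
    qed
    then show ?thesis unfolding lin_def[symmetric] by (simp add: power2_eq_square power3_eq_cube algebra_simps)
  qed
qed

end

text \<open>On the shell w = \<epsilon>^2 + 2 r \<epsilon> gives |lin| \<le> u and 2 |h|^2 / w \<le>
  u^2 with u = |h| / (\<epsilon> / 2), uniformly in r and d. Then 6160 = 5040 + 1120 and 33600 =
  18480 + 3 * 5040. Off the shell the derivatives of the clamped step vanish.\<close>

lemma ball_cutoff_step_bounds:
  fixes x0 x h :: "real Matrix.vec"
  assumes x0: "x0 \<in> carrier_vec d" and x: "x \<in> carrier_vec d" and h: "h \<in> carrier_vec d" and r: "0 \<le> r" and \<epsilon>: "0 < \<epsilon>"
  defines "g \<equiv> ball_cutoff (\<lambda>x. step0 (clamp01 x)) x0 r \<epsilon>"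
    and "I \<equiv> (if r < vnorm (x - x0) \<and> vnorm (x - x0) \<le> r + \<epsilon> then 1 else 0 :: real)"
  shows "\<bar>dir_op h (dir_op h g) x\<bar> \<le> 6160 * vnorm h ^ 2 / (\<epsilon> / 2) ^ 2 * I"
    "\<bar>dir_op h (dir_op h (dir_op h g)) x\<bar> \<le> 33600 * vnorm h ^ 3 / (\<epsilon> / 2) ^ 3 * I"
proof -
  define w where "w = \<epsilon>\<^sup>2 + 2 * r * \<epsilon>"
  have w: "0 < w" using r \<epsilon> by (simp add: w_def add_pos_nonneg)
  note D = dir_op_step[OF x0 h w, of g r, OF _ x]
  let ?s = "sq x0 r w x" and ?l = "lin x0 h w x" and ?H = "2 * scalar_prod h h / w"
  \<comment> \<open>Inside the ball \<open>sq\<close> is nonpositive and clamped to 0, which has the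
    effect of the indicator in \<open>ball_cutoff\<close>.\<close>
  have g: "g y = step0 (clamp01 (sq x0 r w y))" for y
  proof -
    have "(vnorm (y - x0))\<^sup>2 \<le> r\<^sup>2" if "vnorm (y - x0) \<le> r" using that vnorm_nonneg by (rule power_mono)
    then have "sq x0 r w y \<le> 0" if "vnorm (y - x0) \<le> r" using that w by (simp add: sq_def[OF x0 h w] vnorm_sq divide_nonpos_pos)
    then show ?thesis unfolding g_def ball_cutoff_def w_def[symmetric]
      by (simp add: clamp01 sq_def[OF x0 h w] vnorm_sq)
  qed
  note D = D[OF g]
  define u where "u = vnorm h / (\<epsilon> / 2)"
  have u: "0 \<le> u" using \<epsilon> vnorm_nonneg[of h] by (simp add: u_def)
  show "\<bar>dir_op h (dir_op h g) x\<bar> \<le> 6160 * vnorm h ^ 2 / (\<epsilon> / 2) ^ 2 * I"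
    "\<bar>dir_op h (dir_op h (dir_op h g)) x\<bar> \<le> 33600 * vnorm h ^ 3 / (\<epsilon> / 2) ^ 3 * I"
  proof (atomize (full), cases "r < vnorm (x - x0) \<and> vnorm (x - x0) \<le> r + \<epsilon>")
    case True
    have e: "vnorm h ^ k / (\<epsilon> / 2) ^ k = u ^ k" for k by (simp add: u_def power_divide)
    have H: "0 \<le> ?H" "?H \<le> u\<^sup>2"
    proof -
      have "\<epsilon>\<^sup>2 \<le> w * 2" using r \<epsilon> by (simp add: w_def)
      then have "2 * scalar_prod h h / w \<le> 2 * scalar_prod h h / (\<epsilon>\<^sup>2 / 2)"
        using w \<epsilon> scalar_prod_self_nonneg[of h] by (intro divide_left_mono) auto
      then show "?H \<le> u\<^sup>2" by (simp add: u_def power_divide power_mult_distrib vnorm_sq mult.commute)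
      show "0 \<le> ?H" using w scalar_prod_self_nonneg[of h] by simp
    qed
    have l: "\<bar>?l\<bar> \<le> u"
    proof -
      have "\<bar>scalar_prod (x - x0) h\<bar> \<le> vnorm (x - x0) * vnorm h"
        using abs_dot_le[of d "vec_index (x - x0)" "vec_index h"]
        unfolding vnorm_def scalar_prod_eq_sqn[OF h] scalar_prod_eq_sqn[OF minus_carrier_vec[OF x x0]]
        unfolding scalar_prod_eq_dot[OF h] .
      also have "\<dots> \<le> (r + \<epsilon>) * vnorm h" using True vnorm_nonneg[of h] by (intro mult_right_mono) auto
      finally have "\<bar>?l\<bar> \<le> 2 * ((r + \<epsilon>) * vnorm h) / w"
        using w by (simp add: lin_def[OF x0 h w] abs_mult divide_right_mono)
      also have "\<dots> = vnorm h * (2 * (r + \<epsilon>) / w)" by simp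
      also have "\<dots> \<le> vnorm h * (2 / \<epsilon>)"
      proof (rule mult_left_mono[OF _ vnorm_nonneg])
        have "2 * (r + \<epsilon>) * \<epsilon> \<le> 2 * w" using r \<epsilon> by (simp add: w_def power2_eq_square algebra_simps)
        then show "2 * (r + \<epsilon>) / w \<le> 2 / \<epsilon>" using w \<epsilon> by (simp add: divide_simps)
      qed
      finally show ?thesis by (simp add: u_def)
    qed
    have lk: "\<bar>?l\<bar> ^ k \<le> u ^ k" for k using l by (intro power_mono) auto
    note b = step_bounds[of ?s]
    have "\<bar>step2 (clamp01 ?s) * ?l\<^sup>2 + step1 (clamp01 ?s) * ?H\<bar> \<le> \<bar>step2 (clamp01 ?s)\<bar> * \<bar>?l\<bar> ^ 2 + \<bar>step1 (clamp01 ?s)\<bar> * ?H"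
      using abs_triangle_ineq[of "step2 (clamp01 ?s) * ?l\<^sup>2" "step1 (clamp01 ?s) * ?H"] abs_of_nonneg[OF H(1)]
      by (simp only: abs_mult[of _ ?H] abs_mult[of _ "?l\<^sup>2"] power_abs)
    also have "\<dots> \<le> 5040 * u\<^sup>2 + 1120 * u\<^sup>2" using b lk[of 2] H by (intro add_mono mult_mono zero_le_power abs_ge_zero) simp_all
    finally have 2: "\<bar>dir_op h (dir_op h g) x\<bar> \<le> 6160 * u\<^sup>2" unfolding D(2) by simp
    have "\<bar>step3 (clamp01 ?s) * ?l ^ 3 + 3 * (step2 (clamp01 ?s) * ?l * ?H)\<bar>
        \<le> \<bar>step3 (clamp01 ?s)\<bar> * \<bar>?l\<bar> ^ 3 + 3 * (\<bar>step2 (clamp01 ?s)\<bar> * \<bar>?l\<bar> * ?H)"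
      using abs_triangle_ineq[of "step3 (clamp01 ?s) * ?l ^ 3" "3 * (step2 (clamp01 ?s) * ?l * ?H)"] abs_of_nonneg[OF H(1)]
      by (simp only: abs_mult[of _ ?H] abs_mult[of _ ?l] abs_mult[of 3] abs_mult[of _ "?l ^ 3"] power_abs abs_numeral)
    also have "\<dots> \<le> 18480 * u ^ 3 + 3 * (5040 * u * u\<^sup>2)" using b lk[of 3] l H u
      by (intro add_mono mult_mono order_refl mult_nonneg_nonneg zero_le_power abs_ge_zero) simp_all
    finally have 3: "\<bar>dir_op h (dir_op h (dir_op h g)) x\<bar> \<le> 33600 * u ^ 3" unfolding D(3) by (simp add: power3_eq_cube power2_eq_square)
    show "\<bar>dir_op h (dir_op h g) x\<bar> \<le> 6160 * vnorm h ^ 2 / (\<epsilon> / 2) ^ 2 * I \<and>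
      \<bar>dir_op h (dir_op h (dir_op h g)) x\<bar> \<le> 33600 * vnorm h ^ 3 / (\<epsilon> / 2) ^ 3 * I"
      using 2 3 True unfolding I_def times_divide_eq_right[symmetric] e by simp
  next
    case False
    have "?s \<le> 0 \<or> 1 \<le> ?s"
    proof (cases "vnorm (x - x0) \<le> r")
      case True
      then have "(vnorm (x - x0))\<^sup>2 \<le> r\<^sup>2" using vnorm_nonneg by (rule power_mono)
      then show ?thesis using w by (simp add: sq_def[OF x0 h w] vnorm_sq divide_nonpos_pos)
    next
      case 2: False
      then have "(r + \<epsilon>)\<^sup>2 \<le> (vnorm (x - x0))\<^sup>2" using False r \<epsilon> by (intro power_mono) auto
      then have "w \<le> scalar_prod (x - x0) (x - x0) - r\<^sup>2" unfolding vnorm_sq by (simp add: w_def power2_eq_square algebra_simps)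
      then show ?thesis using w by (simp add: sq_def[OF x0 h w] le_divide_eq)
    qed
    from step_clamp_zero[OF this] show "\<bar>dir_op h (dir_op h g) x\<bar> \<le> 6160 * vnorm h ^ 2 / (\<epsilon> / 2) ^ 2 * I \<and>
      \<bar>dir_op h (dir_op h (dir_op h g)) x\<bar> \<le> 33600 * vnorm h ^ 3 / (\<epsilon> / 2) ^ 3 * I"
      using False unfolding I_def D by auto
  qed
qed

lemma CB4_form_large:
  obtains C where "9.5 \<le> C" "K \<le> C" "CB4_form C"
proof -
  let ?\<phi> = "\<lambda>x. step0 (clamp01 x)"
  define Ct where "Ct = max 24 K"
  have "cutoff_const ?\<phi> 2 6160" "cutoff_const ?\<phi> 3 33600"
    unfolding cutoff_const_def deriv_form_def
    using ball_cutoff_step_bounds by (auto simp: eval_nat_numeral simp del: power_Suc)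
  moreover have "anticoncentration_const Ct" by (rule anticoncentration_constI) (simp add: Ct_def)
  ultimately have "CB4_form (9.5 * max 1 Ct * Max {1, 6160, 33600})"
    unfolding CB4_form_def using cutoff_step by blast
  moreover have "9.5 \<le> 9.5 * max 1 Ct * Max {1, 6160, 33600 :: real}" "K \<le> 9.5 * max 1 Ct * Max {1, 6160, 33600 :: real}"
    by (auto simp: Ct_def)
  ultimately show ?thesis using that by blast
qed

section \<open>The score test\<close>

lemma cdf_chi_square: "cdf (chi_square d) t = measure (std_gauss d) {g \<in> space (std_gauss d). sqn d g \<le> t}"
proof -
  have "chi_square d = distr (std_gauss d) borel (sqn d)" by (simp add: chi_square_def sqn_def[abs_def])
  then show ?thesis by (simp add: cdf_def measure_distr vimage_def Int_def conj_commute)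
qed

lemma real_distribution_chi_square: "real_distribution (chi_square d)"
proof -
  have "chi_square d = distr (std_gauss d) borel (sqn d)" by (simp add: chi_square_def sqn_def[abs_def])
  then show ?thesis by (simp add: real_distribution_def real_distribution_axioms_def gauss.prob_space_distr)
qed

text \<open>As a function of the radius the distribution function is Lipschitz by anticoncentration,
  so it takes the value 1 - \<alpha> somewhere. The infimum lies at or before such a point, and
  right continuity excludes a smaller value there, so the quantile has exactly the prescribed
  level.\<close>

lemma cdf_chi_square_q:
  assumes d: "1 \<le> d" and \<alpha>: "0 < \<alpha>" "\<alpha> < 1"
  shows "cdf (chi_square d) (chi_square_q d \<alpha>) = 1 - \<alpha>"
proof -
  interpret chi: real_distribution "chi_square d" by (rule real_distribution_chi_square)
  let ?F = "cdf (chi_square d)"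
  let ?T = "{t. 1 - \<alpha> \<le> ?F t}"
  define q where "q = chi_square_q d \<alpha>"
  have mono: "?F x \<le> ?F y" if "x \<le> y" for x y using that by (rule chi.cdf_nondecreasing)
  have F0: "?F t = 0" if "t \<le> 0" for t
  proof -
    have "?F 0 \<le> 0" using gball_small[OF d, of 0 "\<lambda>_. 0"] by (simp add: cdf_chi_square gball_def)
    then show ?thesis using mono[OF that] chi.cdf_nonneg[of t] by linarith
  qed
  have "24-lipschitz_on {0..} (\<lambda>r. ?F (r\<^sup>2))"
  proof (rule lipschitz_onI)
    have step: "\<bar>?F (x\<^sup>2) - ?F (y\<^sup>2)\<bar> \<le> 24 * (y - x)" if "0 \<le> x" "x \<le> y" for x y
      using std_gauss_ball_anticoncentration[OF d that(1), of "y - x" "\<lambda>_. 0"] that mono[of "x\<^sup>2" "y\<^sup>2"]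
      by (simp add: cdf_chi_square power_mono)
    show "dist (?F (x\<^sup>2)) (?F (y\<^sup>2)) \<le> 24 * dist x y" if "x \<in> {0..}" "y \<in> {0..}" for x y
      using step[of x y] step[of y x] that by (cases "x \<le> y") (auto simp: dist_real_def abs_minus_commute)
  qed simp
  then have cont: "continuous_on {0..} (\<lambda>r. ?F (r\<^sup>2))" by (rule lipschitz_on_continuous_on)
  have "eventually (\<lambda>t. 1 - \<alpha> < ?F t) at_top" using chi.cdf_lim_at_top_prob \<alpha>(1) by (intro order_tendstoD) auto
  then obtain b where b: "\<And>t. b \<le> t \<Longrightarrow> 1 - \<alpha> < ?F t" unfolding eventually_at_top_linorder by blast
  define c where "c = max 1 b"
  have c0: "0 \<le> c" by (simp add: c_def)
  have "b \<le> c\<^sup>2" using self_le_power[of c 2] by (auto simp: c_def)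
  then have "1 - \<alpha> \<le> ?F (c\<^sup>2)" using b by (simp add: less_imp_le)
  then obtain r where "0 \<le> r" "?F (r\<^sup>2) = 1 - \<alpha>"
    using IVT'[of "\<lambda>r. ?F (r\<^sup>2)" 0 "1 - \<alpha>" c] F0[of 0] \<alpha> c0 continuous_on_subset[OF cont, of "{0..c}"] by auto
  then obtain t0 where t0: "?F t0 = 1 - \<alpha>" by blast
  have bdd: "bdd_below ?T"
  proof (rule bdd_belowI)
    fix t assume "t \<in> ?T"
    then show "0 \<le> t" using F0[of t] \<alpha> by (cases "t \<le> 0") auto
  qed
  have "q \<le> t0" unfolding q_def chi_square_q_def using t0 bdd by (intro cInf_lower) auto
  then have le: "?F q \<le> 1 - \<alpha>" using mono[of q t0] t0 by simp
  moreover have "\<not> ?F q < 1 - \<alpha>"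
  proof
    assume "?F q < 1 - \<alpha>"
    moreover have "(?F \<longlongrightarrow> ?F q) (at_right q)" using chi.cdf_is_right_cont[of q] by (simp add: continuous_within)
    ultimately have "eventually (\<lambda>t. ?F t < 1 - \<alpha>) (at_right q)" by (rule order_tendstoD(2)[rotated])
    then obtain u where u: "q < u" "\<And>t. q < t \<Longrightarrow> t < u \<Longrightarrow> ?F t < 1 - \<alpha>" unfolding eventually_at_right_field by blast
    have "(q + u) / 2 \<le> q"
      unfolding q_def chi_square_q_def
    proof (rule cInf_greatest)
      have "t0 \<in> ?T" using t0 by simp
      then show "?T \<noteq> {}" by blast
      fix t assume t: "t \<in> ?T"
      have "?F ((q + u) / 2) < 1 - \<alpha>" using u by simp
      then show "(Inf ?T + u) / 2 \<le> t" using t mono[of t "(q + u) / 2"] unfolding q_def chi_square_q_def by (cases "t \<le> (Inf ?T + u) / 2") auto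
    qed
    then show False using u(1) by simp
  qed
  ultimately show ?thesis unfolding q_def by simp
qed

section \<open>The standardised score as an isotropic vector\<close>

lemma integral_PiM_pair:
  fixes f g :: "'x \<Rightarrow> real"
  assumes M: "prob_space M" and kl: "k < n" "l < n" "k \<noteq> l" and f: "integrable M f" and g: "integrable M g"
  shows "integrable (PiM {..<n} (\<lambda>_::nat. M)) (\<lambda>y. f (y k) * g (y l))"
    "(\<integral>y. f (y k) * g (y l) \<partial>PiM {..<n} (\<lambda>_::nat. M)) = (\<integral>x. f x \<partial>M) * (\<integral>x. g x \<partial>M)"
proof -
  interpret prob_space M by (rule M)
  interpret PP: product_prob_space "\<lambda>_::nat. M" UNIV by (rule product_prob_spaceI) (rule M)
  define h where "h i = (if i = k then f else if i = l then g else (\<lambda>_. 1))" for i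
  have h: "integrable M (h i)" for i using f g by (simp add: h_def)
  have two: "(\<Prod>i<n. F i) = F k * F l" if "\<And>i. i \<noteq> k \<Longrightarrow> i \<noteq> l \<Longrightarrow> F i = 1" for F :: "nat \<Rightarrow> real"
    using kl that by (subst prod.mono_neutral_right[of "{..<n}" "{k, l}"]) auto
  have e: "(\<Prod>i<n. h i (y i)) = f (y k) * g (y l)" for y using kl by (subst two) (auto simp: h_def)
  show "integrable (PiM {..<n} (\<lambda>_::nat. M)) (\<lambda>y. f (y k) * g (y l))"
    using PP.product_integrable_prod[of "{..<n}" h, OF _ h] unfolding e by simp
  have "(\<integral>y. f (y k) * g (y l) \<partial>PiM {..<n} (\<lambda>_::nat. M)) = (\<Prod>i<n. \<integral>x. h i x \<partial>M)"
    using PP.product_integral_prod[of "{..<n}" h, OF _ h] unfolding e by simp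
  also have "\<dots> = (\<integral>x. f x \<partial>M) * (\<integral>x. g x \<partial>M)" using kl by (subst two) (auto simp: h_def prob_space)
  finally show "(\<integral>y. f (y k) * g (y l) \<partial>PiM {..<n} (\<lambda>_::nat. M)) = (\<integral>x. f x \<partial>M) * (\<integral>x. g x \<partial>M)" .
qed

lemma integral_PiM_component:
  fixes f :: "'x \<Rightarrow> real"
  assumes M: "prob_space M" and k: "k < n" and f: "f \<in> borel_measurable M"
  shows "integrable (PiM {..<n} (\<lambda>_::nat. M)) (\<lambda>y. f (y k)) \<longleftrightarrow> integrable M f"
    "(\<integral>y. f (y k) \<partial>PiM {..<n} (\<lambda>_::nat. M)) = (\<integral>x. f x \<partial>M)"
proof -
  have D: "distr (PiM {..<n} (\<lambda>_::nat. M)) M (\<lambda>y. y k) = M" using k M by (intro distr_PiM_component) auto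
  have m: "(\<lambda>y. y k) \<in> measurable (PiM {..<n} (\<lambda>_::nat. M)) M" using k by simp
  show "integrable (PiM {..<n} (\<lambda>_::nat. M)) (\<lambda>y. f (y k)) \<longleftrightarrow> integrable M f"
    using integrable_distr_eq[OF m f] unfolding D by simp
  show "(\<integral>y. f (y k) \<partial>PiM {..<n} (\<lambda>_::nat. M)) = (\<integral>x. f x \<partial>M)"
    using integral_distr[OF m f] unfolding D by simp
qed

lemma mult_mat_index_sum:
  assumes "A \<in> carrier_mat d d" "C \<in> carrier_mat d d" "i < d" "j < d"
  shows "(A * C) $$ (i, j) = (\<Sum>k<d. A $$ (i, k) * C $$ (k, j))"
  using assms by (simp add: scalar_prod_def atLeast0LessThan)

locale score_model =
  fixes d n :: nat and \<nu> :: "'x measure" and p :: "'x \<Rightarrow> real" and \<Theta> :: "real Matrix.vec set"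
    and f :: "real Matrix.vec \<Rightarrow> 'x \<Rightarrow> real" and \<theta> :: "real Matrix.vec"
  assumes d: "1 \<le> d" and n: "1 \<le> n" and pdf: "is_pdf \<nu> p" and \<Theta>: "\<Theta> \<subseteq> carrier_vec d"
    and pdf_\<Theta>: "\<And>u. u \<in> \<Theta> \<Longrightarrow> is_pdf \<nu> (f u)" and \<theta>: "\<theta> \<in> \<Theta>" and regular: "regular_at d \<nu> \<Theta> f \<theta>"
    and p: "\<And>x. x \<in> space \<nu> \<Longrightarrow> p x = f \<theta> x"
    and info: "pos_def (fisher_info (sample_law \<nu> p n) d n f \<theta>)"
    and fourth: "finite_fourth_moments (sample_law \<nu> p n) d (std_score (fisher_info (sample_law \<nu> p n) d n f \<theta>) d n f \<theta> 0)"
begin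

definition "M1 = density \<nu> (\<lambda>x. ennreal (p x))"
definition "P = sample_law \<nu> p n"
definition "J = fisher_info P d n f \<theta>"
definition "B = mat_inv_sqrt J"
definition s :: "'x \<Rightarrow> nat \<Rightarrow> real" where "s x j = score1 d f \<theta> x $ j"
text \<open>\<open>J\<close> is n times the covariance of a single score, so the factor
  \<open>sqrt n\<close> next to the inverse root \<open>B\<close> of \<open>J\<close> gives unit
  covariance.\<close>

definition X :: "'x \<Rightarrow> nat \<Rightarrow> real" where "X x i = sqrt n * (\<Sum>j<d. B $$ (i, j) * s x j)"

lemma P_eq: "P = PiM {..<n} (\<lambda>_. M1)"
  by (simp add: P_def M1_def sample_law_def)

lemma p_measurable [measurable]: "p \<in> borel_measurable \<nu>"
  using pdf by (simp add: is_pdf_def)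

lemma prob_space_M1: "prob_space M1"
  unfolding M1_def using pdf by (intro prob_spaceI) (simp add: emeasure_density is_pdf_def cong: nn_integral_cong)

lemma s_measurable [measurable]: "j < d \<Longrightarrow> (\<lambda>x. s x j) \<in> borel_measurable \<nu>"
  using regular by (simp add: regular_at_def s_def)

lemma s_measurable_M1 [measurable]: "j < d \<Longrightarrow> (\<lambda>x. s x j) \<in> borel_measurable M1"
  unfolding M1_def by simp

lemma X_measurable_M1 [measurable]: "i < d \<Longrightarrow> (\<lambda>x. X x i) \<in> borel_measurable M1"
  unfolding X_def by (intro borel_measurable_times borel_measurable_const borel_measurable_sum s_measurable_M1) auto

lemma J: "J \<in> carrier_mat d d" "pos_def J"
  using info by (simp_all add: J_def P_def fisher_info_def cov_mat_def)

lemmas B = mat_inv_sqrt[OF J(2,1), folded B_def]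

lemma std_score_eq: "k < d \<Longrightarrow> std_score J d n f \<theta> i y $ k = X (y i) k"
  unfolding std_score_def B_def[symmetric] X_def s_def
  using mult_mat_vec_index_sum[OF B(1), of "score1 d f \<theta> (y i)" k] B(1) by (simp add: score1_def del: index_mult_mat_vec)

lemma integral_pdf: "is_pdf \<nu> g \<Longrightarrow> (\<integral>x. g x \<partial>\<nu>) = 1"
  unfolding is_pdf_def by (subst integral_eq_nn_integral) auto

text \<open>Near \<theta> all members of the family are densities, so the integral that is
  differentiated is constant. Where p x > 0, the derivative of ln f is that of f divided by p x.
  Where p x = 0, \<theta> minimizes a nonnegative function along the coordinate line, so its
  derivative vanishes and both sides are 0, whatever value the score has.\<close>

lemma integral_partial_deriv_zero:
  assumes j: "j < d"
  shows "(\<integral>x. partial_deriv j (\<lambda>u. f u x) \<theta> \<partial>\<nu>) = 0"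
    "AE x in \<nu>. p x * s x j = partial_deriv j (\<lambda>u. f u x) \<theta>"
proof -
  have dim: "\<theta> \<in> carrier_vec d" "dim_vec \<theta> = d" using \<theta> \<Theta> by auto
  obtain e where e: "0 < e" "\<And>u. u \<in> carrier_vec d \<Longrightarrow> vnorm (u - \<theta>) < e \<Longrightarrow> u \<in> \<Theta>"
    using regular unfolding regular_at_def by blast
  have in\<Theta>: "\<theta> + t \<cdot>\<^sub>v unit_vec d j \<in> \<Theta>" if "\<bar>t\<bar> < e" for t
  proof (rule e(2))
    have "\<theta> + t \<cdot>\<^sub>v unit_vec d j - \<theta> = t \<cdot>\<^sub>v unit_vec d j" using dim by (intro eq_vecI) auto
    moreover have "vnorm (unit_vec d j) = 1" using j by (simp add: vnorm_def)
    ultimately show "vnorm (\<theta> + t \<cdot>\<^sub>v unit_vec d j - \<theta>) < e" using that by (simp add: vnorm_smult)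
  qed (use dim in simp)
  have D: "((\<lambda>t. \<integral>x. f (\<theta> + t \<cdot>\<^sub>v unit_vec d j) x \<partial>\<nu>) has_real_derivative (\<integral>x. partial_deriv j (\<lambda>u. f u x) \<theta> \<partial>\<nu>)) (at 0)"
    and diff: "AE x in \<nu>. (\<lambda>t. f (\<theta> + t \<cdot>\<^sub>v unit_vec d j) x) differentiable (at 0)"
    using regular j unfolding regular_at_def by blast+
  have "((\<lambda>t. 1) has_real_derivative (\<integral>x. partial_deriv j (\<lambda>u. f u x) \<theta> \<partial>\<nu>)) (at 0)"
    by (rule has_field_derivative_transform_within[OF D e(1)]) (use in\<Theta> integral_pdf[OF pdf_\<Theta>] in auto)
  then show "(\<integral>x. partial_deriv j (\<lambda>u. f u x) \<theta> \<partial>\<nu>) = 0" by (rule DERIV_unique) simp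
  show "AE x in \<nu>. p x * s x j = partial_deriv j (\<lambda>u. f u x) \<theta>"
    using diff AE_space
  proof eventually_elim
    fix x assume df: "(\<lambda>t. f (\<theta> + t \<cdot>\<^sub>v unit_vec d j) x) differentiable (at 0)" and x: "x \<in> space \<nu>"
    define h where "h t = f (\<theta> + t \<cdot>\<^sub>v unit_vec d j) x" for t
    have "\<theta> + 0 \<cdot>\<^sub>v unit_vec d j = \<theta>" using dim by (intro eq_vecI) auto
    then have h0: "h 0 = p x" using p[OF x] by (simp add: h_def)
    have hD: "(h has_real_derivative deriv h 0) (at 0)"
      using df unfolding h_def[symmetric] by (simp add: DERIV_deriv_iff_real_differentiable)
    have pos: "0 \<le> h t" if "\<bar>t\<bar> < e" for t using pdf_\<Theta>[OF in\<Theta>[OF that]] x by (simp add: h_def is_pdf_def)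
    have sx: "s x j = deriv (\<lambda>t. ln (h t)) 0" using j by (simp add: s_def score1_def partial_deriv_def dim h_def)
    have px: "partial_deriv j (\<lambda>u. f u x) \<theta> = deriv h 0" by (simp add: partial_deriv_def dim h_def[abs_def])
    show "p x * s x j = partial_deriv j (\<lambda>u. f u x) \<theta>"
    proof (cases "h 0 = 0")
      case True
      have "deriv h 0 = 0" by (rule DERIV_local_min[OF hD e(1)]) (use pos True in simp)
      then show ?thesis using True h0 px by simp
    next
      case False
      then have h0p: "0 < h 0" using pos[of 0] e(1) by simp
      have "((\<lambda>t. ln (h t)) has_real_derivative deriv h 0 / h 0) (at 0)"
        using hD h0p by (auto intro!: derivative_eq_intros)
      then show ?thesis using False sx px h0 by (simp add: DERIV_imp_deriv)
    qed
  qed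
qed

text \<open>J B is the inverse of B, so the score is a fixed linear image of \<open>X\<close>. The
  moment hypothesis concerns \<open>X\<close> and is carried over to the score in this way.\<close>

lemma s_linear:
  assumes j: "j < d" shows "s x j = (\<Sum>i<d. (J * B) $$ (j, i) / sqrt n * X x i)"
proof -
  have JB: "J * B \<in> carrier_mat d d" using J(1) B(1) by (rule mult_carrier_mat)
  define v where "v = score1 d f \<theta> x"
  have v: "v \<in> carrier_vec d" by (simp add: v_def score1_def)
  have "J * B * B = 1\<^sub>m d" by (rule mat_mult_left_right_inverse[OF B(1) JB B(4)])
  then have "v = (J * B) *\<^sub>v (B *\<^sub>v v)" using assoc_mult_mat_vec[OF JB B(1) v] v by simp
  then have "s x j = ((J * B) *\<^sub>v (B *\<^sub>v v)) $ j" by (simp add: s_def v_def)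
  also have "\<dots> = (\<Sum>i<d. (J * B) $$ (j, i) * (B *\<^sub>v v) $ i)" by (rule mult_mat_vec_index_sum[OF JB mult_mat_vec_carrier[OF B(1) v] j])
  also have "\<dots> = (\<Sum>i<d. (J * B) $$ (j, i) / sqrt n * X x i)"
  proof (intro sum.cong refl)
    fix i assume "i \<in> {..<d}"
    then have "(B *\<^sub>v v) $ i = (\<Sum>j<d. B $$ (i, j) * v $ j)" by (intro mult_mat_vec_index_sum[OF B(1) v]) simp
    then show "(J * B) $$ (j, i) * (B *\<^sub>v v) $ i = (J * B) $$ (j, i) / sqrt n * X x i"
      using n by (simp add: X_def s_def v_def)
  qed
  finally show ?thesis .
qed

lemma integrable_X4: "i < d \<Longrightarrow> j < d \<Longrightarrow> integrable M1 (\<lambda>x. (X x i)\<^sup>2 * (X x j)\<^sup>2)"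
proof -
  assume ij: "i < d" "j < d"
  have m: "(\<lambda>x. X x i * X x i * X x j * X x j) \<in> borel_measurable M1" using ij by measurable
  have "integrable P (\<lambda>y. X (y 0) i * X (y 0) i * X (y 0) j * X (y 0) j)"
    using fourth ij unfolding finite_fourth_moments_def P_def[symmetric] J_def[symmetric] by (simp add: std_score_eq)
  then have "integrable M1 (\<lambda>x. X x i * X x i * X x j * X x j)"
    unfolding P_eq using integral_PiM_component(1)[OF prob_space_M1 _ m, of 0 n] n by simp
  then show ?thesis by (simp add: power2_eq_square mult.assoc)
qed

lemma integrable_sqn_X_square: "integrable M1 (\<lambda>x. (sqn d (X x))\<^sup>2)"
proof -
  have "(sqn d (X x))\<^sup>2 = (\<Sum>i<d. \<Sum>j<d. (X x i)\<^sup>2 * (X x j)\<^sup>2)" for x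
    unfolding sqn_def by (subst power2_eq_square) (rule sum_product)
  then show ?thesis by (simp only:) (intro Bochner_Integration.integrable_sum integrable_X4, auto)
qed

lemma integrable_s2: "i < d \<Longrightarrow> j < d \<Longrightarrow> integrable M1 (\<lambda>x. s x i * s x j)"
  and integrable_s: "i < d \<Longrightarrow> integrable M1 (\<lambda>x. s x i)"
proof -
  interpret prob_space M1 by (rule prob_space_M1)
  have X2: "integrable M1 (\<lambda>x. X x i * X x j)" if ij: "i < d" "j < d" for i j
  proof (rule Bochner_Integration.integrable_bound)
    show "integrable M1 (\<lambda>x. 1 + (X x i)\<^sup>2 * (X x j)\<^sup>2)" using integrable_X4[OF ij] by simp
    show "AE x in M1. norm (X x i * X x j) \<le> norm (1 + (X x i)\<^sup>2 * (X x j)\<^sup>2)"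
    proof (rule AE_I2)
      fix x
      have "0 \<le> (\<bar>X x i * X x j\<bar> - 1)\<^sup>2" by simp
      moreover have "(\<bar>X x i * X x j\<bar> - 1)\<^sup>2 = (X x i)\<^sup>2 * (X x j)\<^sup>2 - 2 * \<bar>X x i * X x j\<bar> + 1"
        by (simp add: power2_diff power_mult_distrib)
      ultimately show "norm (X x i * X x j) \<le> norm (1 + (X x i)\<^sup>2 * (X x j)\<^sup>2)" unfolding real_norm_def by linarith
    qed
  qed (use ij in measurable)
  have s2: "integrable M1 (\<lambda>x. s x i * s x j)" if ij: "i < d" "j < d" for i j
    unfolding s_linear[OF ij(1)] s_linear[OF ij(2)] sum_product
  proof (intro Bochner_Integration.integrable_sum)
    fix a b assume "a \<in> {..<d}" "b \<in> {..<d}"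
    then have "integrable M1 (\<lambda>x. (J * B) $$ (i, a) / sqrt n * ((J * B) $$ (j, b) / sqrt n) * (X x a * X x b))"
      by (intro integrable_mult_right X2) auto
    then show "integrable M1 (\<lambda>x. (J * B) $$ (i, a) / sqrt n * X x a * ((J * B) $$ (j, b) / sqrt n * X x b))"
      by (simp add: mult.assoc mult.left_commute)
  qed
  then show "i < d \<Longrightarrow> j < d \<Longrightarrow> integrable M1 (\<lambda>x. s x i * s x j)" .
  show "integrable M1 (\<lambda>x. s x i)" if i: "i < d"
  proof (rule square_integrable_imp_integrable)
    show "integrable M1 (\<lambda>x. (s x i)\<^sup>2)" using s2[OF i i] by (simp add: power2_eq_square)
  qed (use i in measurable)
qed

lemma expectation_s: "j < d \<Longrightarrow> (\<integral>x. s x j \<partial>M1) = 0"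
proof -
  assume j: "j < d"
  have "(\<integral>x. s x j \<partial>M1) = (\<integral>x. p x * s x j \<partial>\<nu>)"
    unfolding M1_def using j pdf by (subst integral_density) (auto simp: is_pdf_def)
  also have "\<dots> = (\<integral>x. partial_deriv j (\<lambda>u. f u x) \<theta> \<partial>\<nu>)"
  proof (rule integral_cong_AE)
    show "(\<lambda>x. partial_deriv j (\<lambda>u. f u x) \<theta>) \<in> borel_measurable \<nu>" using regular j unfolding regular_at_def by auto
  qed (use j integral_partial_deriv_zero(2)[OF j] in auto)
  finally show ?thesis using integral_partial_deriv_zero(1)[OF j] by simp
qed

text \<open>Scores of different observations are independent with mean zero, so only the
  \<open>n\<close> diagonal terms of the double sum survive.\<close>

lemma fisher_info_eq:
  assumes a: "a < d" and b: "b < d"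
  shows "J $$ (a, b) = n * (\<integral>x. s x a * s x b \<partial>M1)"
proof -
  have comp: "integrable P (\<lambda>y. s (y k) j)" "(\<integral>y. s (y k) j \<partial>P) = 0" if "k \<in> {..<n}" "j < d" for k j
    using that integral_PiM_component[OF prob_space_M1 _ s_measurable_M1, of k n j] integrable_s expectation_s by (auto simp: P_eq)
  have sc: "score d n f \<theta> y $ j = (\<Sum>k<n. s (y k) j)" if "j < d" for j y using that by (simp add: score_def s_def)
  have E: "(\<integral>y. score d n f \<theta> y $ j \<partial>P) = 0" if "j < d" for j
  proof -
    have "(\<integral>y. (\<Sum>k<n. s (y k) j) \<partial>P) = (\<Sum>k<n. \<integral>y. s (y k) j \<partial>P)"
      by (rule Bochner_Integration.integral_sum) (rule comp(1)[OF _ that])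
    then show ?thesis unfolding sc[OF that] using comp(2)[OF _ that] by simp
  qed
  have pair: "integrable P (\<lambda>y. s (y k) a * s (y l) b) \<and> (\<integral>y. s (y k) a * s (y l) b \<partial>P) = (if k = l then (\<integral>x. s x a * s x b \<partial>M1) else 0)"
    if kl: "k \<in> {..<n}" "l \<in> {..<n}" for k l
  proof (cases "k = l")
    case True
    have m: "(\<lambda>x. s x a * s x b) \<in> borel_measurable M1" using a b by measurable
    show ?thesis using True kl integral_PiM_component[OF prob_space_M1 _ m, of k n] integrable_s2[OF a b] by (simp add: P_eq)
  next
    case False
    then show ?thesis using integral_PiM_pair[OF prob_space_M1 _ _ False integrable_s[OF a] integrable_s[OF b], of n] kl expectation_s a
      by (simp add: P_eq)
  qed
  have "J $$ (a, b) = (\<integral>y. (\<Sum>k<n. s (y k) a) * (\<Sum>l<n. s (y l) b) \<partial>P)"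
    unfolding J_def fisher_info_def cov_mat_def using a b by (simp add: E) (simp add: sc)
  also have "\<dots> = (\<integral>y. (\<Sum>k<n. \<Sum>l<n. s (y k) a * s (y l) b) \<partial>P)" by (simp add: sum_product)
  also have "\<dots> = (\<Sum>k<n. \<integral>y. (\<Sum>l<n. s (y k) a * s (y l) b) \<partial>P)"
    by (rule Bochner_Integration.integral_sum) (intro Bochner_Integration.integrable_sum, use pair in blast)
  also have "\<dots> = (\<Sum>k<n. \<Sum>l<n. \<integral>y. s (y k) a * s (y l) b \<partial>P)"
    by (intro sum.cong refl Bochner_Integration.integral_sum) (use pair in blast)
  also have "\<dots> = (\<Sum>k<n. \<Sum>l<n. if k = l then (\<integral>x. s x a * s x b \<partial>M1) else 0)" using pair by (intro sum.cong refl) auto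
  also have "\<dots> = n * (\<integral>x. s x a * s x b \<partial>M1)" by simp
  finally show ?thesis .
qed

sublocale iso: isotropic M1 d X
proof -
  interpret prob_space M1 by (rule prob_space_M1)
  show "isotropic M1 d X"
  proof
    show "\<And>i. i < d \<Longrightarrow> (\<lambda>x. X x i) \<in> borel_measurable M1" by (rule X_measurable_M1)
    show "integrable M1 (\<lambda>x. (sqn d (X x))\<^sup>2)" by (rule integrable_sqn_X_square)
    fix i assume i: "i < d"
    have is1: "integrable M1 (\<lambda>x. B $$ (i, j) * s x j)" if "j \<in> {..<d}" for j using that integrable_s by simp
    show "(\<integral>x. X x i \<partial>M1) = 0"
      unfolding X_def using expectation_s Bochner_Integration.integral_sum[of "{..<d}" M1, OF is1] by simp
    fix j assume j: "j < d"
    have is2: "integrable M1 (\<lambda>x. B $$ (i, a) * B $$ (j, b) * (s x a * s x b))" if "a \<in> {..<d}" "b \<in> {..<d}" for a b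
      using that integrable_s2 by simp
    have "(\<integral>x. X x i * X x j \<partial>M1) = (\<integral>x. n * (\<Sum>a<d. \<Sum>b<d. B $$ (i, a) * B $$ (j, b) * (s x a * s x b)) \<partial>M1)"
    proof -
      have "X x i * X x j = n * (\<Sum>a<d. \<Sum>b<d. B $$ (i, a) * B $$ (j, b) * (s x a * s x b))" for x
      proof -
        have "X x i * X x j = (sqrt n * sqrt n) * ((\<Sum>a<d. B $$ (i, a) * s x a) * (\<Sum>b<d. B $$ (j, b) * s x b))"
          unfolding X_def by (simp only: mult.assoc mult.left_commute)
        then show ?thesis by (simp add: sum_product mult.assoc mult.left_commute)
      qed
      then show ?thesis by simp
    qed
    also have "\<dots> = n * (\<Sum>a<d. \<Sum>b<d. B $$ (i, a) * B $$ (j, b) * (\<integral>x. s x a * s x b \<partial>M1))"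
    proof -
      have "(\<integral>x. (\<Sum>a<d. \<Sum>b<d. B $$ (i, a) * B $$ (j, b) * (s x a * s x b)) \<partial>M1) =
          (\<Sum>a<d. \<integral>x. (\<Sum>b<d. B $$ (i, a) * B $$ (j, b) * (s x a * s x b)) \<partial>M1)"
        by (rule Bochner_Integration.integral_sum) (intro Bochner_Integration.integrable_sum is2)
      also have "\<dots> = (\<Sum>a<d. \<Sum>b<d. \<integral>x. B $$ (i, a) * B $$ (j, b) * (s x a * s x b) \<partial>M1)"
        by (intro sum.cong refl Bochner_Integration.integral_sum is2)
      finally show ?thesis by simp
    qed
    \<comment> \<open>The factor n turns the covariance of one score into J. Since B is symmetric,
      the covariance of \<open>X\<close> becomes B J B, which is the identity.\<close>
    also have "\<dots> = (\<Sum>a<d. \<Sum>b<d. B $$ (i, a) * B $$ (j, b) * J $$ (a, b))"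
      by (simp add: sum_distrib_left fisher_info_eq mult.left_commute)
    also have "\<dots> = (\<Sum>a<d. B $$ (i, a) * (J * B) $$ (a, j))"
    proof (intro sum.cong refl)
      fix a assume "a \<in> {..<d}"
      then have a: "a < d" by simp
      have "B $$ (j, b) = B $$ (b, j)" if "b < d" for b
        using B(1,2) that j unfolding pos_def_def by (metis carrier_matD index_transpose_mat(1))
      then show "(\<Sum>b<d. B $$ (i, a) * B $$ (j, b) * J $$ (a, b)) = B $$ (i, a) * (J * B) $$ (a, j)"
        unfolding mult_mat_index_sum[OF J(1) B(1) a j] sum_distrib_left by (intro sum.cong refl) simp
    qed
    also have "\<dots> = (B * (J * B)) $$ (i, j)"
      by (rule mult_mat_index_sum[OF B(1) mult_carrier_mat[OF J(1) B(1)] i j, symmetric])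
    finally show "(\<integral>x. X x i * X x j \<partial>M1) = (if i = j then 1 else 0)" unfolding B(4) using i j by simp
  qed
qed

text \<open>The inverse of J is B B with B symmetric, so the statistic is |B S|^2 for the total
  score S, while the sum of the \<open>X\<close> over the sample is \<open>sqrt n\<close> times B
  S.\<close>

lemma rao_stat_eq: "rao_stat J d n f \<theta> y = sqn d (iso.psum n y) / n"
proof -
  define S where "S = score d n f \<theta> y"
  have S: "S \<in> carrier_vec d" by (simp add: S_def score_def)
  have BS: "B *\<^sub>v S \<in> carrier_vec d" using B(1) S by simp
  have "rao_stat J d n f \<theta> y = scalar_prod S (B *\<^sub>v (B *\<^sub>v S))"
    unfolding rao_stat_def S_def[symmetric] B(3)[symmetric] using assoc_mult_mat_vec[OF B(1,1) S] by simp
  also have "\<dots> = scalar_prod (B *\<^sub>v S) (B *\<^sub>v S)"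
    using symmetric_scalar_prod[OF B(1) _ S BS] B(2) by (simp add: pos_def_def)
  also have "\<dots> = sqn d (vec_index (B *\<^sub>v S))" by (rule scalar_prod_eq_sqn[OF BS])
  also have "\<dots> = sqn d (iso.psum n y) / n"
    unfolding sqn_def sum_divide_distrib
  proof (intro sum.cong refl)
    fix i assume "i \<in> {..<d}"
    then have i: "i < d" by simp
    have "iso.psum n y i = sqrt n * (\<Sum>j<d. B $$ (i, j) * (\<Sum>k<n. s (y k) j))"
      unfolding iso.psum_def X_def sum_distrib_left by (rule sum.swap)
    also have "(\<Sum>j<d. B $$ (i, j) * (\<Sum>k<n. s (y k) j)) = (B *\<^sub>v S) $ i"
      unfolding mult_mat_vec_index_sum[OF B(1) S i] by (intro sum.cong refl) (simp add: S_def score_def s_def)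
    finally show "((B *\<^sub>v S) $ i)\<^sup>2 = (iso.psum n y i)\<^sup>2 / n" using n by (simp add: power_mult_distrib del: index_mult_mat_vec)
  qed
  finally show ?thesis .
qed

lemma fourth_moment_eq: "(\<integral>y. vnorm (std_score J d n f \<theta> 0 y) ^ 4 \<partial>P) = iso.m4"
proof -
  have v: "vnorm (std_score J d n f \<theta> 0 y) ^ 4 = (sqn d (X (y 0)))\<^sup>2" for y
  proof -
    have c: "std_score J d n f \<theta> 0 y \<in> carrier_vec d"
      unfolding std_score_def B_def[symmetric]
      by (intro smult_carrier_vec[THEN iffD2] mult_mat_vec_carrier[OF B(1)]) (simp add: score1_def)
    have "vnorm (std_score J d n f \<theta> 0 y) ^ 4 = ((vnorm (std_score J d n f \<theta> 0 y))\<^sup>2)\<^sup>2" by (simp add: power_mult[symmetric])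
    also have "(vnorm (std_score J d n f \<theta> 0 y))\<^sup>2 = sqn d (X (y 0))"
      unfolding vnorm_sq scalar_prod_eq_sqn[OF c] sqn_def by (intro sum.cong refl) (simp add: std_score_eq)
    finally show ?thesis .
  qed
  have m: "(\<lambda>x. (sqn d (X x))\<^sup>2) \<in> borel_measurable M1" using integrable_sqn_X_square by simp
  show ?thesis unfolding v iso.m4_def P_eq using integral_PiM_component(2)[OF prob_space_M1 _ m, of 0 n] n by simp
qed

text \<open>Acceptance means that the sum of the \<open>X\<close> lies in the ball about 0 of
  squared radius n q. The corresponding Gaussian probability is the chi-squared distribution
  function at q, that is 1 - \<alpha>.\<close>

lemma rao_test_level:
  assumes \<alpha>: "0 < \<alpha>" "\<alpha> < 1"
  shows "\<bar>measure P {y \<in> space P. rao_stat J d n f \<theta> y > chi_square_q d \<alpha>} - \<alpha>\<bar> \<le> K_BE * sqrt (iso.m4 / n)"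
proof -
  define q where "q = chi_square_q d \<alpha>"
  have PM: "iso.prodM n = P" by (simp add: iso.prodM_def P_eq)
  interpret P: prob_space P using iso.prob_space_prodM[of n] unfolding PM .
  have n0: "0 < sqrt (real n)" using n by simp
  have "{y \<in> space P. rao_stat J d n f \<theta> y > q} = space P - {y \<in> space P. sqn d (iso.psum n y) \<le> n * q}"
    using n by (auto simp: rao_stat_eq field_simps)
  moreover have "{y \<in> space P. sqn d (iso.psum n y) \<le> n * q} \<in> sets P"
    unfolding PM[symmetric] by measurable
  ultimately have 1: "measure P {y \<in> space P. rao_stat J d n f \<theta> y > q} = 1 - sqn_le_prob P d (iso.psum n) (\<lambda>_. 0) (n * q)"
    by (simp add: sqn_le_prob_def P.prob_compl)
  have 2: "sqn_le_prob (std_gauss d) d (\<lambda>z i. sqrt n * z i) (\<lambda>_. 0) (n * q) = 1 - \<alpha>"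
    unfolding sqn_le_prob_scaled_gauss[OF n0] using cdf_chi_square_q[OF d \<alpha>] n by (simp add: cdf_chi_square q_def)
  show ?thesis using iso.ball_berry_esseen[OF d n, of "\<lambda>_. 0" "n * q"] unfolding PM 2 q_def[symmetric] 1 by linarith
qed

lemma spectral_norm_ge_1:
  "1 \<le> spectral_norm (mat_inv ((1 / real n) \<cdot>\<^sub>m J)) * spectral_norm ((1 / real n) \<cdot>\<^sub>m J)"
proof -
  have c: "(1 / real n) \<cdot>\<^sub>m J \<in> carrier_mat d d" using J(1) by simp
  have pd: "pos_def ((1 / real n) \<cdot>\<^sub>m J)"
    unfolding pos_def_def
  proof (intro conjI ballI impI)
    show "transpose_mat ((1 / real n) \<cdot>\<^sub>m J) = (1 / real n) \<cdot>\<^sub>m J"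
    proof (rule eq_matI)
      fix i j assume "i < dim_row ((1 / real n) \<cdot>\<^sub>m J)" "j < dim_col ((1 / real n) \<cdot>\<^sub>m J)"
      moreover have "transpose_mat J = J" using J(2) by (simp add: pos_def_def)
      ultimately show "transpose_mat ((1 / real n) \<cdot>\<^sub>m J) $$ (i, j) = ((1 / real n) \<cdot>\<^sub>m J) $$ (i, j)"
        using J(1) index_transpose_mat(1)[of i J j] by simp
    qed (use J(1) in auto)
    fix v :: "real Matrix.vec" assume v: "v \<in> carrier_vec (dim_row ((1 / real n) \<cdot>\<^sub>m J))" "v \<noteq> 0\<^sub>v (dim_row ((1 / real n) \<cdot>\<^sub>m J))"
    then have v': "v \<in> carrier_vec d" "v \<noteq> 0\<^sub>v d" using J(1) by auto
    have "((1 / real n) \<cdot>\<^sub>m J) *\<^sub>v v = (1 / real n) \<cdot>\<^sub>v (J *\<^sub>v v)" using J(1) v' by (intro eq_vecI) auto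
    moreover have "0 < scalar_prod v (J *\<^sub>v v)" using J v' by (auto simp: pos_def_def)
    ultimately show "0 < scalar_prod v (((1 / real n) \<cdot>\<^sub>m J) *\<^sub>v v)" using n J(1) v' by simp
  qed (use J(1) in auto)
  note inv = pos_def_mat_inv[OF pd c]
  show ?thesis by (rule spectral_norm_inverse_ge_1[OF d inv(1) c inv(3)])
qed

end

section \<open>Comparison with the stated bound\<close>

lemma h1_h2_bounds:
  assumes "0 < \<beta>" "\<beta> < 1" shows "0 \<le> h2 \<beta>" "1 \<le> h1 \<beta>"
proof -
  show "0 \<le> h2 \<beta>" unfolding h2_def by simp
  have "\<beta>\<^sup>2 < 1" using assms by (simp add: power_less_one_iff)
  moreover have "\<beta> ^ 4 \<le> 1" "0 < \<beta> ^ 4" using assms by (auto intro: power_le_one)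
  ultimately have "(1 - \<beta>\<^sup>2) * \<beta> ^ 4 \<le> 1 * 1" "0 < (1 - \<beta>\<^sup>2) * \<beta> ^ 4" by (intro mult_mono, auto)
  then have "1 \<le> 1 / ((1 - \<beta>\<^sup>2) * \<beta> ^ 4)" by (simp add: le_divide_eq)
  then show "1 \<le> h1 \<beta>" unfolding h1_def using \<open>0 \<le> h2 \<beta>\<close> by linarith
qed

text \<open>The middle term alone dominates: h1 \<beta> \<ge> 1 puts at least E under the root, and
  2 C N1 N2 is at least K.\<close>

lemma error_bound_mono:
  fixes E d n :: real
  assumes \<beta>: "0 < \<beta>" "\<beta> < 1" and E: "0 \<le> E" and C: "0 \<le> K" "K \<le> C" and N: "1 \<le> N1 * N2" and T: "0 \<le> T" and n: "0 < n" and d: "0 \<le> d"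
  shows "K * sqrt (E / n) \<le> 1 / (sqrt 6 * \<beta> ^ 3) * T / sqrt n
    + 2 * C * N1 * N2 * sqrt ((h1 \<beta> + 1 / (4 * \<beta> ^ 4)) * E + d\<^sup>2 + 2 * d) / sqrt n
    + 1 / (2 * sqrt 6) * (h1 \<beta> * E + h2 \<beta> * (d\<^sup>2 + 2 * d)) / n"
proof -
  note h = h1_h2_bounds[OF \<beta>]
  have "1 * E \<le> (h1 \<beta> + 1 / (4 * \<beta> ^ 4)) * E" using h \<beta> E by (intro mult_right_mono) (auto simp: add_increasing2)
  then have "sqrt E \<le> sqrt ((h1 \<beta> + 1 / (4 * \<beta> ^ 4)) * E + d\<^sup>2 + 2 * d)" using d by (intro real_sqrt_le_mono) (simp add: add_increasing2)
  moreover have "K \<le> 2 * C * N1 * N2"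
  proof -
    have "2 * C * 1 \<le> 2 * C * (N1 * N2)" using C N by (intro mult_left_mono) auto
    then show ?thesis using C by (simp add: mult.assoc)
  qed
  ultimately have "K * sqrt E \<le> 2 * C * N1 * N2 * sqrt ((h1 \<beta> + 1 / (4 * \<beta> ^ 4)) * E + d\<^sup>2 + 2 * d)"
    using C E by (intro mult_mono) auto
  then have "K * sqrt (E / n) \<le> 2 * C * N1 * N2 * sqrt ((h1 \<beta> + 1 / (4 * \<beta> ^ 4)) * E + d\<^sup>2 + 2 * d) / sqrt n"
    using n by (simp add: real_sqrt_divide divide_right_mono)
  moreover have "0 \<le> 1 / (sqrt 6 * \<beta> ^ 3) * T / sqrt n" using \<beta> T n by simp
  moreover have "0 \<le> 1 / (2 * sqrt 6) * (h1 \<beta> * E + h2 \<beta> * (d\<^sup>2 + 2 * d)) / n" using h E d n by simp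
  ultimately show ?thesis by linarith
qed

theorem theorem7p2:
  shows "\<exists>C::real. 9.5 \<le> C \<and> CB4_form C \<and>
    (\<forall>(d::nat) (n::nat) (\<nu> :: (nat \<Rightarrow> real) measure) (p :: (nat \<Rightarrow> real) \<Rightarrow> real)
       (\<Theta> :: real Matrix.vec set) (f :: real Matrix.vec \<Rightarrow> (nat \<Rightarrow> real) \<Rightarrow> real)
       (\<theta>0 :: real Matrix.vec) (\<theta>' :: real Matrix.vec) (\<beta>::real).
       let P = sample_law \<nu> p n;
           I = fisher_info P d n f \<theta>';
           R = rao_stat I d n f \<theta>';
           X = std_score I d n f \<theta>';
           S = (1 / real n) \<cdot>\<^sub>m I;
           E4 = (\<integral>y. vnorm (X 0 y) ^ 4 \<partial>P)
       in
         1 \<le> d \<longrightarrow> 1 \<le> n \<longrightarrow>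
         reference_measure \<nu> \<longrightarrow> is_pdf \<nu> p \<longrightarrow>
         \<Theta> \<subseteq> carrier_vec d \<longrightarrow> (\<forall>\<theta> \<in> \<Theta>. is_pdf \<nu> (f \<theta>)) \<longrightarrow>
         \<theta>' \<in> \<Theta> \<longrightarrow> regular_at d \<nu> \<Theta> f \<theta>' \<longrightarrow>
         \<theta>0 \<in> \<Theta> \<longrightarrow> (\<forall>x \<in> space \<nu>. p x = f \<theta>0 x) \<longrightarrow>
         \<theta>0 = \<theta>' \<longrightarrow>
         pos_def I \<longrightarrow>
         (\<forall>i<n. finite_fourth_moments P d (X i)) \<longrightarrow>
         0 < \<beta> \<longrightarrow> \<beta> < 1 \<longrightarrow>
         (SUP \<alpha>\<in>{0<..<1}. \<bar>measure P {y \<in> space P. R y > chi_square_q d \<alpha>} - \<alpha>\<bar>)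
           \<le> 1 / (sqrt 6 * \<beta> ^ 3) * third_moment_fnorm P d (X 0) / sqrt (real n)
             + 2 * C * spectral_norm (mat_inv S) * spectral_norm S
                 * sqrt ((h1 \<beta> + 1 / (4 * \<beta> ^ 4)) * E4 + (real d)\<^sup>2 + 2 * real d) / sqrt (real n)
             + 1 / (2 * sqrt 6) * (h1 \<beta> * E4 + h2 \<beta> * ((real d)\<^sup>2 + 2 * real d)) / real n)"
proof -
  obtain C where C: "9.5 \<le> C" "K_BE \<le> C" "CB4_form C" using CB4_form_large by blast
  have K: "0 \<le> K_BE" by (simp add: K_BE_def)
  show ?thesis
    unfolding Let_def
  proof (rule exI[of _ C], intro conjI allI impI)
    fix d n :: nat and \<nu> :: "(nat \<Rightarrow> real) measure" and p :: "(nat \<Rightarrow> real) \<Rightarrow> real" and \<Theta> :: "real Matrix.vec set"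
      and f :: "real Matrix.vec \<Rightarrow> (nat \<Rightarrow> real) \<Rightarrow> real" and \<theta>0 \<theta>' :: "real Matrix.vec" and \<beta> :: real
    let ?P = "sample_law \<nu> p n"
    let ?J = "fisher_info ?P d n f \<theta>'"
    assume d: "1 \<le> d" and n: "1 \<le> n" and p: "is_pdf \<nu> p" and \<Theta>: "\<Theta> \<subseteq> carrier_vec d" "\<forall>\<theta>\<in>\<Theta>. is_pdf \<nu> (f \<theta>)"
      and \<theta>': "\<theta>' \<in> \<Theta>" and reg: "regular_at d \<nu> \<Theta> f \<theta>'" and eq: "\<forall>x\<in>space \<nu>. p x = f \<theta>0 x" "\<theta>0 = \<theta>'"
      and J: "pos_def ?J" and fourth: "\<forall>i<n. finite_fourth_moments ?P d (std_score ?J d n f \<theta>' i)"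
      and \<beta>: "0 < \<beta>" "\<beta> < 1"
    interpret S: score_model d n \<nu> p \<Theta> f \<theta>'
    proof
      show "finite_fourth_moments ?P d (std_score ?J d n f \<theta>' 0)" using fourth n by simp
    qed (use d n p \<Theta> \<theta>' reg eq J in auto)
    have E: "0 \<le> S.iso.m4" using S.iso.m4_ge order_trans[OF zero_le_power2] by blast
    have T: "0 \<le> third_moment_fnorm ?P d (std_score ?J d n f \<theta>' 0)"
      unfolding third_moment_fnorm_def by (intro real_sqrt_ge_zero sum_nonneg zero_le_power2)
    have n0: "0 < real n" and d0: "0 \<le> real d" using n by simp_all
    note eqs = S.P_def[symmetric] S.J_def[symmetric] S.fourth_moment_eq
    show "(SUP \<alpha>\<in>{0<..<1}. \<bar>measure ?P {y \<in> space ?P. rao_stat ?J d n f \<theta>' y > chi_square_q d \<alpha>} - \<alpha>\<bar>)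
      \<le> 1 / (sqrt 6 * \<beta> ^ 3) * third_moment_fnorm ?P d (std_score ?J d n f \<theta>' 0) / sqrt (real n)
        + 2 * C * spectral_norm (mat_inv ((1 / real n) \<cdot>\<^sub>m ?J)) * spectral_norm ((1 / real n) \<cdot>\<^sub>m ?J)
            * sqrt ((h1 \<beta> + 1 / (4 * \<beta> ^ 4)) * (\<integral>y. vnorm (std_score ?J d n f \<theta>' 0 y) ^ 4 \<partial>?P) + (real d)\<^sup>2 + 2 * real d) / sqrt (real n)
        + 1 / (2 * sqrt 6) * (h1 \<beta> * (\<integral>y. vnorm (std_score ?J d n f \<theta>' 0 y) ^ 4 \<partial>?P) + h2 \<beta> * ((real d)\<^sup>2 + 2 * real d)) / real n"
    proof (rule cSUP_least)
      fix \<alpha> :: real assume "\<alpha> \<in> {0<..<1}"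
      then have "\<bar>measure ?P {y \<in> space ?P. rao_stat ?J d n f \<theta>' y > chi_square_q d \<alpha>} - \<alpha>\<bar> \<le> K_BE * sqrt (S.iso.m4 / n)"
        unfolding eqs by (intro S.rao_test_level) auto
      also note error_bound_mono[OF \<beta> E K C(2) S.spectral_norm_ge_1 T[unfolded eqs] n0 d0]
      finally show "\<bar>measure ?P {y \<in> space ?P. rao_stat ?J d n f \<theta>' y > chi_square_q d \<alpha>} - \<alpha>\<bar>
        \<le> 1 / (sqrt 6 * \<beta> ^ 3) * third_moment_fnorm ?P d (std_score ?J d n f \<theta>' 0) / sqrt (real n)
        + 2 * C * spectral_norm (mat_inv ((1 / real n) \<cdot>\<^sub>m ?J)) * spectral_norm ((1 / real n) \<cdot>\<^sub>m ?J)
            * sqrt ((h1 \<beta> + 1 / (4 * \<beta> ^ 4)) * (\<integral>y. vnorm (std_score ?J d n f \<theta>' 0 y) ^ 4 \<partial>?P) + (real d)\<^sup>2 + 2 * real d) / sqrt (real n)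
        + 1 / (2 * sqrt 6) * (h1 \<beta> * (\<integral>y. vnorm (std_score ?J d n f \<theta>' 0 y) ^ 4 \<partial>?P) + h2 \<beta> * ((real d)\<^sup>2 + 2 * real d)) / real n"
        unfolding eqs .
    qed simp
  qed (use C in auto)
qed

end
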